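(* Assume that $$\mathbf E\Big[\sum_{|z|=1}1\Big]>1,\qquad \mathbf E\Big[\sum_{|z|=1}e^{-V(z)}\Big]=1,\qquad \mathbf E\Big[\sum_{|z|=1}V(z)e^{-V(z)}\Big]=0,$$ that the distribution of $L$ is non-lattice, and that $$\mathbf E\Big[\sum_{|z|=1}V(z)^2e^{-V(z)}\Big]<\infty,\qquad \mathbf E\big[X(\log_+X)^2\big]<\infty,\qquad \mathbf E\big[\widetilde X\log_+\widetilde X\big]<\infty .$$ Then for every integer $d\ge1$, $\beta\in(1,\infty)^d$, $\theta\in(0,\infty)^d$ and $\alpha\in\mathbb R_+$, $$\lim_{n\to\infty}\mathbf E\Big(e^{-\sum_{i=1}^d\theta_i\widehat\mu_n(\beta_i)}e^{-\alpha Z_\infty}\mathbf 1_{\{Z_\infty>0\}}\Big)=e^{-\rho_\beta(\theta)}\,\mathbf E\big(e^{-\alpha Z_\infty}\mathbf 1_{\{Z_\infty>0\}}\big).$$ In particular, as $n\to\infty$, conditionally on $\{Z_\infty>0\}$, $(\widehat\mu_n(\beta_1),\dots,\widehat\mu_n(\beta_d))$ converges in law to some random vector $(\widehat\mu_\infty(\beta_1),\dots,\widehat\mu_\infty(\beta_d))$ independent of $Z_\infty$.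
   Context: Branching random walk: let $L$ be a point process on $\mathbb R$. One particle starts at $0$. At time $1$ it gives birth to children whose positions form the point process $L$. At each later time every particle of the current generation gives birth, independently of everything else up to that generation, to children whose displacements from their parent are distributed as $L$. $|z|$ is the generation of a particle $z$ and $V(z)$ its position; $\mathbf P,\mathbf E$ are the law and expectation. Notation: $y_+=\max(y,0)$, $\log_+ y=\max(\log y,0)$, $X:=\sum_{|z|=1}e^{-V(z)}$, $\widetilde X:=\sum_{|z|=1}V(z)_+e^{-V(z)}$ (convention $\infty e^{-\infty}=0$). $Z_\infty:=\lim_{n\to\infty}\sum_{|z|=n}V(z)e^{-V(z)}$; under the stated assumptions the limit is known to exist a.s. and to be strictly positive on non-extinction. For $\beta>1$, $n\ge1$: $\widetilde W_{n,\beta}:=n^{\frac32\beta}\sum_{|z|=n}e^{-\beta V(z)}$, and on $\{Z_\infty>0\}$, $\widehat\mu_n(\beta):=n^{\frac32\beta}\sum_{|z|=n}e^{-\beta(V(z)+\log Z_\infty)}$. For $\beta\in(1,\infty)^d$, $\rho_\beta:(0,\infty)^d\to(0,\infty)$ is the function (which exists and is unique under the assumptions) such that for every $\theta\in(0,\infty)^d$ and $\epsilon>0$ there exist $A\ge0$, $N\in\mathbb N$ with $$\Big|\frac{e^x}{x}\mathbf E\Big(1-\exp\Big\{-\sum_{i=1}^d\theta_ie^{-\beta_ix}\widetilde W_{n,\beta_i}\Big\}\Big)-\rho_\beta(\theta)\Big|\le\epsilon\quad\text{for all } n>N,\ x\in[A,\tfrac32\log n-A].$$ It satisfies $\lim_{\theta\to0}\rho_\beta(\theta)=0$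 and $\rho_\beta(\theta_1e^{\beta_1y},\dots,\theta_de^{\beta_dy})=e^y\rho_\beta(\theta)$ for all $y\in\mathbb R$. *)

theory Defs
  imports "HOL-Probability.Probability"
begin

section \<open>Branching random walks\<close>

text \<open>
  A point process on the line is represented by a random sequence of points
  \<open>nat \<Rightarrow> ereal\<close>, counted with multiplicity, in which an entry \<open>\<infinity>\<close> means that this slot of
  the sequence is not used.  So the number of points is random, possibly \<open>0\<close> or infinite.
\<close>

abbreviation slots :: "(nat \<Rightarrow> ereal) measure" where
  "slots \<equiv> Pi\<^sub>M UNIV (\<lambda>_. borel)"

text \<open>
  Particles are named by Ulam-Harris labels: the root is \<open>[]\<close>, and \<open>k # u\<close> is the particle in the
  \<open>k\<close>-th slot of the offspring of \<open>u\<close>.  The sequence \<open>\<xi> u \<omega>\<close> lists the displacements of the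
  children of \<open>u\<close> from \<open>u\<close>, and \<open>L\<close> is the law of the reproduction point process.
\<close>

locale branching_random_walk = prob_space M
  for M :: "'w measure" and L :: "(nat \<Rightarrow> ereal) measure"
    and \<xi> :: "nat list \<Rightarrow> 'w \<Rightarrow> nat \<Rightarrow> ereal" +
  assumes displ_not_MInf: "\<And>u \<omega> k. \<omega> \<in> space M \<Longrightarrow> \<xi> u \<omega> k \<noteq> - \<infinity>"
    and displ_indep: "indep_vars (\<lambda>_. slots) \<xi> UNIV"
    and displ_law: "\<And>u. distr M slots (\<xi> u) = L"

text \<open>The position is \<open>\<infinity>\<close> if the label or one of its ancestors is an unused slot.\<close>

primrec position :: "(nat list \<Rightarrow> 'w \<Rightarrow> nat \<Rightarrow> ereal) \<Rightarrow> nat list \<Rightarrow> 'w \<Rightarrow> ereal" where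
  "position \<xi> [] \<omega> = 0"
| "position \<xi> (k # u) \<omega> = position \<xi> u \<omega> + \<xi> u \<omega> k"

definition generation :: "(nat list \<Rightarrow> 'w \<Rightarrow> nat \<Rightarrow> ereal) \<Rightarrow> nat \<Rightarrow> 'w \<Rightarrow> nat list set" where
  "generation \<xi> n \<omega> = {z. length z = n \<and> position \<xi> z \<omega> \<noteq> \<infinity>}"

text \<open>
  \<open>gen_sum \<xi> n f \<omega>\<close> is the sum of \<open>f (V z)\<close> over the particles \<open>z\<close> of generation \<open>n\<close>.  It is used
  both for \<open>f\<close> with values in \<^typ>\<open>ennreal\<close>, where every sum exists, and for real \<open>f\<close>.  A real sum
  is \<open>0\<close> if it does not converge absolutely; under the integrability assumptions in force whenever
  it is used below, this happens with probability \<open>0\<close>.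
\<close>

definition gen_sum ::
    "(nat list \<Rightarrow> 'w \<Rightarrow> nat \<Rightarrow> ereal) \<Rightarrow> nat \<Rightarrow> (real \<Rightarrow> 'b :: {comm_monoid_add, t2_space}) \<Rightarrow> 'w \<Rightarrow> 'b"
  where
  "gen_sum \<xi> n f \<omega> = (\<Sum>\<^sub>\<infinity>z\<in>generation \<xi> n \<omega>. f (real_of_ereal (position \<xi> z \<omega>)))"

text \<open>
  Lattice is meant in the sense of the local limit theorem: shifted lattices \<open>a + h\<int>\<close> with
  \<open>h > 0\<close> and arbitrary \<open>a\<close> are included.
\<close>

definition non_lattice :: "(nat \<Rightarrow> ereal) measure \<Rightarrow> bool" where
  "non_lattice L \<longleftrightarrow>
     \<not> (\<exists>a h :: real. h > 0 \<and>
          (AE l in L. \<forall>k. l k \<noteq> \<infinity> \<longrightarrow> (\<exists>m :: int. l k = ereal (a + h * of_int m))))"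

definition log_plus :: "real \<Rightarrow> real" where
  "log_plus y = max (ln y) 0"


section \<open>The assumptions on the reproduction law\<close>

definition X_sum :: "(nat list \<Rightarrow> 'w \<Rightarrow> nat \<Rightarrow> ereal) \<Rightarrow> 'w \<Rightarrow> real" where
  "X_sum \<xi> = gen_sum \<xi> 1 (\<lambda>v. exp (- v))"

definition X_tilde :: "(nat list \<Rightarrow> 'w \<Rightarrow> nat \<Rightarrow> ereal) \<Rightarrow> 'w \<Rightarrow> real" where
  "X_tilde \<xi> = gen_sum \<xi> 1 (\<lambda>v. max v 0 * exp (- v))"

definition boundary_case :: "'w measure \<Rightarrow> (nat list \<Rightarrow> 'w \<Rightarrow> nat \<Rightarrow> ereal) \<Rightarrow> bool" where
  "boundary_case M \<xi> \<longleftrightarrow>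
     (\<integral>\<^sup>+\<omega>. gen_sum \<xi> 1 (\<lambda>_. 1) \<omega> \<partial>M) > 1 \<and>
     (\<integral>\<^sup>+\<omega>. gen_sum \<xi> 1 (\<lambda>v. ennreal (exp (- v))) \<omega> \<partial>M) = 1 \<and>
     has_bochner_integral M (gen_sum \<xi> 1 (\<lambda>v. v * exp (- v))) (0 :: real)"

definition moment_conditions :: "'w measure \<Rightarrow> (nat list \<Rightarrow> 'w \<Rightarrow> nat \<Rightarrow> ereal) \<Rightarrow> bool" where
  "moment_conditions M \<xi> \<longleftrightarrow>
     (\<integral>\<^sup>+\<omega>. gen_sum \<xi> 1 (\<lambda>v. ennreal (v\<^sup>2 * exp (- v))) \<omega> \<partial>M) < \<infinity> \<and>
     (\<integral>\<^sup>+\<omega>. ennreal (X_sum \<xi> \<omega> * (log_plus (X_sum \<xi> \<omega>))\<^sup>2) \<partial>M) < \<infinity> \<and>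
     (\<integral>\<^sup>+\<omega>. ennreal (X_tilde \<xi> \<omega> * log_plus (X_tilde \<xi> \<omega>)) \<partial>M) < \<infinity>"


section \<open>The limit of the derivative martingale and the rescaled partition functions\<close>

definition Z_inf :: "(nat list \<Rightarrow> 'w \<Rightarrow> nat \<Rightarrow> ereal) \<Rightarrow> 'w \<Rightarrow> real" where
  "Z_inf \<xi> \<omega> = lim (\<lambda>n. gen_sum \<xi> n (\<lambda>v. v * exp (- v)) \<omega>)"

definition W_tilde :: "(nat list \<Rightarrow> 'w \<Rightarrow> nat \<Rightarrow> ereal) \<Rightarrow> nat \<Rightarrow> real \<Rightarrow> 'w \<Rightarrow> real" where
  "W_tilde \<xi> n b \<omega> = real n powr (3/2 * b) * gen_sum \<xi> n (\<lambda>v. exp (- b * v)) \<omega>"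

text \<open>Only meaningful where \<open>Z_inf \<xi> \<omega> > 0\<close>.\<close>

definition mu_hat :: "(nat list \<Rightarrow> 'w \<Rightarrow> nat \<Rightarrow> ereal) \<Rightarrow> nat \<Rightarrow> real \<Rightarrow> 'w \<Rightarrow> real" where
  "mu_hat \<xi> n b \<omega> =
     real n powr (3/2 * b) * gen_sum \<xi> n (\<lambda>v. exp (- b * (v + ln (Z_inf \<xi> \<omega>)))) \<omega>"

definition mu_hat_vec ::
    "(nat list \<Rightarrow> 'w \<Rightarrow> nat \<Rightarrow> ereal) \<Rightarrow> nat \<Rightarrow> real ^ 'd \<Rightarrow> 'w \<Rightarrow> real ^ 'd" where
  "mu_hat_vec \<xi> n \<beta> \<omega> = (\<chi> i. mu_hat \<xi> n (\<beta> $ i) \<omega>)"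

text \<open>
  The defining property of \<open>\<rho>\<^sub>\<beta>\<close>.  It determines \<open>\<rho> \<theta>\<close> uniquely for \<open>\<theta>\<close> in the open positive
  orthant and says nothing about other \<open>\<theta>\<close>.
\<close>

definition is_rho ::
    "'w measure \<Rightarrow> (nat list \<Rightarrow> 'w \<Rightarrow> nat \<Rightarrow> ereal) \<Rightarrow> real ^ 'd \<Rightarrow> (real ^ 'd \<Rightarrow> real) \<Rightarrow> bool" where
  "is_rho M \<xi> \<beta> \<rho> \<longleftrightarrow>
     (\<forall>\<theta>. (\<forall>i. \<theta> $ i > 0) \<longrightarrow>
        \<rho> \<theta> > 0 \<and>
        (\<forall>\<epsilon>>0. \<exists>A\<ge>0. \<exists>N :: nat. \<forall>n>N. \<forall>x\<in>{A .. 3/2 * ln (real n) - A}.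
           \<bar>exp x / x *
              (\<integral>\<omega>. 1 - exp (- (\<Sum>i\<in>UNIV. \<theta> $ i * exp (- \<beta> $ i * x) * W_tilde \<xi> n (\<beta> $ i) \<omega>)) \<partial>M)
            - \<rho> \<theta>\<bar> \<le> \<epsilon>))"


section \<open>Convergence in law\<close>

text \<open>The library notion \<^const>\<open>weak_conv_m\<close> is restricted to laws on the real line.\<close>

definition converges_in_law ::
    "(nat \<Rightarrow> 'a :: topological_space measure) \<Rightarrow> 'a measure \<Rightarrow> bool" where
  "converges_in_law \<mu> \<nu> \<longleftrightarrow>
     (\<forall>f :: 'a \<Rightarrow> real. continuous_on UNIV f \<longrightarrow> bounded (range f) \<longrightarrow>
        (\<lambda>n. \<integral>x. f x \<partial>\<mu> n) \<longlonglongrightarrow> (\<integral>x. f x \<partial>\<nu>))"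

text \<open>
  Independence of two random variables with values in possibly different types; the library's
  \<^const>\<open>prob_space.indep_var\<close> requires both to have the same type.
\<close>

definition independent_rvs ::
    "'q measure \<Rightarrow> ('q \<Rightarrow> 'a :: topological_space) \<Rightarrow> ('q \<Rightarrow> 'b :: topological_space) \<Rightarrow> bool" where
  "independent_rvs Q Y Z \<longleftrightarrow>
     Y \<in> borel_measurable Q \<and> Z \<in> borel_measurable Q \<and>
     prob_space.indep_set Q {Y -` A \<inter> space Q | A. A \<in> sets borel} {Z -` B \<inter> space Q | B. B \<in> sets borel}"

definition cond_survival :: "'w measure \<Rightarrow> (nat list \<Rightarrow> 'w \<Rightarrow> nat \<Rightarrow> ereal) \<Rightarrow> 'w measure" where
  "cond_survival M \<xi> = uniform_measure M {\<omega> \<in> space M. Z_inf \<xi> \<omega> > 0}"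

end

theory Submission
  imports Defs "HOL-Real_Asymp.Real_Asymp"
begin

text \<open>
  The hypothesis on \<open>\<rho>\<close> carries the tail asymptotics of the partition functions.  The proof turns it
  into the law of the extremal particles seen from an early generation.

  Put \<open>\<kappa> u = (\<Sum>i. \<theta>\<^sub>i exp (- \<beta>\<^sub>i u))\<close> and \<open>lg n = 3/2 ln n\<close>.  Then the exponent in the hypothesis is the
  sum of \<open>\<kappa> (x + V z - lg n)\<close> over the particles \<open>z\<close> of generation \<open>n\<close>.  Let \<open>Phi n x\<close> be the expectation
  of the exponential of minus this sum, and \<open>Lam n = - ln (Phi n)\<close>.  Cutting the tree at generation \<open>k\<close>
  (\<open>branching\<close>, \<open>branch_Phi\<close>) replaces \<open>\<kappa>\<close> at generation \<open>m + k\<close> by \<open>Lam m\<close> at generation \<open>k\<close>.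
  All particles of a late generation are high (\<open>minimal_position_diverges\<close>), and at high positions \<open>x\<close>
  the hypothesis says that \<open>Lam m x\<close> is close to \<open>\<rho> \<theta> x exp (- x)\<close>.  Together with a bound that is
  uniform in \<open>m\<close>, obtained by first moments and a ballot estimate of order \<open>n\<^sup>-\<^sup>3\<^sup>/\<^sup>2\<close> for a centered
  walk (\<open>stay_and_end\<close>, \<open>descent_bound\<close>), this squeezes the upper and lower limits: \<open>Lam n\<close> converges to
  a function \<open>lam\<close> that is asymptotic to \<open>\<rho> \<theta> x exp (- x)\<close> and is a fixed point of the branching
  recursion (\<open>Lam_tendsto\<close>, \<open>lam_asymptotics\<close>, \<open>lam_fixed_point\<close>).

  By the fixed point equation the exponentials of minus the sums of \<open>lam (x + V z)\<close> over a generation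
  form a bounded martingale.  It converges, and the asymptotics of \<open>lam\<close> identify its exponent with
  \<open>\<rho> \<theta> exp (- x)\<close> times the derivative martingale.  So the derivative martingale converges to some
  \<open>Z \<ge> 0\<close>, and \<open>Z\<close> is not almost surely \<open>0\<close> because \<open>lam\<close> is not \<open>0\<close> (\<open>AE_dmart_convergent\<close>, \<open>Z_positive\<close>).

  For the joint Laplace transform, \<open>Z\<close> is replaced by the term \<open>D\<close> of the derivative martingale at a
  fixed generation \<open>k\<close>, at a cost that is uniform in \<open>n\<close> because the functional is Lipschitz in \<open>ln Z\<close>
  (\<open>tipF_lipschitz\<close>).  Now \<open>ln D\<close> is known at time \<open>k\<close>, so cutting at generation \<open>k\<close> and letting \<open>n\<close> tend
  to infinity leaves the sum of \<open>lam (ln D + V z)\<close> over generation \<open>k\<close>, which tends to \<open>\<rho> \<theta>\<close> as \<open>k\<close> grows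
  (\<open>cutoff_limit\<close>, \<open>Laplace_limit\<close>).

  For convergence in law, the variables \<open>exp (- mu_hat)\<close> and \<open>exp (- Z)\<close> take values in a cube, and their
  mixed moments are the Laplace transforms.  A space filling curve and Helly's theorem provide a limit
  law (\<open>vector_selection\<close>), the Stone-Weierstrass theorem passes from moments to continuous functions,
  and the faces of the cube have no mass because \<open>\<rho>\<close> vanishes at \<open>0\<close>, by its scaling property.
\<close>


text \<open>Short input forms of library terms that occur very often below.\<close>

abbreviation (input) NN :: "'a measure => ('a => ennreal) => ennreal" where
 "NN \<equiv> nn_integral"

abbreviation (input) tends :: "(nat => 'a :: topological_space) => 'a => bool" (infix "--->" 60) where
 "X ---> a \<equiv> (X \<longlongrightarrow> a) sequentially"

abbreviation (input) bmeas :: "'a measure => ('a => 'b :: topological_space) set" where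
 "bmeas M \<equiv> borel_measurable M"

abbreviation (input) roe :: "ereal => real" where "roe \<equiv> real_of_ereal"

abbreviation (input) Evn :: "(nat => bool) => bool" (binder "EVN " 10) where
 "Evn P \<equiv> eventually P sequentially"

abbreviation (input) cs :: "'a set => 'a measure" where "cs \<equiv> count_space"

lemmas Bint_diff = Bochner_Integration.integral_diff
 and Bintegrable_diff = Bochner_Integration.integrable_diff
 and Bint_add = Bochner_Integration.integral_add

section \<open>Centered random walks: splitting and exit from an interval\<close>

definition walk :: "(nat => real) => nat => real" where
 "walk u n = (\<Sum>i<n. u i)"

lemma walk_0 [simp]: "walk u 0 = 0" by (simp add: walk_def)

lemma walk_Suc [simp]: "walk u (Suc n) = walk u n + u n" by (simp add: walk_def)

lemma walk_comb_seq:
 "walk (comb_seq m u u') j = (if j <= m then walk u j else walk u m + walk u' (j - m))"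
proof (induction j)
 case (Suc j)
 show ?case
 proof (cases "j < m")
  case True
  then show ?thesis using Suc by (auto simp: comb_seq_def)
 next
  case False
  then have "walk u' (Suc j - m) = walk u' (j - m) + u' (j - m)" by (simp add: Suc_diff_le)
  then show ?thesis using False Suc by (auto simp: comb_seq_def)
 qed
qed simp

text \<open>The law of a single step of the walk that the many-to-one formula attaches to the branching random walk.\<close>
locale centered_walk = prob_space \<nu> for \<nu> :: "real measure" +
 assumes sets_step [measurable_cong, simp]: "sets \<nu> = sets borel"
  and step_mean: "(LINT v|\<nu>. v) = 0"
  and step_sq: "integrable \<nu> (%v. v^2)"
  and step_var_pos: "(LINT v|\<nu>. v^2) > 0"
begin

abbreviation "paths \<equiv> Pi\<^sub>M (UNIV :: nat set) (%_. \<nu>)"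

lemma space_step [simp]: "space \<nu> = UNIV" using sets_eq_imp_space_eq[OF sets_step] by simp

lemma sequence_space_step: "sequence_space \<nu>" unfolding sequence_space_def by (intro product_prob_spaceI prob_space_axioms)

lemma space_paths [simp]: "space paths = UNIV" by (auto simp: space_PiM)

lemma sets_CollectI: "Measurable.pred paths Q ==> {u. Q u} \<in> sets paths" by (simp add: pred_def)

sublocale P: prob_space paths by (intro prob_space_PiM prob_space_axioms)

lemma measurable_walk [measurable]: "(%u. walk u n) \<in> bmeas paths" unfolding walk_def by measurable

text \<open>The Markov property: the path after time \<open>m\<close> is an independent copy, and \<open>comb_seq\<close> glues it on.\<close>
lemma nn_integral_split:
 assumes [measurable]: "h \<in> bmeas paths"
 shows "(NN paths (%u. h u)) = (\<integral>\<^sup>+u. \<integral>\<^sup>+u'. h (comb_seq m u u') \<partial>paths \<partial>paths)" proof -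
 have "(NN paths (%u. h u))
   = (NN (distr (paths \<Otimes>\<^sub>M paths) paths (%(u, u'). comb_seq m u u')) (%u. h u))"
  by (subst sequence_space.PiM_comb_seq[OF sequence_space_step]) simp
 also have "... = (NN (paths \<Otimes>\<^sub>M paths) (%p. h (case p of (u, u') => comb_seq m u u')))" by (subst nn_integral_distr) auto
 also have "... = (\<integral>\<^sup>+u. \<integral>\<^sup>+u'. h (comb_seq m u u') \<partial>paths \<partial>paths)"
  by (subst P.nn_integral_fst[symmetric]) auto
 finally show ?thesis .
qed

lemma prob_split_le:
 assumes [measurable]: "Measurable.pred paths Q" "Measurable.pred paths A"
  and B [measurable]: "!!u. Measurable.pred paths (B u)"
  and imp: "!!u u'. Q (comb_seq m u u') ==> A u & B u u'"
  and le: "!!u. P.prob {u'. B u u'} <= c"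
 shows "P.prob {u. Q u} <= P.prob {u. A u} * c" proof -
 have c: "0 <= c" using le[of undefined] measure_nonneg order_trans by blast
 have [measurable]: "{u. Q u} \<in> sets paths" "{u. A u} \<in> sets paths" "{u'. B u u'} \<in> sets paths" for u by (intro sets_CollectI assms)+
 have "emeasure paths {u. Q u} = (NN paths (%u. indicator {u. Q u} u))" by (subst nn_integral_indicator) auto
 also have "... = (\<integral>\<^sup>+u. \<integral>\<^sup>+u'. indicator {u. Q u} (comb_seq m u u') \<partial>paths \<partial>paths)"
  by (rule nn_integral_split) measurable
 also have "... <= (\<integral>\<^sup>+u. \<integral>\<^sup>+u'. indicator {u. A u} u * indicator {u'. B u u'} u' \<partial>paths \<partial>paths)"
  using imp by (intro nn_integral_mono) (auto split: split_indicator)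
 also have "... = (NN paths (%u. indicator {u. A u} u * emeasure paths {u'. B u u'}))" by (intro nn_integral_cong) (simp add: nn_integral_cmult)
 also have "... <= (NN paths (%u. indicator {u. A u} u * ennreal c))"
  using le c by (intro nn_integral_mono mult_left_mono) (auto simp: P.emeasure_eq_measure intro!: ennreal_leI)
 also have "... = emeasure paths {u. A u} * ennreal c" by (subst nn_integral_multc) auto
 finally show ?thesis using c by (simp add: P.emeasure_eq_measure ennreal_mult[symmetric])
qed

lemma prob_split:
 assumes [measurable]: "Measurable.pred paths Q" "Measurable.pred paths A" "Measurable.pred paths B"
  and eq: "!!u u'. Q (comb_seq m u u') \<longleftrightarrow> A u & B u'"
 shows "P.prob {u. Q u} = P.prob {u. A u} * P.prob {u. B u}" proof -
 have [measurable]: "{u. Q u} \<in> sets paths" "{u. A u} \<in> sets paths" "{u'. B u'} \<in> sets paths" by (intro sets_CollectI assms)+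
 have "emeasure paths {u. Q u} = (NN paths (%u. indicator {u. Q u} u))" by (subst nn_integral_indicator) auto
 also have "... = (\<integral>\<^sup>+u. \<integral>\<^sup>+u'. indicator {u. Q u} (comb_seq m u u') \<partial>paths \<partial>paths)"
  by (rule nn_integral_split) measurable
 also have "... = (\<integral>\<^sup>+u. \<integral>\<^sup>+u'. indicator {u. A u} u * indicator {u'. B u'} u' \<partial>paths \<partial>paths)"
  using eq by (intro nn_integral_cong) (auto split: split_indicator)
 also have "... = (NN paths (%u. indicator {u. A u} u * emeasure paths {u'. B u'}))" by (intro nn_integral_cong) (simp add: nn_integral_cmult)
 also have "... = emeasure paths {u. A u} * emeasure paths {u'. B u'}" by (subst nn_integral_multc) auto
 finally show ?thesis by (simp add: P.emeasure_eq_measure ennreal_mult[symmetric] measure_nonneg)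
qed

lemma expectation_split:
 fixes A :: "(nat => real) => real"
 assumes [measurable]: "A \<in> bmeas paths" and bdd: "!!u. \<bar>A u\<bar> <= c"
  and A: "!!u u'. A (comb_seq j u u') = A u" and g: "integrable \<nu> g"
 shows "integrable paths (%u. A u * g (u j))"
  and "(LINT u|paths. A u * g (u j)) = (LINT u|paths. A u) * (LINT v|\<nu>. g v)" proof -
 have [measurable]: "g \<in> bmeas borel" using g by (auto simp: measurable_def)
 interpret PP: pair_prob_space paths paths ..
 have law: "distr paths \<nu> (%u. u i) = \<nu>" for i by (rule distr_PiM_component[OF prob_space_axioms]) simp
 have gi: "integrable paths (%u. g (u i))" "(LINT u|paths. g (u i)) = (LINT v|\<nu>. g v)" for i
  using integrable_distr[of "%u. u i" paths \<nu> g] integral_distr[of "%u. u i" paths \<nu> g] g law by auto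
 have Ai: "integrable paths A" by (rule P.integrable_const_bound[of _ c]) (use bdd in auto)
 have "integrable paths (%u. c * \<bar>g (u j)\<bar>)" using gi by auto
 then show int: "integrable paths (%u. A u * g (u j))" by (rule Bochner_Integration.integrable_bound)
   (use order_trans[OF bdd abs_ge_self] in \<open>auto simp: abs_mult intro!: mult_right_mono\<close>)
 have pi: "integrable (paths \<Otimes>\<^sub>M paths) (%(u, u'). A u * g (u' 0))"
  by (rule PP.Fubini_integrable) (use Ai gi in \<open>auto simp: abs_mult\<close>)
 have "(LINT u|paths. A u * g (u j))
   = (\<integral>u. A u * g (u j) \<partial>distr (paths \<Otimes>\<^sub>M paths) paths (%(u, u'). comb_seq j u u'))"
  by (subst sequence_space.PiM_comb_seq[OF sequence_space_step]) simp
 also have "... = (\<integral>p. (case p of (u, u') => A u * g (u' 0)) \<partial>(paths \<Otimes>\<^sub>M paths))"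
  by (subst integral_distr) (auto simp: A comb_seq_def intro!: Bochner_Integration.integral_cong)
 also have "... = (\<integral>u. \<integral>u'. A u * g (u' 0) \<partial>paths \<partial>paths)" by (subst PP.integral_fst'[symmetric, OF pi]) auto
 also have "... = (LINT u|paths. A u) * (LINT v|\<nu>. g v)" using gi by simp
 finally show "(LINT u|paths. A u * g (u j)) = (LINT u|paths. A u) * (LINT v|\<nu>. g v)" .
qed

lemma step_integrable: "integrable \<nu> (%v. v)"
proof (rule Bochner_Integration.integrable_bound)
 show "integrable \<nu> (%v. 1 + v^2)" using step_sq by simp
 have "\<bar>v\<bar> <= 1 + v^2" for v :: real proof -
  have "0 <= (\<bar>v\<bar> - 1)^2" by simp
  then have "2 * \<bar>v\<bar> <= 1 + v^2" by (simp add: power2_diff)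
  then show ?thesis by linarith
 qed
 then show "AE v in \<nu>. norm v <= norm (1 + v^2)" by (auto intro!: AE_I2)
qed measurable

definition stay :: "nat => real => real" where
 "stay n x = P.prob {u. \<forall>i\<in>{1..n}. x + walk u i > 0}"

lemma stay_set: "{u. \<forall>i\<in>{1..n}. x + walk u i > 0} \<in> sets paths" by (rule sets_CollectI) measurable

lemma stay_mono: "x <= y ==> stay n x <= stay n y" unfolding stay_def by (intro P.finite_measure_mono stay_set) fastforce

lemma stay_antimono: "m <= n ==> stay n x <= stay m x" unfolding stay_def by (intro P.finite_measure_mono stay_set) auto

text \<open>The walk has not yet left the open interval from \<open>0\<close> to \<open>x\<close>; the start at \<open>0\<close> is not tested.\<close>
definition alive :: "real => nat => (nat => real) => bool" where
 "alive x j u \<longleftrightarrow> (\<forall>i\<in>{1..j}. 0 < walk u i & walk u i < x)"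

lemma measurable_alive [measurable]: "Measurable.pred paths (alive x j)" unfolding alive_def by measurable

lemma alive_0 [simp]: "alive x 0 u" by (simp add: alive_def)

lemma alive_Suc: "alive x (Suc j) u \<longleftrightarrow> alive x j u & 0 < walk u (Suc j) & walk u (Suc j) < x"
 unfolding alive_def by (auto simp del: walk_Suc simp: le_Suc_eq)

lemma alive_antimono: "alive x j u ==> i <= j ==> alive x i u" unfolding alive_def by auto

lemma alive_comb_seq [simp]: "j <= m ==> alive x j (comb_seq m u u') = alive x j u" by (auto simp: alive_def walk_comb_seq)

text \<open>The walk stopped at its exit from the interval: the step with index \<open>j\<close> is taken while the walk is alive.\<close>
definition stopped :: "real => nat => (nat => real) => real" where
 "stopped x N u = (\<Sum>j<N. of_bool (alive x j u) * u j)"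

lemma stopped_Suc: "stopped x (Suc N) u = stopped x N u + of_bool (alive x N u) * u N" unfolding stopped_def by (simp only: sum.lessThan_Suc)

lemma stopped_0 [simp]: "stopped x 0 u = 0" by (simp add: stopped_def)

lemma stopped_alive: "alive x N u ==> stopped x N u = walk u N" by (induction N) (simp_all add: stopped_Suc alive_Suc)

lemma stopped_exit:
 "\<not> alive x N u ==> \<exists>j<N. alive x j u & \<not> alive x (Suc j) u & stopped x N u = walk u (Suc j)"
proof (induction N)
 case (Suc N)
 show ?case
 proof (cases "alive x N u")
  case True
  then have "stopped x (Suc N) u = walk u (Suc N)" using stopped_alive[OF True] by (simp add: stopped_Suc)
  then show ?thesis using True Suc.prems by blast
 next
  case False
  then have eq: "stopped x (Suc N) u = stopped x N u" by (simp add: stopped_Suc)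
  obtain j where "j < N" "alive x j u" "\<not> alive x (Suc j) u" "stopped x N u = walk u (Suc j)" using Suc.IH[OF False] by blast
  then show ?thesis unfolding eq using less_SucI by blast
 qed
qed simp

text \<open>Whether step \<open>j\<close> is taken depends on earlier steps only, so the stopped walk is centered and its variance is the step variance times the expected number of steps (Wald).\<close>
lemma stopped_moments:
 assumes "x > 0"
 shows "integrable paths (stopped x N)" "(LINT u|paths. stopped x N u) = 0"
  and "integrable paths (%u. (stopped x N u)^2)"
  and "(LINT u|paths. (stopped x N u)^2) = (LINT v|\<nu>. v^2) * (\<Sum>j<N. P.prob {u. alive x j u})" proof -
 have b1: "integrable paths (%u. of_bool (alive x j u) * g (u j))"
  "(LINT u|paths. of_bool (alive x j u) * g (u j)) = P.prob {u. alive x j u} * (LINT v|\<nu>. g v)"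
  if "integrable \<nu> g" for j and g :: "real => real" proof -
  have "(LINT u|paths. of_bool (alive x j u)) = (LINT u|paths. indicator {u. alive x j u} u)"
   by (intro Bochner_Integration.integral_cong) (auto split: split_indicator)
  also have "... = P.prob {u. alive x j u}" using sets_CollectI[OF measurable_alive] by simp
  finally have "(LINT u|paths. of_bool (alive x j u)) = P.prob {u. alive x j u}" .
  then show "integrable paths (%u. of_bool (alive x j u) * g (u j))"
  "(LINT u|paths. of_bool (alive x j u) * g (u j)) = P.prob {u. alive x j u} * (LINT v|\<nu>. g v)"
   using expectation_split[of "%u. of_bool (alive x j u)" 1 j g, OF _ _ _ that] by auto
 qed
 show "integrable paths (stopped x N)" "(LINT u|paths. stopped x N u) = 0" unfolding stopped_def using b1[OF step_integrable] step_mean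
  by (auto simp: Bochner_Integration.integral_sum simp del: sum_of_bool_mult_eq)
 have *: "integrable paths (%u. (stopped x N u)^2) \<and>
  (LINT u|paths. (stopped x N u)^2) = (LINT v|\<nu>. v^2) * (\<Sum>j<N. P.prob {u. alive x j u})"
 proof (induction N)
  case (Suc N)
  have eq: "(stopped x (Suc N) u)^2 = (stopped x N u)^2
   + 2 * ((of_bool (alive x N u) * walk u N) * u N) + of_bool (alive x N u) * (u N)^2" for u proof -
   have sq: "(s + of_bool b * y)^2 = s^2 + 2 * ((of_bool b * w) * y) + of_bool b * y^2"
    if "b ==> s = w" for s w y :: real and b using that by (cases b) (simp_all add: power2_eq_square algebra_simps)
   show ?thesis unfolding stopped_Suc by (rule sq) (rule stopped_alive)
  qed
  have bd: "\<bar>of_bool (alive x N u) * walk u N\<bar> <= x" for u using assms by (cases N) (auto simp: alive_Suc)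
  have cs: "of_bool (alive x N (comb_seq N u u')) * walk (comb_seq N u u') N
    = of_bool (alive x N u) * walk u N" for u u' by (simp add: walk_comb_seq)
  have m: "(%u. of_bool (alive x N u) * walk u N) \<in> bmeas paths" by measurable
  have c: "integrable paths (%u. (of_bool (alive x N u) * walk u N) * u N)"
   "(LINT u|paths. (of_bool (alive x N u) * walk u N) * u N) = 0" by (rule expectation_split(1)[OF m bd cs step_integrable])
    (simp only: expectation_split(2)[OF m bd cs step_integrable] step_mean mult_zero_right)
  have i1: "integrable paths (%u. (stopped x N u)^2)" using Suc by blast
  have i2: "integrable paths (%u. 2 * ((of_bool (alive x N u) * walk u N) * u N))" by (rule integrable_mult_right[OF c(1)])
  have "(LINT u|paths. (stopped x (Suc N) u)^2) = (LINT u|paths. (stopped x N u)^2)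
   + (LINT u|paths. 2 * ((of_bool (alive x N u) * walk u N) * u N))
   + (LINT u|paths. of_bool (alive x N u) * (u N)^2)" unfolding eq Bint_add[OF Bochner_Integration.integrable_add[OF i1 i2] b1(1)[OF step_sq, of N]]
    Bint_add[OF i1 i2] by (rule refl)
  also have "... = (LINT v|\<nu>. v^2) * (\<Sum>j<Suc N. P.prob {u. alive x j u})"
   using c(2) by (simp only: integral_mult_right_zero conjunct2[OF Suc] b1(2)[OF step_sq, of N] sum.lessThan_Suc) (simp add: distrib_left mult.commute)
  finally have "(LINT u|paths. (stopped x (Suc N) u)^2) = (LINT v|\<nu>. v^2) * (\<Sum>j<Suc N. P.prob {u. alive x j u})" .
  moreover have "integrable paths (%u. (stopped x (Suc N) u)^2)"
   unfolding eq by (rule Bochner_Integration.integrable_add[OF Bochner_Integration.integrable_add[OF i1 i2] b1(1)[OF step_sq, of N]])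
  ultimately show ?case by (rule conjI[rotated])
 qed (simp add: stopped_def)
 show "integrable paths (%u. (stopped x N u)^2)" by (rule conjunct1[OF *])
 show "(LINT u|paths. (stopped x N u)^2) = (LINT v|\<nu>. v^2) * (\<Sum>j<N. P.prob {u. alive x j u})" by (rule conjunct2[OF *])
qed

end

section \<open>Reaching a high level before going below zero\<close>

context centered_walk begin

text \<open>The event that the walk leaves the interval at the top or has not left it by time \<open>N\<close>.\<close>
definition top_or_alive :: "real => nat => (nat => real) => bool" where
 "top_or_alive x N u \<longleftrightarrow> alive x N u | (\<exists>j<N. alive x j u & x <= walk u (Suc j))"

lemma measurable_top_or_alive [measurable]: "Measurable.pred paths (top_or_alive x N)" unfolding top_or_alive_def by measurable

lemma big_jumps:
 assumes "integrable \<nu> g"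
 shows "integrable paths (%u. \<Sum>j<N. of_bool (alive x j u) * g (u j))"
  and "(LINT u|paths. (\<Sum>j<N. of_bool (alive x j u) * g (u j)))
   = (\<Sum>j<N. P.prob {u. alive x j u}) * (LINT v|\<nu>. g v)" proof -
 have p: "(LINT u|paths. of_bool (alive x j u)) = P.prob {u. alive x j u}" for j proof -
  have "(LINT u|paths. of_bool (alive x j u)) = (LINT u|paths. indicator {u. alive x j u} u)"
   by (intro Bochner_Integration.integral_cong) (auto split: split_indicator)
  also have "... = P.prob {u. alive x j u}" using sets_CollectI[OF measurable_alive] by simp
  finally show ?thesis .
 qed
 have b: "integrable paths (%u. of_bool (alive x j u) * g (u j))"
  "(LINT u|paths. of_bool (alive x j u) * g (u j)) = P.prob {u. alive x j u} * (LINT v|\<nu>. g v)" for j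
  using expectation_split[of "%u. of_bool (alive x j u)" 1 j g, OF _ _ _ assms] p by auto
 show "integrable paths (%u. \<Sum>j<N. of_bool (alive x j u) * g (u j))" by (intro Bochner_Integration.integrable_sum b)
 show "(LINT u|paths. (\<Sum>j<N. of_bool (alive x j u) * g (u j)))
   = (\<Sum>j<N. P.prob {u. alive x j u}) * (LINT v|\<nu>. g v)" by (subst Bochner_Integration.integral_sum[OF b(1)]) (simp only: b(2) sum_distrib_right)
qed

text \<open>On an exit the stopped walk exceeds the interval by at most the last jump. Jumps larger than \<open>R\<close> are charged to the sum over all steps taken, whose expectation \<open>big_jumps\<close> computes.\<close>
lemma stopped_bounds:
 assumes x: "x > 0" and N: "N > 0" and R: "R \<ge> 0"
 shows "(stopped x N u)^2 <= 2 * x^2 * of_bool (top_or_alive x N u) + 2 * R^2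
   + 2 * (\<Sum>j<N. of_bool (alive x j u) * ((u j)^2 * of_bool (\<bar>u j\<bar> > R)))"
  and "max 0 (stopped x N u) <= (x + R) * of_bool (top_or_alive x N u)
   + (\<Sum>j<N. of_bool (alive x j u) * (\<bar>u j\<bar> * of_bool (\<bar>u j\<bar> > R)))"
  and "max 0 (- u 0) <= max 0 (- stopped x N u)" proof -
 define Q where "Q = (\<Sum>j<N. of_bool (alive x j u) * ((u j)^2 * of_bool (\<bar>u j\<bar> > R)))"
 define Q' where "Q' = (\<Sum>j<N. of_bool (alive x j u) * (\<bar>u j\<bar> * of_bool (\<bar>u j\<bar> > R)))"
 have Q: "0 <= Q" "0 <= Q'" by (auto simp: Q_def Q'_def intro!: sum_nonneg)
 have jump: "(u j)^2 <= R^2 + Q" "\<bar>u j\<bar> <= R + Q'" if "j < N" "alive x j u" for j proof -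
  have "of_bool (alive x j u) * ((u j)^2 * of_bool (\<bar>u j\<bar> > R)) <= Q" unfolding Q_def using that by (intro member_le_sum) auto
  then show "(u j)^2 <= R^2 + Q" using that(2) R power_mono[of "\<bar>u j\<bar>" R 2] Q
   by (cases "\<bar>u j\<bar> > R") (auto, use zero_le_power2[of R] in linarith)
  have "of_bool (alive x j u) * (\<bar>u j\<bar> * of_bool (\<bar>u j\<bar> > R)) <= Q'" unfolding Q'_def using that by (intro member_le_sum) auto
  then show "\<bar>u j\<bar> <= R + Q'" using that(2) R Q by (cases "\<bar>u j\<bar> > R") auto
 qed
 have range: "0 <= walk u j & walk u j < x" if "alive x j u" for j using that x by (cases j) (auto simp: alive_Suc)
 have "(stopped x N u)^2 <= 2 * x^2 * of_bool (top_or_alive x N u) + 2 * R^2 + 2 * Q \<and>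
   max 0 (stopped x N u) <= (x + R) * of_bool (top_or_alive x N u) + Q' \<and>
   max 0 (- u 0) <= max 0 (- stopped x N u)"
 proof (cases "alive x N u")
  case True
  then have t: "top_or_alive x N u" by (simp add: top_or_alive_def)
  have s: "0 <= stopped x N u" "stopped x N u < x" using range[OF True] stopped_alive[OF True] by auto
  have "(stopped x N u)^2 <= x^2" using s by (intro power_mono) auto
  moreover have "u 0 > 0" using alive_antimono[OF True, of 1] N by (simp add: alive_Suc)
  moreover have "max 0 (stopped x N u) <= (x + R) * of_bool (top_or_alive x N u) + Q'" using s t Q R by simp
  moreover have "2 * x^2 * of_bool (top_or_alive x N u) = 2 * x^2" using t by simp
  ultimately show ?thesis using Q by (auto, use zero_le_power2[of x] zero_le_power2[of R] in linarith)
 next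
  case False
  from stopped_exit[OF False] obtain j where j: "j < N" "alive x j u" "\<not> alive x (Suc j) u"
   "stopped x N u = walk u (Suc j)" by blast
  note r = range[OF j(2)] and jmp = jump[OF j(1,2)]
  have 3: "max 0 (- u 0) <= max 0 (- stopped x N u)"
  proof (cases "u 0 < 0")
   case True
   then have "j = 0" using alive_antimono[OF j(2), of 1] by (cases j) (auto simp: alive_Suc)
   then show ?thesis using j by simp
  qed simp
  show ?thesis
  proof (cases "x <= walk u (Suc j)")
   case True
   then have t: "top_or_alive x N u" using j by (auto simp: top_or_alive_def)
   have s: "0 <= stopped x N u" "stopped x N u <= x + \<bar>u j\<bar>" using j(4) True x r by auto
   have "(stopped x N u)^2 <= (x + \<bar>u j\<bar>)^2" using s by (intro power_mono) auto
   also have "... <= 2 * x^2 + 2 * (u j)^2" using sum_squares_bound[of x "\<bar>u j\<bar>"] by (simp add: power2_sum)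
   finally show ?thesis using jmp s t 3 x R Q by simp
  next
   case False
   then have "walk u (Suc j) <= 0" using j by (auto simp: alive_Suc)
   then have "\<bar>stopped x N u\<bar> <= \<bar>u j\<bar>" "stopped x N u <= 0" using j(4) r by auto
   then have "(stopped x N u)^2 <= (u j)^2" "stopped x N u <= 0" by (simp_all only: abs_le_square_iff)
   moreover have "(stopped x N u)^2 <= 2 * (R^2 + Q)" proof -
    have "(stopped x N u)^2 <= R^2 + Q" by (rule order_trans[OF calculation(1) jmp(1)])
    also have "... <= 2 * (R^2 + Q)" using Q by simp
    finally show ?thesis .
   qed
   ultimately show ?thesis using 3 x R Q by (cases "top_or_alive x N u") (auto simp: algebra_simps intro: order_trans)
  qed
 qed
 then show "(stopped x N u)^2 <= 2 * x^2 * of_bool (top_or_alive x N u) + 2 * R^2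
   + 2 * (\<Sum>j<N. of_bool (alive x j u) * ((u j)^2 * of_bool (\<bar>u j\<bar> > R)))"
  and "max 0 (stopped x N u) <= (x + R) * of_bool (top_or_alive x N u)
   + (\<Sum>j<N. of_bool (alive x j u) * (\<bar>u j\<bar> * of_bool (\<bar>u j\<bar> > R)))"
  and "max 0 (- u 0) <= max 0 (- stopped x N u)" unfolding Q_def Q'_def by auto
qed

text \<open>The truncation level \<open>R\<close> is chosen so that large jumps cost a quarter of the variance and can be absorbed on the other side of the inequality.\<close>
lemma small_tail_variance:
 obtains R where "R > 0" "(LINT v|\<nu>. v^2 * of_bool (\<bar>v\<bar> > R)) <= (LINT v|\<nu>. v^2) / 4" proof -
 have "(%n. LINT v|\<nu>. v^2 * of_bool (\<bar>v\<bar> > real n)) ---> (LINT v|\<nu>. 0)"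
 proof (rule integral_dominated_convergence[where w = "%v. v^2"])
  show "AE v in \<nu>. (%n. v^2 * of_bool (\<bar>v\<bar> > real n)) ---> 0"
  proof (intro AE_I2)
   fix v :: real
   obtain m where "\<bar>v\<bar> < real m" using reals_Archimedean2 by blast
   then have "eventually (%n. v^2 * of_bool (\<bar>v\<bar> > real n) = 0) sequentially" by (intro eventually_sequentiallyI[of m]) auto
   then show "(%n. v^2 * of_bool (\<bar>v\<bar> > real n)) ---> 0" by (rule tendsto_eventually)
  qed
 qed (use step_sq in \<open>auto intro!: AE_I2\<close>)
 then have "(%n. LINT v|\<nu>. v^2 * of_bool (\<bar>v\<bar> > real n)) ---> 0" by simp
 from order_tendstoD(2)[OF this, of "(LINT v|\<nu>. v^2) / 4"] step_var_pos
 have "eventually (%n. (LINT v|\<nu>. v^2 * of_bool (\<bar>v\<bar> > real n)) < (LINT v|\<nu>. v^2) / 4) sequentially" by simp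
 with eventually_gt_at_top[of 0] obtain n :: nat where "n > 0"
  "(LINT v|\<nu>. v^2 * of_bool (\<bar>v\<bar> > real n)) < (LINT v|\<nu>. v^2) / 4"
  using eventually_happens[OF eventually_conj] by (metis (mono_tags, lifting) sequentially_bot)
 then show ?thesis by (intro that[of "real n"]) auto
qed

lemma negative_part_pos: "(LINT v|\<nu>. max 0 (- v)) > 0" proof -
 have int: "integrable \<nu> (%v. max 0 (- v))" using step_integrable by simp
 have "(LINT v|\<nu>. max 0 (- v)) ~= 0"
 proof
  assume "(LINT v|\<nu>. max 0 (- v)) = 0"
  then have "AE v in \<nu>. max 0 (- v) = 0" by (subst (asm) integral_nonneg_eq_0_iff_AE[OF int]) auto
  then have nn: "AE v in \<nu>. 0 <= v" by eventually_elim auto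
  have "AE v in \<nu>. v = 0" using step_mean integral_nonneg_eq_0_iff_AE[OF step_integrable nn] by simp
  then have "(LINT v|\<nu>. v^2) = (LINT v|\<nu>. 0)" by (intro integral_cong_AE) auto
  then show False using step_var_pos by simp
 qed
 moreover have "0 <= (LINT v|\<nu>. max 0 (- v))" by (intro integral_nonneg_AE AE_I2) auto
 ultimately show ?thesis by linarith
qed

text \<open>Since the stopped walk is centered, its positive part has at least the mean of the negative part of one step, while it is at most of order \<open>x\<close> on the event in question. The expected exit time is controlled by the second moment of the stopped walk.\<close>
lemma top_or_alive_ge:
 obtains c where "c > 0" "!!x N. 1 <= x ==> 0 < N ==> c / x <= P.prob {u. top_or_alive x N u}" proof -
 define s where "s = (LINT v|\<nu>. v^2)"
 define c0 where "c0 = (LINT v|\<nu>. max 0 (- v))"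
 have s: "s > 0" and c0: "c0 > 0" using step_var_pos negative_part_pos by (auto simp: s_def c0_def)
 obtain R where R: "R > 0" "(LINT v|\<nu>. v^2 * of_bool (\<bar>v\<bar> > R)) <= s / 4" using small_tail_variance unfolding s_def by blast
 define K where "K = max 1 (8 * R^2 / c0)"
 have K: "K \<ge> 1" "8 * R^2 / c0 <= K" by (auto simp: K_def)
 have main: "c0 / (2 * (5 + K)) / x <= P.prob {u. top_or_alive x N u}" if x: "1 <= x" and N: "0 < N" for x N proof -
  define p where "p = P.prob {u. top_or_alive x N u}"
  define e where "e = (\<Sum>j<N. P.prob {u. alive x j u})"
  have x0: "x > 0" using x by simp
  have p0: "0 <= p" by (simp add: p_def)
  have e0: "0 <= e" by (auto simp: e_def intro!: sum_nonneg)
  have ip: "integrable paths (%u. of_bool (top_or_alive x N u) :: real)" by (rule P.integrable_const_bound[of _ 1]) auto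
  have ep: "(LINT u|paths. of_bool (top_or_alive x N u)) = p" proof -
   have "(LINT u|paths. of_bool (top_or_alive x N u)) = (LINT u|paths. indicator {u. top_or_alive x N u} u)"
    by (intro Bochner_Integration.integral_cong) (auto split: split_indicator)
   also have "... = p" using sets_CollectI[OF measurable_top_or_alive] by (simp add: p_def)
   finally show ?thesis .
  qed
  note st = stopped_moments[OF x0, of N]
  have i2: "integrable \<nu> (%v. v^2 * of_bool (\<bar>v\<bar> > r))" for r by (rule Bochner_Integration.integrable_bound[OF step_sq]) auto
  have i1: "integrable \<nu> (%v. \<bar>v\<bar> * of_bool (\<bar>v\<bar> > r))" for r
   by (rule Bochner_Integration.integrable_bound[OF step_integrable]) auto
  have "s * e = (LINT u|paths. (stopped x N u)^2)" using st(4) by (simp add: s_def e_def)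
  also have "... <= (LINT u|paths. 2 * x^2 * of_bool (top_or_alive x N u) + 2 * R^2
   + 2 * (\<Sum>j<N. of_bool (alive x j u) * ((u j)^2 * of_bool (\<bar>u j\<bar> > R))))"
   using R by (intro integral_mono st(3) stopped_bounds[OF x0 N] Bochner_Integration.integrable_add
     integrable_mult_right ip big_jumps(1)[OF i2]) auto
  also have "... = 2 * x^2 * p + 2 * R^2 + 2 * (e * (LINT v|\<nu>. v^2 * of_bool (\<bar>v\<bar> > R)))" proof -
   have j1: "integrable paths (%u. 2 * x^2 * of_bool (top_or_alive x N u))" by (rule integrable_mult_right[OF ip])
   have j2: "integrable paths (%u. 2 * x^2 * of_bool (top_or_alive x N u) + 2 * R^2)" by (rule Bochner_Integration.integrable_add[OF j1]) simp
   show ?thesis unfolding Bint_add[OF j2 integrable_mult_right[OF big_jumps(1)[OF i2]]]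
     Bint_add[OF j1 P.integrable_const] integral_mult_right_zero ep
     big_jumps(2)[OF i2] e_def by (simp add: P.prob_space[simplified])
  qed
  also have "... <= 2 * x^2 * p + 2 * R^2 + 2 * (e * (s / 4))" using R e0 by (intro add_left_mono mult_left_mono) auto
  finally have es: "e * s <= 4 * x^2 * p + 4 * R^2" by (simp add: mult.commute)

  define r where "r = K * x"
  have r: "r > 0" using K x by (simp add: r_def)
  have m: "(LINT v|\<nu>. \<bar>v\<bar> * of_bool (\<bar>v\<bar> > r)) <= s / r" proof -
   have "(LINT v|\<nu>. \<bar>v\<bar> * of_bool (\<bar>v\<bar> > r)) <= (LINT v|\<nu>. v^2 / r)"
   proof (intro integral_mono i1)
    show "\<bar>v\<bar> * of_bool (\<bar>v\<bar> > r) <= v^2 / r" for v using r mult_left_mono[of r "\<bar>v\<bar>" "\<bar>v\<bar>"]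
     by (cases "\<bar>v\<bar> > r") (auto simp: field_simps power2_eq_square)
   qed (use step_sq in simp)
   then show ?thesis by (simp add: s_def)
  qed
  have c0eq: "c0 = (LINT u|paths. max 0 (- u 0))"
   and ic0: "integrable paths (%u. max 0 (- u 0))" proof -
   have *: "integrable \<nu> (%v. max 0 (- v))" using step_integrable by simp
   show "integrable paths (%u. max 0 (- u 0))" "c0 = (LINT u|paths. max 0 (- u 0))"
    using expectation_split[of "%_. 1" 1 0, OF _ _ _ *] by (auto simp: c0_def P.prob_space[simplified])
  qed
  have ipos: "integrable paths (%u. max 0 (stopped x N u))" "integrable paths (%u. max 0 (- stopped x N u))" using st(1) by auto
  have "(LINT u|paths. max 0 (stopped x N u)) - (LINT u|paths. max 0 (- stopped x N u))
    = (LINT u|paths. max 0 (stopped x N u) - max 0 (- stopped x N u))" by (rule Bint_diff[OF ipos, symmetric])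
  also have "... = (LINT u|paths. stopped x N u)" by (intro Bochner_Integration.integral_cong) auto
  finally have bal: "(LINT u|paths. max 0 (- stopped x N u)) = (LINT u|paths. max 0 (stopped x N u))" using st(2) by simp
  have "c0 <= (LINT u|paths. max 0 (- stopped x N u))" unfolding c0eq by (intro integral_mono ic0 ipos stopped_bounds(3)[OF x0 N order_refl])
  also have "... <= (LINT u|paths. (x + r) * of_bool (top_or_alive x N u)
   + (\<Sum>j<N. of_bool (alive x j u) * (\<bar>u j\<bar> * of_bool (\<bar>u j\<bar> > r))))"
   unfolding bal using r by (intro integral_mono ipos stopped_bounds(2)[OF x0 N] Bochner_Integration.integrable_add
     integrable_mult_right ip big_jumps(1)[OF i1]) auto
  also have "... = (x + r) * p + e * (LINT v|\<nu>. \<bar>v\<bar> * of_bool (\<bar>v\<bar> > r))"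
   unfolding Bint_add[OF integrable_mult_right[OF ip] big_jumps(1)[OF i1]]
    integral_mult_right_zero ep big_jumps(2)[OF i1] e_def ..
  also have "... <= (x + r) * p + e * (s / r)" using e0 m by (intro add_left_mono mult_left_mono)
  also have "... = (x + r) * p + (e * s) / r" by simp
  also have "... <= (x + r) * p + (4 * x^2 * p + 4 * R^2) / r" using r es by (intro add_left_mono divide_right_mono) auto
  also have "... = (x + r) * p + 4 * x^2 * p / r + 4 * R^2 / r" by (simp add: add_divide_distrib)
  also have "... <= (x + K * x) * p + 4 * x * p + c0 / 2"
  proof (intro add_mono)
   show "4 * x^2 * p / r <= 4 * x * p" unfolding r_def using K x p0 mult_right_mono[of 1 K "x * p"] by (auto simp: divide_simps power2_eq_square mult_ac)
   have "8 * R^2 <= c0 * K" using K c0 by (simp add: field_simps)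
   also have "... <= c0 * (K * x)" using c0 K x by (intro mult_left_mono) (auto simp: mult_le_cancel_left1)
   finally show "4 * R^2 / r <= c0 / 2" unfolding r_def using K x by (simp add: divide_simps mult_ac)
  qed (simp add: r_def)
  finally have "c0 / 2 <= (5 + K) * x * p" by (simp add: algebra_simps)
  then show ?thesis unfolding p_def[symmetric] using K x by (simp add: divide_simps mult_ac)
 qed
 show ?thesis by (rule that[of "c0 / (2 * (5 + K))"]) (use c0 K main in auto)
qed

end

section \<open>Staying positive: dependence on the starting point and reversal\<close>

context centered_walk begin

text \<open>To stay positive when started from \<open>0\<close>, the walk can first climb above \<open>x\<close>, which has probability at least of order \<open>1/x\<close>, and then stay positive from there.\<close>
lemma stay_le_linear:
 obtains c where "c > 0" "!!x n. 1 <= x ==> stay n x <= c * x * stay n 0" proof -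
 obtain c where c: "c > 0" "!!x N. 1 <= x ==> 0 < N ==> c / x <= P.prob {p. top_or_alive x N p}" using top_or_alive_ge by blast
 have main: "stay n x <= (1 / c) * x * stay n 0" if x: "1 <= x" and n: "0 < n" for x n proof -
  define U where "U = {p. \<forall>i\<in>{1..n}. 0 + walk p i > 0}"
  define top where "top j = (%p. alive x j p & x <= walk p (Suc j))" for j
  define A where "A j = {p. top j p & (\<forall>i\<in>{1..n}. x + (walk p (Suc j + i) - walk p (Suc j)) > 0)}" for j
  have [measurable]: "Measurable.pred paths (top j)" for j unfolding top_def by (measurable)
  have sets: "U \<in> sets paths" "A j \<in> sets paths" for j unfolding U_def A_def by (intro sets_CollectI; measurable)+
  have st: "0 <= stay n x" "stay n x <= 1" by (auto simp: stay_def)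
  have pA: "P.prob (A j) = P.prob {p. top j p} * stay n x" for j unfolding A_def stay_def
  proof (rule prob_split[where m = "Suc j"])
   show "(top j (comb_seq (Suc j) p p') & (\<forall>i\<in>{1..n}. 0 < x + (walk (comb_seq (Suc j) p p') (Suc j + i)
     - walk (comb_seq (Suc j) p p') (Suc j)))) = (top j p & (\<forall>i\<in>{1..n}. 0 < x + walk p' i))" for p p'
    by (auto simp: top_def walk_comb_seq simp del: walk_Suc)
  qed measurable
  have incl: "{p. alive x n p} \<union> (\<Union>j<n. A j) \<subseteq> U" proof -
   have "p \<in> U" if w: "p \<in> A j" "j < n" for p j proof -
    have al: "alive x j p" "x <= walk p (Suc j)"
     and w2: "!!i. i \<in> {1..n} ==> x + (walk p (Suc j + i) - walk p (Suc j)) > 0" using w by (auto simp: A_def top_def)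
    have "0 < walk p i" if i: "i \<in> {1..n}" for i
    proof (cases "i <= Suc j")
     case True
     then show ?thesis using al x i by (cases "i = Suc j") (auto simp: alive_def simp del: walk_Suc)
    next
     case False
     then have "i - Suc j \<in> {1..n}" using i by auto
     from w2[OF this] show ?thesis using False al by (simp del: walk_Suc)
    qed
    then show ?thesis by (simp add: U_def)
   qed
   moreover have "p \<in> U" if "alive x n p" for p using that by (auto simp: U_def alive_def)
   ultimately show ?thesis by auto
  qed
  have top_uniq: "i = j" if "top i p" "top j p" for i j p
  proof (rule ccontr)
   assume "i ~= j"
   then consider "i < j" | "j < i" by linarith
   then show False using that alive_antimono[of x j p "Suc i"] alive_antimono[of x i p "Suc j"] by cases (auto simp: top_def alive_Suc)
  qed
  have disj: "disjoint_family_on A {..<n}" unfolding disjoint_family_on_def A_def using top_uniq by blast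
  have "alive x n p ==> j < n ==> \<not> top j p" for p j using alive_antimono[of x n p "Suc j"] by (auto simp: top_def alive_Suc)
  then have disj2: "{p. alive x n p} \<inter> (\<Union>j<n. A j) = {}" by (auto simp: A_def)
  have "c / x * stay n x <= P.prob {p. top_or_alive x n p} * stay n x" using c(2)[OF x n] st by (intro mult_right_mono) auto
  also have "P.prob {p. top_or_alive x n p} <= P.prob {p. alive x n p} + (\<Sum>j<n. P.prob {p. top j p})" proof -
   have e: "{p. top_or_alive x n p} = {p. alive x n p} \<union> (\<Union>j<n. {p. top j p})" by (auto simp: top_or_alive_def top_def)
   have s: "{p. alive x n p} \<in> sets paths" "{p. top j p} \<in> sets paths" for j by (intro sets_CollectI; measurable)+
   have "P.prob {p. top_or_alive x n p} <= P.prob {p. alive x n p} + P.prob (\<Union>j<n. {p. top j p})" unfolding e using s by (intro measure_Un_le) auto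
   also have "P.prob (\<Union>j<n. {p. top j p}) <= (\<Sum>j<n. P.prob {p. top j p})" using s by (intro P.finite_measure_subadditive_finite) auto
   finally show ?thesis by simp
  qed
  also have "(P.prob {p. alive x n p} + (\<Sum>j<n. P.prob {p. top j p})) * stay n x
    <= P.prob {p. alive x n p} + (\<Sum>j<n. P.prob (A j))" unfolding pA using st by (simp add: distrib_right sum_distrib_right mult_left_le)
  also have "... = P.prob ({p. alive x n p} \<union> (\<Union>j<n. A j))"
   using disj disj2 sets by (subst P.finite_measure_Union) (auto intro!: sets_CollectI P.finite_measure_finite_Union[symmetric])
  also have "... <= stay n 0" unfolding stay_def U_def[symmetric] using incl sets by (intro P.finite_measure_mono) auto
  finally show ?thesis using st c(1) x by (simp add: field_simps mult_right_mono)
 qed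
 have "stay n x <= max 1 (1 / c) * x * stay n 0" if x: "1 <= x" for x n
 proof (cases "n = 0")
  case True
  then show ?thesis using x mult_mono[of 1 "max 1 (1/c)" 1 x] by (simp add: stay_def P.prob_space[simplified])
 next
  case False
  then have "stay n x <= (1 / c) * x * stay n 0" using main x by simp
  also have "... <= max 1 (1 / c) * x * stay n 0" using x by (intro mult_right_mono) (auto simp: stay_def)
  finally show ?thesis .
 qed
 then show ?thesis using that[of "max 1 (1/c)"] by auto
qed

lemma stay_nonneg [simp]: "0 <= stay n x" by (simp add: stay_def)

text \<open>Reversal of the first \<open>m\<close> steps; later steps are kept, so that the law of the whole path is invariant.\<close>
definition rev_path :: "nat => (nat => real) => nat => real" where
 "rev_path m p = (%i. p (if i < m then m - 1 - i else i))"

lemma distr_rev_path: "distr paths paths (rev_path m) = paths" proof -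
 have "inj (%i. if i < m then m - 1 - i else i)" by (rule injI) (auto split: if_splits)
 then show ?thesis using distr_PiM_reindex[where M = "%_::nat. \<nu>" and f = "%i. if i < m then m - 1 - i else i" and I = UNIV and K = UNIV]
   prob_space_axioms by (simp add: rev_path_def[abs_def] restrict_UNIV)
qed

lemma measurable_rev_path [measurable]: "rev_path m \<in> measurable paths paths" unfolding rev_path_def by (rule measurable_PiM_single') auto

lemma prob_rev_path:
 assumes "Measurable.pred paths Q"
 shows "P.prob {p. Q (rev_path m p)} = P.prob {p. Q p}" proof -
 have "P.prob {p. Q p} = measure (distr paths paths (rev_path m)) {p. Q p}" by (simp add: distr_rev_path)
 also have "... = P.prob {p. Q (rev_path m p)}" by (subst measure_distr) (auto intro!: sets_CollectI assms)
 finally show ?thesis ..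
qed

lemma walk_rev_path: "i <= m ==> walk (rev_path m p) i = walk p m - walk p (m - i)"
proof (induction i)
 case (Suc i)
 have "m - i = Suc (m - Suc i)" using Suc.prems by simp
 then have "walk p (m - i) = walk p (m - Suc i) + p (m - Suc i)" by simp
 then show ?case using Suc by (simp add: rev_path_def)
qed (simp add: walk_def)

lemma walk_rev_path_ge: "m <= i ==> walk (rev_path m p) i = walk p i"
proof (induction i rule: dec_induct)
 case base
 show ?case by (simp add: walk_rev_path)
next
 case (step i)
 then show ?case by (simp add: rev_path_def)
qed

definition stay_below :: "nat => real => real" where
 "stay_below n y = P.prob {p. \<forall>i\<in>{1..n}. walk p i < y}"

lemma stay_below_nonneg [simp]: "0 <= stay_below n y" by (simp add: stay_below_def)

lemma stay_below_antimono: "m <= n ==> stay_below n x <= stay_below m x"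
 unfolding stay_below_def by (intro P.finite_measure_mono) (auto intro!: sets_CollectI)

text \<open>A path has at most one strict minimum.\<close>

text \<open>A path of length \<open>n\<close> has at most one strict minimum. Splitting at its time and reversing the first part gives \<open>n + 1\<close> disjoint events, each at least as likely as the product.\<close>
lemma stay_stay_below_0: "stay n 0 * stay_below n 0 <= 1 / (n + 1)" proof -
 define A where "A j = {p. (\<forall>i<j. walk p j < walk p i) & (\<forall>i\<in>{j<..n}. walk p j < walk p i)}" for j
 have A: "A j \<in> sets paths" for j unfolding A_def by (rule sets_CollectI) measurable
 have "P.prob (A j) = stay_below j 0 * stay (n - j) 0" if "j <= n" for j proof -
  define Q where "Q p \<longleftrightarrow> (\<forall>i\<in>{1..j}. walk p i < 0) & (\<forall>i\<in>{1..n-j}. 0 < 0 + (walk p (j + i) - walk p j))" for p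
  have Qm: "Measurable.pred paths Q" unfolding Q_def by measurable
  have "Q (rev_path j p) \<longleftrightarrow> p \<in> A j" for p proof -
   have "(\<forall>i\<in>{1..j}. walk (rev_path j p) i < 0) \<longleftrightarrow> (\<forall>i\<in>{1..j}. walk p j < walk p (j - i))"
    by (simp add: walk_rev_path)
   also have "... \<longleftrightarrow> (\<forall>i<j. walk p j < walk p i)"
   proof safe
    fix i assume *: "\<forall>i\<in>{1..j}. walk p j < walk p (j - i)" "i < j"
    show "walk p j < walk p i" using *(1)[rule_format, of "j - i"] *(2) by simp
   qed auto
   finally have 1: "(\<forall>i\<in>{1..j}. walk (rev_path j p) i < 0) \<longleftrightarrow> (\<forall>i<j. walk p j < walk p i)" .
   have "(\<forall>i\<in>{1..n-j}. 0 < 0 + (walk (rev_path j p) (j + i) - walk (rev_path j p) j))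
     \<longleftrightarrow> (\<forall>i\<in>{1..n-j}. walk p j < walk p (j + i))" by (simp add: walk_rev_path_ge)
   also have "... \<longleftrightarrow> (\<forall>i\<in>{j<..n}. walk p j < walk p i)"
   proof safe
    fix i assume *: "\<forall>i\<in>{1..n-j}. walk p j < walk p (j + i)" "i \<in> {j<..n}"
    have "i - j \<in> {1..n-j}" "j + (i - j) = i" using *(2) by auto
    then show "walk p j < walk p i" using *(1) by metis
   qed auto
   finally show ?thesis using 1 by (simp add: Q_def A_def)
  qed
  then have "P.prob (A j) = P.prob {p. Q p}" using prob_rev_path[OF Qm, of j] by simp
  also have "... = stay_below j 0 * stay (n - j) 0" unfolding stay_below_def stay_def
  proof (rule prob_split[where m = j])
   show "Q (comb_seq j p p') = ((\<forall>i\<in>{1..j}. walk p i < 0) & (\<forall>i\<in>{1..n - j}. 0 < 0 + walk p' i))" for p p'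
    by (auto simp: Q_def walk_comb_seq)
  qed (use Qm in measurable)
  finally show ?thesis .
 qed
 note pA = this
 have disj: "disjoint_family_on A {..n}" unfolding disjoint_family_on_def
 proof (intro ballI impI)
  fix i j assume ij: "i \<in> {..n}" "j \<in> {..n}" "i ~= j"
  have "A i \<inter> A j = {}" if "i < j" "j <= n" for i j proof -
   have "walk p j < walk p i" "walk p i < walk p j" if "p \<in> A i" "p \<in> A j" for p
    using that \<open>i < j\<close> \<open>j <= n\<close> by (auto simp: A_def)
   then show ?thesis by fastforce
  qed
  then show "A i \<inter> A j = {}" using ij by (metis Int_commute atMost_iff linorder_neqE_nat)
 qed
 have "(\<Sum>j\<le>n. stay_below n 0 * stay n 0) <= (\<Sum>j\<le>n. P.prob (A j))"
  by (intro sum_mono) (auto intro!: mult_mono stay_antimono stay_below_antimono simp: pA)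
 also have "... = P.prob (\<Union>j\<le>n. A j)" using A disj by (intro P.finite_measure_finite_Union[symmetric]) auto
 also have "... <= 1" by simp
 finally show ?thesis by (simp add: field_simps)
qed

lemma centered_walk_reflected: "centered_walk (distr \<nu> borel uminus)" proof -
 interpret R: prob_space "distr \<nu> borel uminus" by (rule prob_space_distr) simp
 show ?thesis by unfold_locales (use step_mean step_sq step_var_pos in \<open>auto simp: integral_distr integrable_distr_eq\<close>)
qed

lemma stay_below_reflected: "stay_below n y = centered_walk.stay (distr \<nu> borel uminus) n y" proof -
 interpret R: centered_walk "distr \<nu> borel uminus" by (rule centered_walk_reflected)
 have [measurable]: "(%p i. - p i) \<in> measurable paths R.paths" by (rule measurable_PiM_single') auto
 have "R.paths = distr paths R.paths (%p i. - p i)"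
 proof (rule measure_eqI_PiM_infinite[where I = UNIV and M = "%_. distr \<nu> borel uminus"])
  show "finite_measure R.paths" by unfold_locales
  fix A and J :: "nat set" assume J: "finite J" "J \<subseteq> UNIV" and A: "!!i. i \<in> J ==> A i \<in> sets (distr \<nu> borel uminus)"
  have Ai: "uminus -` A i \<in> sets \<nu>" if "i \<in> J" for i using measurable_sets[of uminus \<nu> borel "A i"] A[OF that] by simp
  interpret S: product_prob_space "%_::nat. \<nu>" UNIV by (intro product_prob_spaceI prob_space_axioms)
  interpret SR: product_prob_space "%_::nat. distr \<nu> borel uminus" UNIV by (intro product_prob_spaceI R.prob_space_axioms)
  have "emeasure (distr paths R.paths (%p i. - p i)) (prod_emb UNIV (%_. distr \<nu> borel uminus) J (Pi\<^sub>E J A))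
   = emeasure paths (prod_emb UNIV (%_. \<nu>) J (Pi\<^sub>E J (%i. uminus -` A i)))" using sets_PiM_I[OF J, of A "%_. distr \<nu> borel uminus"] A
   by (subst emeasure_distr) (auto simp: prod_emb_def PiE_iff intro!: arg_cong[where f = "emeasure paths"])
  also have "... = (\<Prod>i\<in>J. emeasure \<nu> (uminus -` A i))" using J Ai by (intro S.emeasure_PiM_emb) auto
  also have "... = (\<Prod>i\<in>J. emeasure (distr \<nu> borel uminus) (A i))" using A by (intro prod.cong refl) (simp add: emeasure_distr)
  also have "... = emeasure R.paths (prod_emb UNIV (%_. distr \<nu> borel uminus) J (Pi\<^sub>E J A))"
   using J A by (intro SR.emeasure_PiM_emb[symmetric]) auto
  finally show "emeasure R.paths (prod_emb UNIV (%_. distr \<nu> borel uminus) J (Pi\<^sub>E J A)) =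
   emeasure (distr paths R.paths (%p i. - p i)) (prod_emb UNIV (%_. distr \<nu> borel uminus) J (Pi\<^sub>E J A))" ..
 qed auto
 then have "R.stay n y = measure (distr paths R.paths (%p i. - p i)) {p. \<forall>i\<in>{1..n}. y + walk p i > 0}" unfolding R.stay_def by simp
 also have "... = P.prob {p. \<forall>i\<in>{1..n}. y + walk (%i. - p i) i > 0}" by (subst measure_distr) (auto intro!: R.sets_CollectI)
 also have "... = stay_below n y" by (simp add: stay_below_def walk_def sum_negf)
 finally show ?thesis ..
qed

text \<open>The linear dependence on the starting points follows by applying \<open>stay_le_linear\<close> to the walk and to its reflection.\<close>
lemma stay_stay_below:
 obtains c where "c > 0" "!!x y n. 1 <= x ==> 1 <= y ==> stay n x * stay_below n y <= c * x * y / (n + 1)" proof -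
 interpret R: centered_walk "distr \<nu> borel uminus" by (rule centered_walk_reflected)
 obtain a where a: "a > 0" "!!x n. 1 <= x ==> stay n x <= a * x * stay n 0" using stay_le_linear by blast
 obtain b where b: "b > 0" "!!x n. 1 <= x ==> R.stay n x <= b * x * R.stay n 0" using R.stay_le_linear by blast
 have "stay n x * stay_below n y <= a * b * x * y / (n + 1)" if "1 <= x" "1 <= y" for x y n proof -
  have "stay n x * stay_below n y <= (a * x * stay n 0) * (b * y * stay_below n 0)"
   unfolding stay_below_reflected using a b that by (intro mult_mono) (auto simp: R.stay_def stay_def)
  also have "... = (a * b * x * y) * (stay n 0 * stay_below n 0)" by (simp add: mult_ac)
  also have "... <= (a * b * x * y) * (1 / (n + 1))" using stay_stay_below_0[of n] a(1) b(1) that by (intro mult_left_mono) (auto simp: add.commute)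
  finally show ?thesis by simp
 qed
 then show ?thesis using that[of "a * b"] a(1) b(1) by auto
qed

end

section \<open>Concentration of the walk on unit intervals\<close>

context centered_walk begin

lemma real_distribution_step: "real_distribution \<nu>" by unfold_locales auto

text \<open>Near \<open>0\<close> the characteristic function of a centered step with positive variance is Gaussian.\<close>
lemma char_bound:
 obtains a c where "0 < a" "a <= 1" "0 < c" "!!t. \<bar>t\<bar> <= a ==> cmod (char \<nu> t) <= exp (- c * t^2)" proof -
 interpret RD: real_distribution \<nu> by (rule real_distribution_step)
 define s where "s = (LINT v|\<nu>. v^2)"
 define J where "J t = (LINT x|\<nu>. min (6 * x^2) (\<bar>t\<bar> * \<bar>x\<bar> ^ 3))" for t :: real
 have s: "s > 0" using step_var_pos by (simp add: s_def)
 have approx: "cmod (char \<nu> t - complex_of_real (1 - t^2 * s / 2)) <= t^2 / 6 * J t" for t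
  unfolding J_def by (rule RD.char_approx3) (use step_mean step_integrable step_sq in \<open>auto simp: s_def\<close>)
 have int: "integrable \<nu> (%x. min (6 * x^2) (\<bar>t\<bar> * \<bar>x\<bar> ^ 3))" for t :: real
  by (rule Bochner_Integration.integrable_bound[where f = "%x. 6 * x^2"]) (use step_sq in auto)
 have "(%n. J (1 / real (Suc n))) ---> (LINT x|\<nu>. 0)" unfolding J_def
 proof (rule integral_dominated_convergence[where w = "%x. 6 * x^2"])
  show "AE x in \<nu>. (%n. min (6 * x^2) (\<bar>1 / real (Suc n)\<bar> * \<bar>x\<bar> ^ 3)) ---> 0"
  proof (intro AE_I2)
   fix x :: real
   have "(%n. (1 / real (Suc n)) * \<bar>x\<bar> ^ 3) ---> 0 * \<bar>x\<bar> ^ 3"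
    using LIMSEQ_inverse_real_of_nat by (intro tendsto_intros) (simp add: inverse_eq_divide)
   then have "(%n. min (6 * x^2) (\<bar>1 / real (Suc n)\<bar> * \<bar>x\<bar> ^ 3)) ---> min (6 * x^2) 0" by (intro tendsto_min) auto
   then show "(%n. min (6 * x^2) (\<bar>1 / real (Suc n)\<bar> * \<bar>x\<bar> ^ 3)) ---> 0" by simp
  qed
 qed (use step_sq in auto)
 then have "eventually (%n. J (1 / real (Suc n)) < s) sequentially" using order_tendstoD(2)[of _ 0 sequentially s] s by simp
 then obtain m where m: "J (1 / real (Suc m)) < s" using eventually_sequentially by auto
 define a where "a = min 1 (min (1 / real (Suc m)) (sqrt (2 / s)))"
 have a: "0 < a" "a <= 1" "a <= 1 / real (Suc m)" "a <= sqrt (2 / s)" using s by (auto simp: a_def)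
 have "cmod (char \<nu> t) <= exp (- (s / 3) * t^2)" if t: "\<bar>t\<bar> <= a" for t proof -
  have "J t <= J (1 / real (Suc m))" unfolding J_def using t a by (intro integral_mono int min.mono order_refl mult_right_mono) auto
  then have "t^2 / 6 * J t <= t^2 / 6 * s" using m by (intro mult_left_mono) auto
  with approx[of t] have "cmod (char \<nu> t - complex_of_real (1 - t^2 * s / 2)) <= t^2 * s / 6" by simp
  moreover have "cmod (char \<nu> t) <= cmod (char \<nu> t - complex_of_real (1 - t^2 * s / 2)) + cmod (complex_of_real (1 - t^2 * s / 2))"
   by (metis norm_triangle_sub add.commute)
  moreover have "cmod (complex_of_real (1 - t^2 * s / 2)) = 1 - t^2 * s / 2" proof -
   have "\<bar>t\<bar> <= sqrt (2 / s)" using t a by simp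
   then have "t^2 <= 2 / s" by (metis real_le_rsqrt real_sqrt_abs real_sqrt_le_iff)
   then have "t^2 * s / 2 <= 1" using s by (simp add: field_simps)
   then have "0 <= 1 - t^2 * s / 2" by simp
   then show ?thesis by (metis abs_of_nonneg norm_of_real)
  qed
  ultimately have "cmod (char \<nu> t) <= 1 + (- (s / 3) * t^2)" by (simp add: algebra_simps)
  also have "... <= exp (- (s / 3) * t^2)" by (rule exp_ge_add_one_self)
  finally show ?thesis .
 qed
 then show ?thesis using that[of a "s / 3"] a s by auto
qed

lemma walk_trig:
 "Complex (LINT h|paths. cos (t * walk h n)) (LINT h|paths. sin (t * walk h n)) = char \<nu> t ^ n"
proof (induction n)
 case 0
 then show ?case by (simp add: P.prob_space[simplified] one_complex.code)
next
 case (Suc n)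
 have i: "integrable \<nu> (%v. cos (t * v))" "integrable \<nu> (%v. sin (t * v))" by (auto intro!: integrable_const_bound[of _ 1])
 have ch: "char \<nu> t = Complex (LINT v|\<nu>. cos (t * v)) (LINT v|\<nu>. sin (t * v))"
 proof (rule complex_eqI)
  have ii: "complex_integrable \<nu> (%x. iexp (t * x))" by (rule integrable_const_bound[of _ 1]) auto
  show "Re (char \<nu> t) = Re (Complex (LINT v|\<nu>. cos (t * v)) (LINT v|\<nu>. sin (t * v)))"
   unfolding char_def by (subst integral_Re[OF ii, symmetric]) (simp add: Re_exp)
  show "Im (char \<nu> t) = Im (Complex (LINT v|\<nu>. cos (t * v)) (LINT v|\<nu>. sin (t * v)))"
   unfolding char_def by (subst integral_Im[OF ii, symmetric]) (simp add: Im_exp)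
 qed
 have m: "(%h. cos (t * walk h n)) \<in> bmeas paths" "(%h. sin (t * walk h n)) \<in> bmeas paths" by measurable
 have b: "\<bar>cos (t * walk h n)\<bar> <= 1" "\<bar>sin (t * walk h n)\<bar> <= 1" for h by auto
 have d: "cos (t * walk (comb_seq n h h') n) = cos (t * walk h n)"
  "sin (t * walk (comb_seq n h h') n) = sin (t * walk h n)" for h h' by (simp_all add: walk_comb_seq)
 note E = expectation_split[OF m(1) b(1) d(1) i(1)] expectation_split[OF m(1) b(1) d(1) i(2)]
  expectation_split[OF m(2) b(2) d(2) i(1)] expectation_split[OF m(2) b(2) d(2) i(2)]
 have c: "(LINT h|paths. cos (t * walk h (Suc n)))
  = (LINT h|paths. cos (t * walk h n)) * (LINT v|\<nu>. cos (t * v)) - (LINT h|paths. sin (t * walk h n)) * (LINT v|\<nu>. sin (t * v))"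
  by (simp only: walk_Suc distrib_left cos_add Bint_diff[OF E(1) E(7)] E)
 have s: "(LINT h|paths. sin (t * walk h (Suc n)))
  = (LINT h|paths. sin (t * walk h n)) * (LINT v|\<nu>. cos (t * v)) + (LINT h|paths. cos (t * walk h n)) * (LINT v|\<nu>. sin (t * v))"
  by (simp only: walk_Suc distrib_left sin_add Bint_add[OF E(5) E(3)] E)
 have "char \<nu> t ^ Suc n = char \<nu> t * Complex (LINT h|paths. cos (t * walk h n)) (LINT h|paths. sin (t * walk h n))" using Suc by simp
 also have "... = Complex (LINT h|paths. cos (t * walk h (Suc n))) (LINT h|paths. sin (t * walk h (Suc n)))"
  unfolding c s ch by (simp add: complex_eq_iff algebra_simps)
 finally show ?case ..
qed

lemma cos_walk_le: "(LINT h|paths. cos (t * (walk h n - r))) <= cmod (char \<nu> t) ^ n" proof -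
 have i: "integrable paths (%h. cos (t * walk h n) * cos (t * r))" "integrable paths (%h. sin (t * walk h n) * sin (t * r))"
  by (auto intro!: P.integrable_const_bound[of _ 1] integrable_mult_left)
 have "(LINT h|paths. cos (t * (walk h n - r)))
   = (LINT h|paths. cos (t * walk h n)) * cos (t * r) + (LINT h|paths. sin (t * walk h n)) * sin (t * r)"
  by (simp only: right_diff_distrib cos_diff Bint_add[OF i] integral_mult_left_zero)
 also have "... = Re (char \<nu> t ^ n * cis (- (t * r)))" unfolding walk_trig[symmetric] by simp
 also have "... <= cmod (char \<nu> t ^ n * cis (- (t * r)))" by (rule complex_Re_le_cmod)
 also have "... = cmod (char \<nu> t) ^ n" by (simp add: norm_mult norm_power)
 finally show ?thesis .
qed

end

lemma average_le: "a <= c ==> b <= c ==> (a + b) / 2 <= (c :: real)" by simp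

lemma uniform_gauss_le:
 assumes q: "q > 0"
 shows "(\<integral>s. exp (- q * (s + r)^2) \<partial>uniform_measure lborel {-1..1::real}) <= sqrt (pi / q)" proof -
 interpret U: prob_space "uniform_measure lborel {-1..1::real}" by (rule prob_space_uniform_measure) auto
 have eq: "exp (- q * (s + r)^2) = sqrt (pi / q) * normal_density (- r) (1 / sqrt (2 * q)) s" for s
  using q by (simp add: normal_density_def real_sqrt_divide power_divide field_simps real_sqrt_mult)
 interpret N: prob_space "density lborel (normal_density (- r) (1 / sqrt (2 * q)))" using q by (intro prob_space_normal_density) simp
 have "(\<integral>\<^sup>+s. ennreal (exp (- q * (s + r)^2)) \<partial>uniform_measure lborel {-1..1::real})
   = (\<integral>\<^sup>+s\<in>{-1..1}. ennreal (exp (- q * (s + r)^2)) \<partial>lborel) / emeasure lborel {-1..1::real}"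
  by (rule nn_integral_uniform_measure) auto
 also have "... <= (NN lborel (%s. ennreal (exp (- q * (s + r)^2)))) / emeasure lborel {-1..1::real}"
  by (intro divide_right_mono_ennreal nn_integral_mono) (auto split: split_indicator)
 also have "... <= (NN lborel (%s. ennreal (exp (- q * (s + r)^2))))" proof -
  have "X / 2 <= X" for X :: ennreal by (cases X) (auto simp: ennreal_divide_numeral intro!: ennreal_leI)
  then show ?thesis by simp
 qed
 also have "... = (NN lborel (%s. ennreal (sqrt (pi / q)) * ennreal (normal_density (- r) (1 / sqrt (2 * q)) s)))"
  unfolding eq using q by (simp add: ennreal_mult)
 also have "... = ennreal (sqrt (pi / q)) * emeasure (density lborel (normal_density (- r) (1 / sqrt (2 * q)))) UNIV"
  by (subst nn_integral_cmult) (auto simp: emeasure_density)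
 also have "... = ennreal (sqrt (pi / q))" using N.emeasure_space_1 by simp
 finally have "(\<integral>\<^sup>+s. ennreal (exp (- q * (s + r)^2)) \<partial>uniform_measure lborel {-1..1::real}) <= ennreal (sqrt (pi / q))" .
 then show ?thesis using q by (subst integral_eq_nn_integral) (auto intro!: enn2real_leI)
qed

context centered_walk begin

text \<open>A nonnegative trigonometric kernel, the square of an average of cosines, is at least a quarter on the unit interval. Its expectation is an average of characteristic functions, which \<open>char_bound\<close> estimates by a Gaussian integral.\<close>
lemma concentration:
 obtains C where "C > 0" "!!n r. 0 < n ==> P.prob {h. \<bar>walk h n - r\<bar> <= 1} <= C / sqrt (real n)" proof -
 obtain b c where bc: "0 < b" "b <= 1" "0 < c" "!!t. \<bar>t\<bar> <= b ==> cmod (char \<nu> t) <= exp (- c * t^2)" using char_bound by blast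
 define a where "a = b / 2"
 have a: "0 < a" "a <= 1" using bc by (auto simp: a_def)
 define \<sigma> where "\<sigma> = uniform_measure lborel {-1..1::real}"
 have [measurable_cong, simp]: "sets \<sigma> = sets borel" by (simp add: \<sigma>_def)
 interpret U: prob_space \<sigma> unfolding \<sigma>_def by (rule prob_space_uniform_measure) auto
 have AE01: "AE s in \<sigma>. \<bar>s\<bar> <= 1" unfolding \<sigma>_def by (rule AE_uniform_measureI) auto
 interpret UU: pair_prob_space \<sigma> \<sigma> ..
 interpret PU: pair_prob_space paths "\<sigma> \<Otimes>\<^sub>M \<sigma>" ..
 have [simp]: "space \<sigma> = UNIV" using sets_eq_imp_space_eq[of \<sigma> borel] by simp
 have AE2: "AE p in \<sigma> \<Otimes>\<^sub>M \<sigma>. \<bar>fst p\<bar> <= 1 & \<bar>snd p\<bar> <= 1" proof -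
  have *: "AE s in \<sigma>. AE s' in \<sigma>. \<bar>fst (s, s')\<bar> <= 1 & \<bar>snd (s, s')\<bar> <= 1"
   using AE01 by eventually_elim (use AE01 in \<open>simp\<close>)
  have "Measurable.pred (\<sigma> \<Otimes>\<^sub>M \<sigma>) (%p. \<bar>fst p\<bar> <= 1 & \<bar>snd p\<bar> <= 1)" by measurable
  then show ?thesis using * by (intro UU.AE_pair_measure) (simp_all add: pred_def)
 qed
 have main: "P.prob {h. \<bar>walk h n - r\<bar> <= 1} <= (4 * sqrt (pi / (c * a^2))) / sqrt (real n)" if n: "0 < n" for n r proof -
  define q where "q = c * a^2 * real n"
  have q: "q > 0" using a bc n by (simp add: q_def)
  define k where "k u = (LINT s|\<sigma>. cos (a * s * u))" for u :: real
  have icos: "integrable \<sigma> (%s. cos (a * s * u))" for u by (rule U.integrable_const_bound[of _ 1]) auto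
  have kk: "(k u)^2 = (\<integral>p. cos (a * fst p * u) * cos (a * snd p * u) \<partial>(\<sigma> \<Otimes>\<^sub>M \<sigma>))" for u proof -
   have i: "integrable (\<sigma> \<Otimes>\<^sub>M \<sigma>) (%(s, s'). cos (a * s * u) * cos (a * s' * u))"
    by (rule UU.P.integrable_const_bound[of _ 1]) (auto simp: abs_mult split_beta' intro!: AE_I2 mult_le_one)
   have "(\<integral>p. cos (a * fst p * u) * cos (a * snd p * u) \<partial>(\<sigma> \<Otimes>\<^sub>M \<sigma>))
     = (\<integral>p. (case p of (s, s') => cos (a * s * u) * cos (a * s' * u)) \<partial>(\<sigma> \<Otimes>\<^sub>M \<sigma>))"
    by (intro Bochner_Integration.integral_cong) auto
   also have "... = (\<integral>s. \<integral>s'. cos (a * s * u) * cos (a * s' * u) \<partial>\<sigma> \<partial>\<sigma>)"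
    by (subst UU.integral_fst'[symmetric, OF i]) simp
   also have "... = (k u)^2" by (simp add: k_def power2_eq_square)
   finally show ?thesis ..
  qed
  have kbig: "1 / 4 <= (k u)^2" if u: "\<bar>u\<bar> <= 1" for u proof -
   have "(LINT s|\<sigma>. 1 / 2) <= k u" unfolding k_def
   proof (intro integral_mono_AE icos)
    show "AE s in \<sigma>. 1 / 2 <= cos (a * s * u)" using AE01
    proof eventually_elim
     fix s :: real assume s: "\<bar>s\<bar> <= 1"
     have "\<bar>a * s * u\<bar> <= 1 * 1 * 1" unfolding abs_mult using a s u by (intro mult_mono) auto
     then have "\<bar>a * s * u\<bar> <= pi / 3" using pi_gt3 by linarith
     then have "cos (pi / 3) <= cos \<bar>a * s * u\<bar>" by (intro cos_monotone_0_pi_le) auto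
     then show "1 / 2 <= cos (a * s * u)" by (simp add: cos_60)
    qed
   qed auto
   then have "1 / 2 <= k u" using U.prob_space by simp
   then have "(1 / 2)^2 <= (k u)^2" by (intro power_mono) auto
   then show ?thesis by (simp add: power2_eq_square)
  qed
  define F where "F h p = cos (a * fst p * (walk h n - r)) * cos (a * snd p * (walk h n - r))"
   for h :: "nat => real" and p :: "real \<times> real"
  have Fm [measurable]: "(%z. F (fst z) (snd z)) \<in> bmeas (paths \<Otimes>\<^sub>M (\<sigma> \<Otimes>\<^sub>M \<sigma>))" unfolding F_def by measurable
  have F1: "\<bar>F h p\<bar> <= 1" for h p unfolding F_def abs_mult by (intro mult_le_one) auto
  have iF: "integrable (paths \<Otimes>\<^sub>M (\<sigma> \<Otimes>\<^sub>M \<sigma>)) (%(h, p). F h p)"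
   using Fm F1 by (intro PU.P.integrable_const_bound[of _ 1]) (auto simp: split_beta')
  have ik: "integrable paths (%h. (k (walk h n - r))^2)" using PU.integrable_fst'[OF iF] unfolding kk F_def by simp
  have "P.prob {h. \<bar>walk h n - r\<bar> <= 1} = (LINT h|paths. indicator {h. \<bar>walk h n - r\<bar> <= 1} h)"
   by (subst Bochner_Integration.integral_indicator) (auto intro!: sets_CollectI)
  also have "... <= (LINT h|paths. 4 * (k (walk h n - r))^2)"
  proof (intro integral_mono)
   show "integrable paths (indicat_real {h. \<bar>walk h n - r\<bar> <= 1})"
    by (rule P.integrable_const_bound[of _ 1]) (auto intro!: sets_CollectI borel_measurable_indicator)
   show "indicator {h. \<bar>walk h n - r\<bar> <= 1} h <= 4 * (k (walk h n - r))^2" for h using kbig[of "walk h n - r"] by (auto split: split_indicator)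
  qed (use ik in auto)
  also have "... = 4 * (\<integral>p. \<integral>h. F h p \<partial>paths \<partial>(\<sigma> \<Otimes>\<^sub>M \<sigma>))"
   using PU.Fubini_integral[OF iF] unfolding kk F_def by simp
  also have "(\<integral>p. \<integral>h. F h p \<partial>paths \<partial>(\<sigma> \<Otimes>\<^sub>M \<sigma>)) \<le>
   (\<integral>p. (exp (- q * (fst p + snd p)^2) + exp (- q * (fst p + - snd p)^2)) / 2 \<partial>(\<sigma> \<Otimes>\<^sub>M \<sigma>))"
  proof (intro integral_mono_AE)
   show "integrable (\<sigma> \<Otimes>\<^sub>M \<sigma>) (%p. LINT h|paths. F h p)" using PU.integrable_snd[OF iF] by simp
   show "integrable (\<sigma> \<Otimes>\<^sub>M \<sigma>) (%p. (exp (- q * (fst p + snd p)^2) + exp (- q * (fst p + - snd p)^2)) / 2)"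
   proof (intro UU.P.integrable_const_bound[of _ 1] AE_I2)
    fix p :: "real \<times> real"
    have "exp (- q * z^2) <= 1" for z using q by simp
    from this[of "fst p + snd p"] this[of "fst p + - snd p"]
    show "norm ((exp (- q * (fst p + snd p)^2) + exp (- q * (fst p + - snd p)^2)) / 2) <= 1"
     by (simp only: real_norm_def abs_of_nonneg add_nonneg_nonneg divide_nonneg_pos exp_ge_zero) (rule average_le)
   qed measurable
   show "AE p in \<sigma> \<Otimes>\<^sub>M \<sigma>. (LINT h|paths. F h p) <= (exp (- q * (fst p + snd p)^2) + exp (- q * (fst p + - snd p)^2)) / 2"
    using AE2
   proof eventually_elim
    fix p :: "real \<times> real" assume p: "\<bar>fst p\<bar> <= 1 & \<bar>snd p\<bar> <= 1"
    have bd: "(LINT h|paths. cos ((a * y) * (walk h n - r))) <= exp (- q * y^2)" if y: "\<bar>y\<bar> <= 2" for y proof -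
     have "\<bar>a * y\<bar> <= b" using y a unfolding abs_mult a_def by (auto simp: mult_left_le)
     then have "cmod (char \<nu> (a * y)) ^ n <= exp (- c * (a * y)^2) ^ n" by (intro power_mono bc(4)) auto
     also have "... = exp (- q * y^2)" unfolding exp_of_nat_mult[symmetric] q_def by (simp add: power_mult_distrib mult_ac)
     finally show ?thesis using cos_walk_le[of "a * y" n r] by simp
    qed
    have i: "integrable paths (%h. cos ((a * y) * (walk h n - r)))" for y by (rule P.integrable_const_bound[of _ 1]) auto
    have "F h p = (cos ((a * (fst p + - snd p)) * (walk h n - r)) + cos ((a * (fst p + snd p)) * (walk h n - r))) / 2" for h
     unfolding F_def cos_times_cos by (simp add: algebra_simps)
    then have "(LINT h|paths. F h p) = ((LINT h|paths. cos ((a * (fst p + - snd p)) * (walk h n - r)))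
      + (LINT h|paths. cos ((a * (fst p + snd p)) * (walk h n - r)))) / 2" by (simp only: Bint_add[OF i i] integral_divide_zero)
    also have "... <= (exp (- q * (fst p + - snd p)^2) + exp (- q * (fst p + snd p)^2)) / 2" using p by (intro divide_right_mono add_mono bd) auto
    finally show "(LINT h|paths. F h p) <= (exp (- q * (fst p + snd p)^2) + exp (- q * (fst p + - snd p)^2)) / 2" by (simp add: add.commute)
   qed
  qed
  also have "... <= sqrt (pi / q)" proof -
   define G where "G e p = exp (- q * (fst p + e * snd p)^2)" for e :: real and p :: "real \<times> real"
   have Gm [measurable]: "G e \<in> bmeas (\<sigma> \<Otimes>\<^sub>M \<sigma>)" for e unfolding G_def by measurable
   have iG: "integrable (\<sigma> \<Otimes>\<^sub>M \<sigma>) (G e)" for e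
    using q by (intro UU.P.integrable_const_bound[of _ 1]) (auto simp: G_def mult_nonneg_nonpos2)
   have "(\<integral>p. G e p \<partial>(\<sigma> \<Otimes>\<^sub>M \<sigma>)) <= sqrt (pi / q)" for e proof -
    have "integrable (\<sigma> \<Otimes>\<^sub>M \<sigma>) (%(s, s'). G e (s, s'))" using iG by simp
    from UU.integral_snd[OF this] UU.integrable_snd[OF this]
    have 1: "(\<integral>p. G e p \<partial>(\<sigma> \<Otimes>\<^sub>M \<sigma>)) = (\<integral>s'. \<integral>s. G e (s, s') \<partial>\<sigma> \<partial>\<sigma>)"
     and 2: "integrable \<sigma> (%s'. LINT s|\<sigma>. G e (s, s'))" by auto
    have "(\<integral>s'. \<integral>s. G e (s, s') \<partial>\<sigma> \<partial>\<sigma>) <= (LINT s'|\<sigma>. sqrt (pi / q))"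
     using uniform_gauss_le[OF q] 2 unfolding \<sigma>_def[symmetric] by (intro integral_mono) (auto simp: G_def)
    then show ?thesis using 1 U.prob_space by simp
   qed
   from this[of 1] this[of "-1"]
   have "(\<integral>p. (G 1 p + G (-1) p) / 2 \<partial>(\<sigma> \<Otimes>\<^sub>M \<sigma>)) <= sqrt (pi / q)"
    by (simp only: integral_divide_zero Bint_add[OF iG iG]) (rule average_le)
   then show ?thesis by (simp add: G_def)
  qed
  finally show ?thesis using n unfolding q_def by (simp add: real_sqrt_divide real_sqrt_mult mult_ac)
 qed
 show ?thesis by (rule that[of "4 * sqrt (pi / (c * a^2))"]) (use main a bc in auto)
qed

end

section \<open>The ballot estimate\<close>

lemma walk_comb_seq_add: "walk (comb_seq m w w') (m + j) = walk w m + walk w' j" by (cases j) (auto simp: walk_comb_seq simp del: walk_Suc)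

context centered_walk begin

text \<open>The path is cut into three parts. The first stays nonnegative, the last, read backwards, stays below the end point, and the middle part has to hit a unit interval; the factors are of order \<open>1/n\<close> together and \<open>1/sqrt n\<close>.\<close>
lemma stay_and_end:
 obtains C where "C > 0"
  "!!n x y. 0 < n ==> 0 <= x ==> 0 <= y ==>
   P.prob {w. (\<forall>j\<le>n. 0 <= x + walk w j) & x + walk w n \<in> {y..y + 1}}
    <= C * (1 + x) * (1 + y) / (real n * sqrt (real n))" proof -
 obtain c where c: "c > 0" "!!x y n. 1 <= x ==> 1 <= y ==> stay n x * stay_below n y <= c * x * y / (n + 1)" using stay_stay_below by blast
 obtain K where K: "K > 0" "!!n r. 0 < n ==> P.prob {w. \<bar>walk w n - r\<bar> <= 1} <= K / sqrt (real n)" using concentration by blast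
 have main: "P.prob {w. (\<forall>j\<le>n. 0 <= x + walk w j) & x + walk w n \<in> {y..y + 1}}
    <= (c * K * 12) * (1 + x) * (1 + y) / (real n * sqrt (real n))"
  if n: "0 < n" and x: "0 <= x" and y: "0 <= y" for n x y proof -
  define m where "m = n div 3"
  define l where "l = n - 2 * m"
  have l: "0 < l" "m + (l + m) = n" "real n <= 3 * real l" and mn: "real n <= 3 * (real m + 1)" using n by (auto simp: l_def m_def)
  have last: "P.prob {w. r + walk w (l + m) \<in> {y..y+1} & (\<forall>j\<le>m. 0 <= r + walk w (l + j))}
    <= K / sqrt (real l) * stay_below m (y + 2)" for r proof -
   define Q where "Q w \<longleftrightarrow> r + walk w (l + m) \<in> {y..y+1} & (\<forall>j\<le>m. 0 <= r + walk w (l + j))" for w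
   define A where "A w \<longleftrightarrow> (\<forall>j\<le>m. walk w m - walk w j <= y + 1)" for w
   have [measurable]: "Measurable.pred paths Q" "Measurable.pred paths A" unfolding Q_def A_def by measurable
   have s: "{w. Q w} \<in> sets paths" "{w. A w} \<in> sets paths"
    "{w'. \<bar>walk w' l - z\<bar> <= 1} \<in> sets paths" for z by (intro sets_CollectI; measurable)+
   interpret PP: pair_prob_space paths paths ..
   have "emeasure paths {w. Q w} = (NN paths (%w. indicator {w. Q w} w))" using s by (subst nn_integral_indicator) auto
   also have "... = (\<integral>\<^sup>+w. \<integral>\<^sup>+w'. indicator {w. Q w} (comb_seq l w w') \<partial>paths \<partial>paths)"
    using s by (intro nn_integral_split) (rule borel_measurable_indicator)
   also have "... = (\<integral>\<^sup>+w'. \<integral>\<^sup>+w. indicator {w. Q w} (comb_seq l w w') \<partial>paths \<partial>paths)"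
   proof (rule PP.Fubini'[symmetric])
    show "(%(w, w'). indicator {w. Q w} (comb_seq l w w') :: ennreal) \<in> bmeas (paths \<Otimes>\<^sub>M paths)"
     using measurable_compose[OF measurable_comb_seq borel_measurable_indicator[OF s(1)], of l] by (simp add: split_beta')
   qed
   also have "... <= (\<integral>\<^sup>+w'. \<integral>\<^sup>+w. indicator {w. A w} w' * indicator {w. \<bar>walk w l - (y + 1 / 2 - r - walk w' m)\<bar> <= 1} w \<partial>paths \<partial>paths)"
   proof (intro nn_integral_mono)
    fix w w'
    show "indicator {w. Q w} (comb_seq l w w') \<le>
     (indicator {w. A w} w' * indicator {w. \<bar>walk w l - (y + 1 / 2 - r - walk w' m)\<bar> <= 1} w :: ennreal)"
    proof (cases "Q (comb_seq l w w')")
     case True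
     then have 1: "r + (walk w l + walk w' m) \<in> {y..y+1}" and 2: "!!j. j <= m ==> 0 <= r + (walk w l + walk w' j)"
      unfolding Q_def walk_comb_seq_add by blast+
     have "A w'" unfolding A_def
     proof (intro allI impI)
      fix j assume "j <= m"
      from 2[OF this] 1 show "walk w' m - walk w' j <= y + 1" by simp
     qed
     moreover have "\<bar>walk w l - (y + 1 / 2 - r - walk w' m)\<bar> <= 1" using 1 by (simp add: abs_if)
     ultimately show ?thesis using True by simp
    qed simp
   qed
   also have "... = (NN paths (%w'. indicator {w. A w} w' * emeasure paths {w. \<bar>walk w l - (y + 1 / 2 - r - walk w' m)\<bar> <= 1}))"
    using s by (intro nn_integral_cong) (simp add: nn_integral_cmult)
   also have "... <= (NN paths (%w'. indicator {w. A w} w' * ennreal (K / sqrt (real l))))"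
    using K(2)[OF l(1)] by (intro nn_integral_mono mult_left_mono) (auto simp: P.emeasure_eq_measure intro!: ennreal_leI)
   also have "... = emeasure paths {w. A w} * ennreal (K / sqrt (real l))" using s by (subst nn_integral_multc) auto
   also have "... = ennreal (P.prob {w. A w} * (K / sqrt (real l)))" using K(1) by (simp add: P.emeasure_eq_measure flip: ennreal_mult')
   finally have 1: "P.prob {w. Q w} <= P.prob {w. A w} * (K / sqrt (real l))" using K(1) by (simp add: P.emeasure_eq_measure)
   have "P.prob {w. A w} = P.prob {w. A (rev_path m w)}" by (rule prob_rev_path[symmetric]) measurable
   also have "... <= stay_below m (y + 2)" unfolding stay_below_def
   proof (intro P.finite_measure_mono subsetI CollectI ballI)
    fix w i assume "w \<in> {w. A (rev_path m w)}" and i: "i \<in> {1..m}"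
    then have "walk (rev_path m w) m - walk (rev_path m w) (m - i) <= y + 1" by (auto simp: A_def)
    then show "walk w i < y + 2" using i by (simp add: walk_rev_path)
   qed (intro sets_CollectI; measurable)
   finally have "P.prob {w. A w} * (K / sqrt (real l)) <= stay_below m (y + 2) * (K / sqrt (real l))" using K(1) by (intro mult_right_mono) auto
   then show ?thesis using 1 by (simp add: Q_def mult.commute)
  qed
  have "P.prob {w. (\<forall>j\<le>n. 0 <= x + walk w j) & x + walk w n \<in> {y..y + 1}}
    <= P.prob {w. \<forall>i\<in>{1..m}. x + 1 + walk w i > 0} * (K / sqrt (real l) * stay_below m (y + 2))"
  proof (rule prob_split_le[where m = m and B = "%w w'. (x + walk w m) + walk w' (l + m) \<in> {y..y+1} & (\<forall>j\<le>m. 0 <= (x + walk w m) + walk w' (l + j))"])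
   fix w w'
   assume *: "(\<forall>j\<le>n. 0 <= x + walk (comb_seq m w w') j) & x + walk (comb_seq m w w') n \<in> {y..y + 1}"
   have nn: "0 <= x + walk (comb_seq m w w') j" if "j <= n" for j using * that by blast
   have 1: "0 < x + 1 + walk w j" if "j \<in> {1..m}" for j using nn[of j] that l(2) by (simp add: walk_comb_seq)
   have 2: "0 <= (x + walk w m) + walk w' (l + j)" if "j <= m" for j using nn[of "m + (l + j)"] that l(2) unfolding walk_comb_seq_add by simp
   have "x + walk (comb_seq m w w') (m + (l + m)) \<in> {y..y + 1}" using * l(2) by simp
   then have 3: "(x + walk w m) + walk w' (l + m) \<in> {y..y + 1}" unfolding walk_comb_seq_add by (simp add: add.assoc)
   show "(\<forall>i\<in>{1..m}. 0 < x + 1 + walk w i) & x + walk w m + walk w' (l + m) \<in> {y..y + 1} \<and>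
     (\<forall>j\<le>m. 0 <= x + walk w m + walk w' (l + j))" using 1 2 3 by blast
  next
   show "P.prob {w'. (x + walk w m) + walk w' (l + m) \<in> {y..y+1} & (\<forall>j\<le>m. 0 <= (x + walk w m) + walk w' (l + j))}
    <= K / sqrt (real l) * stay_below m (y + 2)" for w by (rule last)
  qed measurable
  also have "... = stay m (x + 1) * stay_below m (y + 2) * (K / sqrt (real l))" by (simp add: stay_def mult_ac)
  also have "... <= c * (x + 1) * (y + 2) / (m + 1) * (K / sqrt (real l))" using K(1) x y by (intro mult_right_mono c(2)) auto
  also have "... <= (c * (x + 1) * (2 * (y + 1)) * (3 / real n)) * (K * (2 / sqrt (real n)))"
  proof (intro mult_mono)
   have "1 / (real m + 1) <= 3 / real n" using mn n by (simp add: field_simps)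
   then have "(c * (x + 1) * (y + 2)) * (1 / (real m + 1)) <= (c * (x + 1) * (2 * (y + 1))) * (3 / real n)" using c(1) x y by (intro mult_mono) auto
   then show "c * (x + 1) * (y + 2) / real (m + 1) <= (c * (x + 1) * (2 * (y + 1)) * (3 / real n))" by (simp add: add.commute)
   have "sqrt (real n) <= sqrt (4 * real l)" using l by (intro real_sqrt_le_mono) auto
   also have "... = 2 * sqrt (real l)" by (simp add: real_sqrt_mult)
   finally have "1 / sqrt (real l) <= 2 / sqrt (real n)" using n l(1) by (simp add: field_simps)
   then have "K * (1 / sqrt (real l)) <= K * (2 / sqrt (real n))" using K(1) by (intro mult_left_mono) auto
   then show "K / sqrt (real l) <= K * (2 / sqrt (real n))" by simp
  qed (use c K x y in auto)
  also have "... = (c * K * 12) * (1 + x) * (1 + y) / (real n * sqrt (real n))" using n by (simp add: field_simps)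
  finally show ?thesis .
 qed
 show ?thesis by (rule that[of "c * K * 12"]) (use main c K in auto)
qed

end

section \<open>Labelled families and the branching property\<close>

text \<open>The exponential of the negative with value \<open>0\<close> at infinity; it turns sums with values in \<^typ>\<open>ennreal\<close> into products.\<close>
definition nexp :: "ennreal => real" where
 "nexp a = (if a = \<infinity> then 0 else exp (- enn2real a))"

lemma nexp_bounds [simp]: "0 <= nexp a" "nexp a <= 1" "\<bar>nexp a\<bar> <= 1" by (auto simp: nexp_def)

lemma nexp_0 [simp]: "nexp 0 = 1" by (simp add: nexp_def)
lemma nexp_top [simp]: "nexp \<top> = 0" by (simp add: nexp_def)

lemma nexp_ennreal: "0 <= x ==> nexp (ennreal x) = exp (- x)" by (simp add: nexp_def)

lemma nexp_add: "nexp (a + b) = nexp a * nexp b" by (cases a; cases b) (auto simp: nexp_def enn2real_plus exp_add[symmetric])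

lemma nexp_sum: "finite A ==> nexp (\<Sum>x\<in>A. f x) = (\<Prod>x\<in>A. nexp (f x))" by (induction A rule: finite_induct) (auto simp: nexp_add)

lemma nexp_antimono: "a <= b ==> nexp b <= nexp a" by (auto simp: nexp_def top_unique intro!: enn2real_mono simp: less_top[symmetric])

lemma measurable_nexp [measurable]: "nexp \<in> bmeas borel" unfolding nexp_def by measurable

lemma tendsto_nexp:
 assumes "(f \<longlongrightarrow> a) F"
 shows "((%x. nexp (f x)) \<longlongrightarrow> nexp a) F"
proof (cases "a = \<infinity>")
 case False
 then have fin: "a < \<top>" by (simp add: less_top)
 have "eventually (%x. f x < \<top>) F" by (rule order_tendstoD(2)[OF assms fin])
 then have "eventually (%x. exp (- enn2real (f x)) = nexp (f x)) F" by eventually_elim (auto simp: nexp_def)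
 moreover have "((%x. exp (- enn2real (f x))) \<longlongrightarrow> exp (- enn2real a)) F" using assms fin by (intro tendsto_intros tendsto_enn2real) auto
 ultimately have "((%x. nexp (f x)) \<longlongrightarrow> exp (- enn2real a)) F" by (rule Lim_transform_eventually[rotated])
 then show ?thesis using False by (simp add: nexp_def)
next
 case True
 show ?thesis
 proof (rule tendstoI)
  fix e :: real assume e: "e > 0"
  define K where "K = max 0 (- ln e) + 1"
  have "ennreal K < a" using True by simp
  then have "eventually (%x. ennreal K < f x) F" by (rule order_tendstoD(1)[OF assms])
  then show "eventually (%x. dist (nexp (f x)) (nexp a) < e) F"
  proof eventually_elim
   fix x assume "ennreal K < f x"
   then have "nexp (f x) <= nexp (ennreal K)" by (intro nexp_antimono) simp
   also have "... = exp (- K)" by (rule nexp_ennreal) (simp add: K_def)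
   also have "... < exp (ln e)" by (subst exp_less_cancel_iff) (auto simp: K_def)
   finally show "dist (nexp (f x)) (nexp a) < e" using e True by simp
  qed
 qed
qed

lemma measurable_count_sum:
 assumes "countable A" and [measurable]: "!!z. z \<in> A ==> (%x. F x z) \<in> bmeas N"
 shows "(%x. \<integral>\<^sup>+z. F x z \<partial>cs A) \<in> bmeas N" proof -
 interpret C: sigma_finite_measure "cs A" using assms(1) by (rule sigma_finite_measure_count_space_countable)
 have "(%(z, x). F x z) \<in> bmeas (cs A \<Otimes>\<^sub>M N)" using assms by (intro measurable_pair_measure_countable1) auto
 then have "case_prod F \<in> bmeas (N \<Otimes>\<^sub>M cs A)" by (subst measurable_pair_swap_iff) (simp add: split_beta')
 then show ?thesis by (rule C.borel_measurable_nn_integral)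
qed

lemma count_sum_limit:
 fixes a :: "'a :: countable => ennreal"
 shows "(%N. \<Sum>z\<in>{z\<in>A. to_nat z < N}. a z) ---> (NN (cs A) (%z. a z))" proof -
 have fin: "finite {z\<in>A. to_nat z < N}" for N
 proof (rule finite_subset)
  show "finite (to_nat -` {..<N} :: 'a set)" by (intro finite_vimageI) auto
 qed auto
 have eq: "(\<Sum>z\<in>{z\<in>A. to_nat z < N}. a z) = (NN (cs A) (%z. a z * indicator {z. to_nat z < N} z))" for N proof -
  have "(NN (cs A) (%z. a z * indicator {z. to_nat z < N} z)) = (\<Sum>z\<in>{z\<in>A. to_nat z < N}. a z * indicator {z. to_nat z < N} z)"
   by (rule nn_integral_count_space'[OF fin]) (auto split: split_indicator)
  also have "... = (\<Sum>z\<in>{z\<in>A. to_nat z < N}. a z)" by (rule sum.cong) auto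
  finally show ?thesis ..
 qed
 have "incseq (%N. \<Sum>z\<in>{z\<in>A. to_nat z < N}. a z)" using fin by (intro incseq_SucI sum_mono2) auto
 then have "(%N. \<Sum>z\<in>{z\<in>A. to_nat z < N}. a z) ---> (SUP N. \<Sum>z\<in>{z\<in>A. to_nat z < N}. a z)" by (rule LIMSEQ_SUP)
 also have "(SUP N. \<Sum>z\<in>{z\<in>A. to_nat z < N}. a z) = (NN (cs A) (%z. (SUP N. a z * indicator {z. to_nat z < N} z)))" unfolding eq
 proof (rule nn_integral_monotone_convergence_SUP[symmetric])
  show "incseq (%N z. a z * indicator {z. to_nat z < N} z)"
  proof (intro incseq_SucI le_funI)
   show "a z * indicator {z. to_nat z < N} z <= a z * indicator {z. to_nat z < Suc N} z" for N z by (cases "to_nat z < N") auto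
  qed
 qed simp
 also have "... = (NN (cs A) (%z. a z))"
 proof (intro nn_integral_cong antisym)
  fix z
  show "(SUP N. a z * indicator {z. to_nat z < N} z) <= a z" by (intro SUP_least) (auto split: split_indicator)
  show "a z <= (SUP N. a z * indicator {z. to_nat z < N} z)" by (rule SUP_upper2[of "Suc (to_nat z)"]) auto
 qed
 finally show ?thesis .
qed

type_synonym family = "nat list => nat => ereal"

primrec pos :: "nat list => family => ereal" where
 "pos [] t = 0"
| "pos (k # u) t = pos u t + t u k"

definition sub :: "nat list => family => family" where
 "sub z t = (%u. t (u @ z))"

text \<open>Forgets all displacements from generation \<open>k\<close> on. A functional that is unchanged by \<open>trunc k\<close> depends on the first \<open>k\<close> generations only, which replaces filtrations.\<close>
definition trunc :: "nat => family => family" where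
 "trunc k t = (%u. if length u < k then t u else (%_. 0))"

text \<open>The family \<open>r\<close> with the subtree above \<open>z\<close> replaced by \<open>s\<close>.\<close>
definition graft :: "nat list => family => family => family" where
 "graft z r s = (%v. if \<exists>u. v = u @ z then s (THE u. v = u @ z) else r v)"

definition lev :: "nat => nat list set" where
 "lev n = {z. length z = n}"

lemma lev_0 [simp]: "lev 0 = {[]}" by (auto simp: lev_def)

lemma pos_append: "pos (u @ z) t = pos z t + pos u (sub z t)" by (induction u) (auto simp: sub_def add.assoc)

lemma position_eq_pos: "position \<xi> z q = pos z (%u. \<xi> u q)" by (induction z) auto

lemma pos_trunc: "length z <= k ==> pos z (trunc k t) = pos z t" by (induction z) (auto simp: trunc_def)

lemma sub_graft [simp]: "sub z (graft z r s) = s" by (auto simp: sub_def graft_def)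

lemma graft_short: "length v < length z ==> graft z r s v = r v" by (auto simp: graft_def)

lemma trunc_graft: "k <= length z ==> trunc k (graft z r s) = trunc k r" by (auto simp: trunc_def graft_short)

lemma sub_graft_other: "length z' = length z ==> z' ~= z ==> sub z' (graft z r s) = sub z' r" by (auto simp: sub_def graft_def)

locale tree_law = prob_space L for L :: "(nat => ereal) measure" +
 assumes sets_L [measurable_cong, simp]: "sets L = sets slots"
begin

abbreviation "fam \<equiv> Pi\<^sub>M (UNIV :: nat list set) (%_. L)"

lemma space_L [simp]: "space L = UNIV" using sets_eq_imp_space_eq[OF sets_L] by (auto simp: space_PiM)

lemma space_families [simp]: "space fam = UNIV" by (auto simp: space_PiM)

sublocale T: prob_space fam by (intro prob_space_PiM prob_space_axioms)

sublocale TP: product_prob_space "%_. L" "UNIV :: nat list set" by (intro product_prob_spaceI prob_space_axioms)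

sublocale TT: pair_prob_space fam fam ..

lemma measurable_slot [measurable]: "(%t. t u k) \<in> bmeas fam" proof -
 have "(%l. l k) \<in> bmeas L" by (simp add: measurable_cong_sets[OF sets_L refl])
 from measurable_compose[where f = "%t. t u", OF _ this] show ?thesis by simp
qed

lemma measurable_familiesI:
 assumes "!!u. (%x. f x u) \<in> measurable N L"
 shows "f \<in> measurable N fam" using assms by (intro measurable_PiM_single') (auto dest: measurable_space)

lemma measurable_pos [measurable]: "pos z \<in> bmeas fam" by (induction z) auto

lemma measurable_sub [measurable]: "sub z \<in> measurable fam fam" unfolding sub_def by (rule measurable_familiesI) measurable

lemma measurable_trunc [measurable]: "trunc k \<in> measurable fam fam" unfolding trunc_def
proof (rule measurable_familiesI)
 show "(%t. if length u < k then t u else (%_. 0)) \<in> measurable fam L" for u by (cases "length u < k") auto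
qed

lemma measurable_graft [measurable]: "(%p. graft z (fst p) (snd p)) \<in> measurable (fam \<Otimes>\<^sub>M fam) fam"
proof (rule measurable_familiesI)
 show "(%p. graft z (fst p) (snd p) u) \<in> measurable (fam \<Otimes>\<^sub>M fam) L" for u by (cases "\<exists>v. u = v @ z") (auto simp: graft_def)
qed

lemma distr_graft: "distr (fam \<Otimes>\<^sub>M fam) fam (%p. graft z (fst p) (snd p)) = fam" (is "?D = _")
proof (rule TP.PiM_eq)
 fix J :: "nat list set" and E assume J: "finite J" "J \<subseteq> UNIV" "!!j. j \<in> J ==> E j \<in> sets L"
 let ?X = "prod_emb UNIV (%_. L) J (\<Pi>\<^sub>E j\<in>J. E j)"
 define S where "S = range (%u. u @ z)"
 have inj: "inj (%u. u @ z)" by (auto intro: injI)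
 let ?f = "%p. graft z (fst p) (snd p)"
 have g1: "graft z r s v = r v" if "v \<notin> S" for r s v using that by (auto simp: S_def graft_def)
 have g2: "graft z r s (u @ z) = s u" for r s u by (auto simp: graft_def)
 have "?f -` ?X \<inter> space (fam \<Otimes>\<^sub>M fam) =
  (prod_emb UNIV (%_. L) (J - S) (\<Pi>\<^sub>E j\<in>J - S. E j)) \<times>
  (prod_emb UNIV (%_. L) ((%u. u @ z) -` J) (\<Pi>\<^sub>E u\<in>(%u. u @ z) -` J. E (u @ z)))" (is "_ = ?E \<times> ?F") proof -
  have "(\<forall>j\<in>J. graft z r s j \<in> E j) \<longleftrightarrow> (\<forall>j\<in>J - S. r j \<in> E j) & (\<forall>u\<in>(%u. u @ z) -` J. s u \<in> E (u @ z))" for r s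
  proof -
   have "(\<forall>j\<in>J. graft z r s j \<in> E j) \<longleftrightarrow> (\<forall>j\<in>J - S. graft z r s j \<in> E j) & (\<forall>j\<in>J \<inter> S. graft z r s j \<in> E j)"
    by blast
   also have "(\<forall>j\<in>J - S. graft z r s j \<in> E j) \<longleftrightarrow> (\<forall>j\<in>J - S. r j \<in> E j)"
    using g1 by (intro ball_cong) auto
   also have "(\<forall>j\<in>J \<inter> S. graft z r s j \<in> E j) \<longleftrightarrow> (\<forall>u\<in>(%u. u @ z) -` J. s u \<in> E (u @ z))"
   proof safe
    fix u assume "\<forall>j\<in>J \<inter> S. graft z r s j \<in> E j" "u @ z \<in> J"
    then have "graft z r s (u @ z) \<in> E (u @ z)" by (auto simp: S_def)
    then show "s u \<in> E (u @ z)" by (simp add: g2)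
   next
    fix j assume "\<forall>u\<in>(%u. u @ z) -` J. s u \<in> E (u @ z)" "j \<in> J" "j \<in> S"
    then show "graft z r s j \<in> E j" by (auto simp: S_def g2)
   qed
   finally show ?thesis .
  qed
  then show ?thesis by (auto simp: space_pair_measure prod_emb_def PiE_iff)
 qed
 then have "emeasure ?D ?X = emeasure (fam \<Otimes>\<^sub>M fam) (?E \<times> ?F)"
  using J by (subst emeasure_distr[OF measurable_graft]) (auto intro!: sets_PiM_I)
 also have "... = emeasure fam ?E * emeasure fam ?F" using J inj by (intro T.emeasure_pair_measure_Times) (auto intro!: sets_PiM_I finite_vimageI)
 also have "emeasure fam ?F = (\<Prod>u\<in>(%u. u @ z) -` J. emeasure L (E (u @ z)))"
  using J inj by (intro TP.emeasure_PiM_emb) (auto intro: finite_vimageI)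
 also have "... = (\<Prod>j\<in>J \<inter> S. emeasure L (E j))"
  by (rule prod.reindex_cong[of "%u. u @ z" _ _, symmetric]) (auto simp: S_def intro: inj_on_subset[OF inj])
 also have "emeasure fam ?E = (\<Prod>j\<in>J - S. emeasure L (E j))" using J by (intro TP.emeasure_PiM_emb) auto
 also have "(\<Prod>j\<in>J - S. emeasure L (E j)) * (\<Prod>j\<in>J \<inter> S. emeasure L (E j)) = (\<Prod>j\<in>J. emeasure L (E j))"
  using J(1) by (subst prod.union_disjoint[symmetric]) (auto simp: Un_Diff_Int intro!: prod.cong)
 finally show "emeasure ?D ?X = (\<Prod>j\<in>J. emeasure L (E j))" .
qed simp

text \<open>Independence of the labels means that grafting an independent copy does not change the law; this is the only form in which independence is used below.\<close>
lemma nn_integral_graft: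
 assumes [measurable]: "h \<in> bmeas fam"
 shows "(NN fam (%t. h t)) = (\<integral>\<^sup>+r. \<integral>\<^sup>+s. h (graft z r s) \<partial>fam \<partial>fam)" proof -
 have "(NN fam (%t. h t)) = (NN (distr (fam \<Otimes>\<^sub>M fam) fam (%p. graft z (fst p) (snd p))) (%t. h t))" by (subst distr_graft) simp
 also have "... = (NN (fam \<Otimes>\<^sub>M fam) (%p. h (graft z (fst p) (snd p))))" by (subst nn_integral_distr) auto
 also have "... = (\<integral>\<^sup>+r. \<integral>\<^sup>+s. h (graft z r s) \<partial>fam \<partial>fam)" by (subst T.nn_integral_fst[symmetric]) auto
 finally show ?thesis .
qed

lemma nn_integral_sub:
 assumes [measurable]: "(%p. g (fst p) (snd p)) \<in> bmeas (fam \<Otimes>\<^sub>M fam)"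
  and dep: "!!t s. g (trunc (length z) t) s = g t s"
 shows "(NN fam (%t. g t (sub z t))) = (\<integral>\<^sup>+t. \<integral>\<^sup>+s. g t s \<partial>fam \<partial>fam)" proof -
 have [measurable]: "(%t. g t (sub z t)) \<in> bmeas fam"
  using measurable_compose[of "%t. (t, sub z t)" fam "fam \<Otimes>\<^sub>M fam" "%p. g (fst p) (snd p)"] by simp
 have "g (graft z r s) s = g r s" for r s by (metis dep trunc_graft order_refl)
 then show ?thesis by (subst nn_integral_graft[of _ z]) simp_all
qed

lemma branching_finite:
 assumes "finite S" "S \<subseteq> lev k"
  and "Y \<in> bmeas fam" "!!t. Y (trunc k t) = Y t"
  and "!!z. z \<in> S ==> (%p. g z (fst p) (snd p)) \<in> bmeas (fam \<Otimes>\<^sub>M fam)"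
  and "!!z t s. z \<in> S ==> g z (trunc k t) s = g z t s"
 shows "(NN fam (%t. Y t * (\<Prod>z\<in>S. g z t (sub z t))))
   = (\<integral>\<^sup>+t. Y t * (\<Prod>z\<in>S. NN fam (%s. g z t s)) \<partial>(fam :: family measure))" using assms
proof (induction S arbitrary: Y rule: finite_induct)
 case (insert z S)
 have z: "length z = k" using insert.prems by (auto simp: lev_def)
 have [measurable]: "Y \<in> bmeas fam" by fact
 have gm: "(%p. g z' (fst p) (snd p)) \<in> bmeas (fam \<Otimes>\<^sub>M fam)" if "z' \<in> insert z S" for z' by (rule insert.prems(4)) fact
 have gs: "(%t. g z' t (sub z' t)) \<in> bmeas fam" if "z' \<in> insert z S" for z'
  using measurable_compose[of "%t. (t, sub z' t)" fam "fam \<Otimes>\<^sub>M fam" "%p. g z' (fst p) (snd p)"] gm[OF that] by simp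
 have gi: "(%t. NN fam (%s. g z' t s)) \<in> bmeas fam" if "z' \<in> insert z S" for z' using T.borel_measurable_nn_integral_fst[OF gm[OF that]] by simp
 have [measurable]: "(%t. Y t * (\<Prod>z\<in>insert z S. g z t (sub z t))) \<in> bmeas fam"
  using gs by (intro borel_measurable_times_ennreal borel_measurable_prod_ennreal) auto
 have "(NN fam (%t. Y t * (\<Prod>z\<in>insert z S. g z t (sub z t))))
   = (\<integral>\<^sup>+r. \<integral>\<^sup>+s. Y (graft z r s) * (\<Prod>z'\<in>insert z S. g z' (graft z r s) (sub z' (graft z r s))) \<partial>fam \<partial>fam)"
  by (rule nn_integral_graft) measurable
 also have "... = (\<integral>\<^sup>+r. \<integral>\<^sup>+s. (Y r * (\<Prod>z'\<in>S. g z' r (sub z' r))) * g z r s \<partial>fam \<partial>fam)"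
 proof (intro nn_integral_cong)
  fix r s
  have tr: "trunc k (graft z r s) = trunc k r" using z by (simp add: trunc_graft)
  have "Y (graft z r s) = Y r" using insert.prems(3) tr by metis
  moreover have "g z' (graft z r s) x = g z' r x" if "z' \<in> insert z S" for z' x using insert.prems(5)[OF that] tr by metis
  moreover have "sub z' (graft z r s) = sub z' r" if "z' \<in> S" for z'
   using insert.prems(1) insert.hyps that z by (intro sub_graft_other) (auto simp: lev_def)
  ultimately show "Y (graft z r s) * (\<Prod>z'\<in>insert z S. g z' (graft z r s) (sub z' (graft z r s)))
   = (Y r * (\<Prod>z'\<in>S. g z' r (sub z' r))) * g z r s" using insert.hyps by (simp add: mult_ac)
 qed
 also have "... = (NN fam (%r. (Y r * (NN fam (%s. g z r s))) * (\<Prod>z'\<in>S. g z' r (sub z' r))))"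
 proof (intro nn_integral_cong)
  fix r
  have "g z r \<in> bmeas fam" using measurable_Pair2[OF gm[of z], of r] by simp
  then show "(NN fam (%s. (Y r * (\<Prod>z'\<in>S. g z' r (sub z' r))) * g z r s))
   = (Y r * (NN fam (%s. g z r s))) * (\<Prod>z'\<in>S. g z' r (sub z' r))" by (subst nn_integral_cmult) (simp_all only: mult_ac)
 qed
 also have "... = (NN fam (%r. (Y r * (NN fam (%s. g z r s))) * (\<Prod>z'\<in>S. NN fam (%s. g z' r s))))" using insert.prems gi by (intro insert.IH) auto
 also have "... = (NN fam (%t. Y t * (\<Prod>z\<in>insert z S. NN fam (%s. g z t s))))" using insert.hyps by (simp add: mult_ac)
 finally show ?case .
qed simp

text \<open>The branching property for exponentials of sums: given the first \<open>k\<close> generations, the subtrees of the particles of generation \<open>k\<close> are independent. Finite products are treated one particle at a time, and infinite generations by dominated convergence.\<close>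
lemma branching:
 assumes Y [measurable]: "Y \<in> bmeas fam" and Yt: "!!t. Y (trunc k t) = Y t"
  and Y1: "!!t. Y t <= ennreal c"
  and a: "!!z. z \<in> lev k ==> (%p. a z (fst p) (snd p)) \<in> bmeas (fam \<Otimes>\<^sub>M fam)"
  and at: "!!z t s. z \<in> lev k ==> a z (trunc k t) s = a z t s"
  and b: "!!z t. z \<in> lev k ==> ennreal (nexp (b z t)) = (NN fam (%s. ennreal (nexp (a z t s))))"
  and bm: "!!z. z \<in> lev k ==> b z \<in> bmeas fam"
 shows "(NN fam (%t. Y t * ennreal (nexp (NN (cs (lev k)) (%z. a z t (sub z t))))))
   = (NN fam (%t. Y t * ennreal (nexp (NN (cs (lev k)) (%z. b z t)))))" proof -
 define S where "S N = {z\<in>lev k. to_nat z < N}" for N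
 have finS: "finite (S N)" for N unfolding S_def by (rule finite_subset[OF _ finite_vimageI[of "{..<N}" to_nat]]) auto
 have am: "(%t. a z t (sub z t)) \<in> bmeas fam" if "z \<in> lev k" for z
  using measurable_compose[of "%t. (t, sub z t)" fam "fam \<Otimes>\<^sub>M fam" "%p. a z (fst p) (snd p)"] a[OF that] by simp
 have lim: "(%N. NN fam (%t. Y t * (\<Prod>z\<in>S N. ennreal (nexp (h z t)))))
   ---> (NN fam (%t. Y t * ennreal (nexp (NN (cs (lev k)) (%z. h z t)))))"
  if hm: "!!z. z \<in> lev k ==> h z \<in> bmeas fam" for h :: "nat list => family => ennreal"
 proof (rule nn_integral_dominated_convergence[where w = "%_. ennreal c"])
  have nh: "(%t. ennreal (nexp (h z t))) \<in> bmeas fam" if "z \<in> lev k" for z using hm[OF that] by measurable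
  show "(%t. Y t * (\<Prod>z\<in>S N. ennreal (nexp (h z t)))) \<in> bmeas fam" for N
   using nh by (intro borel_measurable_times_ennreal borel_measurable_prod_ennreal Y) (auto simp: S_def)
  have hs: "(%t. \<integral>\<^sup>+z. h z t \<partial>cs (lev k)) \<in> bmeas fam" using hm by (intro measurable_count_sum) auto
  then show "(%t. Y t * ennreal (nexp (NN (cs (lev k)) (%z. h z t)))) \<in> bmeas fam" by measurable
  show "AE t in fam. Y t * (\<Prod>z\<in>S N. ennreal (nexp (h z t))) <= ennreal c" for N
  proof (intro AE_I2)
   fix t
   have "(\<Prod>z\<in>S N. ennreal (nexp (h z t))) <= 1" by (intro prod_le_1) (auto simp: ennreal_le_1)
   from mult_mono[OF Y1 this] show "Y t * (\<Prod>z\<in>S N. ennreal (nexp (h z t))) <= ennreal c" by simp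
  qed
  show "AE t in fam. (%N. Y t * (\<Prod>z\<in>S N. ennreal (nexp (h z t)))) ---> Y t * ennreal (nexp (NN (cs (lev k)) (%z. h z t)))"
  proof (intro AE_I2)
   fix t
   have "(%N. ennreal (nexp (\<Sum>z\<in>S N. h z t))) ---> ennreal (nexp (NN (cs (lev k)) (%z. h z t)))"
    unfolding S_def by (intro tendsto_ennrealI tendsto_nexp count_sum_limit)
   moreover have "Y t < \<top>" using Y1[of t] by (auto intro: order_le_less_trans)
   ultimately show "(%N. Y t * (\<Prod>z\<in>S N. ennreal (nexp (h z t)))) ---> Y t * ennreal (nexp (NN (cs (lev k)) (%z. h z t)))"
    by (intro ennreal_tendsto_cmult) (simp_all add: nexp_sum finS prod_ennreal)
  qed
 qed (use T.emeasure_space_1 in auto)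
 have "(NN fam (%t. Y t * (\<Prod>z\<in>S N. ennreal (nexp (a z t (sub z t))))))
   = (NN fam (%t. Y t * (\<Prod>z\<in>S N. ennreal (nexp (b z t)))))" for N proof -
  have "(NN fam (%t. Y t * (\<Prod>z\<in>S N. ennreal (nexp (a z t (sub z t))))))
    = (NN fam (%t. Y t * (\<Prod>z\<in>S N. NN fam (%s. ennreal (nexp (a z t s))))))" using Yt a at by (intro branching_finite[OF finS]) (auto simp: S_def)
  also have "... = (NN fam (%t. Y t * (\<Prod>z\<in>S N. ennreal (nexp (b z t)))))"
   using b by (intro nn_integral_cong arg_cong2[where f = "(*)"] prod.cong refl) (auto simp: S_def)
  finally show ?thesis .
 qed
 then have "(%N. NN fam (%t. Y t * (\<Prod>z\<in>S N. ennreal (nexp (b z t)))))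
   ---> (NN fam (%t. Y t * ennreal (nexp (NN (cs (lev k)) (%z. a z t (sub z t))))))" using lim[of "%z t. a z t (sub z t)"] am by simp
 from LIMSEQ_unique[OF this lim[OF bm]] show ?thesis by simp
qed

end

section \<open>Sums over a generation and the tilted step law\<close>

abbreviation finr :: "ereal => bool" where "finr v \<equiv> \<bar>v\<bar> ~= \<infinity>"

text \<open>Labels with an infinite position are not particles; the value \<open>- \<infinity>\<close> has probability \<open>0\<close>.\<close>
definition psum :: "(real => ennreal) => nat => family => ennreal" where
 "psum g n t = (NN (cs (lev n)) (%z. (if finr (pos z t) then g (roe (pos z t)) else 0)))"

text \<open>The intensity measure of the reproduction process, tilted by \<open>exp (- v)\<close>.\<close>
definition step_law :: "(nat => ereal) measure => real measure" where
 "step_law L = distr (density (cs UNIV \<Otimes>\<^sub>M L)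
   (%p. if finr (snd p (fst p)) then ennreal (exp (- roe (snd p (fst p)))) else 0))
  borel (%p. roe (snd p (fst p)))"

lemma lev_sum_append:
 fixes F :: "nat list => ennreal"
 shows "(NN (cs (lev (n + m))) (%w. F w))
   = (\<integral>\<^sup>+z. \<integral>\<^sup>+u. F (u @ z) \<partial>cs (lev n) \<partial>cs (lev m))" proof -
 have 1: "(NN (cs UNIV) (%w. F w * indicator {w\<in>lev (n + m). drop n w = z} w))
   = (NN (cs (lev n)) (%u. F (u @ z)))" if z: "z \<in> lev m" for z proof -
  have "bij_betw (%u. u @ z) (lev n) {w\<in>lev (n + m). drop n w = z}"
  proof (rule bij_betwI')
   fix w assume w: "w \<in> {w\<in>lev (n + m). drop n w = z}"
   then have "w = take n w @ z" by (metis (mono_tags, lifting) append_take_drop_id mem_Collect_eq)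
   moreover have "take n w \<in> lev n" using w by (auto simp: lev_def)
   ultimately show "\<exists>u\<in>lev n. w = u @ z" by blast
  qed (use z in \<open>auto simp: lev_def\<close>)
  from nn_integral_bij_count_space[OF this, of F]
  show ?thesis by (simp add: nn_integral_count_space_indicator)
 qed
 have 2: "(NN (cs (lev m)) (%z. F w * indicator {w\<in>lev (n + m). drop n w = z} w))
   = F w * indicator (lev (n + m)) w" for w
 proof (cases "w \<in> lev (n + m)")
  case True
  then have d: "drop n w \<in> lev m" by (auto simp: lev_def)
  have "(NN (cs (lev m)) (%z. F w * indicator {w\<in>lev (n + m). drop n w = z} w))
    = (\<Sum>z\<in>{drop n w}. F w * indicator {w\<in>lev (n + m). drop n w = z} w)"
   by (rule nn_integral_count_space') (use d in \<open>auto split: split_indicator\<close>)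
  then show ?thesis using True by simp
 qed (simp add: indicator_def)
 have "(NN (cs (lev (n + m))) (%w. F w)) = (NN (cs UNIV) (%w. F w * indicator (lev (n + m)) w))" by (simp add: nn_integral_count_space_indicator)
 also have "... = (\<integral>\<^sup>+w. \<integral>\<^sup>+z. F w * indicator {w\<in>lev (n + m). drop n w = z} w \<partial>cs (lev m) \<partial>cs UNIV)"
  unfolding 2 ..
 also have "... = (\<integral>\<^sup>+z. \<integral>\<^sup>+w. F w * indicator {w\<in>lev (n + m). drop n w = z} w \<partial>cs UNIV \<partial>cs (lev m))"
  by (rule nn_integral_count_space_nn_integral) auto
 also have "... = (\<integral>\<^sup>+z. \<integral>\<^sup>+u. F (u @ z) \<partial>cs (lev n) \<partial>cs (lev m))" by (intro nn_integral_cong 1) simp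
 finally show ?thesis .
qed

lemma lev_1_sum:
 "(NN (cs (lev (Suc 0))) (%z. F z)) = (NN (cs UNIV) (%k. F [k]))" proof -
 have "bij_betw (%k. [k]) UNIV (lev (Suc 0))" by (rule bij_betwI') (auto simp: lev_def length_Suc_conv)
 from nn_integral_bij_count_space[OF this, of F] show ?thesis by simp
qed

lemma psum_append:
 "psum g (n + m) t = (NN (cs (lev m)) (%z. (if finr (pos z t) then psum (%v. g (roe (pos z t) + v)) n (sub z t) else 0)))" proof -
 have "(NN (cs (lev n)) (%u. (if finr (pos (u @ z) t) then g (roe (pos (u @ z) t)) else 0)))
   = (if finr (pos z t) then psum (%v. g (roe (pos z t) + v)) n (sub z t) else 0)" for z
 proof (cases "finr (pos z t)")
  case True
  then obtain r where r: "pos z t = ereal r" by (cases "pos z t") auto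
  have "(if finr (pos (u @ z) t) then g (roe (pos (u @ z) t)) else 0)
   = (if finr (pos u (sub z t)) then g (roe (pos z t) + roe (pos u (sub z t))) else 0)" for u unfolding pos_append r by (cases "pos u (sub z t)") auto
  then show ?thesis using True by (simp add: psum_def)
 next
  case False
  then have "\<not> finr (pos (u @ z) t)" for u unfolding pos_append by (cases "pos z t"; cases "pos u (sub z t)") auto
  then show ?thesis using False by simp
 qed
 then show ?thesis unfolding psum_def[of g "n + m"] lev_sum_append by simp
qed

lemma psum_0: "psum g 0 t = g 0" by (simp add: psum_def nn_integral_count_space_finite)

lemma psum_Suc:
 "psum g (Suc n) t = (NN (cs UNIV) (%k. (if finr (t [] k) then psum (%v. g (roe (t [] k) + v)) n (sub [k] t) else 0)))"
 using psum_append[of g n 1 t] by (simp add: lev_1_sum cong: if_cong)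

lemma psum_mono: "(!!v. f v <= g v) ==> psum f n t <= psum g n t" unfolding psum_def by (intro nn_integral_mono) auto

lemma psum_cong: "(!!v. f v = g v) ==> psum f n t = psum g n t" by (metis ext)

lemma psum_cmult: "psum (%v. c * f v) n t = c * psum f n t" unfolding psum_def by (subst nn_integral_cmult[symmetric]) (auto intro!: nn_integral_cong)

lemma psum_add: "psum (%v. f v + g v) n t = psum f n t + psum g n t"
 unfolding psum_def by (subst nn_integral_add[symmetric]) (auto intro!: nn_integral_cong)

lemma psum_trunc: "n <= k ==> psum g n (trunc k t) = psum g n t" unfolding psum_def by (intro nn_integral_cong) (auto simp: lev_def pos_trunc)

context tree_law begin

lemma measurable_psum_param:
 assumes [measurable]: "(%p. g (fst p) (snd p)) \<in> bmeas (N \<Otimes>\<^sub>M borel)"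
 shows "(%p. psum (g (fst p)) n (snd p)) \<in> bmeas (N \<Otimes>\<^sub>M fam)" unfolding psum_def
proof (rule measurable_count_sum)
 show "(%p. if finr (pos z (snd p)) then g (fst p) (roe (pos z (snd p))) else 0) \<in> bmeas (N \<Otimes>\<^sub>M fam)" for z proof -
  have "(%p. (fst p, roe (pos z (snd p)))) \<in> measurable (N \<Otimes>\<^sub>M fam) (N \<Otimes>\<^sub>M borel)" by measurable
  from measurable_compose[OF this assms]
  have [measurable]: "(%p. g (fst p) (roe (pos z (snd p)))) \<in> bmeas (N \<Otimes>\<^sub>M fam)" by simp
  show ?thesis by measurable
 qed
qed simp

lemma measurable_psum [measurable]:
 assumes [measurable]: "g \<in> bmeas borel"
 shows "psum g n \<in> bmeas fam" unfolding psum_def by (rule measurable_count_sum) auto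

lemma sets_step_law: "sets (step_law L) = sets borel" by (simp add: step_law_def)

lemma measurable_slot_pair [measurable]: "(%p. snd p (fst p)) \<in> bmeas (cs UNIV \<Otimes>\<^sub>M L)" proof -
 have "(%l. l k) \<in> bmeas L" for k by (simp add: measurable_cong_sets[OF sets_L refl])
 then have "(%(k, l). l k) \<in> bmeas (cs UNIV \<Otimes>\<^sub>M L)" by (intro measurable_pair_measure_countable1) auto
 then show ?thesis by (simp add: split_beta')
qed

lemma nn_integral_step_law:
 assumes [measurable]: "\<phi> \<in> bmeas borel"
 shows "(NN (step_law L) (%v. \<phi> v))
  = (\<integral>\<^sup>+l. \<integral>\<^sup>+k. (if finr (l k) then ennreal (exp (- roe (l k))) * \<phi> (roe (l k)) else 0) \<partial>cs UNIV \<partial>L)"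
proof -
 interpret C: sigma_finite_measure "cs (UNIV :: nat set)" by (rule sigma_finite_measure_count_space)
 have [measurable]: "(%l. l k) \<in> bmeas L" for k by (simp add: measurable_cong_sets[OF sets_L refl])
 have "(NN (step_law L) (%v. \<phi> v)) = (NN (cs UNIV \<Otimes>\<^sub>M L) (%p. (if finr (snd p (fst p)) then ennreal (exp (- roe (snd p (fst p)))) else 0)
   * \<phi> (roe (snd p (fst p)))))" unfolding step_law_def by (subst nn_integral_distr, measurable, subst nn_integral_density, measurable)
 also have "... = (NN (cs UNIV \<Otimes>\<^sub>M L) (%p. (if finr (snd p (fst p)) then ennreal (exp (- roe (snd p (fst p))))
   * \<phi> (roe (snd p (fst p))) else 0)))" by (intro nn_integral_cong) auto
 also have "... = (\<integral>\<^sup>+k. \<integral>\<^sup>+l. (if finr (l k) then ennreal (exp (- roe (l k))) * \<phi> (roe (l k)) else 0) \<partial>L \<partial>cs UNIV)"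
  by (subst nn_integral_fst[symmetric]) (auto cong: if_cong)
 also have "... = (\<integral>\<^sup>+l. \<integral>\<^sup>+k. (if finr (l k) then ennreal (exp (- roe (l k))) * \<phi> (roe (l k)) else 0) \<partial>cs UNIV \<partial>L)"
  by (rule nn_integral_count_space_nn_integral[symmetric]) auto
 finally show ?thesis .
qed

lemma distr_root: "distr fam L (%t. t []) = L" by (rule distr_PiM_component[OF prob_space_axioms]) simp

text \<open>The many-to-one formula for the first generation: the tilting turns the sum over children into an expectation over one step.\<close>
lemma first_step:
 assumes [measurable]: "(%p. H (fst p) (snd p)) \<in> bmeas (borel \<Otimes>\<^sub>M fam)"
 shows "(\<integral>\<^sup>+t. \<integral>\<^sup>+k. (if finr (t [] k) then H (roe (t [] k)) (sub [k] t) else 0) \<partial>cs UNIV \<partial>fam)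
   = (NN (step_law L) (%v. ennreal (exp v) * (NN fam (%s. H v s))))" proof -
 have [measurable]: "(%l. l k) \<in> bmeas L" for k by (simp add: measurable_cong_sets[OF sets_L refl])
 have Hi [measurable]: "(%v. NN fam (%s. H v s)) \<in> bmeas borel" using T.borel_measurable_nn_integral_fst[OF assms] by simp
 have Hc: "(%p. H (roe (fst p [] k)) (snd p)) \<in> bmeas (fam \<Otimes>\<^sub>M fam)" for k proof -
  have "(%p. (roe (fst p [] k), snd p)) \<in> measurable (fam \<Otimes>\<^sub>M fam) (borel \<Otimes>\<^sub>M fam)"
   by (intro measurable_Pair measurable_compose[OF measurable_fst] measurable_compose[OF measurable_slot]) measurable
  from measurable_compose[OF this assms] show ?thesis by simp
 qed
 have sl: "(%p. fst p [] k) \<in> bmeas (fam \<Otimes>\<^sub>M fam)" for k by (rule measurable_compose[OF measurable_fst measurable_slot])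
 have mk: "(%p. if finr (fst p [] k) then H (roe (fst p [] k)) (snd p) else 0) \<in> bmeas (fam \<Otimes>\<^sub>M fam)" for k
  using Hc[of k] sl[of k] by measurable
 have mk2: "(%t. if finr (t [] k) then H (roe (t [] k)) (sub [k] t) else 0) \<in> bmeas fam" for k
  using measurable_compose[of "%t. (t, sub [k] t)" fam "fam \<Otimes>\<^sub>M fam", OF _ mk[of k]] by (simp cong: if_cong)
 have "(\<integral>\<^sup>+t. \<integral>\<^sup>+k. (if finr (t [] k) then H (roe (t [] k)) (sub [k] t) else 0) \<partial>cs UNIV \<partial>fam)
  = (\<integral>\<^sup>+k. \<integral>\<^sup>+t. (if finr (t [] k) then H (roe (t [] k)) (sub [k] t) else 0) \<partial>fam \<partial>cs UNIV)"
  using mk2 by (intro nn_integral_count_space_nn_integral) auto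
 also have "... = (\<integral>\<^sup>+k. \<integral>\<^sup>+t. \<integral>\<^sup>+s. (if finr (t [] k) then H (roe (t [] k)) s else 0) \<partial>fam \<partial>fam \<partial>cs UNIV)"
  using mk by (intro nn_integral_cong nn_integral_sub[where g = "%t s. if finr (t [] _) then H (roe (t [] _)) s else 0"])
   (auto simp: trunc_def)
 also have "... = (\<integral>\<^sup>+k. \<integral>\<^sup>+t. (if finr (t [] k) then \<integral>\<^sup>+s. H (roe (t [] k)) s \<partial>fam else 0) \<partial>fam \<partial>cs UNIV)"
  by (intro nn_integral_cong) auto
 also have "... = (\<integral>\<^sup>+k. \<integral>\<^sup>+l. (if finr (l k) then \<integral>\<^sup>+s. H (roe (l k)) s \<partial>fam else 0) \<partial>L \<partial>cs UNIV)"
 proof (intro nn_integral_cong)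
  fix k
  have m: "(%l. if finr (l k) then \<integral>\<^sup>+s. H (roe (l k)) s \<partial>fam else 0) \<in> bmeas L"
   using measurable_compose[OF _ Hi, of "%l. roe (l k)" L] by measurable
  show "(NN fam (%t. (if finr (t [] k) then \<integral>\<^sup>+s. H (roe (t [] k)) s \<partial>fam else 0)))
   = (NN L (%l. (if finr (l k) then \<integral>\<^sup>+s. H (roe (l k)) s \<partial>fam else 0)))" proof -
   have "(NN (distr fam L (%t. t [])) (%l. (if finr (l k) then \<integral>\<^sup>+s. H (roe (l k)) s \<partial>fam else 0)))
    = (NN fam (%t. (if finr (t [] k) then \<integral>\<^sup>+s. H (roe (t [] k)) s \<partial>fam else 0)))" by (rule nn_integral_distr) (use m in auto)
   then show ?thesis by (simp only: distr_root)
  qed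
 qed
 also have "... = (\<integral>\<^sup>+l. \<integral>\<^sup>+k. (if finr (l k) then \<integral>\<^sup>+s. H (roe (l k)) s \<partial>fam else 0) \<partial>cs UNIV \<partial>L)"
 proof (rule nn_integral_count_space_nn_integral[symmetric])
  show "(%l. if finr (l k) then \<integral>\<^sup>+s. H (roe (l k)) s \<partial>fam else 0) \<in> bmeas L" for k
   using measurable_compose[OF _ Hi, of "%l. roe (l k)" L] by measurable
 qed simp
 also have "... = (NN (step_law L) (%v. ennreal (exp v) * (NN fam (%s. H v s))))" proof -
  have *: "ennreal (exp (- r)) * (ennreal (exp r) * a) = a" for r a by (simp add: mult.assoc[symmetric] ennreal_mult[symmetric] exp_add[symmetric])
  show ?thesis by (subst nn_integral_step_law) (auto simp: * intro!: nn_integral_cong)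
 qed
 finally show ?thesis .
qed

lemma AE_slots:
 assumes "AE l in L. \<forall>k. l k ~= - \<infinity>"
 shows "AE t in fam. \<forall>u k. t u k ~= - \<infinity>" proof -
 have "AE t in fam. \<forall>k. t u k ~= - \<infinity>" for u using TP.AE_component[of u "%l. \<forall>k. l k ~= - \<infinity>"] assms by simp
 then show ?thesis by (simp add: AE_all_countable)
qed

end

lemma pos_not_MInf: "\<forall>u k. t u k ~= - \<infinity> ==> pos z t ~= - \<infinity>" by (induction z) (auto simp: ereal_plus_eq_MInfty)

section \<open>First moments and the lowest position\<close>

locale brw_law = tree_law L + step: centered_walk "step_law L" for L :: "(nat => ereal) measure" +
 assumes no_MInf: "AE l in L. \<forall>k. l k ~= - \<infinity>"
begin

lemma nn_integral_psum_Suc: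
 assumes [measurable]: "g \<in> bmeas borel"
 shows "(NN fam (%t. psum g (Suc n) t))
  = (NN (step_law L) (%v. ennreal (exp v) * (NN fam (%t. psum (%u. g (v + u)) n t))))" proof -
 have "(%p. psum (%u. g (fst p + u)) n (snd p)) \<in> bmeas (borel \<Otimes>\<^sub>M fam)"
  by (rule measurable_psum_param[where g = "%v u. g (v + u)"]) measurable
 from first_step[OF this] show ?thesis unfolding psum_Suc .
qed

text \<open>The tilted walk has mean \<open>0\<close>, so its second moment after \<open>n\<close> steps is the sum of the starting square and \<open>n\<close> variances.\<close>
lemma second_moment:
 "(NN fam (%t. psum (%v. ennreal ((1 + (x + v)^2) * exp (- v))) n t))
  = ennreal (1 + x^2 + real n * (\<integral>v. v^2 \<partial>step_law L))"
proof (induction n arbitrary: x)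
 case 0
 then show ?case using T.emeasure_space_1 by (simp add: psum_0)
next
 case (Suc n)
 define s where "s = (\<integral>v. v^2 \<partial>step_law L)"
 have s: "s > 0" using step.step_var_pos by (simp add: s_def)
 have "(NN fam (%t. psum (%v. ennreal ((1 + (x + v)^2) * exp (- v))) (Suc n) t))
   = (NN (step_law L) (%v. ennreal (exp v) * (NN fam (%t. psum (%u. ennreal ((1 + (x + (v + u))^2) * exp (- (v + u)))) n t))))"
  by (rule nn_integral_psum_Suc) measurable
 also have "... = (NN (step_law L) (%v. ennreal (1 + (x + v)^2 + real n * s)))"
 proof (intro nn_integral_cong)
  fix v
  have "psum (%u. ennreal ((1 + (x + (v + u))^2) * exp (- (v + u)))) n t
    = ennreal (exp (- v)) * psum (%u. ennreal ((1 + ((x + v) + u)^2) * exp (- u))) n t" for t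
  proof (subst psum_cmult[symmetric], rule psum_cong)
   fix u
   have "exp (- (v + u)) = exp (- v) * exp (- u)" by (simp only: minus_add_distrib exp_add)
   then have "(1 + (x + (v + u))^2) * exp (- (v + u)) = exp (- v) * ((1 + ((x + v) + u)^2) * exp (- u))" by (simp only: add.assoc mult.left_commute)
   then show "ennreal ((1 + (x + (v + u))^2) * exp (- (v + u))) = ennreal (exp (- v)) * ennreal ((1 + ((x + v) + u)^2) * exp (- u))"
    by (simp only: ennreal_mult'[OF exp_ge_zero])
  qed
  then have "(NN fam (%t. psum (%u. ennreal ((1 + (x + (v + u))^2) * exp (- (v + u)))) n t))
    = ennreal (exp (- v)) * ennreal (1 + (x + v)^2 + real n * s)" using Suc[of "x + v"] by (simp add: nn_integral_cmult s_def)
  then show "ennreal (exp v) * (NN fam (%t. psum (%u. ennreal ((1 + (x + (v + u))^2) * exp (- (v + u)))) n t))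
    = ennreal (1 + (x + v)^2 + real n * s)" by (simp add: mult.assoc[symmetric] ennreal_mult[symmetric] exp_add[symmetric])
 qed
 also have "... = (NN (step_law L) (%v. ennreal ((1 + x^2 + real n * s) + v^2 + (2 * x) * v)))"
  by (intro nn_integral_cong arg_cong[where f = ennreal]) (simp add: power2_sum)
 also have "... = ennreal (\<integral>v. (1 + x^2 + real n * s) + v^2 + (2 * x) * v \<partial>step_law L)"
 proof (rule nn_integral_eq_integral)
  show "integrable (step_law L) (%v. (1 + x^2 + real n * s) + v^2 + (2 * x) * v)" using step.step_sq step.step_integrable by simp
  have "(1 + x^2 + real n * s) + v^2 + (2 * x) * v = 1 + (x + v)^2 + real n * s" for v by (simp add: power2_sum)
  moreover have "0 <= 1 + (x + v)^2 + real n * s" for v using s by simp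
  ultimately show "AE v in step_law L. 0 <= (1 + x^2 + real n * s) + v^2 + (2 * x) * v" by (simp only: AE_I2)
 qed
 also have "(\<integral>v. (1 + x^2 + real n * s) + v^2 + (2 * x) * v \<partial>step_law L) = (1 + x^2 + real n * s) + s"
  using step.step_sq step.step_integrable step.step_mean step.prob_space by (simp add: s_def)
 also have "(1 + x^2 + real n * s) + s = 1 + x^2 + real (Suc n) * s" by (simp add: distrib_right)
 finally show ?case by (simp only: s_def)
qed

lemma AE_second_moment: "AE t in fam. \<forall>n. psum (%v. ennreal ((1 + v^2) * exp (- v))) n t < \<infinity>" proof -
 have "AE t in fam. psum (%v. ennreal ((1 + v^2) * exp (- v))) n t ~= \<infinity>" for n
  using second_moment[of 0 n] by (intro nn_integral_noteq_infinite) auto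
 then have "AE t in fam. \<forall>n. psum (%v. ennreal ((1 + v^2) * exp (- v))) n t ~= \<infinity>" by (simp add: AE_all_countable)
 then show ?thesis by (simp add: less_top)
qed

lemma AE_no_MInf: "AE t in fam. \<forall>u k. t u k ~= - \<infinity>" by (rule AE_slots[OF no_MInf])

definition low :: "nat => real => family => bool" where
 "low N a t \<longleftrightarrow> (\<exists>z. length z <= N & pos z t <= ereal (- a))"

lemma measurable_low [measurable]: "Measurable.pred fam (low N a)" unfolding low_def by measurable

lemma families_setI: "Measurable.pred fam Q ==> {t. Q t} \<in> sets fam" by (simp add: pred_def)

text \<open>The bound is trivial for \<open>a \<le> 0\<close>. For \<open>a > 0\<close> the first step reproduces it, because the tilting compensates the exponential.\<close>
lemma low_prob: "emeasure fam {t. low N a t} <= ennreal (exp (- a))"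
proof (induction N arbitrary: a)
 case 0
 show ?case
 proof (cases "a <= 0")
  case True
  then have "1 <= ennreal (exp (- a))" by (simp add: ennreal_ge_1)
  then show ?thesis by (rule order_trans[OF T.emeasure_le_1])
 next
  case False
  then have "{t. low 0 a t} = {}" by (auto simp: low_def zero_ereal_def)
  then show ?thesis by (simp only: emeasure_empty) simp
 qed
next
 case (Suc N)
 show ?case
 proof (cases "a <= 0")
  case True
  then have "1 <= ennreal (exp (- a))" by (simp add: ennreal_ge_1)
  then show ?thesis by (rule order_trans[OF T.emeasure_le_1])
 next
  case a: False
  have m: "(%p. indicator {t. low N (a + fst p) t} (snd p) :: ennreal) \<in> bmeas (borel \<Otimes>\<^sub>M fam)" proof -
   have "Measurable.pred (borel \<Otimes>\<^sub>M fam) (%p. low N (a + fst p) (snd p))" unfolding low_def by measurable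
   then have "(%p. if low N (a + fst p) (snd p) then 1 else 0 :: ennreal) \<in> bmeas (borel \<Otimes>\<^sub>M fam)" by measurable
   then show ?thesis by (simp add: indicator_def of_bool_def)
  qed
  have "emeasure fam {t. low (Suc N) a t} = (NN fam (%t. indicator {t. low (Suc N) a t} t))" by (subst nn_integral_indicator) (auto intro!: families_setI)
  also have "... <= (\<integral>\<^sup>+t. \<integral>\<^sup>+k. (if finr (t [] k) then indicator {s. low N (a + roe (t [] k)) s} (sub [k] t) else 0) \<partial>cs UNIV \<partial>fam)"
  proof (rule nn_integral_mono_AE)
   show "AE t in fam. indicator {t. low (Suc N) a t} t <= (NN (cs UNIV) (%k. (if finr (t [] k) then indicator {s. low N (a + roe (t [] k)) s} (sub [k] t) else (0::ennreal))))"
    using AE_no_MInf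
   proof eventually_elim
    fix t :: family assume nm: "\<forall>u k. t u k ~= - \<infinity>"
    show "indicator {t. low (Suc N) a t} t <= (NN (cs UNIV) (%k. (if finr (t [] k) then indicator {s. low N (a + roe (t [] k)) s} (sub [k] t) else (0::ennreal))))"
    proof (cases "low (Suc N) a t")
     case True
     then obtain z where z: "length z <= Suc N" "pos z t <= ereal (- a)" by (auto simp: low_def)
     have "z ~= []" using z(2) a by (auto simp: zero_ereal_def)
     then obtain u k where uk: "z = u @ [k]" by (metis rev_exhaust)
     have p: "t [] k + pos u (sub [k] t) <= ereal (- a)" using z(2) by (simp add: uk pos_append)
     have "finr (t [] k)" using p nm by (cases "t [] k"; cases "pos u (sub [k] t)") auto
     then obtain r where r: "t [] k = ereal r" by (cases "t [] k") auto
     have "pos u (sub [k] t) <= ereal (- (a + r))" using p r by (cases "pos u (sub [k] t)") auto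
     then have "low N (a + r) (sub [k] t)" using z(1) uk by (auto simp: low_def)
     then have "(1::ennreal) = (if finr (t [] k) then indicator {s. low N (a + roe (t [] k)) s} (sub [k] t) else 0)" using r by simp
     also have "... <= (NN (cs UNIV) (%k. (if finr (t [] k) then indicator {s. low N (a + roe (t [] k)) s} (sub [k] t) else (0::ennreal))))"
      by (rule nn_integral_ge_point) simp
     finally show ?thesis using True by simp
    qed simp
   qed
  qed
  also have "... = (NN (step_law L) (%v. ennreal (exp v) * (NN fam (%s. indicator {t. low N (a + v) t} s))))" by (rule first_step[OF m])
  also have "... <= (NN (step_law L) (%v. ennreal (exp v) * ennreal (exp (- (a + v)))))"
  proof (intro nn_integral_mono mult_left_mono)
   fix v
   have "(NN fam (%s. indicator {t. low N (a + v) t} s)) = emeasure fam {t. low N (a + v) t}" by (subst nn_integral_indicator) (auto intro!: families_setI)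
   then show "(NN fam (%s. indicator {t. low N (a + v) t} s)) <= ennreal (exp (- (a + v)))" using Suc[of "a + v"] by simp
  qed simp
  also have "... = (NN (step_law L) (%v. ennreal (exp (- a))))" by (intro nn_integral_cong) (simp add: ennreal_mult[symmetric] exp_add[symmetric])
  also have "... = ennreal (exp (- a))" using step.emeasure_space_1 by simp
  finally show ?thesis .
 qed
qed

lemma low_ever_prob: "T.prob {t. \<exists>N. low N a t} <= exp (- a)" proof -
 have "(%N. T.prob {t. low N a t}) ---> T.prob (\<Union>N. {t. low N a t})"
  by (rule T.finite_Lim_measure_incseq) (auto intro!: families_setI simp: incseq_def low_def, metis le_trans)
 moreover have "(\<Union>N. {t. low N a t}) = {t. \<exists>N. low N a t}" by auto
 moreover have "T.prob {t. low N a t} <= exp (- a)" for N using low_prob[of N a] by (simp add: T.emeasure_eq_measure)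
 ultimately show ?thesis using LIMSEQ_le_const2[of _ "T.prob {t. \<exists>N. low N a t}" "exp (- a)"] by auto
qed

text \<open>The tilted step is negative with positive probability, so some slot can be followed repeatedly to go down as far as desired.\<close>
lemma going_down:
 obtains k m where "T.prob {t. pos (replicate m k) t <= ereal (- a)} > 0" proof -
 have meas: "(%l. l k) \<in> bmeas L" for k by (simp add: measurable_cong_sets[OF sets_L refl])
 have "\<exists>k j. \<not> (AE l in L. \<not> l k <= ereal (- (1 / real (Suc j))))"
 proof (rule ccontr)
  assume "\<not> ?thesis"
  then have "AE l in L. \<forall>k j. \<not> l k <= ereal (- (1 / real (Suc j)))" by (simp add: AE_all_countable)
  then have nn: "AE l in L. \<forall>k. 0 <= l k"
  proof eventually_elim
   fix l :: "nat => ereal" assume *: "\<forall>k j. \<not> l k <= ereal (- (1 / real (Suc j)))"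
   show "\<forall>k. 0 <= l k"
   proof (rule ccontr)
    assume "\<not> (\<forall>k. 0 <= l k)"
    then obtain k where k: "l k < 0" by (auto simp: not_le)
    show False
    proof (cases "l k")
     case (real r)
     then have "0 < - r" using k by simp
     then obtain j where "inverse (real (Suc j)) < - r" using reals_Archimedean by blast
     then have "l k <= ereal (- (1 / real (Suc j)))" using real by (simp add: inverse_eq_divide)
     then show False using * by blast
    next
     case MInf
     then have "l k <= ereal (- (1 / real (Suc 0)))" by simp
     then show False using * by blast
    qed (use k in auto)
   qed
  qed
  have "(NN (step_law L) (%v. ennreal (max 0 (- v)))) = 0" proof -
   have "(NN (step_law L) (%v. ennreal (max 0 (- v)))) = (\<integral>\<^sup>+l. \<integral>\<^sup>+k. (if finr (l k) then ennreal (exp (- roe (l k)))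
    * ennreal (max 0 (- roe (l k))) else 0) \<partial>cs UNIV \<partial>L)" by (rule nn_integral_step_law) measurable
   also have "... = (NN L (%l. 0))"
   proof (rule nn_integral_cong_AE)
    show "AE l in L. (NN (cs UNIV) (%k. (if finr (l k) then ennreal (exp (- roe (l k)))
    * ennreal (max 0 (- roe (l k))) else 0))) = 0" using nn
    proof eventually_elim
     fix l :: "nat => ereal" assume "\<forall>k. 0 <= l k"
     then have "max 0 (- roe (l k)) = 0" for k by (simp add: real_of_ereal_pos)
     then have "(if finr (l k) then ennreal (exp (- roe (l k)))
      * ennreal (max 0 (- roe (l k))) else 0) = 0" for k by (simp only: ennreal_0 mult_zero_right if_cancel)
     then show "(NN (cs UNIV) (%k. (if finr (l k) then ennreal (exp (- roe (l k)))
      * ennreal (max 0 (- roe (l k))) else 0))) = 0" by (simp only:) simp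
    qed
   qed
   finally show ?thesis by simp
  qed
  then have "(\<integral>v. max 0 (- v) \<partial>step_law L) = 0" by (subst integral_eq_nn_integral) auto
  then show False using step.negative_part_pos by simp
 qed
 then obtain k j where kj: "\<not> (AE l in L. \<not> l k <= ereal (- (1 / real (Suc j))))" by blast
 define \<delta> where "\<delta> = 1 / real (Suc j)"
 have \<delta>: "\<delta> > 0" by (simp add: \<delta>_def)
 define D where "D = {t :: family. t [] k <= ereal (- \<delta>)}"
 have D: "D \<in> sets fam" unfolding D_def by (rule families_setI) measurable
 define q where "q = emeasure fam D"
 have q: "q > 0"
 proof (rule ccontr)
  assume "\<not> q > 0"
  then have "D \<in> null_sets fam" using D by (auto simp: q_def null_sets_def)
  then have "AE t in fam. t \<notin> D" by (rule AE_not_in)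
  then have "AE t in fam. \<not> t [] k <= ereal (- \<delta>)" by (simp add: D_def)
  moreover have "{l \<in> space L. \<not> l k <= ereal (- \<delta>)} \<in> sets L"
   using measurable_sets[OF meas[of k], of "{ereal (- \<delta>)<..}"] by (simp add: vimage_def not_le)
  ultimately have "AE l in distr fam L (%t. t []). \<not> l k <= ereal (- \<delta>)" by (subst AE_distr_iff) auto
  then show False using kj unfolding distr_root by (simp add: \<delta>_def)
 qed
 have spine: "q ^ m <= emeasure fam {t. pos (replicate m k) t <= ereal (- (real m * \<delta>))}" for m
 proof (induction m)
  case 0
  then show ?case using T.emeasure_space_1 by (simp add: zero_ereal_def)
 next
  case (Suc m)
  define g where "g t s = (indicator D t * indicator {s. pos (replicate m k) s <= ereal (- (real m * \<delta>))} s :: ennreal)"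
   for t s :: family
  have set2: "{s. pos (replicate m k) s <= ereal (- (real m * \<delta>))} \<in> sets fam" by (rule families_setI) measurable
  have gm: "(%p. g (fst p) (snd p)) \<in> bmeas (fam \<Otimes>\<^sub>M fam)" unfolding g_def using D set2
   by (intro borel_measurable_times_ennreal measurable_compose[OF measurable_fst borel_measurable_indicator]
     measurable_compose[OF measurable_snd borel_measurable_indicator])
  have "q ^ Suc m <= q * emeasure fam {t. pos (replicate m k) t <= ereal (- (real m * \<delta>))}" using Suc by (simp add: mult_left_mono)
  also have "... = (NN fam (%t. indicator D t * emeasure fam {t. pos (replicate m k) t <= ereal (- (real m * \<delta>))}))"
   using D by (subst nn_integral_multc) (simp_all add: q_def)
  also have "... = (\<integral>\<^sup>+t. \<integral>\<^sup>+s. g t s \<partial>fam \<partial>fam)"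
   unfolding g_def using set2 by (intro nn_integral_cong) (simp add: nn_integral_cmult)
  also have "... = (NN fam (%t. g t (sub [k] t)))" by (rule nn_integral_sub[symmetric, OF gm]) (simp add: g_def trunc_def D_def indicator_def)
  also have "... <= (NN fam (%t. indicator {t. pos (replicate (Suc m) k) t <= ereal (- (real (Suc m) * \<delta>))} t))"
  proof (intro nn_integral_mono)
   fix t
   have "pos (replicate (Suc m) k) t <= ereal (- (real (Suc m) * \<delta>))"
    if "t [] k <= ereal (- \<delta>)" "pos (replicate m k) (sub [k] t) <= ereal (- (real m * \<delta>))" proof -
    have "pos (replicate (Suc m) k) t = t [] k + pos (replicate m k) (sub [k] t)"
     using pos_append[of "replicate m k" "[k]" t] by (simp add: replicate_append_same)
    also have "... <= ereal (- \<delta>) + ereal (- (real m * \<delta>))" using that by (rule add_mono)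
    finally show ?thesis by (simp add: algebra_simps)
   qed
   then show "g t (sub [k] t) <= indicator {t. pos (replicate (Suc m) k) t <= ereal (- (real (Suc m) * \<delta>))} t"
    unfolding g_def D_def by (auto split: split_indicator)
  qed
  also have "... = emeasure fam {t. pos (replicate (Suc m) k) t <= ereal (- (real (Suc m) * \<delta>))}"
   by (rule nn_integral_indicator) (intro families_setI; measurable)
  finally show ?case .
 qed
 obtain m :: nat where m: "a / \<delta> < real m" using reals_Archimedean2 by blast
 then have am: "a <= real m * \<delta>" using \<delta> by (simp add: field_simps)
 have "0 < q ^ m" using q by (induction m) (auto simp: ennreal_zero_less_mult_iff)
 also have "... <= emeasure fam {t. pos (replicate m k) t <= ereal (- (real m * \<delta>))}" by (rule spine)
 also have "... <= emeasure fam {t. pos (replicate m k) t <= ereal (- a)}" using am by (intro emeasure_mono families_setI) (auto intro: order_trans)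
 finally show ?thesis by (intro that[of m k]) (simp add: T.emeasure_eq_measure)
qed

end

section \<open>The minimal position diverges\<close>

lemma unique_indicator_sum:
 assumes "!!z z'. P z ==> P z' ==> z = z'"
 shows "(NN (cs UNIV) (%z. indicator {z. P z} z)) = (if \<exists>z. P z then 1 else 0 :: ennreal)"
proof (cases "\<exists>z. P z")
 case True
 then obtain z where z: "P z" by blast
 have "{z. P z} = {z}" using assms z by blast
 then show ?thesis using True by simp
qed (simp add: indicator_def)

context brw_law begin

text \<open>The first particle after generation \<open>n\<close> below level \<open>A\<close>, in the order of generations and then of labels. Choosing one particle keeps the events for different particles disjoint.\<close>
definition first_low :: "nat => real => nat list => family => bool" where
 "first_low n A z t \<longleftrightarrow> n <= length z & pos z t <= ereal A \<and>
  (\<forall>z'. n <= length z' --> length z' < length z | length z' = length z & to_nat z' < to_nat z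
    --> \<not> pos z' t <= ereal A)"

lemma first_low_unique: "first_low n A z t ==> first_low n A z' t ==> z = z'"
 unfolding first_low_def by (metis linorder_neqE_nat to_nat_split from_nat_to_nat)

lemma first_low_exists:
 assumes "n <= length z" "pos z t <= ereal A"
 shows "\<exists>z. first_low n A z t" proof -
 define P where "P z \<longleftrightarrow> n <= length z & pos z t <= ereal A" for z
 define l where "l = (LEAST l. \<exists>z. P z & length z = l)"
 have "\<exists>z. P z & length z = l" unfolding l_def
  by (rule LeastI[of "%l. \<exists>z. P z & length z = l" "length z"]) (use assms in \<open>auto simp: P_def\<close>)
 then obtain y where y: "P y" "length y = l" by blast
 define c where "c = (LEAST c. \<exists>z. P z & length z = l & to_nat z = c)"
 have "\<exists>z. P z & length z = l & to_nat z = c" unfolding c_def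
  by (rule LeastI[of "%c. \<exists>z. P z & length z = l & to_nat z = c" "to_nat y"]) (use y in auto)
 then obtain x where x: "P x" "length x = l" "to_nat x = c" by blast
 have "\<not> P z'" if "length z' < l" for z' using not_less_Least[of "length z'" "%l. \<exists>z. P z & length z = l"] that unfolding l_def by blast
 moreover have "\<not> P z'" if "length z' = l" "to_nat z' < c" for z'
  using not_less_Least[of "to_nat z'" "%c. \<exists>z. P z & length z = l & to_nat z = c"] that unfolding c_def by blast
 ultimately have "first_low n A x t" using x unfolding first_low_def P_def by auto
 then show ?thesis by blast
qed

lemma first_low_trunc: "first_low n A z (trunc (length z) t) = first_low n A z t" proof -
 have "pos z' (trunc (length z) t) = pos z' t" if "length z' <= length z" for z' using that by (rule pos_trunc)
 then show ?thesis unfolding first_low_def by (metis less_imp_le order_refl)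
qed

lemma measurable_first_low [measurable]: "Measurable.pred fam (first_low n A z)" unfolding first_low_def by measurable

text \<open>From a particle below \<open>A\<close> its descendants reach \<open>- a\<close> with a probability \<open>p\<close> that does not depend on the past.\<close>
lemma return_low:
 obtains p where "p > 0" "!!N. p * T.prob {t. \<not> low N a t & (\<exists>z. N <= length z & pos z t <= ereal A)}
   <= T.prob {t. \<not> low N a t & (\<exists>N. low N a t)}" proof -
 obtain k m where km: "T.prob {t. pos (replicate m k) t <= ereal (- (A + a))} > 0" using going_down by blast
 define H where "H = {t. pos (replicate m k) t <= ereal (- (A + a))}"
 define p where "p = T.prob H"
 have H: "H \<in> sets fam" unfolding H_def by (rule families_setI) measurable
 have p: "p > 0" using km by (simp add: p_def H_def)
 have "p * T.prob {t. \<not> low N a t & (\<exists>z. N <= length z & pos z t <= ereal A)}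
   <= T.prob {t. \<not> low N a t & (\<exists>N. low N a t)}" for N proof -
  define C where "C z = {t. \<not> low N a t & first_low N A z t}" for z
  have C: "C z \<in> sets fam" for z unfolding C_def by (rule families_setI) measurable
  have Ctr: "trunc (length z) t \<in> C z \<longleftrightarrow> t \<in> C z" for z t
  proof (cases "N <= length z")
   case True
   then have "low N a (trunc (length z) t) = low N a t" unfolding low_def by (metis pos_trunc le_trans)
   then show ?thesis by (simp add: C_def first_low_trunc)
  qed (auto simp: C_def first_low_def)
  have one: "(NN fam (%t. indicator (C z) t * indicator H (sub z t))) = ennreal p * (NN fam (%t. indicator (C z) t))" for z proof -
   have "(NN fam (%t. indicator (C z) t * indicator H (sub z t))) = (\<integral>\<^sup>+t. \<integral>\<^sup>+s. indicator (C z) t * indicator H s \<partial>fam \<partial>fam)"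
   proof (rule nn_integral_sub[where g = "%t s. indicator (C z) t * indicator H s"])
    show "(%q. indicator (C z) (fst q) * indicator H (snd q) :: ennreal) \<in> bmeas (fam \<Otimes>\<^sub>M fam)"
     using C H by (intro borel_measurable_times_ennreal measurable_compose[OF measurable_fst borel_measurable_indicator]
      measurable_compose[OF measurable_snd borel_measurable_indicator])
   qed (simp add: indicator_def Ctr)
   also have "... = (NN fam (%t. indicator (C z) t * ennreal p))"
    using H by (intro nn_integral_cong) (simp add: nn_integral_cmult p_def T.emeasure_eq_measure)
   also have "... = (NN fam (%t. indicator (C z) t)) * ennreal p" using C by (intro nn_integral_multc) simp
   finally show ?thesis by (simp only: mult.commute)
  qed
  have cov: "indicator {t. \<not> low N a t & (\<exists>z. N <= length z & pos z t <= ereal A)} t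
    = (NN (cs UNIV) (%z. indicator (C z) t))" for t proof -
   have "(NN (cs UNIV) (%z. indicator (C z) t)) = (NN (cs UNIV) (%z. indicator {z. t \<in> C z} z))" by (intro nn_integral_cong) (simp add: indicator_def)
   also have "... = (if \<exists>z. t \<in> C z then 1 else 0)" by (rule unique_indicator_sum) (auto simp: C_def dest: first_low_unique)
   also have "... = indicator {t. \<not> low N a t & (\<exists>z. N <= length z & pos z t <= ereal A)} t" proof -
    have "(\<exists>z. t \<in> C z) \<longleftrightarrow> \<not> low N a t & (\<exists>z. N <= length z & pos z t <= ereal A)"
     using first_low_exists[of N _ t A] unfolding C_def first_low_def[of N A _ t] mem_Collect_eq by blast
    then show ?thesis by (simp add: indicator_def)
   qed
   finally show ?thesis ..
  qed
  have setA: "{t. \<not> low N a t & (\<exists>z. N <= length z & pos z t <= ereal A)} \<in> sets fam"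
   "{t. \<not> low N a t & (\<exists>N. low N a t)} \<in> sets fam" by (intro families_setI; measurable)+
  have hm: "(%t. indicator (C z) t * indicator H (sub z t) :: ennreal) \<in> bmeas fam" for z
   using C H by (intro borel_measurable_times_ennreal borel_measurable_indicator
      measurable_compose[OF measurable_sub borel_measurable_indicator])
  have "ennreal p * emeasure fam {t. \<not> low N a t & (\<exists>z. N <= length z & pos z t <= ereal A)}
    = ennreal p * (\<integral>\<^sup>+t. \<integral>\<^sup>+z. indicator (C z) t \<partial>cs UNIV \<partial>fam)"
   using setA by (simp only: cov[symmetric] nn_integral_indicator)
  also have "... = ennreal p * (\<integral>\<^sup>+z. \<integral>\<^sup>+t. indicator (C z) t \<partial>fam \<partial>cs UNIV)"
   using C by (subst nn_integral_count_space_nn_integral) auto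
  also have "... = (\<integral>\<^sup>+z. \<integral>\<^sup>+t. indicator (C z) t * indicator H (sub z t) \<partial>fam \<partial>cs UNIV)"
   unfolding one by (rule nn_integral_cmult[symmetric]) simp
  also have "... = (\<integral>\<^sup>+t. \<integral>\<^sup>+z. indicator (C z) t * indicator H (sub z t) \<partial>cs UNIV \<partial>fam)"
   using hm by (intro nn_integral_count_space_nn_integral[symmetric]) auto
  also have "... <= (NN fam (%t. indicator {t. \<not> low N a t & (\<exists>N. low N a t)} t))"
  proof (intro nn_integral_mono)
   fix t
   have sub_low: "\<not> low N a t & (\<exists>N. low N a t)" if "t \<in> C z" "sub z t \<in> H" for z proof -
    have "pos (replicate m k @ z) t = pos z t + pos (replicate m k) (sub z t)" by (rule pos_append)
    also have "... <= ereal A + ereal (- (A + a))" using that by (intro add_mono) (auto simp: C_def first_low_def H_def)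
    finally have "pos (replicate m k @ z) t <= ereal (- a)" by simp
    then show ?thesis using that(1) unfolding C_def low_def by blast
   qed
   show "(NN (cs UNIV) (%z. indicator (C z) t * indicator H (sub z t)))
    <= (indicator {t. \<not> low N a t & (\<exists>N. low N a t)} t :: ennreal)"
   proof (cases "\<exists>z. t \<in> C z & sub z t \<in> H")
    case True
    have "(NN (cs UNIV) (%z. indicator (C z) t * indicator H (sub z t))) <= (NN (cs UNIV) (%z. indicator (C z) t))"
     by (intro nn_integral_mono) (auto split: split_indicator)
    also have "... <= (1::ennreal)" unfolding cov[symmetric] by (simp add: indicator_def)
    also have "1 = indicator {t. \<not> low N a t & (\<exists>N. low N a t)} t" using True sub_low by (auto simp: indicator_def)
    finally show ?thesis .
   next
    case False
    then have "indicator (C z) t * indicator H (sub z t) = (0::ennreal)" for z by (auto simp: indicator_def)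
    then show ?thesis by (simp only: nn_integral_const) simp
   qed
  qed
  also have "... = emeasure fam {t. \<not> low N a t & (\<exists>N. low N a t)}" using setA by (intro nn_integral_indicator)
  finally show ?thesis using p by (simp add: T.emeasure_eq_measure ennreal_mult[symmetric] measure_nonneg)
 qed
 then show ?thesis using that p by blast
qed

text \<open>If particles below \<open>A\<close> appeared at arbitrarily late generations, then by \<open>return_low\<close> level \<open>- a\<close> would be reached after arbitrarily late generations although it was not reached before; for large \<open>a\<close> this contradicts \<open>low_prob\<close>.\<close>
theorem minimal_position_diverges:
 "AE t in fam. \<forall>A :: real. \<exists>n. \<forall>z. n <= length z --> ereal A < pos z t" proof -
 have "AE t in fam. \<exists>n. \<forall>z. n <= length z --> ereal (real A) < pos z t" for A :: nat proof -
  define E where "E = {t. \<forall>n. \<exists>z. n <= length z & pos z t <= ereal (real A)}"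
  have E: "E \<in> sets fam" unfolding E_def by (rule families_setI) measurable
  have "T.prob E <= exp (- a)" for a proof -
   define B where "B = {t. \<exists>N. low N a t}"
   have B: "B \<in> sets fam" unfolding B_def by (rule families_setI) measurable
   obtain p where p: "p > 0" "!!N. p * T.prob {t. \<not> low N a t & (\<exists>z. N <= length z & pos z t <= ereal (real A))}
    <= T.prob {t. \<not> low N a t & (\<exists>N. low N a t)}" using return_low[of a "real A"] by blast
   have le: "p * T.prob (E - B) <= T.prob {t. \<not> low N a t & (\<exists>N. low N a t)}" for N proof -
    have "T.prob (E - B) <= T.prob {t. \<not> low N a t & (\<exists>z. N <= length z & pos z t <= ereal (real A))}"
     by (intro T.finite_measure_mono families_setI) (auto simp: E_def B_def)
    then have "p * T.prob (E - B) <= p * T.prob {t. \<not> low N a t & (\<exists>z. N <= length z & pos z t <= ereal (real A))}"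
     using p(1) by (intro mult_left_mono) auto
    with p(2)[of N] show ?thesis by linarith
   qed
   have "(%N. T.prob {t. \<not> low N a t & (\<exists>N. low N a t)}) ---> T.prob (\<Inter>N. {t. \<not> low N a t & (\<exists>N. low N a t)})"
   proof (rule T.finite_Lim_measure_decseq)
    show "range (%N. {t. \<not> low N a t & (\<exists>N. low N a t)}) \<subseteq> sets fam" by (auto intro!: families_setI)
    show "decseq (%N. {t. \<not> low N a t & (\<exists>N. low N a t)})" unfolding decseq_def low_def using le_trans by blast
   qed
   also have "(\<Inter>N. {t. \<not> low N a t & (\<exists>N. low N a t)}) = {}" by blast
   finally have "(%N. T.prob {t. \<not> low N a t & (\<exists>N. low N a t)}) ---> 0" by simp
   then have "p * T.prob (E - B) <= 0" using le by (intro LIMSEQ_le_const) auto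
   then have "T.prob (E - B) = 0" using p(1) measure_nonneg[of fam "E - B"] by (simp add: mult_le_0_iff)
   have "T.prob E <= T.prob (E - B) + T.prob B" proof -
    have "T.prob E <= T.prob ((E - B) \<union> B)" using E B by (intro T.finite_measure_mono) auto
    also have "... <= T.prob (E - B) + T.prob B" using E B by (intro measure_Un_le) auto
    finally show ?thesis .
   qed
   then show ?thesis using \<open>T.prob (E - B) = 0\<close> low_ever_prob[of a] unfolding B_def by linarith
  qed
  note * = this
  have "(%a :: nat. exp (- real a)) ---> 0" by (intro filterlim_compose[OF exp_at_bot]) (simp add: filterlim_uminus_at_bot filterlim_real_sequentially)
  then have "T.prob E <= 0" by (rule LIMSEQ_le_const) (use * in auto)
  then have "T.prob E = 0" using measure_nonneg[of fam E] by simp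
  then have "E \<in> null_sets fam" using E by (simp add: null_sets_def T.emeasure_eq_measure)
  then have "AE t in fam. t \<notin> E" by (rule AE_not_in)
  then show ?thesis by eventually_elim (simp add: E_def not_le, meson not_le)
 qed
 then have "AE t in fam. \<forall>A :: nat. \<exists>n. \<forall>z. n <= length z --> ereal (real A) < pos z t" by (simp add: AE_all_countable)
 then show ?thesis
 proof eventually_elim
  fix t :: family assume *: "\<forall>A :: nat. \<exists>n. \<forall>z. n <= length z --> ereal (real A) < pos z t"
  show "\<forall>A :: real. \<exists>n. \<forall>z. n <= length z --> ereal A < pos z t"
  proof
   fix A :: real
   obtain m :: nat where m: "A < real m" using reals_Archimedean2 by blast
   obtain n where "\<forall>z. n <= length z --> ereal (real m) < pos z t" using * by blast
   then have "\<forall>z. n <= length z --> ereal A < pos z t" using m by (auto intro: less_trans[of "ereal A" "ereal (real m)"])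
   then show "\<exists>n. \<forall>z. n <= length z --> ereal A < pos z t" by blast
  qed
 qed
qed

end

section \<open>A uniform first moment bound\<close>

lemma geometric_weight_sum:
 fixes c :: real
 assumes c: "c > 0"
 obtains C where "C > 0"
  "!!l. 0 <= l ==> (NN (cs UNIV) (%m. ennreal ((1 + real m) * exp (- c * \<bar>real m - l\<bar>)))) <= ennreal (C * (1 + l))" proof -
 define a where "a j = (1 + real j) * exp (- c * real j)" for j
 define s where "s = 1 / (1 - exp (- c))^2"
 have a0: "0 <= a j" for j by (simp add: a_def)
 have "(%n. of_nat (Suc n) * exp (- c) ^ n) sums s" unfolding s_def by (rule geometric_deriv_sums) (use c in simp)
 moreover have "of_nat (Suc n) * exp (- c) ^ n = a n" for n by (simp add: a_def exp_of_nat_mult[symmetric] mult.commute)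
 ultimately have "a sums s" by simp
 then have S: "(NN (cs UNIV) (%j. ennreal (a j))) = ennreal s" by (simp add: nn_integral_count_space_nat suminf_ennreal_eq[OF a0])
 have s: "s > 0" unfolding s_def using c by simp
 have "(NN (cs UNIV) (%m. ennreal ((1 + real m) * exp (- c * \<bar>real m - l\<bar>)))) <= ennreal ((2 * exp c * s) * (1 + l))" if l: "0 <= l" for l
 proof -
  define N where "N = nat \<lfloor>l\<rfloor>"
  have N: "real N <= l" "l <= real N + 1" using l by (auto simp: N_def)
  define b1 where "b1 m = ennreal (a (m - N)) * indicator {N..} m" for m
  define b2 where "b2 m = ennreal (a (N - m)) * indicator {..<N} m" for m
  have "ennreal ((1 + real m) * exp (- c * \<bar>real m - l\<bar>)) <= ennreal (exp c * (1 + l)) * (b1 m + b2 m)" for m proof -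
   define j where "j = (if N <= m then m - N else N - m)"
   have j: "real j = \<bar>real m - real N\<bar>" by (auto simp: j_def)
   have "b1 m + b2 m = ennreal (a j)" by (auto simp: b1_def b2_def j_def)
   moreover have "(1 + real m) * exp (- c * \<bar>real m - l\<bar>) <= (exp c * (1 + l)) * a j" proof -
    have "real m <= real N + real j" unfolding j by simp
    moreover have "0 <= real N * real j" by simp
    moreover have "(1 + real N) * (1 + real j) = 1 + real N + real j + real N * real j" by (simp add: algebra_simps)
    ultimately have "1 + real m <= (1 + real N) * (1 + real j)" by linarith
    also have "... <= (1 + l) * (1 + real j)" using N by (intro mult_right_mono) auto
    finally have 1: "1 + real m <= (1 + l) * (1 + real j)" .
    have "real j - 1 <= \<bar>real m - l\<bar>" unfolding j using N by auto
    then have "c * (real j - 1) <= c * \<bar>real m - l\<bar>" using c by (intro mult_left_mono) auto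
    then have "exp (- c * \<bar>real m - l\<bar>) <= exp (c + - c * real j)" by (simp add: algebra_simps)
    then have 2: "exp (- c * \<bar>real m - l\<bar>) <= exp c * exp (- c * real j)" by (simp only: exp_add)
    have "(1 + real m) * exp (- c * \<bar>real m - l\<bar>) <= ((1 + l) * (1 + real j)) * (exp c * exp (- c * real j))"
     using 1 2 l by (intro mult_mono) auto
    then show ?thesis by (simp add: a_def mult_ac)
   qed
   ultimately show ?thesis using l a0 by (simp add: ennreal_mult[symmetric] ennreal_leI)
  qed
  then have "(NN (cs UNIV) (%m. ennreal ((1 + real m) * exp (- c * \<bar>real m - l\<bar>))))
   <= (NN (cs UNIV) (%m. ennreal (exp c * (1 + l)) * (b1 m + b2 m)))" by (intro nn_integral_mono)
  also have "... = ennreal (exp c * (1 + l)) * ((NN (cs UNIV) (%m. b1 m)) + (NN (cs UNIV) (%m. b2 m)))" by (simp add: nn_integral_cmult nn_integral_add)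
  also have "... <= ennreal (exp c * (1 + l)) * (ennreal s + ennreal s)"
  proof (intro mult_left_mono add_mono)
   show "(NN (cs UNIV) (%m. b1 m)) <= ennreal s" proof -
   have "bij_betw (%j. j + N) UNIV {N..}" by (rule bij_betwI[where g = "%m. m - N"]) auto
   from nn_integral_bij_count_space[OF this, of "%m. ennreal (a (m - N))"]
   show ?thesis unfolding b1_def S[symmetric] by (simp add: nn_integral_count_space_indicator)
  qed
   show "(NN (cs UNIV) (%m. b2 m)) <= ennreal s" proof -
   have "bij_betw (%m. N - m) {..<N} {1..N}" by (rule bij_betwI[where g = "%m. N - m"]) auto
   from nn_integral_bij_count_space[OF this, of "%j. ennreal (a j)"]
   have "(NN (cs UNIV) (%m. b2 m)) = (NN (cs {1..N}) (%j. ennreal (a j)))" unfolding b2_def by (simp add: nn_integral_count_space_indicator)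
   also have "... <= (NN (cs UNIV) (%j. ennreal (a j)))"
    by (subst nn_integral_count_space_indicator) (auto intro!: nn_integral_mono split: split_indicator)
   finally show ?thesis unfolding S .
  qed
  qed simp
  also have "ennreal (exp c * (1 + l)) * (ennreal s + ennreal s) = ennreal ((2 * exp c * s) * (1 + l))"
   using s l by (simp add: ennreal_mult[symmetric] ennreal_plus[symmetric] algebra_simps del: ennreal_plus)
  finally show ?thesis .
 qed
 then show ?thesis using that[of "2 * exp c * s"] s by auto
qed

lemma min_one_count_sum:
 "min 1 (NN (cs A) (%k. F k)) <= (\<integral>\<^sup>+k. min 1 (F k) \<partial>cs A :: ennreal)"
proof (cases "\<exists>k\<in>A. 1 <= F k")
 case True
 then obtain k where k: "k \<in> A" "1 <= F k" by blast
 have "(1 :: ennreal) = min 1 (F k)" using k by (simp add: min_def)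
 also have "... <= (NN (cs A) (%k. min 1 (F k)))" using k by (intro nn_integral_ge_point)
 finally show ?thesis by (simp add: min.coboundedI1)
next
 case False
 then have "(NN (cs A) (%k. F k)) = (NN (cs A) (%k. min 1 (F k)))" by (intro nn_integral_cong) (auto simp: min_def not_le intro: antisym)
 then show ?thesis by simp
qed

context brw_law begin

text \<open>Expectation of the tilted walk killed below \<open>0\<close>.\<close>
definition killed :: "(real => ennreal) => nat => real => ennreal" where
 "killed f n x = (NN step.paths (%q. f (x + walk q n) * indicator {q. \<forall>j\<le>n. 0 <= x + walk q j} q))"

lemma killed_Suc:
 assumes [measurable]: "f \<in> bmeas borel" and x: "0 <= x"
 shows "killed f (Suc n) x = (NN (step_law L) (%v. killed f n (x + v)))" proof -
 have set: "{q. \<forall>j\<le>n. 0 <= x + walk q j} \<in> sets step.paths" for n x by (rule step.sets_CollectI) measurable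
 have m: "(%q. f (x + walk q n) * indicator {q. \<forall>j\<le>n. 0 <= x + walk q j} q) \<in> bmeas step.paths" for n x
  by (intro borel_measurable_times_ennreal borel_measurable_indicator set) measurable
 have p: "Measurable.pred (borel \<Otimes>\<^sub>M step.paths) (%p. \<forall>j\<le>n. 0 <= x + fst p + walk (snd p) j)" by measurable
 have m2: "(%p. f (x + fst p + walk (snd p) n) * indicator {q. \<forall>j\<le>n. 0 <= x + fst p + walk q j} (snd p))
   \<in> bmeas (borel \<Otimes>\<^sub>M step.paths)" proof -
  have "(%p. if (\<forall>j\<le>n. 0 <= x + fst p + walk (snd p) j) then 1 else 0 :: ennreal) \<in> bmeas (borel \<Otimes>\<^sub>M step.paths)"
   using p by measurable
  then have "(%p. f (x + fst p + walk (snd p) n) * (if (\<forall>j\<le>n. 0 <= x + fst p + walk (snd p) j) then 1 else 0 :: ennreal)) \<in> bmeas (borel \<Otimes>\<^sub>M step.paths)"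
   by (intro borel_measurable_times_ennreal) measurable
  then show ?thesis by (simp add: indicator_def of_bool_def)
 qed
 have km: "(%v. killed f n (x + v)) \<in> bmeas borel" using step.P.borel_measurable_nn_integral_fst[OF m2] by (simp add: killed_def)
 have "killed f (Suc n) x = (\<integral>\<^sup>+q. \<integral>\<^sup>+q'. f (x + walk (comb_seq 1 q q') (Suc n))
  * indicator {q. \<forall>j\<le>Suc n. 0 <= x + walk q j} (comb_seq 1 q q') \<partial>step.paths \<partial>step.paths)"
  unfolding killed_def by (rule step.nn_integral_split[OF m])
 also have "... = (NN step.paths (%q. killed f n (x + q 0)))" unfolding killed_def
 proof (intro nn_integral_cong)
  fix q q' :: "nat => real"
  have w: "walk (comb_seq 1 q q') (Suc j) = q 0 + walk q' j" for j using walk_comb_seq_add[of 1 q q' j] by simp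
  have "(\<forall>j\<le>Suc n. 0 <= x + walk (comb_seq 1 q q') j) \<longleftrightarrow> (\<forall>j\<le>n. 0 <= x + q 0 + walk q' j)"
  proof safe
   fix j assume "\<forall>j\<le>Suc n. 0 <= x + walk (comb_seq 1 q q') j" "j <= n"
   then have "0 <= x + walk (comb_seq 1 q q') (Suc j)" by blast
   then show "0 <= x + q 0 + walk q' j" unfolding w by simp
  next
   fix j assume "\<forall>j\<le>n. 0 <= x + q 0 + walk q' j" "j <= Suc n"
   then show "0 <= x + walk (comb_seq 1 q q') j" using x w by (cases j) (auto simp del: walk_Suc simp: add.assoc)
  qed
  then show "f (x + walk (comb_seq 1 q q') (Suc n)) * indicator {q. \<forall>j\<le>Suc n. 0 <= x + walk q j} (comb_seq 1 q q')
   = f (x + q 0 + walk q' n) * indicator {q'. \<forall>j\<le>n. 0 <= x + q 0 + walk q' j} q'" unfolding w by (simp add: indicator_def add.assoc)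
 qed
 also have "... = (NN (distr step.paths (step_law L) (%q. q 0)) (%v. killed f n (x + v)))" using km by (subst nn_integral_distr) auto
 also have "distr step.paths (step_law L) (%q. q 0) = step_law L" by (rule distr_PiM_component[OF step.prob_space_axioms]) simp
 finally show ?thesis .
qed

text \<open>Particles whose ancestors stay nonnegative are counted by the killed walk. If some ancestor goes below \<open>0\<close>, the bound by one is used there; these first passages account for the summand \<open>1\<close>.\<close>
lemma first_moment_killed:
 assumes [measurable]: "\<kappa> \<in> bmeas borel"
 shows "ennreal (exp x) * (NN fam (%t. min 1 (psum (%v. \<kappa> (x + v)) n t)))
  <= 1 + killed (%y. ennreal (exp y) * min 1 (\<kappa> y)) n x"
proof (induction n arbitrary: x)
 case 0
 show ?case
 proof (cases "x < 0")
  case True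
  have "ennreal (exp x) * (NN fam (%t. min 1 (psum (%v. \<kappa> (x + v)) 0 t))) <= 1 * (NN fam (%t. 1))"
   using True by (intro mult_mono nn_integral_mono) (auto simp: ennreal_le_1)
  also have "... <= 1 + killed (%y. ennreal (exp y) * min 1 (\<kappa> y)) 0 x" using T.emeasure_space_1 by simp
  finally show ?thesis .
 next
  case False
  then show ?thesis using T.emeasure_space_1 step.P.emeasure_space_1 by (simp add: psum_0 killed_def indicator_def add_increasing)
 qed
next
 case (Suc n)
 show ?case
 proof (cases "x < 0")
  case True
  have "ennreal (exp x) * (NN fam (%t. min 1 (psum (%v. \<kappa> (x + v)) (Suc n) t))) <= 1 * (NN fam (%t. 1))"
   using True by (intro mult_mono nn_integral_mono) (auto simp: ennreal_le_1)
  also have "... <= 1 + killed (%y. ennreal (exp y) * min 1 (\<kappa> y)) (Suc n) x" using T.emeasure_space_1 by simp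
  finally show ?thesis .
 next
  case False
  have m: "(%p. min 1 (psum (%u. \<kappa> (x + fst p + u)) n (snd p))) \<in> bmeas (borel \<Otimes>\<^sub>M fam)"
   by (intro borel_measurable_min borel_measurable_const measurable_psum_param[where g = "%v u. \<kappa> (x + v + u)"]) measurable
  have Am: "(%v. NN fam (%t. min 1 (psum (%u. \<kappa> (x + v + u)) n t))) \<in> bmeas borel" using T.borel_measurable_nn_integral_fst[OF m] by simp
  have "(NN fam (%t. min 1 (psum (%v. \<kappa> (x + v)) (Suc n) t)))
   <= (\<integral>\<^sup>+t. \<integral>\<^sup>+k. (if finr (t [] k) then min 1 (psum (%u. \<kappa> (x + roe (t [] k) + u)) n (sub [k] t)) else 0) \<partial>cs UNIV \<partial>fam)"
  proof (intro nn_integral_mono)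
   fix t
   have "min 1 (psum (%v. \<kappa> (x + v)) (Suc n) t)
    <= (NN (cs UNIV) (%k. min 1 (if finr (t [] k) then psum (%u. \<kappa> (x + (roe (t [] k) + u))) n (sub [k] t) else 0)))"
    unfolding psum_Suc by (rule min_one_count_sum)
   also have "... = (NN (cs UNIV) (%k. (if finr (t [] k) then min 1 (psum (%u. \<kappa> (x + roe (t [] k) + u)) n (sub [k] t)) else 0)))"
    by (intro nn_integral_cong) (simp add: add.assoc)
   finally show "min 1 (psum (%v. \<kappa> (x + v)) (Suc n) t) <= (NN (cs UNIV) (%k. (if finr (t [] k) then min 1 (psum (%u. \<kappa> (x + roe (t [] k) + u)) n (sub [k] t)) else 0)))" .
  qed
  also have "... = (NN (step_law L) (%v. ennreal (exp v) * (NN fam (%t. min 1 (psum (%u. \<kappa> (x + v + u)) n t)))))" by (rule first_step[OF m])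
  finally have "ennreal (exp x) * (NN fam (%t. min 1 (psum (%v. \<kappa> (x + v)) (Suc n) t)))
   <= ennreal (exp x) * (NN (step_law L) (%v. ennreal (exp v) * (NN fam (%t. min 1 (psum (%u. \<kappa> (x + v + u)) n t)))))" by (rule mult_left_mono) simp
  also have "... = (NN (step_law L) (%v. ennreal (exp (x + v)) * (NN fam (%t. min 1 (psum (%u. \<kappa> (x + v + u)) n t)))))"
   using Am by (subst nn_integral_cmult[symmetric]) (auto simp: exp_add ennreal_mult mult.assoc intro!: nn_integral_cong)
  also have "... <= (NN (step_law L) (%v. 1 + killed (%y. ennreal (exp y) * min 1 (\<kappa> y)) n (x + v)))" by (intro nn_integral_mono Suc)
  also have "... = 1 + killed (%y. ennreal (exp y) * min 1 (\<kappa> y)) (Suc n) x" proof -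
   have p: "Measurable.pred (borel \<Otimes>\<^sub>M step.paths) (%p. \<forall>j\<le>n. 0 <= x + fst p + walk (snd p) j)" by measurable
   have "(%p. if (\<forall>j\<le>n. 0 <= x + fst p + walk (snd p) j) then 1 else 0 :: ennreal) \<in> bmeas (borel \<Otimes>\<^sub>M step.paths)"
    using p by measurable
   then have "(%p. (ennreal (exp (x + fst p + walk (snd p) n)) * min 1 (\<kappa> (x + fst p + walk (snd p) n))) *
    (if (\<forall>j\<le>n. 0 <= x + fst p + walk (snd p) j) then 1 else 0 :: ennreal)) \<in> bmeas (borel \<Otimes>\<^sub>M step.paths)"
    by (intro borel_measurable_times_ennreal) measurable
   then have "(%p. (ennreal (exp (x + fst p + walk (snd p) n)) * min 1 (\<kappa> (x + fst p + walk (snd p) n))) *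
    indicator {q. \<forall>j\<le>n. 0 <= x + fst p + walk q j} (snd p)) \<in> bmeas (borel \<Otimes>\<^sub>M step.paths)"
    by (simp add: indicator_def of_bool_def)
   from step.P.borel_measurable_nn_integral_fst[OF this]
   have "(%v. killed (%y. ennreal (exp y) * min 1 (\<kappa> y)) n (x + v)) \<in> bmeas borel" by (simp add: killed_def)
   then have "(NN (step_law L) (%v. 1 + killed (%y. ennreal (exp y) * min 1 (\<kappa> y)) n (x + v)))
    = 1 + (NN (step_law L) (%v. killed (%y. ennreal (exp y) * min 1 (\<kappa> y)) n (x + v)))" using step.emeasure_space_1 by (subst nn_integral_add) auto
   moreover have "killed (%y. ennreal (exp y) * min 1 (\<kappa> y)) (Suc n) x
    = (NN (step_law L) (%v. killed (%y. ennreal (exp y) * min 1 (\<kappa> y)) n (x + v)))" using False by (intro killed_Suc) auto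
   ultimately show ?thesis by simp
  qed
  finally show ?thesis .
 qed
qed

text \<open>The level \<open>3/2 ln n\<close> turns the factor \<open>n\<^sup>-\<^sup>3\<^sup>/\<^sup>2\<close> of the ballot estimate into a constant. The decay of \<open>\<kappa>\<close> makes the sum over the end points of the walk converge.\<close>
lemma descent_bound:
 assumes [measurable]: "\<kappa> \<in> bmeas borel" and c: "c > 0" and M: "M \<ge> 0"
  and \<kappa>: "!!u. ennreal (exp u) * min 1 (\<kappa> u) <= ennreal (M * exp (- c * \<bar>u\<bar>))"
 obtains C where "C > 0"
  "!!n x. 0 < n ==> 0 <= x ==> (NN fam (%t. min 1 (psum (%v. \<kappa> (x + v - 3/2 * ln (real n))) n t)))
   <= ennreal (C * (1 + x) * (1 + 3/2 * ln (real n)) * exp (- x))" proof -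
 obtain C1 where C1: "C1 > 0" "!!l. 0 <= l ==> (NN (cs UNIV) (%m. ennreal ((1 + real m) * exp (- c * \<bar>real m - l\<bar>)))) <= ennreal (C1 * (1 + l))"
  using geometric_weight_sum[OF c] by blast
 obtain C2 where C2: "C2 > 0" "!!n x y. 0 < n ==> 0 <= x ==> 0 <= y ==>
   step.P.prob {q. (\<forall>j\<le>n. 0 <= x + walk q j) & x + walk q n \<in> {y..y + 1}}
    <= C2 * (1 + x) * (1 + y) / (real n * sqrt (real n))" using step.stay_and_end by blast
 have main: "(NN fam (%t. min 1 (psum (%v. \<kappa> (x + v - 3/2 * ln (real n))) n t)))
   <= ennreal ((1 + M * exp c * C2 * C1) * (1 + x) * (1 + 3/2 * ln (real n)) * exp (- x))"
  if n: "0 < n" and x: "0 <= x" for n x proof -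
  define l where "l = 3/2 * ln (real n)"
  have l: "0 <= l" using n by (simp add: l_def)
  have el: "exp l = real n * sqrt (real n)" proof -
   have "exp l = exp (ln (real n) + ln (real n) / 2)" by (simp add: l_def)
   also have "... = real n * sqrt (real n)" using n by (simp only: exp_add) (simp add: ln_sqrt[symmetric])
   finally show ?thesis .
  qed
  define f where "f y = ennreal (exp y) * min 1 (\<kappa> (y - l))" for y
  have fb: "f y <= ennreal (exp l * M * exp (- c * \<bar>y - l\<bar>))" for y proof -
   have "f y = ennreal (exp l) * (ennreal (exp (y - l)) * min 1 (\<kappa> (y - l)))"
    unfolding f_def by (simp add: mult.assoc[symmetric] ennreal_mult[symmetric] exp_add[symmetric])
   also have "... <= ennreal (exp l) * ennreal (M * exp (- c * \<bar>y - l\<bar>))" by (intro mult_left_mono \<kappa>) simp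
   finally show ?thesis using M by (simp add: ennreal_mult[symmetric] mult.assoc)
  qed
  define E where "E m = {q. (\<forall>j\<le>n. 0 <= x + walk q j) & x + walk q n \<in> {real m..real m + 1}}" for m :: nat
  have E: "E m \<in> sets step.paths" for m unfolding E_def by (rule step.sets_CollectI) measurable
  have "killed f n x <= (\<integral>\<^sup>+q. \<integral>\<^sup>+m. ennreal (exp l * M * exp c * exp (- c * \<bar>real m - l\<bar>)) * indicator (E m) q \<partial>cs UNIV \<partial>step.paths)"
   unfolding killed_def
  proof (intro nn_integral_mono)
   fix q
   show "f (x + walk q n) * indicator {q. \<forall>j\<le>n. 0 <= x + walk q j} q
    <= (NN (cs UNIV) (%m. ennreal (exp l * M * exp c * exp (- c * \<bar>real m - l\<bar>)) * indicator (E m) q))"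
   proof (cases "\<forall>j\<le>n. 0 <= x + walk q j")
    case True
    define y where "y = x + walk q n"
    define m where "m = nat \<lfloor>y\<rfloor>"
    have y: "0 <= y" using True by (simp add: y_def)
    have m: "real m <= y" "y <= real m + 1" using y by (auto simp: m_def)
    then have "q \<in> E m" using True by (auto simp: E_def y_def)
    have "f y <= ennreal (exp l * M * exp (- c * \<bar>y - l\<bar>))" by (rule fb)
    also have "... <= ennreal (exp l * M * (exp c * exp (- c * \<bar>real m - l\<bar>)))"
    proof (intro ennreal_leI mult_left_mono)
     have "\<bar>real m - l\<bar> <= 1 + \<bar>y - l\<bar>" using m by linarith
     then have "c * \<bar>real m - l\<bar> <= c * (1 + \<bar>y - l\<bar>)" using c by (intro mult_left_mono) auto
     then have "exp (- c * \<bar>y - l\<bar>) <= exp (c + - c * \<bar>real m - l\<bar>)" by (simp add: algebra_simps)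
     then show "exp (- c * \<bar>y - l\<bar>) <= exp c * exp (- c * \<bar>real m - l\<bar>)" by (simp only: exp_add)
    qed (use M in auto)
    also have "... = ennreal (exp l * M * exp c * exp (- c * \<bar>real m - l\<bar>)) * indicator (E m) q"
     using \<open>q \<in> E m\<close> by (simp add: mult.assoc)
    also have "... <= (NN (cs UNIV) (%m. ennreal (exp l * M * exp c * exp (- c * \<bar>real m - l\<bar>)) * indicator (E m) q))"
     by (rule nn_integral_ge_point) simp
    finally show ?thesis using True by (simp add: y_def)
   qed simp
  qed
  also have "... = (\<integral>\<^sup>+m. \<integral>\<^sup>+q. ennreal (exp l * M * exp c * exp (- c * \<bar>real m - l\<bar>)) * indicator (E m) q \<partial>step.paths \<partial>cs UNIV)"
   using E by (intro nn_integral_count_space_nn_integral) auto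
  also have "... = (NN (cs UNIV) (%m. ennreal (exp l * M * exp c * exp (- c * \<bar>real m - l\<bar>)) * emeasure step.paths (E m)))"
   using E by (intro nn_integral_cong nn_integral_cmult_indicator) auto
  also have "... <= (NN (cs UNIV) (%m. ennreal (M * exp c * C2 * (1 + x)) * ennreal ((1 + real m) * exp (- c * \<bar>real m - l\<bar>))))"
  proof (intro nn_integral_mono)
   fix m
   have "emeasure step.paths (E m) <= ennreal (C2 * (1 + x) * (1 + real m) / exp l)"
    unfolding el E_def using C2(2)[OF n x, of "real m"] by (simp add: step.P.emeasure_eq_measure ennreal_leI)
   then have "ennreal (exp l * M * exp c * exp (- c * \<bar>real m - l\<bar>)) * emeasure step.paths (E m)
    <= ennreal (exp l * M * exp c * exp (- c * \<bar>real m - l\<bar>)) * ennreal (C2 * (1 + x) * (1 + real m) / exp l)" by (rule mult_left_mono) simp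
   also have "... = ennreal (exp l * M * exp c * exp (- c * \<bar>real m - l\<bar>) * (C2 * (1 + x) * (1 + real m) / exp l))"
    using M C2 x by (intro ennreal_mult[symmetric]) auto
   also have "exp l * M * exp c * exp (- c * \<bar>real m - l\<bar>) * (C2 * (1 + x) * (1 + real m) / exp l)
    = (M * exp c * C2 * (1 + x)) * ((1 + real m) * exp (- c * \<bar>real m - l\<bar>))" by simp
   also have "ennreal ... = ennreal (M * exp c * C2 * (1 + x)) * ennreal ((1 + real m) * exp (- c * \<bar>real m - l\<bar>))"
    using M C2 x by (intro ennreal_mult) auto
   finally show "ennreal (exp l * M * exp c * exp (- c * \<bar>real m - l\<bar>)) * emeasure step.paths (E m)
    <= ennreal (M * exp c * C2 * (1 + x)) * ennreal ((1 + real m) * exp (- c * \<bar>real m - l\<bar>))" .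
  qed
  also have "... = ennreal (M * exp c * C2 * (1 + x)) * (NN (cs UNIV) (%m. ennreal ((1 + real m) * exp (- c * \<bar>real m - l\<bar>))))"
   by (rule nn_integral_cmult) simp
  also have "... <= ennreal (M * exp c * C2 * (1 + x)) * ennreal (C1 * (1 + l))" by (intro mult_left_mono C1(2) l) simp
  also have "... = ennreal (M * exp c * C2 * (1 + x) * (C1 * (1 + l)))" using M C1 C2 x l by (intro ennreal_mult[symmetric]) auto
  finally have k: "killed f n x <= ennreal (M * exp c * C2 * (1 + x) * (C1 * (1 + l)))" .
  have "ennreal (exp x) * (NN fam (%t. min 1 (psum (%v. \<kappa> (x + v - l)) n t))) <= 1 + killed f n x"
   unfolding f_def by (rule first_moment_killed[of "%y. \<kappa> (y - l)"]) measurable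
  also have "... <= 1 + ennreal (M * exp c * C2 * (1 + x) * (C1 * (1 + l)))" by (intro add_left_mono k)
  also have "... = ennreal (1 + M * exp c * C2 * (1 + x) * (C1 * (1 + l)))" using M C1 C2 x l by (subst ennreal_plus) auto
  also have "... <= ennreal ((1 + M * exp c * C2 * C1) * (1 + x) * (1 + l))"
  proof (rule ennreal_leI)
   have "1 * 1 <= (1 + x) * (1 + l)" using x l by (intro mult_mono) auto
   then show "1 + M * exp c * C2 * (1 + x) * (C1 * (1 + l)) <= (1 + M * exp c * C2 * C1) * (1 + x) * (1 + l)" proof -
    have "(1 + M * exp c * C2 * C1) * (1 + x) * (1 + l) = (1 + x) * (1 + l) + M * exp c * C2 * (1 + x) * (C1 * (1 + l))" by (simp add: algebra_simps)
    then show ?thesis using \<open>1 * 1 <= (1 + x) * (1 + l)\<close> by linarith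
   qed
  qed
  finally have "ennreal (exp (- x)) * (ennreal (exp x) * (NN fam (%t. min 1 (psum (%v. \<kappa> (x + v - l)) n t))))
   <= ennreal (exp (- x)) * ennreal ((1 + M * exp c * C2 * C1) * (1 + x) * (1 + l))" by (rule mult_left_mono) simp
  also have "... = ennreal ((1 + M * exp c * C2 * C1) * (1 + x) * (1 + l) * exp (- x))"
   using M C1 C2 x l by (subst ennreal_mult[symmetric]) (auto simp: mult_ac)
  finally show ?thesis by (simp add: mult.assoc[symmetric] ennreal_mult[symmetric] exp_add[symmetric] l_def)
 qed
 have "1 + M * exp c * C2 * C1 > 0" using M C1 C2 by (simp add: add_pos_nonneg)
 then show ?thesis using that main by blast
qed

end

section \<open>Convergence of bounded martingales\<close>

context prob_space begin

lemma bounded_martingale_maximal: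
 fixes X :: "nat => 'a => real" and \<tau> :: "nat => 'a => 'a"
 assumes X [measurable]: "!!n. X n \<in> bmeas M"
  and bdd: "!!n w. \<bar>X n w\<bar> <= 1"
  and \<tau> [measurable]: "!!n. \<tau> n \<in> measurable M M"
  and adapted: "!!l i w. l <= i ==> X l (\<tau> i w) = X l w"
  and mart: "!!i j y. i <= j ==> y \<in> bmeas M ==> (!!w. \<bar>y w\<bar> <= 2) ==> (!!w. y (\<tau> i w) = y w) ==>
   (LINT w|M. y w * X j w) = (LINT w|M. y w * X i w)"
  and iN: "i <= N" and e: "e > 0"
 shows "e^2 * prob {w \<in> space M. \<exists>j\<in>{i..N}. e < \<bar>X j w - X i w\<bar>}
  <= (LINT w|M. (X N w)^2) - (LINT w|M. (X i w)^2)" proof -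
 have int: "integrable M f" if "f \<in> bmeas M" "!!w. \<bar>f w\<bar> <= c" for f :: "'a => real" and c
  using that by (intro integrable_const_bound[of _ c]) auto
 have sq: "(X n w)^2 <= 1" for n w using bdd[of n w] by (simp add: abs_square_le_1)
 have pr: "\<bar>X n w * X m w\<bar> <= 1" for n m w using bdd[of n w] bdd[of m w] by (simp add: abs_mult mult_le_one)
 define A where "A j = {w \<in> space M. e < \<bar>X j w - X i w\<bar> & (\<forall>l\<in>{i..<j}. \<not> e < \<bar>X l w - X i w\<bar>)}" for j
 define I where "I j w = (if e < \<bar>X j w - X i w\<bar> & (\<forall>l\<in>{i..<j}. \<not> e < \<bar>X l w - X i w\<bar>) then 1 else 0 :: real)" for j w
 have A [measurable]: "A j \<in> sets M" for j unfolding A_def by measurable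
 have I [measurable]: "I j \<in> bmeas M" for j unfolding I_def by measurable
 have I01: "0 <= I j w" "I j w <= 1" for j w by (auto simp: I_def)
 have IA: "(LINT w|M. I j w) = prob (A j)" for j proof -
  have "(LINT w|M. I j w) = (LINT w|M. indicator (A j) w)" by (intro Bochner_Integration.integral_cong) (auto simp: I_def A_def indicator_def)
  then show ?thesis using A by simp
 qed
 have disj: "disjoint_family_on A {i..N}" unfolding disjoint_family_on_def
 proof (intro ballI impI)
  fix j k assume jk: "j \<in> {i..N}" "k \<in> {i..N}" "j ~= k"
  have *: "A j \<inter> A k = {}" if "j \<in> {i..N}" "j < k" for j k proof -
   have "j \<in> {i..<k}" using that by auto
   then show ?thesis unfolding A_def by blast
  qed
  show "A j \<inter> A k = {}" using *[of j k] *[of k j] jk by (metis Int_commute linorder_neqE_nat)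
 qed
 have cover: "{w \<in> space M. \<exists>j\<in>{i..N}. e < \<bar>X j w - X i w\<bar>} = (\<Union>j\<in>{i..N}. A j)"
 proof safe
  fix w j assume *: "w \<in> space M" "j \<in> {i..N}" "e < \<bar>X j w - X i w\<bar>"
  define k where "k = (LEAST k. k \<in> {i..N} & e < \<bar>X k w - X i w\<bar>)"
  have k: "k \<in> {i..N} & e < \<bar>X k w - X i w\<bar>" unfolding k_def by (rule LeastI[of _ j]) (use * in blast)
  have "\<not> e < \<bar>X l w - X i w\<bar>" if "l \<in> {i..<k}" for l
  proof
   assume "e < \<bar>X l w - X i w\<bar>"
   then have "k <= l" unfolding k_def using that k by (intro Least_le) auto
   then show False using that by simp
  qed
  then have "w \<in> A k" using k *(1) by (auto simp: A_def)
  then show "w \<in> (\<Union>j\<in>{i..N}. A j)" using k by blast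
 qed (auto simp: A_def)
 have Idep: "I j (\<tau> k w) = I j w" if "j <= k" "i <= k" for j k w using that adapted by (auto simp: I_def)
 have sumI: "(\<Sum>j\<in>{i..N}. I j w) <= 1" if "w \<in> space M" for w
 proof (cases "\<exists>j\<in>{i..N}. I j w ~= 0")
  case True
  then obtain j where j: "j \<in> {i..N}" "I j w ~= 0" by blast
  have "I k w = 0" if "k \<in> {i..N} - {j}" for k
  proof (rule ccontr)
   assume "I k w ~= 0"
   then have "w \<in> A k \<inter> A j" using j \<open>w \<in> space M\<close> by (auto simp: I_def A_def split: if_splits)
   moreover have "A k \<inter> A j = {}" using disj that j(1) unfolding disjoint_family_on_def by blast
   ultimately show False by blast
  qed
  then have "(\<Sum>j\<in>{i..N}. I j w) = I j w" using j by (subst sum.remove[of _ j]) auto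
  then show ?thesis using I01 by simp
 qed simp
 have key: "(LINT w|M. I j w * (X N w - X i w)^2) \<ge> e^2 * prob (A j)" if j: "j \<in> {i..N}" for j proof -
  define y where "y w = I j w * (X j w - X i w)" for w
  have y2: "\<bar>y w\<bar> <= 2" for w using I01[of j w] bdd[of j w] bdd[of i w] mult_mono[of "I j w" 1 "\<bar>X j w - X i w\<bar>" 2]
   by (auto simp: y_def abs_mult)
  have ym [measurable]: "y \<in> bmeas M" unfolding y_def by measurable
  have cross: "(LINT w|M. y w * X N w) = (LINT w|M. y w * X j w)" using j y2 by (intro mart ym) (auto simp: y_def Idep adapted)
  have yb: "\<bar>y w * X n w\<bar> <= 2" for n w using mult_mono[OF y2[of w] bdd[of n w]] by (simp add: abs_mult)
  have iyX: "integrable M (%w. y w * X n w)" for n by (rule int[OF _ yb]) measurable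
  have b4: "\<bar>I j w * (X n w - X m w)^2\<bar> <= 4" for n m w proof -
   have "\<bar>X n w - X m w\<bar> <= 2" using bdd[of n w] bdd[of m w] by linarith
   then have "(X n w - X m w)^2 <= 2^2" using abs_le_square_iff[of "X n w - X m w" 2] by simp
   then show ?thesis using I01[of j w] mult_mono[of "I j w" 1 "(X n w - X m w)^2" 4] by (simp add: abs_mult)
  qed
  have i4: "integrable M (%w. I j w * (X n w - X m w)^2)" for n m by (rule int[OF _ b4]) measurable
  have "I j w * (X N w - X i w)^2 = I j w * (X N w - X j w)^2 + 2 * (y w * X N w - y w * X j w) + I j w * (X j w - X i w)^2" for w
   unfolding y_def by (simp add: power2_eq_square algebra_simps)
  then have "(LINT w|M. I j w * (X N w - X i w)^2) = (LINT w|M. I j w * (X N w - X j w)^2)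
    + 2 * ((LINT w|M. y w * X N w) - (LINT w|M. y w * X j w)) + (LINT w|M. I j w * (X j w - X i w)^2)" using i4 iyX by (simp add: Bint_add Bint_diff)
  also have "... \<ge> (LINT w|M. I j w * (X j w - X i w)^2)" using cross I01 by (simp add: integral_nonneg_AE)
  finally have 1: "(LINT w|M. I j w * (X j w - X i w)^2) <= (LINT w|M. I j w * (X N w - X i w)^2)" .
  have "e^2 * prob (A j) = (LINT w|M. e^2 * I j w)" by (simp add: IA)
  also have "... <= (LINT w|M. I j w * (X j w - X i w)^2)"
  proof (intro integral_mono i4)
   show "integrable M (%w. e^2 * I j w)" by (intro integrable_mult_right int[of "I j" 1]) (use I01 in auto)
   show "e^2 * I j w <= I j w * (X j w - X i w)^2" for w
   proof (cases "I j w = 0")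
    case False
    then have "e < \<bar>X j w - X i w\<bar>" "I j w = 1" by (auto simp: I_def split: if_splits)
    then show ?thesis using e abs_le_square_iff[of e "X j w - X i w"] by simp
   qed simp
  qed
  finally show ?thesis using 1 by simp
 qed
 have ib: "\<bar>I j w * (X N w - X i w)^2\<bar> <= 4" for j w proof -
  have "\<bar>X N w - X i w\<bar> <= 2" using bdd[of N w] bdd[of i w] by linarith
  then have "(X N w - X i w)^2 <= 2^2" using abs_le_square_iff[of "X N w - X i w" 2] by simp
  then show ?thesis using I01[of j w] mult_mono[of "I j w" 1 "(X N w - X i w)^2" 4] by (simp add: abs_mult)
 qed
 have iI: "integrable M (%w. I j w * (X N w - X i w)^2)" for j by (rule int[OF _ ib]) measurable
 have i1: "integrable M (%w. (X n w)^2)" for n by (rule int[of _ 1]) (use sq in auto)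
 have i2: "integrable M (%w. X i w * X N w)" by (rule int[OF _ pr]) measurable
 have "e^2 * prob {w \<in> space M. \<exists>j\<in>{i..N}. e < \<bar>X j w - X i w\<bar>} = (\<Sum>j\<in>{i..N}. e^2 * prob (A j))"
  unfolding cover using disj by (subst finite_measure_finite_Union) (auto simp: sum_distrib_left)
 also have "... <= (\<Sum>j\<in>{i..N}. LINT w|M. I j w * (X N w - X i w)^2)" by (intro sum_mono key)
 also have "... = (LINT w|M. (\<Sum>j\<in>{i..N}. I j w) * (X N w - X i w)^2)"
  by (simp only: Bochner_Integration.integral_sum[OF iI, symmetric] sum_distrib_right)
 also have "... <= (LINT w|M. (X N w)^2 + (X i w)^2 - 2 * (X i w * X N w))"
 proof (rule integral_mono)
  show "integrable M (%w. (\<Sum>j\<in>{i..N}. I j w) * (X N w - X i w)^2)" unfolding sum_distrib_right by (intro Bochner_Integration.integrable_sum iI)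
  show "integrable M (%w. (X N w)^2 + (X i w)^2 - 2 * (X i w * X N w))" using i1 i2 by simp
  show "(\<Sum>j\<in>{i..N}. I j w) * (X N w - X i w)^2 <= (X N w)^2 + (X i w)^2 - 2 * (X i w * X N w)"
   if "w \<in> space M" for w proof -
   have "(\<Sum>j\<in>{i..N}. I j w) * (X N w - X i w)^2 <= 1 * (X N w - X i w)^2" using sumI[OF that] by (rule mult_right_mono) simp
   also have "1 * (X N w - X i w)^2 = (X N w)^2 + (X i w)^2 - 2 * (X i w * X N w)" by (simp add: power2_diff mult_ac)
   finally show ?thesis .
  qed
 qed
 also have "... = (LINT w|M. (X N w)^2) + (LINT w|M. (X i w)^2) - 2 * (LINT w|M. X i w * X N w)" using i1 i2 by simp
 also have "(LINT w|M. X i w * X N w) = (LINT w|M. X i w * X i w)" using iN order_trans[OF bdd, of 2] by (intro mart) (auto simp: adapted)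
 finally show ?thesis by (simp add: power2_eq_square)
qed

text \<open>Adaptedness is expressed by maps \<open>\<tau> n\<close> that forget the future. The second moments increase to a limit, and the maximal inequality bounds the oscillation after time \<open>i\<close> by the remaining increment.\<close>
lemma bounded_martingale_converges:
 fixes X :: "nat => 'a => real" and \<tau> :: "nat => 'a => 'a"
 assumes X [measurable]: "!!n. X n \<in> bmeas M"
  and bdd: "!!n w. \<bar>X n w\<bar> <= 1"
  and \<tau> [measurable]: "!!n. \<tau> n \<in> measurable M M"
  and adapted: "!!l i w. l <= i ==> X l (\<tau> i w) = X l w"
  and mart: "!!i j y. i <= j ==> y \<in> bmeas M ==> (!!w. \<bar>y w\<bar> <= 2) ==> (!!w. y (\<tau> i w) = y w) ==>
   (LINT w|M. y w * X j w) = (LINT w|M. y w * X i w)"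
 shows "AE w in M. convergent (%n. X n w)" proof -
 define q where "q n = (LINT w|M. (X n w)^2)" for n
 have max: "e^2 * prob {w \<in> space M. \<exists>j\<in>{i..N}. e < \<bar>X j w - X i w\<bar>} <= q N - q i"
  if "i <= N" "e > 0" for i N e unfolding q_def by (rule bounded_martingale_maximal[where \<tau> = \<tau>]) (use assms that in auto)
 have q1: "q n <= 1" for n proof -
  have "(X n w)^2 <= 1" for w using bdd[of n w] by (simp add: abs_square_le_1)
  then show ?thesis unfolding q_def by (intro integral_le_const integrable_const_bound[of _ 1]) auto
 qed
 have "incseq q"
 proof (rule incseq_SucI)
  show "q n <= q (Suc n)" for n proof -
   have "0 <= (1::real)^2 * prob {w \<in> space M. \<exists>j\<in>{n..Suc n}. 1 < \<bar>X j w - X n w\<bar>}" by simp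
   also have "... <= q (Suc n) - q n" by (rule max) auto
   finally show ?thesis by simp
  qed
 qed
 then obtain l where l: "q ---> l" "!!n. q n <= l" using incseq_convergent[of q 1] q1 by (metis)
 have "AE w in M. \<exists>i. \<forall>j\<ge>i. \<bar>X j w - X i w\<bar> <= e" if e: "e > 0" for e proof -
  define B where "B i = {w \<in> space M. \<exists>j\<ge>i. e < \<bar>X j w - X i w\<bar>}" for i
  have B [measurable]: "B i \<in> sets M" for i unfolding B_def by measurable
  have pB: "e^2 * prob (B i) <= l - q i" for i proof -
   define C where "C N = {w \<in> space M. \<exists>j\<in>{i..N}. e < \<bar>X j w - X i w\<bar>}" for N
   have "(%N. prob (C N)) ---> prob (\<Union>N. C N)" by (rule finite_Lim_measure_incseq) (auto simp: C_def incseq_def)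
   moreover have "(\<Union>N. C N) = B i" by (auto simp: C_def B_def) (metis atLeastAtMost_iff order_refl)
   ultimately have "(%N. e^2 * prob (C N)) ---> e^2 * prob (B i)" by (auto intro: tendsto_intros)
   then show ?thesis
   proof (rule LIMSEQ_le_const2)
    show "\<exists>N. \<forall>n\<ge>N. e^2 * prob (C n) <= l - q i"
     using max[OF _ e] l(2) unfolding C_def by (intro exI[of _ i]) (meson diff_right_mono order_trans)
   qed
  qed
  define E where "E = {w \<in> space M. \<forall>i. w \<in> B i}"
  have E [measurable]: "E \<in> sets M" unfolding E_def by measurable
  have "e^2 * prob E <= l - q i" for i proof -
   have "e^2 * prob E <= e^2 * prob (B i)" by (intro mult_left_mono finite_measure_mono) (auto simp: E_def)
   then show ?thesis using pB[of i] by linarith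
  qed
  moreover have "(%i. l - q i) ---> l - l" by (intro tendsto_intros l)
  ultimately have "e^2 * prob E <= 0" by (intro LIMSEQ_le_const[of "%i. l - q i"]) auto
  then have "prob E <= 0" using e by (simp add: mult_le_0_iff)
  then have "prob E = 0" using measure_nonneg[of M E] by linarith
  then have "E \<in> null_sets M" using E by (auto simp: null_sets_def emeasure_eq_measure)
  then have "AE w in M. w \<notin> E" by (rule AE_not_in)
  then show ?thesis using AE_space by eventually_elim (auto simp: E_def B_def not_less)
 qed
 then have "AE w in M. \<exists>i. \<forall>j\<ge>i. \<bar>X j w - X i w\<bar> <= 1 / real (Suc m)" for m by simp
 then have "AE w in M. \<forall>m. \<exists>i. \<forall>j\<ge>i. \<bar>X j w - X i w\<bar> <= 1 / real (Suc m)" by (simp add: AE_all_countable)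
 then show ?thesis
 proof eventually_elim
  fix w assume *: "\<forall>m. \<exists>i. \<forall>j\<ge>i. \<bar>X j w - X i w\<bar> <= 1 / real (Suc m)"
  have "Cauchy (%n. X n w)"
  proof (rule metric_CauchyI)
   fix e :: real assume "0 < e"
   then obtain m where m: "inverse (real (Suc m)) < e / 2" using reals_Archimedean[of "e / 2"] by auto
   obtain i where i: "\<forall>j\<ge>i. \<bar>X j w - X i w\<bar> <= 1 / real (Suc m)" using * by blast
   have "dist (X j w) (X k w) < e" if "j \<ge> i" "k \<ge> i" for j k proof -
    have "\<bar>X j w - X i w\<bar> < e / 2" "\<bar>X k w - X i w\<bar> < e / 2"
     using i that m by (auto simp: inverse_eq_divide intro: order_le_less_trans)
    then show ?thesis unfolding dist_real_def by linarith
   qed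
   then show "\<exists>N. \<forall>m\<ge>N. \<forall>n\<ge>N. dist (X m w) (X n w) < e" by blast
  qed
  then show "convergent (%n. X n w)" by (rule Cauchy_convergent)
 qed
qed

end

section \<open>The functional of the tip of the tree\<close>

lemma powr_tangent:
 fixes w c :: real
 assumes "0 <= w" "1 <= c"
 shows "c * w - (c - 1) <= w powr c"
proof (cases "c = 1")
 case False
 then have c: "c > 1" using assms by simp
 have "w * 1 <= w powr c / c + 1 powr (c / (c - 1)) / (c / (c - 1))" using c assms by (intro Youngs_inequality) (auto simp: field_simps)
 then have "w <= w powr c / c + (c - 1) / c" by simp
 then have "c * w <= c * (w powr c / c + (c - 1) / c)" using c by (intro mult_left_mono) auto
 also have "... = w powr c + (c - 1)" using c by (simp add: distrib_left)
 finally show ?thesis by simp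
qed (use assms in simp)

lemma (in prob_space) powr_expectation_le:
 fixes U :: "'a => real"
 assumes [measurable]: "U \<in> bmeas M" and U: "!!p. 0 <= U p" "!!p. U p <= 1" and c: "1 <= c"
 shows "(LINT p|M. U p) powr c <= (LINT p|M. U p powr c)" proof -
 have iU: "integrable M U" by (rule integrable_const_bound[of _ 1]) (use U in auto)
 have iUc: "integrable M (%p. U p powr c)" by (rule integrable_const_bound[of _ 1]) (use U c in \<open>auto intro!: powr_le1\<close>)
 define m where "m = (LINT p|M. U p)"
 have m0: "0 <= m" unfolding m_def using U by (intro integral_nonneg_AE AE_I2) auto
 show ?thesis
 proof (cases "m = 0")
  case True
  have "0 <= (LINT p|M. U p powr c)" by (intro integral_nonneg_AE AE_I2) auto
  then show ?thesis using True c by (simp add: m_def)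
 next
  case False
  then have m: "m > 0" using m0 by simp
  have "m powr c * (c * (U p / m) - (c - 1)) <= U p powr c" for p proof -
   have "m powr c * (c * (U p / m) - (c - 1)) <= m powr c * (U p / m) powr c" using U m c by (intro mult_left_mono powr_tangent) auto
   also have "... = U p powr c" using U m by (simp add: powr_divide)
   finally show ?thesis .
  qed
  then have "(LINT p|M. m powr c * (c * (U p / m) - (c - 1))) <= (LINT p|M. U p powr c)" using iU iUc by (intro integral_mono) auto
  moreover have "(LINT p|M. m powr c * (c * (U p / m) - (c - 1))) = m powr c" using iU m by (simp add: prob_space m_def[symmetric])
  ultimately have "m powr c <= (LINT p|M. U p powr c)" by linarith
  then show ?thesis by (simp only: m_def)
 qed
qed

lemma nexp_powr: "0 < c ==> nexp (ennreal c * a) = nexp a powr c"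
 by (cases a) (auto simp: nexp_ennreal ennreal_mult[symmetric] ennreal_mult_top powr_def mult.commute)

lemma one_minus_nexp_le: "ennreal (1 - nexp a) <= min 1 a"
proof (cases a)
 case (real x)
 have "1 - exp (- x) <= x" using exp_ge_add_one_self[of "- x"] by linarith
 then show ?thesis using real by (auto simp: nexp_ennreal min_def ennreal_le_1 intro!: ennreal_leI)
qed simp

definition lg :: "nat => real" where "lg n = 3/2 * ln (real n)"

text \<open>The part of the assumptions on \<open>\<kappa>\<close> that the analysis uses. The function is kept abstract: scaling costs at most \<open>exp (b h)\<close>, and the last assumption is the defining property of \<open>\<rho>\<close>, with \<open>r\<close> for its value.\<close>
locale tip = brw_law L for L +
 fixes \<kappa> :: "real => real" and b c M r :: real
 assumes \<kappa>_measurable [measurable]: "\<kappa> \<in> bmeas borel"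
  and \<kappa>_nonneg: "!!u. 0 <= \<kappa> u"
  and \<kappa>_antimono: "!!u v. u <= v ==> \<kappa> v <= \<kappa> u"
  and \<kappa>_scale: "!!u h. 0 <= h ==> \<kappa> (u - h) <= exp (b * h) * \<kappa> u"
  and b: "b > 0" and c: "c > 0" and M: "M \<ge> 0"
  and \<kappa>_decay: "!!u. exp u * min 1 (\<kappa> u) <= M * exp (- c * \<bar>u\<bar>)"
  and r: "r > 0"
  and asymptotics: "!!eps. eps > 0 ==> \<exists>A\<ge>0. \<exists>N. \<forall>n>N. \<forall>x\<in>{A..lg n - A}.
   \<bar>exp x / x * (1 - (LINT t|fam. nexp (psum (%v. ennreal (\<kappa> (x + v - lg n))) n t))) - r\<bar> <= eps"
begin

definition Phi :: "nat => real => real" where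
 "Phi n x = (LINT t|fam. nexp (psum (%v. ennreal (\<kappa> (x + v - lg n))) n t))"

definition Lam :: "nat => real => real" where "Lam n x = - ln (Phi n x)"

lemma integrable_nexp: "f \<in> bmeas fam ==> integrable fam (%t. nexp (f t))" by (rule T.integrable_const_bound[of _ 1]) auto

lemma Phi_nonneg: "0 <= Phi n x" unfolding Phi_def by (intro integral_nonneg_AE AE_I2) auto

lemma Phi_le_1: "Phi n x <= 1" unfolding Phi_def by (intro T.integral_le_const integrable_nexp) auto

lemma Phi_mono: "x <= y ==> Phi n x <= Phi n y" unfolding Phi_def
 by (intro integral_mono integrable_nexp nexp_antimono psum_mono ennreal_leI \<kappa>_antimono) auto

lemma Phi_upper:
 obtains C where "C > 0" "!!n x. 0 < n ==> 0 <= x ==> 1 - Phi n x <= C * (1 + x) * (1 + lg n) * exp (- x)" proof -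
 have "ennreal (exp u) * min 1 (ennreal (\<kappa> u)) <= ennreal (M * exp (- c * \<bar>u\<bar>))" for u proof -
  have "min 1 (ennreal (\<kappa> u)) = ennreal (min 1 (\<kappa> u))" using \<kappa>_nonneg[of u] by (simp add: min_def ennreal_le_1 ennreal_ge_1)
  then have "ennreal (exp u) * min 1 (ennreal (\<kappa> u)) = ennreal (exp u * min 1 (\<kappa> u))" using \<kappa>_nonneg[of u] by (simp add: ennreal_mult)
  then show ?thesis using \<kappa>_decay[of u] by (simp add: ennreal_leI)
 qed
 from descent_bound[where \<kappa> = "%u. ennreal (\<kappa> u)", OF _ c M this]
 obtain C where C: "C > 0" "!!n x. 0 < n ==> 0 <= x ==>
  (NN fam (%t. min 1 (psum (%v. ennreal (\<kappa> (x + v - 3/2 * ln (real n)))) n t))) <= ennreal (C * (1 + x) * (1 + 3/2 * ln (real n)) * exp (- x))"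
  by auto
 have "1 - Phi n x <= C * (1 + x) * (1 + lg n) * exp (- x)" if "0 < n" "0 <= x" for n x proof -
  define Y where "Y = psum (%v. ennreal (\<kappa> (x + v - lg n))) n"
  have [measurable]: "Y \<in> bmeas fam" unfolding Y_def by measurable
  have l: "0 <= lg n" using that by (simp add: lg_def)
  have "1 - Phi n x = (LINT t|fam. 1 - nexp (Y t))" unfolding Phi_def Y_def[symmetric] using T.prob_space
   by (subst Bint_diff) (auto intro: integrable_nexp)
  also have "ennreal ... = (NN fam (%t. ennreal (1 - nexp (Y t))))" by (rule nn_integral_eq_integral[symmetric]) (auto intro!: integrable_nexp)
  also have "... <= (NN fam (%t. min 1 (Y t)))" by (intro nn_integral_mono one_minus_nexp_le)
  also have "... <= ennreal (C * (1 + x) * (1 + lg n) * exp (- x))" unfolding Y_def lg_def using C(2)[OF that] by simp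
  finally show ?thesis using C(1) that l by (simp add: ennreal_le_iff)
 qed
 then show ?thesis using that C(1) by blast
qed

text \<open>Shifting by \<open>h\<close> multiplies the exponent by at most \<open>exp (b h)\<close>; Jensen's inequality moves this power outside the expectation.\<close>
lemma Phi_powr:
 assumes h: "0 <= h"
 shows "Phi n x powr exp (b * h) <= Phi n (x - h)" proof -
 define Y where "Y = psum (%v. ennreal (\<kappa> (x + v - lg n))) n"
 have [measurable]: "Y \<in> bmeas fam" unfolding Y_def by measurable
 have "Phi n x powr exp (b * h) <= (LINT t|fam. nexp (Y t) powr exp (b * h))"
  unfolding Phi_def Y_def[symmetric] using h b by (intro T.powr_expectation_le) auto
 also have "... = (LINT t|fam. nexp (ennreal (exp (b * h)) * Y t))" by (simp add: nexp_powr)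
 also have "... <= Phi n (x - h)" unfolding Phi_def
 proof (intro integral_mono integrable_nexp nexp_antimono)
  fix t
  have "psum (%v. ennreal (\<kappa> (x - h + v - lg n))) n t <= psum (%v. ennreal (exp (b * h)) * ennreal (\<kappa> (x + v - lg n))) n t"
  proof (rule psum_mono)
   fix v
   have "\<kappa> (x - h + v - lg n) <= exp (b * h) * \<kappa> (x + v - lg n)" using \<kappa>_scale[OF h, of "x + v - lg n"] by (simp add: algebra_simps)
   then show "ennreal (\<kappa> (x - h + v - lg n)) <= ennreal (exp (b * h)) * ennreal (\<kappa> (x + v - lg n))"
    by (simp add: ennreal_mult'[symmetric] ennreal_leI)
  qed
  then show "psum (%v. ennreal (\<kappa> (x - h + v - lg n))) n t <= ennreal (exp (b * h)) * Y t" by (simp add: psum_cmult Y_def)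
 qed measurable
 finally show ?thesis .
qed

lemma Phi_pos: assumes "0 < n" shows "0 < Phi n x" proof -
 obtain C where C: "C > 0" "!!n x. 0 < n ==> 0 <= x ==> 1 - Phi n x <= C * (1 + x) * (1 + lg n) * exp (- x)" using Phi_upper by blast
 have "((%x::real. C * (1 + x) * (1 + lg n) * exp (- x)) \<longlongrightarrow> 0) at_top" by real_asymp
 then have "eventually (%x. C * (1 + x) * (1 + lg n) * exp (- x) < 1) at_top" by (rule order_tendstoD) simp
 then have "eventually (%y. C * (1 + y) * (1 + lg n) * exp (- y) < 1 & max 0 x <= y) at_top" using eventually_ge_at_top by (rule eventually_conj)
 then obtain y where y: "C * (1 + y) * (1 + lg n) * exp (- y) < 1" "0 <= y" "x <= y" using eventually_happens by fastforce
 then have "0 < Phi n y" using C(2)[OF assms y(2)] by linarith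
 then have "0 < Phi n y powr exp (b * (y - x))" by simp
 also have "... <= Phi n (y - (y - x))" using y by (intro Phi_powr) auto
 finally show ?thesis by simp
qed

lemma Phi_eq_exp: "0 < n ==> Phi n x = exp (- Lam n x)" using Phi_pos[of n x] by (simp add: Lam_def)

lemma Lam_nonneg: "0 < n ==> 0 <= Lam n x" using Phi_le_1[of n x] Phi_pos[of n x] by (simp add: Lam_def)

lemma Lam_antimono: "0 < n ==> x <= y ==> Lam n y <= Lam n x" using Phi_mono[of x y n] Phi_pos[of n x] by (simp add: Lam_def)

lemma Lam_scale:
 assumes "0 < n" "0 <= h"
 shows "Lam n (x - h) <= exp (b * h) * Lam n x" proof -
 have "ln (Phi n x powr exp (b * h)) <= ln (Phi n (x - h))" using Phi_powr[OF assms(2), of n x] Phi_pos[OF assms(1), of x] Phi_pos[OF assms(1), of "x - h"]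
  by (subst ln_le_cancel_iff) auto
 then show ?thesis using Phi_pos[OF assms(1), of x] by (simp add: Lam_def ln_powr)
qed

lemma Lam_vs_Phi:
 assumes "0 < n" "1 - Phi n x <= 1 / 2"
 shows "1 - Phi n x <= Lam n x" "Lam n x <= (1 - Phi n x) + 2 * (1 - Phi n x)^2" proof -
 define g where "g = 1 - Phi n x"
 have g: "0 <= g" "g <= 1/2" using assms Phi_le_1[of n x] by (auto simp: g_def)
 have "- g - 2 * g^2 <= ln (1 - g)" using g by (rule ln_one_minus_pos_lower_bound)
 then show "Lam n x <= (1 - Phi n x) + 2 * (1 - Phi n x)^2" by (simp add: Lam_def g_def)
 have "ln (1 - g) <= (1 - g) - 1" using g by (intro ln_le_minus_one) auto
 then show "1 - Phi n x <= Lam n x" by (simp add: Lam_def g_def)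
qed

lemma lg_at_top: "filterlim lg at_top sequentially" unfolding lg_def by real_asymp

text \<open>For small arguments \<open>- ln (1 - g)\<close> is \<open>g\<close> up to \<open>2 g\<^sup>2\<close>, and the square is negligible at high positions.\<close>
lemma Lam_asymptotics:
 assumes e: "eps > 0"
 shows "\<exists>A\<ge>1. \<forall>y\<ge>A. EVN n. \<bar>Lam n y - r * y * exp (- y)\<bar> <= eps * (y * exp (- y))" proof -
 define d where "d = min 1 (eps / 2)"
 have d: "0 < d" "d <= 1" "d <= eps / 2" using e by (auto simp: d_def)
 obtain A N where A: "A \<ge> 0" and AN: "!!n x. n > N ==> x \<in> {A..lg n - A} ==> \<bar>exp x / x * (1 - Phi n x) - r\<bar> <= d"
  using asymptotics[OF d(1)] unfolding Phi_def by metis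
 have "((%y::real. (r + 1) * y * exp (- y)) \<longlongrightarrow> 0) at_top" by real_asymp
 then have "eventually (%y. (r + 1) * y * exp (- y) < min (1/2) (eps / (4 * (r + 1)))) at_top" by (rule order_tendstoD) (use e r in auto)
 then obtain B where B: "!!y. y \<ge> B ==> (r + 1) * y * exp (- y) < min (1/2) (eps / (4 * (r + 1)))" by (auto simp: eventually_at_top_linorder)
 have "EVN n. \<bar>Lam n y - r * y * exp (- y)\<bar> <= eps * (y * exp (- y))" if y: "y \<ge> max 1 (max A B)" for y proof -
  have "eventually (%n. lg n \<ge> y + A) sequentially" using lg_at_top by (auto simp: filterlim_at_top)
  moreover have "eventually (%n. n > N) sequentially" by (rule eventually_gt_at_top)
  moreover have "eventually (%n. n > 0) sequentially" by (rule eventually_gt_at_top)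
  ultimately show ?thesis
  proof eventually_elim
   fix n assume n: "lg n \<ge> y + A" "n > N" "0 < n"
   define g where "g = 1 - Phi n y"
   define w where "w = y * exp (- y)"
   have w: "w > 0" using y by (simp add: w_def)
   have "\<bar>exp y / y * g - r\<bar> <= d" unfolding g_def using y n by (intro AN) auto
   then have "\<bar>exp y / y * g - r\<bar> * w <= d * w" using w by (intro mult_right_mono) auto
   also have "\<bar>exp y / y * g - r\<bar> * w = \<bar>(exp y / y * g - r) * w\<bar>" using w by (simp add: abs_mult)
   also have "(exp y / y * g - r) * w = g - r * w" using y by (simp add: w_def left_diff_distrib exp_minus field_simps)
   finally have gw: "\<bar>g - r * w\<bar> <= d * w" .
   have "d * w <= 1 * w" using d w by (intro mult_right_mono) auto
   with gw have gle: "g <= (r + 1) * w" by (simp add: distrib_right abs_le_iff)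
   have Bw: "(r + 1) * w < 1/2" "(r + 1) * w < eps / (4 * (r + 1))" using B[of y] y by (auto simp: w_def mult.assoc)
   have g0: "0 <= g" using Phi_le_1[of n y] by (simp add: g_def)
   have L: "g <= Lam n y" "Lam n y <= g + 2 * g^2" using Lam_vs_Phi[OF n(3), of y] gle Bw by (auto simp: g_def)
   have "g^2 <= ((r + 1) * w)^2" using gle g0 by (intro power_mono) auto
   also have "... = ((r + 1) * w) * ((r + 1) * w)" by (simp add: power2_eq_square)
   also have "... <= eps / (4 * (r + 1)) * ((r + 1) * w)" using Bw w r by (intro mult_right_mono) auto
   also have "... = eps / 4 * w" using r by (simp add: field_simps)
   finally have "2 * g^2 <= eps / 2 * w" by simp
   moreover have "d * w <= eps / 2 * w" using d w by (intro mult_right_mono) auto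
   moreover have "eps / 2 * w + eps / 2 * w = eps * w" by simp
   ultimately have "\<bar>Lam n y - r * w\<bar> <= eps * w" using L gw w e by (simp only: abs_le_iff) linarith
   then show "\<bar>Lam n y - r * y * exp (- y)\<bar> <= eps * (y * exp (- y))" by (simp add: w_def mult.assoc)
  qed
 qed
 then show ?thesis by (intro exI[of _ "max 1 (max A B)"]) auto
qed

lemma Lam_dominated:
 obtains A K N where "A \<ge> 0" "K \<ge> 0"
  "!!n y. n > N ==> A <= y ==> Lam n y <= K * ((1 + y^2) * exp (- y))"
  "!!n y. n > N ==> y <= A ==> Lam n y <= exp (b * (A - y))" proof -
 obtain A1 N where A1: "A1 \<ge> 0" and AN: "!!n x. n > N ==> x \<in> {A1..lg n - A1} ==> \<bar>exp x / x * (1 - Phi n x) - r\<bar> <= r"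
  using asymptotics[OF r] unfolding Phi_def by metis
 obtain C where C: "C > 0" "!!n x. 0 < n ==> 0 <= x ==> 1 - Phi n x <= C * (1 + x) * (1 + lg n) * exp (- x)" using Phi_upper by blast
 define K where "K = max (2 * r) (2 * C * (1 + A1))"
 have K: "2 * r <= K" "2 * C * (1 + A1) <= K" "0 < K" using r by (auto simp: K_def)
 have G: "1 - Phi n y <= K * ((1 + y^2) * exp (- y))" if n: "n > N" and y: "max 1 A1 <= y" for n y
 proof (cases "y <= lg n - A1")
  case True
  have y1: "1 <= y" "A1 <= y" using y by auto
  have "\<bar>exp y / y * (1 - Phi n y) - r\<bar> <= r" using True y1 n by (intro AN) auto
  then have "exp y / y * (1 - Phi n y) <= 2 * r" by linarith
  then have "1 - Phi n y <= 2 * r * (y * exp (- y))" using y1 by (simp add: exp_minus field_simps)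
  also have "... <= K * ((1 + y^2) * exp (- y))" proof -
   have "y * 1 <= y * y" using y1 by (intro mult_left_mono) auto
   then have "y <= 1 + y^2" by (simp add: power2_eq_square)
   then have "y * exp (- y) <= (1 + y^2) * exp (- y)" by (intro mult_right_mono) auto
   then show ?thesis using K y1 by (intro mult_mono) auto
  qed
  finally show ?thesis .
 next
  case False
  have y1: "1 <= y" "A1 <= y" using y by auto
  have n0: "0 < n" using n by simp
  have "1 - Phi n y <= C * (1 + y) * (1 + lg n) * exp (- y)" using y1 n0 by (intro C(2)) auto
  also have "... <= C * (1 + y) * ((1 + A1) * (1 + y)) * exp (- y)"
  proof (intro mult_right_mono mult_left_mono)
   have "0 <= A1 * y" using A1 y1 by simp
   then show "1 + lg n <= (1 + A1) * (1 + y)" using False by (simp add: algebra_simps)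
  qed (use C y1 in auto)
  also have "... = (C * (1 + A1)) * ((1 + y)^2 * exp (- y))" by (simp add: power2_eq_square)
  also have "... <= (C * (1 + A1)) * ((2 * (1 + y^2)) * exp (- y))"
  proof (intro mult_left_mono mult_right_mono)
   have "0 <= (1 - y)^2" by simp
   then have "2 * y <= 1 + y^2" by (simp add: power2_diff)
   then show "(1 + y)^2 <= 2 * (1 + y^2)" by (simp add: power2_sum)
  qed (use C A1 in auto)
  also have "... = (2 * C * (1 + A1)) * ((1 + y^2) * exp (- y))" by simp
  also have "... <= K * ((1 + y^2) * exp (- y))" by (intro mult_right_mono K) simp
  finally show ?thesis .
 qed
 have "((%y::real. K * ((1 + y^2) * exp (- y))) \<longlongrightarrow> 0) at_top" by real_asymp
 then have "eventually (%y. K * ((1 + y^2) * exp (- y)) < 1/2) at_top" by (rule order_tendstoD) simp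
 then obtain B where B: "!!y. y \<ge> B ==> K * ((1 + y^2) * exp (- y)) < 1/2" by (auto simp: eventually_at_top_linorder)
 define A where "A = max (max 1 A1) B"
 have up: "Lam n y <= 2 * K * ((1 + y^2) * exp (- y))" "Lam n y <= 1" if n: "n > N" and y: "A <= y" for n y proof -
  define g where "g = 1 - Phi n y"
  have g: "g <= K * ((1 + y^2) * exp (- y))" "g <= 1/2" "0 <= g" using G[OF n, of y] B[of y] y Phi_le_1[of n y] by (auto simp: A_def g_def)
  have "Lam n y <= g + 2 * g^2" using n g by (auto simp: g_def intro!: Lam_vs_Phi)
  also have "g^2 <= 1/2 * g" unfolding power2_eq_square using g by (intro mult_right_mono) auto
  finally have "Lam n y <= 2 * g" by simp
  then show "Lam n y <= 2 * K * ((1 + y^2) * exp (- y))" "Lam n y <= 1" using g by auto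
 qed
 have low: "Lam n y <= exp (b * (A - y))" if n: "n > N" and y: "y <= A" for n y proof -
  have n0: "0 < n" using n by simp
  have "Lam n (A - (A - y)) <= exp (b * (A - y)) * Lam n A" using y n0 by (intro Lam_scale) auto
  also have "... <= exp (b * (A - y)) * 1" using up(2)[OF n, of A] by (intro mult_left_mono) auto
  finally show ?thesis by simp
 qed
 show ?thesis by (rule that[of A "2 * K" N]) (use up low K in \<open>auto simp: A_def\<close>)
qed

end

section \<open>Cutting the tree at a fixed generation\<close>

text \<open>A condition under which every function dominated by \<open>(1 + v\<^sup>2) exp (- v)\<close> at high positions has finite sums over all generations.\<close>
definition good :: "family => bool" where
 "good t \<longleftrightarrow> (\<forall>n. psum (%v. ennreal ((1 + v^2) * exp (- v))) n t < \<infinity>)"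

lemma psum_finite_if_dominated:
 assumes t: "good t"
  and h: "!!s. \<exists>C\<ge>0. \<forall>v\<ge>-s. h v <= C * ((1 + v^2) * exp (- v))"
 shows "psum (%v. ennreal (h v)) k t < \<infinity>" proof -
 define S where "S = psum (%v. ennreal ((1 + v^2) * exp (- v))) k t"
 have Sf: "S < \<infinity>" using t by (simp add: good_def S_def)
 then obtain s where s: "S = ennreal s" "0 <= s" by (cases S) auto
 obtain C where C: "C \<ge> 0" "!!v. v \<ge> - ln (s + 1) ==> h v <= C * ((1 + v^2) * exp (- v))" using h[of "ln (s + 1)"] by blast
 have "psum (%v. ennreal (h v)) k t <= ennreal C * S" proof -
  have "psum (%v. ennreal (h v)) k t <= psum (%v. ennreal C * ennreal ((1 + v^2) * exp (- v))) k t" unfolding psum_def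
  proof (intro nn_integral_mono)
   fix z assume z: "z \<in> space (cs (lev k))"
   show "(if finr (pos z t) then ennreal (h (roe (pos z t))) else 0)
    <= (if finr (pos z t) then ennreal C * ennreal ((1 + (roe (pos z t))^2) * exp (- roe (pos z t))) else 0)"
   proof (cases "finr (pos z t)")
    case True
    define v where "v = roe (pos z t)"
    have "ennreal ((1 + v^2) * exp (- v)) = (if finr (pos z t) then ennreal ((1 + (roe (pos z t))^2) * exp (- roe (pos z t))) else 0)"
     using True by (simp add: v_def)
    also have "... <= S" unfolding S_def psum_def using z by (intro nn_integral_ge_point) simp
    finally have "(1 + v^2) * exp (- v) <= s" using s by (simp add: ennreal_le_iff)
    moreover have "1 * exp (- v) <= (1 + v^2) * exp (- v)" by (intro mult_right_mono) auto
    ultimately have "exp (- v) <= s + 1" using s(2) by linarith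
    then have "ln (exp (- v)) <= ln (s + 1)" using s(2) by (subst ln_le_cancel_iff) auto
    then have "v \<ge> - ln (s + 1)" by simp
    from C(2)[OF this] show ?thesis using True C(1) by (simp add: v_def ennreal_mult[symmetric] ennreal_leI)
   qed simp
  qed
  also have "... = ennreal C * S" by (simp add: psum_cmult S_def)
  finally show ?thesis .
 qed
 also have "... < \<infinity>" using Sf by (simp add: ennreal_mult_less_top)
 finally show ?thesis .
qed

context tree_law begin

text \<open>The starting point \<open>\<zeta>\<close> may depend on the first \<open>k\<close> generations; this is needed later for \<open>\<zeta> = ln D\<close>.\<close>
lemma branch_shift:
 fixes g \<Lambda> :: "real => real"
 assumes g [measurable]: "g \<in> bmeas borel" and \<Lambda> [measurable]: "\<Lambda> \<in> bmeas borel"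
  and \<Lambda>0: "!!x. 0 <= \<Lambda> x"
  and eq: "!!x. (NN fam (%s. ennreal (nexp (psum (%v. ennreal (g (x + v))) m s)))) = ennreal (exp (- \<Lambda> x))"
  and Y: "Y \<in> bmeas fam" "!!t. Y (trunc k t) = Y t" "!!t. Y t <= ennreal C"
  and \<zeta> [measurable]: "\<zeta> \<in> bmeas fam" and \<zeta>t: "!!t. \<zeta> (trunc k t) = \<zeta> t"
 shows "(NN fam (%t. Y t * ennreal (nexp (psum (%v. ennreal (g (\<zeta> t + v))) (m + k) t))))
   = (NN fam (%t. Y t * ennreal (nexp (psum (%v. ennreal (\<Lambda> (\<zeta> t + v))) k t))))" proof -
 define a where "a z t s = (if finr (pos z t) then psum (%v. ennreal (g (\<zeta> t + (roe (pos z t) + v)))) m s else 0)" for z t s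
 define d where "d z t = (if finr (pos z t) then ennreal (\<Lambda> (\<zeta> t + roe (pos z t))) else 0)" for z t
 have "(NN fam (%t. Y t * ennreal (nexp (NN (cs (lev k)) (%z. a z t (sub z t))))))
   = (NN fam (%t. Y t * ennreal (nexp (NN (cs (lev k)) (%z. d z t)))))"
 proof (rule branching[OF Y])
  fix z assume z: "z \<in> lev k"
  show "(%p. a z (fst p) (snd p)) \<in> bmeas (fam \<Otimes>\<^sub>M fam)" proof -
   have "(%p. psum (%v. ennreal (g (\<zeta> (fst p) + (roe (pos z (fst p)) + v)))) m (snd p)) \<in> bmeas (fam \<Otimes>\<^sub>M fam)"
    by (rule measurable_psum_param[where g = "%t v. ennreal (g (\<zeta> t + (roe (pos z t) + v)))"]) measurable
   then show ?thesis unfolding a_def by measurable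
  qed
  have p: "pos z (trunc k t) = pos z t" for t using z by (intro pos_trunc) (simp add: lev_def)
  show "a z (trunc k t) s = a z t s" for t s by (simp add: a_def p \<zeta>t)
  show "d z \<in> bmeas fam" unfolding d_def by measurable
  show "ennreal (nexp (d z t)) = (NN fam (%s. ennreal (nexp (a z t s))))" for t using eq[of "\<zeta> t + roe (pos z t)"] T.emeasure_space_1 \<Lambda>0
   by (simp add: a_def d_def nexp_ennreal add.assoc)
 qed
 then show ?thesis unfolding psum_append a_def d_def psum_def[of _ k] .
qed

end

lemma liminf_psum_le: "psum (%v. liminf (%m. f m v)) k t <= liminf (%m. psum (f m) k t)" proof -
 have "psum (%v. liminf (%m. f m v)) k t = (NN (cs (lev k)) (%z. liminf (%m. if finr (pos z t) then f m (roe (pos z t)) else 0)))"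
  unfolding psum_def by (intro nn_integral_cong) (auto simp: Liminf_const)
 also have "... <= liminf (%m. psum (f m) k t)" unfolding psum_def by (intro nn_integral_liminf) simp
 finally show ?thesis .
qed

lemma limsup_psum_le:
 assumes "!!m v. f m v <= w v" "psum w k t < \<infinity>"
 shows "limsup (%m. psum (f m) k t) <= psum (%v. limsup (%m. f m v)) k t" proof -
 have "limsup (%m. psum (f m) k t) <= (NN (cs (lev k)) (%z. limsup (%m. if finr (pos z t) then f m (roe (pos z t)) else 0)))"
  unfolding psum_def using assms
  by (intro nn_integral_limsup[where w = "%z. if finr (pos z t) then w (roe (pos z t)) else 0"]) (auto simp: psum_def intro!: AE_I2)
 also have "... = psum (%v. limsup (%m. f m v)) k t" unfolding psum_def by (intro nn_integral_cong) (auto simp: Limsup_const)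
 finally show ?thesis .
qed

lemma tendsto_psum:
 assumes "!!m v. f m v <= w v" "psum w k t < \<infinity>" "!!v. (%m. f m v) ---> h v"
 shows "(%m. psum (f m) k t) ---> psum h k t" unfolding psum_def
 by (rule nn_integral_dominated_convergence[where w = "%z. if finr (pos z t) then w (roe (pos z t)) else 0"])
  (use assms in \<open>auto simp: psum_def intro!: AE_I2\<close>)

lemma limsup_nexp: "limsup (%m. ennreal (nexp (a m))) = ennreal (nexp (liminf a))"
 by (rule Limsup_compose_continuous_antimono[where f = "%a. ennreal (nexp a)"])
  (auto simp: continuous_on_def antimono_def intro!: tendsto_ennrealI tendsto_nexp ennreal_leI nexp_antimono tendsto_ident_at)

lemma liminf_nexp: "liminf (%m. ennreal (nexp (a m))) = ennreal (nexp (limsup a))"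
 by (rule Liminf_compose_continuous_antimono[where f = "%a. ennreal (nexp a)"])
  (auto simp: continuous_on_def antimono_def intro!: tendsto_ennrealI tendsto_nexp ennreal_leI nexp_antimono tendsto_ident_at)

text \<open>With sums between \<open>(r - eps) s\<close> and \<open>(r + eps) s\<close> the exponentials differ by order \<open>eps\<close>, uniformly in \<open>s\<close>.\<close>
lemma nexp_gap:
 assumes e: "0 < eps" "eps <= r / 2"
  and a: "ennreal (r - eps) * s <= a" and b: "b <= ennreal (r + eps) * s"
 shows "nexp a - nexp b <= 4 * eps / r" proof -
 have r: "r > 0" using e by linarith
 have "nexp a - nexp b <= nexp (ennreal (r - eps) * s) - nexp (ennreal (r + eps) * s)" using nexp_antimono[OF a] nexp_antimono[OF b] by linarith
 also have "... <= 4 * eps / r"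
 proof (cases s)
  case (real x)
  define y where "y = (r - eps) * x"
  have y: "0 <= y" using real e r by (simp add: y_def)
  have "nexp (ennreal (r - eps) * s) - nexp (ennreal (r + eps) * s) = exp (- y) - exp (- ((r + eps) * x))"
   using real e r by (simp add: ennreal_mult[symmetric] nexp_ennreal y_def del: ennreal_plus)
  also have "exp (- ((r + eps) * x)) = exp (- y) * exp (- (2 * eps * x))" by (simp add: y_def exp_add[symmetric] algebra_simps)
  also have "exp (- y) - exp (- y) * exp (- (2 * eps * x)) = exp (- y) * (1 - exp (- (2 * eps * x)))" by (simp add: right_diff_distrib)
  also have "... <= exp (- y) * (2 * eps * x)" using exp_ge_add_one_self[of "- (2 * eps * x)"] by (intro mult_left_mono) auto
  also have "... = (y * exp (- y)) * (2 * eps / (r - eps))" using e r by (simp add: y_def)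
  also have "... <= 1 * (2 * eps / (r / 2))"
  proof (intro mult_mono divide_left_mono)
   have "y <= exp y" using exp_ge_add_one_self[of y] by linarith
   then show "y * exp (- y) <= 1" by (simp add: exp_minus field_simps)
  qed (use e r in auto)
  finally show ?thesis by simp
 next
  case top
  have "0 < r - eps" "0 < r + eps" using e r by auto
  then show ?thesis using top e r by (simp add: ennreal_mult_top)
 qed
 finally show ?thesis .
qed

context brw_law begin

lemma AE_good: "AE t in fam. good t" using AE_second_moment by (simp add: good_def)

lemma AE_high: "AE t in fam. \<forall>A :: real. EVN n. \<forall>z\<in>lev n. ereal A < pos z t" using minimal_position_diverges
proof eventually_elim
 fix t :: family assume *: "\<forall>A :: real. \<exists>n. \<forall>z. n <= length z --> ereal A < pos z t"
 show "\<forall>A :: real. EVN n. \<forall>z\<in>lev n. ereal A < pos z t"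
 proof
  fix A :: real
  obtain n where "\<forall>z. n <= length z --> ereal A < pos z t" using * by blast
  then show "EVN n. \<forall>z\<in>lev n. ereal A < pos z t" by (intro eventually_sequentiallyI[of n]) (auto simp: lev_def)
 qed
qed

end

context tip begin

lemma Lam_measurable [measurable]: "0 < n ==> Lam n \<in> bmeas borel" proof -
 assume n: "0 < n"
 have "mono (%x. - Lam n x)" using Lam_antimono[OF n] by (auto intro!: monoI)
 from borel_measurable_uminus[OF borel_measurable_mono[OF this]] show ?thesis by simp
qed

lemma Lam_envelope:
 obtains B N where "B \<in> bmeas borel" "!!n y. n > N ==> Lam n y <= B y" "!!y. 0 <= B y"
  "!!t k x C. good t ==> 0 <= C ==> psum (%v. ennreal (C * B (x + v))) k t < \<infinity>" proof -
 obtain A K N where A: "A \<ge> 0" "K \<ge> 0"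
  "!!n y. n > N ==> A <= y ==> Lam n y <= K * ((1 + y^2) * exp (- y))"
  "!!n y. n > N ==> y <= A ==> Lam n y <= exp (b * (A - y))" using Lam_dominated by blast
 define B where "B y = (if A <= y then K * ((1 + y^2) * exp (- y)) else exp (b * (A - y)))" for y
 have fin: "psum (%v. ennreal (C * B (x + v))) k t < \<infinity>" if t: "good t" and C: "0 <= C" for t k x C
 proof (rule psum_finite_if_dominated[OF t])
  fix s
  define C1 where "C1 = K * (2 * (1 + x^2)) * exp (- x)"
  define C2 where "C2 = exp (b * (A - x + s)) * exp (A - x)"
  have C0: "0 <= C1" "0 <= C2" using A by (auto simp: C1_def C2_def)
  have "B (x + v) <= (C1 + C2) * ((1 + v^2) * exp (- v))" if v: "v \<ge> - s" for v
  proof (cases "A <= x + v")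
   case True
   have e: "exp (- (x + v)) = exp (- x) * exp (- v)" by (simp only: minus_add_distrib exp_add)
   have "1 + (x + v)^2 <= 2 * (1 + x^2) * (1 + v^2)" proof -
    have 1: "0 <= (x - v)^2" and 2: "0 <= x^2 * v^2" by simp_all
    have "2 * (1 + x^2) * (1 + v^2) - (1 + (x + v)^2) = 1 + (x - v)^2 + 2 * (x^2 * v^2)" by (simp add: power2_eq_square algebra_simps)
    then show ?thesis using 1 2 by linarith
   qed
   then have "K * ((1 + (x + v)^2) * (exp (- x) * exp (- v))) <= K * ((2 * (1 + x^2) * (1 + v^2)) * (exp (- x) * exp (- v)))"
    using A by (intro mult_left_mono mult_right_mono) auto
   also have "... = C1 * ((1 + v^2) * exp (- v))" by (simp add: C1_def)
   also have "... <= (C1 + C2) * ((1 + v^2) * exp (- v))" using C0 by (intro mult_right_mono) auto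
   finally show ?thesis using True by (simp only: B_def if_True e)
  next
   case False
   have "exp (b * (A - (x + v))) <= exp (b * (A - x + s))" using b v by auto
   also have "... * 1 <= exp (b * (A - x + s)) * (exp (A - x) * ((1 + v^2) * exp (- v)))"
   proof (intro mult_left_mono)
    have "1 <= exp (A - x + - v)" using False by simp
    also have "... = exp (A - x) * (1 * exp (- v))" by (simp only: exp_add mult_1)
    also have "... <= exp (A - x) * ((1 + v^2) * exp (- v))" by (intro mult_left_mono mult_right_mono) auto
    finally show "1 <= exp (A - x) * ((1 + v^2) * exp (- v))" .
   qed simp
   also have "... = C2 * ((1 + v^2) * exp (- v))" by (simp add: C2_def)
   also have "... <= (C1 + C2) * ((1 + v^2) * exp (- v))" using C0 by (intro mult_right_mono) auto
   finally show ?thesis using False by (simp add: B_def)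
  qed
  then have "C * B (x + v) <= (C * (C1 + C2)) * ((1 + v^2) * exp (- v))" if "v \<ge> - s" for v using mult_left_mono[OF _ C] that by (simp add: mult.assoc)
  then show "\<exists>C'\<ge>0. \<forall>v\<ge>-s. C * B (x + v) <= C' * ((1 + v^2) * exp (- v))" using C C0 by (intro exI[of _ "C * (C1 + C2)"]) auto
 qed
 show ?thesis
 proof (rule that[of B N])
  show "B \<in> bmeas borel" unfolding B_def by measurable
  show "Lam n y <= B y" if "n > N" for n y using A(3)[OF that, of y] A(4)[OF that, of y] by (simp add: B_def)
  show "0 <= B y" for y using A by (simp add: B_def)
 qed (rule fin)
qed

text \<open>The centering changes by this vanishing amount when the generation is cut into \<open>m + k\<close>.\<close>
definition gap :: "nat => nat => real" where "gap k m = lg (m + k) - lg m"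

lemma gap_nonneg: "0 < m ==> 0 <= gap k m" by (simp add: gap_def lg_def)

lemma gap_tendsto: "gap k ---> 0" unfolding gap_def lg_def by real_asymp

lemma branch_Phi:
 assumes m: "0 < m"
  and Y: "Y \<in> bmeas fam" "!!t. Y (trunc k t) = Y t" "!!t. Y t <= ennreal C"
  and \<zeta>: "\<zeta> \<in> bmeas fam" "!!t. \<zeta> (trunc k t) = \<zeta> t"
 shows "(NN fam (%t. Y t * ennreal (nexp (psum (%v. ennreal (\<kappa> (\<zeta> t + v - lg (m + k)))) (m + k) t))))
   = (NN fam (%t. Y t * ennreal (nexp (psum (%v. ennreal (Lam m (\<zeta> t + v - gap k m))) k t))))" proof -
 have [measurable]: "Lam m \<in> bmeas borel" by (rule Lam_measurable[OF m])
 have e: "(NN fam (%s. ennreal (nexp (psum (%v. ennreal (\<kappa> (x + v - lg (m + k)))) m s)))) = ennreal (exp (- Lam m (x - gap k m)))" for x proof -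
  have "x + v - lg (m + k) = x - gap k m + v - lg m" for v by (simp add: gap_def)
  then have "(NN fam (%s. ennreal (nexp (psum (%v. ennreal (\<kappa> (x + v - lg (m + k)))) m s)))) = ennreal (Phi m (x - gap k m))"
   unfolding Phi_def by (simp only:) (intro nn_integral_eq_integral integrable_nexp; simp)
  then show ?thesis by (simp add: Phi_eq_exp[OF m])
 qed
 have "(NN fam (%t. Y t * ennreal (nexp (psum (%v. ennreal (\<kappa> (\<zeta> t + v - lg (m + k)))) (m + k) t))))
   = (NN fam (%t. Y t * ennreal (nexp (psum (%v. ennreal (Lam m (\<zeta> t + v - gap k m))) k t))))"
  using branch_shift[where g = "%u. \<kappa> (u - lg (m + k))" and \<Lambda> = "%u. Lam m (u - gap k m)" and m = m and Y = Y and k = k and C = C and \<zeta> = \<zeta>]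
   e Y \<zeta> Lam_nonneg[OF m] by auto
 then show ?thesis .
qed

end

section \<open>Convergence of the log-Laplace functional\<close>

context tip begin

lemma psum_compare:
 assumes "!!y. A <= y ==> f y <= g y" and "\<forall>z\<in>lev k. ereal (A - x) < pos z t"
 shows "psum (%v. f (x + v)) k t <= psum (%v. g (x + v)) k t" unfolding psum_def
proof (intro nn_integral_mono)
 fix z assume z: "z \<in> space (cs (lev k))"
 show "(if finr (pos z t) then f (x + roe (pos z t)) else 0) <= (if finr (pos z t) then g (x + roe (pos z t)) else 0)"
 proof (cases "finr (pos z t)")
  case True
  then obtain v where v: "pos z t = ereal v" by (cases "pos z t") auto
  have "ereal (A - x) < pos z t" using assms(2) z by simp
  then have "A <= x + v" using v by simp
  then show ?thesis using assms(1) v by simp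
 qed simp
qed

text \<open>Both the upper and the lower limit are compared with expectations over generation \<open>k\<close>, by Fatou's lemma and its reverse. As \<open>k\<close> grows all particles are in the range where the asymptotics of \<open>Lam\<close> hold, and the two expectations approach each other.\<close>
lemma Phi_limit: "convergent (%n. Phi n x)" proof -
 obtain B N where B: "B \<in> bmeas borel" "!!n y. n > N ==> Lam n y <= B y" "!!y. 0 <= B y"
  "!!t k x C. good t ==> 0 <= C ==> psum (%v. ennreal (C * B (x + v))) k t < \<infinity>" using Lam_envelope by blast
 have [measurable]: "Lam (Suc m + j) \<in> bmeas borel" for m j by (rule Lam_measurable) simp
 define q where "q = (%m. Suc N + m)"
 have q: "0 < q m" "N < q m" for m by (auto simp: q_def)
 have [measurable]: "Lam (q m) \<in> bmeas borel" for m by (rule Lam_measurable[OF q(1)])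
 have qfil: "filterlim q sequentially sequentially" unfolding q_def by (rule filterlim_subseq) (auto simp: strict_mono_def)
 define lo where "lo y = liminf (%m. ennreal (Lam (q m) y))" for y
 define hi where "hi k y = limsup (%m. ennreal (exp (b * gap k (q m)) * Lam (q m) y))" for k y
 have [measurable]: "lo \<in> bmeas borel" "hi k \<in> bmeas borel" for k unfolding lo_def hi_def by measurable
 define p where "p k = (LINT t|fam. nexp (psum (%v. lo (x + v)) k t))" for k
 define w where "w k = (LINT t|fam. nexp (psum (%v. hi k (x + v)) k t))" for k
 have Phi_int: "ennreal (Phi (q m + k) x) = (NN fam (%t. ennreal (nexp (psum (%v. ennreal (Lam (q m) (x + v - gap k (q m)))) k t))))" for m k proof -
  have "ennreal (Phi (q m + k) x) = (NN fam (%t. ennreal (nexp (psum (%v. ennreal (\<kappa> (x + v - lg (q m + k)))) (q m + k) t))))"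
   unfolding Phi_def by (rule nn_integral_eq_integral[symmetric]) (auto intro!: integrable_nexp)
  also have "... = (NN fam (%t. ennreal (nexp (psum (%v. ennreal (Lam (q m) (x + v - gap k (q m)))) k t))))"
   using branch_Phi[OF q(1), of "%_. 1" k 1 "%_. x" m] by simp
  finally show ?thesis .
 qed
 have upper: "limsup (%n. ennreal (Phi n x)) <= ennreal (p k)" for k proof -
  have "limsup (%n. ennreal (Phi n x)) = limsup (%m. ennreal (Phi (m + (Suc N + k)) x))" by (rule limsup_shift_k[symmetric])
  also have "... = limsup (%m. ennreal (Phi (q m + k) x))" by (simp add: q_def add_ac)
  also have "... <= limsup (%m. NN fam (%t. ennreal (nexp (psum (%v. ennreal (Lam (q m) (x + v))) k t))))" unfolding Phi_int using gap_nonneg[OF q(1)]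
   by (intro Limsup_mono always_eventually allI nn_integral_mono ennreal_leI nexp_antimono psum_mono Lam_antimono q) auto
  also have "... <= (NN fam (%t. limsup (%m. ennreal (nexp (psum (%v. ennreal (Lam (q m) (x + v))) k t)))))"
   by (rule nn_integral_limsup[where w = "%_. 1"]) (use T.emeasure_space_1 in \<open>auto simp: ennreal_le_1\<close>)
  also have "... <= (NN fam (%t. ennreal (nexp (psum (%v. lo (x + v)) k t))))"
   unfolding limsup_nexp lo_def by (intro nn_integral_mono ennreal_leI nexp_antimono liminf_psum_le)
  also have "... = ennreal (p k)" unfolding p_def by (rule nn_integral_eq_integral) (auto intro!: integrable_nexp)
  finally show ?thesis .
 qed
 have lower: "ennreal (w k) <= liminf (%n. ennreal (Phi n x))" for k proof -
  have gb: "exp (b * gap k (q m)) <= exp (b * gap k 1)" for m proof -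
   have "1 + real k / real (q m) = real (q m + k) / real (q m)" using q(1)[of m] by (simp add: field_simps)
   then have "gap k (q m) = 3/2 * ln (1 + real k / real (q m))" using q(1)[of m] by (simp add: gap_def lg_def ln_div)
   also have "... <= 3/2 * ln (1 + real k / 1)"
    using q(1)[of m] by (intro mult_left_mono ln_mono add_left_mono divide_left_mono) (auto simp: add_pos_nonneg)
   also have "... = gap k 1" by (simp add: gap_def lg_def add.commute)
   finally show ?thesis using b by simp
  qed
  have "ennreal (w k) = (NN fam (%t. ennreal (nexp (psum (%v. hi k (x + v)) k t))))"
   unfolding w_def by (rule nn_integral_eq_integral[symmetric]) (auto intro!: integrable_nexp)
  also have "... <= (NN fam (%t. liminf (%m. ennreal (nexp (psum (%v. ennreal (exp (b * gap k (q m)) * Lam (q m) (x + v))) k t)))))"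
  proof (rule nn_integral_mono_AE)
   show "AE t in fam. ennreal (nexp (psum (%v. hi k (x + v)) k t)) <= liminf (%m. ennreal (nexp (psum (%v. ennreal (exp (b * gap k (q m)) * Lam (q m) (x + v))) k t)))"
    using AE_good
   proof eventually_elim
    fix t assume t: "good t"
    have "limsup (%m. psum (%v. ennreal (exp (b * gap k (q m)) * Lam (q m) (x + v))) k t) <= psum (%v. hi k (x + v)) k t" unfolding hi_def
    proof (rule limsup_psum_le)
     show "ennreal (exp (b * gap k (q m)) * Lam (q m) (x + v)) <= ennreal (exp (b * gap k 1) * B (x + v))" for m v
      using gb B(2)[OF q(2)] Lam_nonneg[OF q(1)] by (intro ennreal_leI mult_mono) auto
     show "psum (%v. ennreal (exp (b * gap k 1) * B (x + v))) k t < \<infinity>" by (rule B(4)[OF t]) simp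
    qed
    then show "ennreal (nexp (psum (%v. hi k (x + v)) k t)) <= liminf (%m. ennreal (nexp (psum (%v. ennreal (exp (b * gap k (q m)) * Lam (q m) (x + v))) k t)))"
     unfolding liminf_nexp by (intro ennreal_leI nexp_antimono)
   qed
  qed
  also have "... <= liminf (%m. NN fam (%t. ennreal (nexp (psum (%v. ennreal (exp (b * gap k (q m)) * Lam (q m) (x + v))) k t))))"
   by (rule nn_integral_liminf) measurable
  also have "... <= liminf (%m. ennreal (Phi (q m + k) x))" unfolding Phi_int
  proof (intro Liminf_mono always_eventually allI nn_integral_mono ennreal_leI nexp_antimono psum_mono)
   fix m v
   show "Lam (q m) (x + v - gap k (q m)) <= exp (b * gap k (q m)) * Lam (q m) (x + v)"
    using Lam_scale[OF q(1) gap_nonneg[OF q(1)], of m "x + v" k m] by (simp add: algebra_simps)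
  qed
  also have "... = liminf (%m. ennreal (Phi (m + (Suc N + k)) x))" by (simp add: q_def add_ac)
  also have "... = liminf (%n. ennreal (Phi n x))" by (rule liminf_shift_k)
  finally show ?thesis .
 qed
 have "(%k. p k - w k) ---> 0" proof -
  have "(%k. LINT t|fam. max 0 (nexp (psum (%v. lo (x + v)) k t) - nexp (psum (%v. hi k (x + v)) k t))) ---> (LINT t|fam. 0)"
  proof (rule integral_dominated_convergence[where w = "%_. 1"])
   show "AE t in fam. norm (max 0 (nexp (psum (%v. lo (x + v)) k t) - nexp (psum (%v. hi k (x + v)) k t))) <= 1" for k
   proof (intro AE_I2)
    fix t
    have "nexp a - nexp a' <= 1" for a a' using nexp_bounds(1)[of a'] nexp_bounds(2)[of a] by linarith
    then show "norm (max 0 (nexp (psum (%v. lo (x + v)) k t) - nexp (psum (%v. hi k (x + v)) k t))) <= 1" by simp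
   qed
   show "AE t in fam. (%k. max 0 (nexp (psum (%v. lo (x + v)) k t) - nexp (psum (%v. hi k (x + v)) k t))) ---> 0" using AE_high
   proof eventually_elim
    fix t assume t: "\<forall>A :: real. EVN n. \<forall>z\<in>lev n. ereal A < pos z t"
    show "(%k. max 0 (nexp (psum (%v. lo (x + v)) k t) - nexp (psum (%v. hi k (x + v)) k t))) ---> 0"
    proof (rule tendstoI)
     fix e :: real assume e: "e > 0"
     define eps where "eps = min (r / 2) (r * e / 8)"
     have eps: "0 < eps" "eps <= r / 2" "4 * eps / r < e" using r e by (auto simp: eps_def min_def field_simps)
     define eps1 where "eps1 = eps / 2"
     obtain A where A: "A \<ge> 1" "!!y. y \<ge> A ==> EVN n. \<bar>Lam n y - r * y * exp (- y)\<bar> <= eps1 * (y * exp (- y))"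
      using Lam_asymptotics[of eps1] eps by (auto simp: eps1_def)
     have Lq: "EVN m. \<bar>Lam (q m) y - r * y * exp (- y)\<bar> <= eps1 * (y * exp (- y))" if "y \<ge> A" for y
      using A(2)[OF that] qfil by (rule eventually_compose_filterlim)
     have lo: "ennreal (r - eps) * ennreal (y * exp (- y)) <= lo y" if y: "A <= y" for y unfolding lo_def
     proof (rule Liminf_bounded)
      show "EVN m. ennreal (r - eps) * ennreal (y * exp (- y)) <= ennreal (Lam (q m) y)" using Lq[OF y]
      proof eventually_elim
       case (elim m)
       have "eps1 * (y * exp (- y)) <= eps * (y * exp (- y))" using eps y A by (intro mult_right_mono) (auto simp: eps1_def)
       then have "(r - eps) * (y * exp (- y)) <= Lam (q m) y" using elim by (simp add: left_diff_distrib abs_le_iff)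
       then show ?case using eps r y A by (subst ennreal_mult[symmetric]) (auto intro: ennreal_leI)
      qed
     qed
     have hi: "hi k y <= ennreal (r + eps) * ennreal (y * exp (- y))" if y: "A <= y" for y k unfolding hi_def
     proof (rule Limsup_bounded)
      have "(%m. exp (b * gap k (q m))) ---> exp (b * 0)" by (intro tendsto_intros filterlim_compose[OF gap_tendsto qfil])
      then have "eventually (%m. exp (b * gap k (q m)) < (r + eps) / (r + eps1)) sequentially"
       using r eps by (intro order_tendstoD(2)) (auto simp: eps1_def)
      with Lq[OF y] show "EVN m. ennreal (exp (b * gap k (q m)) * Lam (q m) y) <= ennreal (r + eps) * ennreal (y * exp (- y))"
      proof eventually_elim
       case (elim m)
       have "Lam (q m) y <= (r + eps1) * (y * exp (- y))" using elim(1) by (simp add: distrib_right abs_le_iff)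
       then have "exp (b * gap k (q m)) * Lam (q m) y <= (r + eps) / (r + eps1) * ((r + eps1) * (y * exp (- y)))"
        using elim(2) Lam_nonneg[OF q(1)] r eps by (intro mult_mono) (auto simp: eps1_def)
       also have "... = (r + eps) * (y * exp (- y))" using r eps by (simp add: eps1_def)
       finally show ?case using eps r y A by (subst ennreal_mult[symmetric]) (auto intro!: ennreal_leI)
      qed
     qed
     show "EVN k. dist (max 0 (nexp (psum (%v. lo (x + v)) k t) - nexp (psum (%v. hi k (x + v)) k t))) 0 < e" using t[rule_format, of "A - x"]
     proof eventually_elim
      case (elim k)
      define s where "s = psum (%v. ennreal ((x + v) * exp (- (x + v)))) k t"
      have "ennreal (r - eps) * s <= psum (%v. lo (x + v)) k t"
       unfolding s_def psum_cmult[symmetric] using lo elim by (intro psum_compare[where A = A]) auto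
      moreover have "psum (%v. hi k (x + v)) k t <= ennreal (r + eps) * s"
       unfolding s_def psum_cmult[symmetric] using hi elim by (intro psum_compare[where A = A]) auto
      ultimately have "nexp (psum (%v. lo (x + v)) k t) - nexp (psum (%v. hi k (x + v)) k t) <= 4 * eps / r" by (rule nexp_gap[OF eps(1,2)])
      then show ?case using eps(3) e by (auto simp: dist_real_def)
     qed
    qed
   qed
  qed measurable
  then have l: "(%k. LINT t|fam. max 0 (nexp (psum (%v. lo (x + v)) k t) - nexp (psum (%v. hi k (x + v)) k t))) ---> 0" by simp
  show ?thesis
  proof (rule tendsto_sandwich[OF _ _ tendsto_const l])
   show "EVN k. 0 <= p k - w k"
   proof (intro always_eventually allI)
    fix k
    have "ennreal (w k) <= ennreal (p k)"
     using lower[of k] upper[of k] Liminf_le_Limsup[OF sequentially_bot, of "%n. ennreal (Phi n x)"] by (meson order_trans)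
    moreover have "0 <= p k" unfolding p_def by (intro integral_nonneg_AE AE_I2) auto
    ultimately show "0 <= p k - w k" by (simp add: ennreal_le_iff)
   qed
   show "EVN k. p k - w k <= (LINT t|fam. max 0 (nexp (psum (%v. lo (x + v)) k t) - nexp (psum (%v. hi k (x + v)) k t)))"
   proof (intro always_eventually allI)
    fix k
    have "p k - w k = (LINT t|fam. nexp (psum (%v. lo (x + v)) k t) - nexp (psum (%v. hi k (x + v)) k t))"
     unfolding p_def w_def by (rule Bint_diff[symmetric]) (auto intro!: integrable_nexp)
    also have "... <= (LINT t|fam. max 0 (nexp (psum (%v. lo (x + v)) k t) - nexp (psum (%v. hi k (x + v)) k t)))"
     by (intro integral_mono Bintegrable_diff integrable_max integrable_nexp) auto
    finally show "p k - w k <= (LINT t|fam. max 0 (nexp (psum (%v. lo (x + v)) k t) - nexp (psum (%v. hi k (x + v)) k t)))" .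
   qed
  qed
 qed
 note pw = this
 define S where "S = enn2real (limsup (%n. ennreal (Phi n x)))"
 define I where "I = enn2real (liminf (%n. ennreal (Phi n x)))"
 have le1: "limsup (%n. ennreal (Phi n x)) <= 1" by (intro Limsup_bounded always_eventually allI) (simp add: ennreal_le_1 Phi_le_1)
 have IS: "liminf (%n. ennreal (Phi n x)) <= limsup (%n. ennreal (Phi n x))" by (rule Liminf_le_Limsup) simp
 have S: "limsup (%n. ennreal (Phi n x)) = ennreal S" "0 <= S"
  and I: "liminf (%n. ennreal (Phi n x)) = ennreal I" "0 <= I"
  using le1 IS by (auto simp: S_def I_def less_top[symmetric] top_unique intro!: ennreal_enn2real[symmetric])
 have "S - I <= p k - w k" for k proof -
  have "0 <= p k" unfolding p_def by (intro integral_nonneg_AE AE_I2) auto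
  then show ?thesis using upper[of k] lower[of k] S I by (simp add: ennreal_le_iff)
 qed
 then have "S - I <= 0" using pw by (intro LIMSEQ_le_const[of _ 0]) auto
 then have "limsup (%n. ennreal (Phi n x)) <= liminf (%n. ennreal (Phi n x))" unfolding S I by (simp add: ennreal_leI)
 then have "(%n. ennreal (Phi n x)) ---> ennreal S" using IS S by (intro iffD2[OF tendsto_iff_Liminf_eq_Limsup]) auto
 then have "(%n. Phi n x) ---> S" using S by (simp add: Phi_nonneg)
 then show ?thesis by (rule convergentI)
qed

definition lam :: "real => real" where "lam x = lim (%n. Lam n x)"

lemma Lam_tendsto: "(%n. Lam n x) ---> lam x" proof -
 obtain l where l: "(%n. Phi n x) ---> l" using Phi_limit convergent_def by blast
 obtain B N where B: "!!n y. n > N ==> Lam n y <= B y" using Lam_envelope by metis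
 have "exp (- B x) <= l"
 proof (rule LIMSEQ_le_const[OF l])
  have "exp (- B x) <= Phi n x" if "n \<ge> Suc N" for n using B[of n x] that Phi_eq_exp[of n x] by simp
  then show "\<exists>N. \<forall>n\<ge>N. exp (- B x) <= Phi n x" by blast
 qed
 then have "0 < l" by (rule less_le_trans[rotated]) simp
 then have "(%n. Lam n x) ---> - ln l" unfolding Lam_def using l by (intro tendsto_intros) auto
 then show ?thesis unfolding lam_def by (simp add: limI)
qed

lemma lam_nonneg: "0 <= lam x" by (rule LIMSEQ_le_const[OF Lam_tendsto]) (auto intro!: exI[of _ 1] Lam_nonneg)

lemma lam_antimono: "x <= y ==> lam y <= lam x" by (rule LIMSEQ_le[OF Lam_tendsto Lam_tendsto]) (auto intro!: exI[of _ 1] Lam_antimono)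

lemma lam_measurable [measurable]: "lam \<in> bmeas borel" proof -
 have "mono (%x. - lam x)" using lam_antimono by (auto intro!: monoI)
 from borel_measurable_uminus[OF borel_measurable_mono[OF this]] show ?thesis by simp
qed

lemma lam_asymptotics:
 assumes "eps > 0"
 shows "\<exists>A\<ge>1. \<forall>y\<ge>A. \<bar>lam y - r * y * exp (- y)\<bar> <= eps * (y * exp (- y))" proof -
 obtain A where A: "A \<ge> 1" "!!y. y \<ge> A ==> EVN n. \<bar>Lam n y - r * y * exp (- y)\<bar> <= eps * (y * exp (- y))"
  using Lam_asymptotics[OF assms] by blast
 have "\<bar>lam y - r * y * exp (- y)\<bar> <= eps * (y * exp (- y))" if "y \<ge> A" for y
 proof (rule tendsto_upperbound[OF _ A(2)[OF that]])
  show "(%n. \<bar>Lam n y - r * y * exp (- y)\<bar>) ---> \<bar>lam y - r * y * exp (- y)\<bar>" by (intro tendsto_intros Lam_tendsto)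
 qed simp
 then show ?thesis using A(1) by blast
qed

lemma psum_Lam_tendsto:
 assumes t: "good t"
 shows "(%m. psum (%v. ennreal (Lam m (x + v - gap k m))) k t) ---> psum (%v. ennreal (lam (x + v))) k t" proof -
 obtain B N where B: "!!n y. n > N ==> Lam n y <= B y" "!!y. 0 <= B y"
  "!!t k x C. good t ==> 0 <= C ==> psum (%v. ennreal (C * B (x + v))) k t < \<infinity>" using Lam_envelope by metis
 have "(%m. exp (b * gap k m)) ---> exp (b * 0)" by (intro tendsto_intros gap_tendsto)
 then have "eventually (%m. exp (b * gap k m) < 2) sequentially" by (rule order_tendstoD) simp
 then obtain N1 where N1: "!!m. m \<ge> N1 ==> exp (b * gap k m) < 2" by (auto simp: eventually_sequentially)
 define q where "q = Suc (N + N1)"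
 have Lle: "Lam m (y - gap k m) <= exp (b * gap k m) * Lam m y" if "0 < m" for m y using Lam_scale[OF that gap_nonneg[OF that]] .
 have "(%m. psum (%v. ennreal (Lam (m + q) (x + v - gap k (m + q)))) k t) ---> psum (%v. ennreal (lam (x + v))) k t"
 proof (rule tendsto_psum)
  show "ennreal (Lam (m + q) (x + v - gap k (m + q))) <= ennreal (2 * B (x + v))" for m v
  proof (rule ennreal_leI)
   have "Lam (m + q) (x + v - gap k (m + q)) <= exp (b * gap k (m + q)) * Lam (m + q) (x + v)" by (rule Lle) (simp add: q_def)
   also have "... <= 2 * B (x + v)" using N1[of "m + q"] B(1)[of "m + q" "x + v"] Lam_nonneg[of "m + q"] by (intro mult_mono) (auto simp: q_def)
   finally show "Lam (m + q) (x + v - gap k (m + q)) <= 2 * B (x + v)" .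
  qed
  show "psum (%v. ennreal (2 * B (x + v))) k t < \<infinity>" by (rule B(3)[OF t]) simp
  fix v
  have "(%m. Lam m (x + v - gap k m)) ---> lam (x + v)"
  proof (rule tendsto_sandwich[OF _ _ Lam_tendsto])
   show "EVN m. Lam m (x + v) <= Lam m (x + v - gap k m)" by (rule eventually_sequentiallyI[of 1]) (auto intro!: Lam_antimono gap_nonneg)
   show "EVN m. Lam m (x + v - gap k m) <= exp (b * gap k m) * Lam m (x + v)" by (rule eventually_sequentiallyI[of 1]) (auto intro!: Lle)
   have "(%m. exp (b * gap k m) * Lam m (x + v)) ---> exp (b * 0) * lam (x + v)" by (intro tendsto_intros gap_tendsto Lam_tendsto)
   then show "(%m. exp (b * gap k m) * Lam m (x + v)) ---> lam (x + v)" by simp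
  qed
  from LIMSEQ_ignore_initial_segment[OF this, of q]
  show "(%m. ennreal (Lam (m + q) (x + v - gap k (m + q)))) ---> ennreal (lam (x + v))" by (intro tendsto_ennrealI)
 qed
 then show ?thesis by (rule LIMSEQ_offset)
qed

text \<open>The branching relation in the limit, where the gap has vanished.\<close>
lemma lam_fixed_point:
 "(NN fam (%t. ennreal (nexp (psum (%v. ennreal (lam (x + v))) k t)))) = ennreal (exp (- lam x))" proof -
 define u where "u m t = ennreal (nexp (psum (%v. ennreal (Lam (Suc m) (x + v - gap k (Suc m)))) k t))" for m t
 have Lm [measurable]: "Lam (Suc m) \<in> bmeas borel" for m by (rule Lam_measurable) simp
 have 1: "(%m. NN fam (%t. u m t)) ---> (NN fam (%t. ennreal (nexp (psum (%v. ennreal (lam (x + v))) k t))))"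
 proof (rule nn_integral_dominated_convergence[where w = "%_. 1"])
  show "AE t in fam. (%m. u m t) ---> ennreal (nexp (psum (%v. ennreal (lam (x + v))) k t))" using AE_good unfolding u_def
   by eventually_elim (intro tendsto_ennrealI tendsto_nexp LIMSEQ_Suc psum_Lam_tendsto)
 qed (use T.emeasure_space_1 in \<open>auto simp: u_def ennreal_le_1\<close>)
 have "(NN fam (%t. u m t)) = ennreal (exp (- Lam (Suc m + k) x))" for m proof -
  have "(NN fam (%t. u m t)) = (NN fam (%t. ennreal (nexp (psum (%v. ennreal (\<kappa> (x + v - lg (Suc m + k)))) (Suc m + k) t))))"
   unfolding u_def using branch_Phi[of "Suc m" "%_. 1" k 1 "%_. x"] by simp
  also have "... = ennreal (Phi (Suc m + k) x)" unfolding Phi_def by (rule nn_integral_eq_integral) (auto intro!: integrable_nexp)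
  finally show ?thesis by (subst (asm) Phi_eq_exp) auto
 qed
 moreover have "(%m. ennreal (exp (- Lam (Suc m + k) x))) ---> ennreal (exp (- lam x))"
  using LIMSEQ_ignore_initial_segment[OF Lam_tendsto[of x], of "Suc k"] by (intro tendsto_intros tendsto_ennrealI) (simp add: add_ac)
 ultimately show ?thesis using LIMSEQ_unique[OF 1] by simp
qed

end

section \<open>Real sums and the derivative martingale\<close>

abbreviation labels :: "nat list => family => nat => ereal" where "labels \<equiv> %u t. t u"

lemma gen_sum_labels: "gen_sum \<xi> n f s = gen_sum labels n f (%u. \<xi> u s)" by (simp add: gen_sum_def generation_def position_eq_pos)

lemma infsum_real_nn_integral:
 fixes F :: "'a => real"
 shows "infsum F A = (if (NN (cs A) (%x. ennreal \<bar>F x\<bar>)) < \<infinity>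
  then enn2real (NN (cs A) (%x. ennreal (F x))) - enn2real (NN (cs A) (%x. ennreal (- F x))) else 0)"
proof (cases "(NN (cs A) (%x. ennreal \<bar>F x\<bar>)) < \<infinity>")
 case True
 then have i: "integrable (cs A) F" by (auto simp: integrable_iff_bounded)
 then have "Infinite_Set_Sum.abs_summable_on F A" by (simp add: abs_summable_on_def)
 then have "infsum F A = infsetsum F A" by (rule infsetsum_infsum[symmetric])
 then show ?thesis using True by (simp add: infsetsum_def real_lebesgue_integral_def[OF i])
next
 case False
 have "\<not> F summable_on A"
 proof
  assume "F summable_on A"
  then have "(%x. norm (F x)) summable_on A" by (rule iffD1[OF summable_on_iff_abs_summable_on_real])
  then have "Infinite_Set_Sum.abs_summable_on F A" by (simp add: abs_summable_equivalent[symmetric])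
  then have "integrable (cs A) F" by (simp add: abs_summable_on_def)
  then show False using False by (auto simp: integrable_iff_bounded)
 qed
 then show ?thesis using False by (simp add: infsum_not_exists)
qed

definition gsum :: "(real => ennreal) => nat => family => ennreal" where
 "gsum g n t = (NN (cs (lev n)) (%z. (if pos z t ~= \<infinity> then g (roe (pos z t)) else 0)))"

lemma gsum_eq_psum: "\<forall>u k. t u k ~= - \<infinity> ==> gsum g n t = psum g n t"
 unfolding gsum_def psum_def using pos_not_MInf[of t] by (intro nn_integral_cong) auto

lemma gen_sum_nn:
 "(NN (cs (generation labels n t)) (%z. g (roe (pos z t)))) = gsum g n t" proof -
 have "generation labels n t = {z\<in>lev n. pos z t ~= \<infinity>}" by (auto simp: generation_def position_eq_pos lev_def)
 then show ?thesis unfolding gsum_def by (auto simp: nn_integral_count_space_indicator intro!: nn_integral_cong split: split_indicator)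
qed

text \<open>A real sum is the difference of the sums of its positive and negative parts, with the default \<open>0\<close> when it does not converge absolutely; this gives measurability.\<close>
lemma gen_sum_real:
 fixes f :: "real => real"
 shows "gen_sum labels n f t = (if gsum (%v. ennreal \<bar>f v\<bar>) n t < \<infinity>
  then enn2real (gsum (%v. ennreal (f v)) n t) - enn2real (gsum (%v. ennreal (- f v)) n t) else 0)" proof -
 have "gen_sum labels n f t = infsum (%z. f (roe (pos z t))) (generation labels n t)" by (simp add: gen_sum_def position_eq_pos)
 then show ?thesis unfolding infsum_real_nn_integral
  by (simp only: gen_sum_nn[where g = "%v. ennreal \<bar>f v\<bar>"] gen_sum_nn[where g = "%v. ennreal (f v)"] gen_sum_nn[where g = "%v. ennreal (- f v)"])
qed

lemma gen_sum_trunc: "n <= k ==> gen_sum labels n f (trunc k t) = gen_sum labels n f t" proof -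
 assume "n <= k"
 then have p: "pos z (trunc k t) = pos z t" if "length z = n" for z using that by (intro pos_trunc) auto
 then have "generation labels n (trunc k t) = generation labels n t" by (auto simp: generation_def position_eq_pos)
 moreover have "infsum (%z. f (roe (position labels z (trunc k t)))) (generation labels n t)
   = infsum (%z. f (roe (position labels z t))) (generation labels n t)" using p by (intro infsum_cong) (auto simp: position_eq_pos generation_def)
 ultimately show ?thesis unfolding gen_sum_def by simp
qed

lemma gen_sum_nonneg_psum:
 assumes t: "\<forall>u k. t u k ~= - \<infinity>" and f: "!!z. z \<in> lev n ==> finr (pos z t) ==> 0 <= f (roe (pos z t))"
  and fin: "psum (%v. ennreal (f v)) n t < \<infinity>"
 shows "gen_sum labels n f t = enn2real (psum (%v. ennreal (f v)) n t)" proof -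
 have 1: "psum (%v. ennreal \<bar>f v\<bar>) n t = psum (%v. ennreal (f v)) n t" unfolding psum_def using f by (intro nn_integral_cong) auto
 have "psum (%v. ennreal (- f v)) n t = (NN (cs (lev n)) (%z. 0))" unfolding psum_def using f by (intro nn_integral_cong) (auto simp: ennreal_neg)
 then have 2: "psum (%v. ennreal (- f v)) n t = 0" by simp
 show ?thesis unfolding gen_sum_real gsum_eq_psum[OF t] 1 2 using fin by simp
qed

context tree_law begin

lemma measurable_gsum [measurable]:
 assumes [measurable]: "g \<in> bmeas borel"
 shows "gsum g n \<in> bmeas fam" unfolding gsum_def by (rule measurable_count_sum) auto

lemma measurable_gen_sum [measurable]:
 fixes f :: "real => real"
 assumes [measurable]: "f \<in> bmeas borel"
 shows "gen_sum labels n f \<in> bmeas fam" unfolding gen_sum_real[abs_def] by measurable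

end

definition dmart :: "nat => family => real" where
 "dmart n = gen_sum labels n (%v. v * exp (- v))"

definition dlim :: "family => real" where "dlim t = lim (%n. dmart n t)"

lemma Z_eq: "dlim = Z_inf labels" by (simp add: fun_eq_iff dlim_def Z_inf_def dmart_def)

definition wsum :: "nat => family => real" where
 "wsum n t = enn2real (psum (%v. ennreal (exp (- v))) n t)"

lemma ennreal_mult3:
 "0 <= a ==> 0 <= b ==> 0 <= c ==> ennreal a * (ennreal b * ennreal c) = ennreal (a * (b * c))" by (simp add: ennreal_mult)

text \<open>When all positions of a generation exceed \<open>A\<close>, the terms of the derivative martingale are nonnegative and it dominates \<open>A\<close> times the additive martingale.\<close>
lemma shifted_dmart:
 assumes g: "good t" and nm: "\<forall>u k. t u k ~= - \<infinity>" and hi: "\<forall>z\<in>lev n. ereal A < pos z t" "0 <= A" "0 <= x + A"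
 shows "psum (%v. ennreal ((x + v) * exp (- (x + v)))) n t = ennreal (exp (- x) * (dmart n t + x * wsum n t))"
  and "A * wsum n t <= dmart n t" "0 <= wsum n t" "0 <= dmart n t" "0 <= dmart n t + x * wsum n t" proof -
 have v: "A < v" if "z \<in> lev n" "pos z t = ereal v" for z v proof -
  have "ereal A < pos z t" using hi(1) that(1) by blast
  then show ?thesis using that(2) by simp
 qed
 have b1: "v * exp (- v) <= 1 * ((1 + v^2) * exp (- v))" for v :: real proof -
  have "0 <= (1 - v)^2" "0 <= v^2" by simp_all
  then have "2 * v <= 1 + v^2" "0 <= v^2" by (simp_all add: power2_diff)
  then have "v <= 1 + v^2" by (cases "0 <= v") linarith+
  then show ?thesis by (simp add: mult_right_mono)
 qed
 have f1: "psum (%v. ennreal (v * exp (- v))) n t < \<infinity>"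
  by (rule psum_finite_if_dominated[OF g]) (use b1 in \<open>auto intro!: exI[of _ 1]\<close>)
 have f2: "psum (%v. ennreal (exp (- v))) n t < \<infinity>" by (rule psum_finite_if_dominated[OF g]) (auto intro!: exI[of _ 1])
 have d: "ennreal (dmart n t) = psum (%v. ennreal (v * exp (- v))) n t" unfolding dmart_def
 proof (subst gen_sum_nonneg_psum[OF nm _ f1])
  fix z assume "z \<in> lev n" "finr (pos z t)"
  then show "0 <= roe (pos z t) * exp (- roe (pos z t))"
   using v[of z] hi(2) by (cases "pos z t") (auto intro!: mult_nonneg_nonneg less_imp_le order_le_less_trans)
 qed (use f1 in simp)
 have w: "ennreal (wsum n t) = psum (%v. ennreal (exp (- v))) n t" unfolding wsum_def using f2 by simp
 show w0: "0 <= wsum n t" by (simp add: wsum_def)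
 have "ennreal A * psum (%v. ennreal (exp (- v))) n t <= psum (%v. ennreal (v * exp (- v))) n t" unfolding psum_cmult[symmetric] unfolding psum_def
 proof (intro nn_integral_mono)
  fix z assume "z \<in> space (cs (lev n))"
  then show "(if finr (pos z t) then ennreal A * ennreal (exp (- roe (pos z t))) else 0)
   <= (if finr (pos z t) then ennreal (roe (pos z t) * exp (- roe (pos z t))) else 0)"
   using v[of z] hi(2) by (cases "pos z t") (auto simp: ennreal_mult'[symmetric] intro!: ennreal_leI mult_right_mono)
 qed
 then have Aw: "ennreal (A * wsum n t) <= ennreal (dmart n t)" using d w hi(2) w0 by (simp add: ennreal_mult)
 have "0 <= dmart n t" unfolding dmart_def
 proof (subst gen_sum_nonneg_psum[OF nm _ f1])
  fix z assume "z \<in> lev n" "finr (pos z t)"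
  then show "0 <= roe (pos z t) * exp (- roe (pos z t))"
   using v[of z] hi(2) by (cases "pos z t") (auto intro!: mult_nonneg_nonneg less_imp_le order_le_less_trans)
 qed simp
 then show d0: "0 <= dmart n t" .
 then show Awr: "A * wsum n t <= dmart n t" using Aw hi(2) w0 by (simp add: ennreal_le_iff)
 have "(- x) * wsum n t <= A * wsum n t" using hi(3) w0 by (intro mult_right_mono) auto
 then show s0: "0 <= dmart n t + x * wsum n t" using Awr by simp
 show "psum (%v. ennreal ((x + v) * exp (- (x + v)))) n t = ennreal (exp (- x) * (dmart n t + x * wsum n t))"
 proof (cases "0 <= x")
  case True
  have "psum (%v. ennreal ((x + v) * exp (- (x + v)))) n t = psum (%v. ennreal (exp (- x)) * (ennreal (v * exp (- v)) + ennreal x * ennreal (exp (- v)))) n t"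
   unfolding psum_def
  proof (intro nn_integral_cong)
   fix z assume "z \<in> space (cs (lev n))"
   then show "(if finr (pos z t) then ennreal ((x + roe (pos z t)) * exp (- (x + roe (pos z t)))) else 0)
    = (if finr (pos z t) then ennreal (exp (- x)) * (ennreal (roe (pos z t) * exp (- roe (pos z t))) + ennreal x * ennreal (exp (- roe (pos z t)))) else 0)"
    using v[of z] hi(2) True
   proof (cases "pos z t")
    case (real y)
    then have y: "0 <= y" using v[of z y] \<open>z \<in> space (cs (lev n))\<close> hi(2) by simp
    have "exp (- (x + y)) = exp (- x) * exp (- y)" by (simp only: minus_add_distrib exp_add)
    then have "(x + y) * exp (- (x + y)) = exp (- x) * (y * exp (- y) + x * exp (- y))" by (simp add: distrib_left distrib_right)
    then show ?thesis using real y True by (simp add: ennreal_mult[symmetric] ennreal_plus[symmetric] del: ennreal_plus)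
   qed auto
  qed
  also have "... = ennreal (exp (- x)) * (ennreal (dmart n t) + ennreal x * ennreal (wsum n t))" by (simp only: psum_cmult psum_add d w)
  also have "... = ennreal (exp (- x) * (dmart n t + x * wsum n t))"
   using d0 w0 True by (simp add: ennreal_mult[symmetric] ennreal_plus[symmetric] del: ennreal_plus)
  finally show ?thesis .
 next
  case False
  have "psum (%v. ennreal ((x + v) * exp (- (x + v)))) n t + ennreal (exp (- x)) * (ennreal (- x) * ennreal (wsum n t)) = ennreal (exp (- x)) * ennreal (dmart n t)"
   unfolding d w psum_cmult[symmetric] psum_add[symmetric] unfolding psum_def
  proof (intro nn_integral_cong)
   fix z assume "z \<in> space (cs (lev n))"
   then show "(if finr (pos z t) then ennreal ((x + roe (pos z t)) * exp (- (x + roe (pos z t)))) + ennreal (exp (- x)) * (ennreal (- x) * ennreal (exp (- roe (pos z t)))) else 0)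
    = (if finr (pos z t) then ennreal (exp (- x)) * ennreal (roe (pos z t) * exp (- roe (pos z t))) else 0)"
   proof (cases "pos z t")
    case (real y)
    then have y: "0 <= y" "0 <= x + y" using v[of z y] \<open>z \<in> space (cs (lev n))\<close> hi by simp_all
    have "exp (- (x + y)) = exp (- x) * exp (- y)" by (simp only: minus_add_distrib exp_add)
    then have "(x + y) * exp (- (x + y)) + exp (- x) * (- x * exp (- y)) = exp (- x) * (y * exp (- y))" by (simp add: distrib_left distrib_right)
    moreover have "ennreal (exp (- x)) * (ennreal (- x) * ennreal (exp (- y))) = ennreal (exp (- x) * (- x * exp (- y)))"
     using False by (intro ennreal_mult3) auto
    moreover have "ennreal (exp (- x)) * ennreal (y * exp (- y)) = ennreal (exp (- x) * (y * exp (- y)))" using y by (intro ennreal_mult[symmetric]) auto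
    moreover have "ennreal ((x + y) * exp (- (x + y))) + ennreal (exp (- x) * (- x * exp (- y)))
      = ennreal ((x + y) * exp (- (x + y)) + exp (- x) * (- x * exp (- y)))" using y False by (intro ennreal_plus[symmetric] mult_nonneg_nonneg) auto
    moreover have "finr (pos z t)" "roe (pos z t) = y" using real by auto
    ultimately show ?thesis by (simp only: if_True)
   qed auto
  qed
  moreover have "ennreal (exp (- x)) * (ennreal (- x) * ennreal (wsum n t)) = ennreal (exp (- x) * (- x * wsum n t))"
   using False w0 by (intro ennreal_mult3) auto
  moreover have "ennreal (exp (- x)) * ennreal (dmart n t) = ennreal (exp (- x) * dmart n t)" using d0 by (intro ennreal_mult[symmetric]) auto
  moreover have "exp (- x) * dmart n t = exp (- x) * (dmart n t + x * wsum n t) + exp (- x) * (- x * wsum n t)" by (simp add: distrib_left)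
  moreover have "ennreal (exp (- x) * (dmart n t + x * wsum n t) + exp (- x) * (- x * wsum n t))
    = ennreal (exp (- x) * (dmart n t + x * wsum n t)) + ennreal (exp (- x) * (- x * wsum n t))"
   using s0 False w0 by (intro ennreal_plus mult_nonneg_nonneg) auto
  ultimately have "ennreal (exp (- x) * (- x * wsum n t)) + psum (%v. ennreal ((x + v) * exp (- (x + v)))) n t
   = ennreal (exp (- x) * (- x * wsum n t)) + ennreal (exp (- x) * (dmart n t + x * wsum n t))"
   by (simp only: add.commute[of "ennreal (exp (- x) * (- x * wsum n t))"])
  then show ?thesis unfolding ennreal_add_left_cancel by (simp only: infinity_ennreal_def ennreal_neq_top) simp
 qed
qed

section \<open>Convergence of the derivative martingale\<close>

text \<open>The almost sure properties of a family that the limits below use.\<close>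
definition tame :: "family => bool" where
 "tame t \<longleftrightarrow> good t & (\<forall>u k. t u k ~= - \<infinity>) & (\<forall>A :: real. EVN n. \<forall>z\<in>lev n. ereal A < pos z t)"

context brw_law begin

lemma AE_tame: "AE t in fam. tame t" using AE_good AE_no_MInf AE_high by eventually_elim (simp add: tame_def)

end

lemma tame_wsum:
 assumes "tame t" "0 <= A"
 shows "EVN n. A * wsum n t <= dmart n t & 0 <= wsum n t & 0 <= dmart n t" proof -
 have "EVN n. \<forall>z\<in>lev n. ereal A < pos z t" using assms by (simp add: tame_def)
 then show ?thesis
 proof eventually_elim
  case (elim n)
  then show ?case using shifted_dmart(2-4)[of t n A 0] assms by (simp add: tame_def)
 qed
qed

context tip begin

definition Mart :: "real => nat => family => real" where
 "Mart x n t = nexp (psum (%v. ennreal (lam (x + v))) n t)"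

lemma Mart_bounds: "0 <= Mart x n t" "Mart x n t <= 1" by (simp_all add: Mart_def)

lemma measurable_Mart [measurable]: "Mart x n \<in> bmeas fam" unfolding Mart_def[abs_def] by measurable

lemma integral_Mart: "(LINT t|fam. Mart x n t) = exp (- lam x)" proof -
 have "(LINT t|fam. Mart x n t) = enn2real (NN fam (%t. ennreal (Mart x n t)))" by (rule integral_eq_nn_integral) (auto simp: Mart_bounds)
 then show ?thesis using lam_fixed_point[of x n] by (simp add: Mart_def)
qed

lemma Mart_convergent: "AE t in fam. convergent (%n. Mart x n t)"
proof (rule T.bounded_martingale_converges[where \<tau> = trunc])
 show "\<bar>Mart x n t\<bar> <= 1" for n t by (simp add: Mart_def)
 show "Mart x l (trunc i t) = Mart x l t" if "l <= i" for l i t unfolding Mart_def psum_trunc[OF that] ..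
 fix i j :: nat and y :: "family => real"
 assume ij: "i <= j" and y [measurable]: "y \<in> bmeas fam" and y2: "!!t. \<bar>y t\<bar> <= 2" and yt: "!!t. y (trunc i t) = y t"
 have *: "(LINT t|fam. w t * Mart x j t) = (LINT t|fam. w t * Mart x i t)"
  if w [measurable]: "w \<in> bmeas fam" and w0: "!!t. 0 <= w t" and w4: "!!t. w t <= 4" and wt: "!!t. w (trunc i t) = w t" for w proof -
  have "(NN fam (%t. ennreal (w t) * ennreal (nexp (psum (%v. ennreal (lam (x + v))) ((j - i) + i) t))))
   = (NN fam (%t. ennreal (w t) * ennreal (nexp (psum (%v. ennreal (lam (x + v))) i t))))"
   using ennreal_leI[OF w4] by (intro branch_shift[where C = 4 and \<zeta> = "%_. x"]) (auto simp: lam_nonneg lam_fixed_point wt)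
  then have "(NN fam (%t. ennreal (w t * Mart x j t))) = (NN fam (%t. ennreal (w t * Mart x i t)))" using ij w0 by (simp add: Mart_def ennreal_mult)
  moreover have "(LINT t|fam. w t * Mart x n t) = enn2real (NN fam (%t. ennreal (w t * Mart x n t)))" for n
   by (rule integral_eq_nn_integral) (auto simp: Mart_bounds w0)
  ultimately show ?thesis by simp
 qed
 have iM: "integrable fam (%t. y t * Mart x n t)" for n using mult_mono[OF y2 Mart_bounds(2)] Mart_bounds
  by (intro T.integrable_const_bound[of _ 2]) (auto simp: abs_mult)
 have i2: "integrable fam (%t. 2 * Mart x n t)" for n using Mart_bounds by (intro integrable_mult_right T.integrable_const_bound[of _ 1]) auto
 have a: "(LINT t|fam. (y t + 2) * Mart x j t) = (LINT t|fam. (y t + 2) * Mart x i t)"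
 proof (rule *)
  show "0 <= y t + 2" "y t + 2 <= 4" for t using y2[of t] by (auto simp: abs_le_iff)
 qed (simp_all add: yt)
 have c: "(LINT t|fam. 2 * Mart x j t) = (LINT t|fam. 2 * Mart x i t)" by (simp add: integral_Mart)
 have "(LINT t|fam. y t * Mart x n t) = (LINT t|fam. (y t + 2) * Mart x n t) - (LINT t|fam. 2 * Mart x n t)" for n
  unfolding distrib_right by (subst Bint_add[OF iM i2]) simp
 then show "(LINT t|fam. y t * Mart x j t) = (LINT t|fam. y t * Mart x i t)" using a c by simp
qed simp_all

text \<open>Uniformity in \<open>x\<close> is needed because \<open>x\<close> will later depend on the generation.\<close>
lemma psum_lam_estimate:
 assumes t: "tame t" and e: "eps > 0"
 shows "EVN n. \<forall>x\<ge>x0. 0 <= exp (- x) * (dmart n t + x * wsum n t) \<and>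
  (\<exists>p\<ge>0. psum (%v. ennreal (lam (x + v))) n t = ennreal p \<and>
   \<bar>p - r * (exp (- x) * (dmart n t + x * wsum n t))\<bar> <= eps * (exp (- x) * (dmart n t + x * wsum n t)))" proof -
 define \<delta> where "\<delta> = min eps (r / 2)"
 have d: "\<delta> > 0" "\<delta> < r" "\<delta> <= eps" using e r by (auto simp: \<delta>_def)
 obtain A where A: "A \<ge> 1" "!!y. y \<ge> A ==> \<bar>lam y - r * y * exp (- y)\<bar> <= \<delta> * (y * exp (- y))"
  using lam_asymptotics[OF d(1)] by blast
 define B where "B = \<bar>A\<bar> + \<bar>x0\<bar>"
 have "EVN n. \<forall>z\<in>lev n. ereal B < pos z t" using t by (simp add: tame_def)
 then show ?thesis
 proof eventually_elim
  case (elim n)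
  show ?case
  proof (intro allI impI)
   fix x assume x: "x \<ge> x0"
   have xB: "0 <= B" "0 <= x + B" "A <= x + B" "A - x <= B" using x by (auto simp: B_def)
   define s where "s = exp (- x) * (dmart n t + x * wsum n t)"
   have gt: "good t" "\<forall>u k. t u k ~= - \<infinity>" using t by (auto simp: tame_def)
   note sd = shifted_dmart[OF gt elim xB(1,2)]
   have s0: "0 <= s" unfolding s_def using sd(5) by simp
   have hi: "\<forall>z\<in>lev n. ereal (A - x) < pos z t" using elim xB(4) by (meson ereal_less_eq(3) order_le_less_trans)
   define S where "S = psum (%v. ennreal (lam (x + v))) n t"
   have "psum (%v. ennreal (r - \<delta>) * ennreal ((x + v) * exp (- (x + v)))) n t <= S" unfolding S_def
   proof (rule psum_compare[where A = A and f = "%y. ennreal (r - \<delta>) * ennreal (y * exp (- y))" and g = "%y. ennreal (lam y)", OF _ hi])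
    fix y assume y: "A <= y"
    have "(r - \<delta>) * (y * exp (- y)) <= lam y" using A(2)[OF y] by (simp add: left_diff_distrib abs_le_iff)
    then show "ennreal (r - \<delta>) * ennreal (y * exp (- y)) <= ennreal (lam y)"
     using d y A(1) by (subst ennreal_mult[symmetric]) (auto intro: ennreal_leI)
   qed
   then have lo: "ennreal ((r - \<delta>) * s) <= S" unfolding psum_cmult sd(1) s_def using d sd(5) by (subst ennreal_mult) auto
   have "S <= psum (%v. ennreal (r + \<delta>) * ennreal ((x + v) * exp (- (x + v)))) n t" unfolding S_def
   proof (rule psum_compare[where A = A and g = "%y. ennreal (r + \<delta>) * ennreal (y * exp (- y))" and f = "%y. ennreal (lam y)", OF _ hi])
    fix y assume y: "A <= y"
    have "lam y <= (r + \<delta>) * (y * exp (- y))" using A(2)[OF y] by (simp add: distrib_right abs_le_iff)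
    then show "ennreal (lam y) <= ennreal (r + \<delta>) * ennreal (y * exp (- y))"
     using d y A(1) r by (subst ennreal_mult[symmetric]) (auto intro: ennreal_leI)
   qed
   then have up: "S <= ennreal ((r + \<delta>) * s)" unfolding psum_cmult sd(1) s_def using d r sd(5) by (subst ennreal_mult) auto
   obtain p where p: "S = ennreal p" "0 <= p" using up by (cases S) (auto simp: top_unique)
   have "(r - \<delta>) * s <= p" using lo p by (simp add: ennreal_le_iff)
   moreover have "p <= (r + \<delta>) * s" using up p d s0 r by (simp add: ennreal_le_iff)
   moreover have "\<delta> * s <= eps * s" using d s0 by (intro mult_right_mono) auto
   ultimately have "\<bar>p - r * s\<bar> <= eps * s" by (simp add: left_diff_distrib distrib_right abs_le_iff)
   then show "0 <= exp (- x) * (dmart n t + x * wsum n t) \<and>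
  (\<exists>p\<ge>0. psum (%v. ennreal (lam (x + v))) n t = ennreal p \<and>
   \<bar>p - r * (exp (- x) * (dmart n t + x * wsum n t))\<bar> <= eps * (exp (- x) * (dmart n t + x * wsum n t)))"
    using s0 p unfolding s_def S_def by blast
  qed
 qed
qed

lemma psum_lam_tendsto:
 assumes t: "tame t" and D: "(%n. dmart n t) ---> D" and w: "(%n. wsum n t) ---> 0" and xs: "xs ---> x"
 shows "(%n. psum (%v. ennreal (lam (xs n + v))) n t) ---> ennreal (r * (exp (- x) * D))" proof -
 define s where "s n = exp (- xs n) * (dmart n t + xs n * wsum n t)" for n
 define p where "p n = enn2real (psum (%v. ennreal (lam (xs n + v))) n t)" for n
 have sl: "s ---> exp (- x) * (D + x * 0)" unfolding s_def by (intro tendsto_intros D w xs)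
 have x1: "EVN n. x - 1 <= xs n" using order_tendstoD(1)[OF xs, of "x - 1"] by (auto elim: eventually_mono)
 have ev: "EVN n. 0 <= s n & psum (%v. ennreal (lam (xs n + v))) n t = ennreal (p n) & \<bar>p n - r * s n\<bar> <= eps * s n" if "eps > 0" for eps
  using psum_lam_estimate[OF t that, of "x - 1"] x1
 proof eventually_elim
  case (elim n)
  then obtain q where "0 <= s n" "q \<ge> 0" "psum (%v. ennreal (lam (xs n + v))) n t = ennreal q" "\<bar>q - r * s n\<bar> <= eps * s n"
   unfolding s_def by meson
  then show ?case by (simp add: p_def)
 qed
 obtain C where C: "C > 0" "!!n. \<bar>s n\<bar> <= C" using convergent_imp_Bseq[OF convergentI[OF sl]] by (auto simp: Bseq_def)
 have "(%n. p n - r * s n) ---> 0"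
 proof (rule tendstoI)
  fix e :: real assume e: "e > 0"
  have "e / (2 * C) > 0" using e C(1) by simp
  from ev[OF this] show "EVN n. dist (p n - r * s n) 0 < e"
  proof (rule eventually_mono)
   fix n assume *: "0 <= s n & psum (%v. ennreal (lam (xs n + v))) n t = ennreal (p n) & \<bar>p n - r * s n\<bar> <= e / (2 * C) * s n"
   have "e / (2 * C) * s n <= e / (2 * C) * C" using C e *  by (intro mult_left_mono) (auto simp: abs_le_iff)
   also have "... = e / 2" using C by simp
   finally have "\<bar>p n - r * s n\<bar> <= e / 2" using * by linarith
   then show "dist (p n - r * s n) 0 < e" using e by (simp add: dist_real_def)
  qed
 qed
 then have "(%n. (p n - r * s n) + r * s n) ---> 0 + r * (exp (- x) * (D + x * 0))" by (intro tendsto_intros sl)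
 then have "p ---> r * (exp (- x) * D)" by simp
 then have "(%n. ennreal (p n)) ---> ennreal (r * (exp (- x) * D))" by (rule tendsto_ennrealI)
 then show ?thesis by (rule Lim_transform_eventually) (use ev[of 1] in \<open>auto elim: eventually_mono\<close>)
qed

text \<open>The exponent of the martingale \<open>Mart 0\<close> is comparable with the derivative martingale, hence both converge or both tend to infinity.\<close>
lemma dmart_dichotomy:
 assumes t: "tame t" and c: "convergent (%n. Mart 0 n t)"
 shows "convergent (%n. dmart n t) | filterlim (%n. dmart n t) at_top sequentially" proof -
 define p where "p n = enn2real (psum (%v. ennreal (lam (0 + v))) n t)" for n
 have ev: "EVN n. 0 <= dmart n t & Mart 0 n t = exp (- p n) & 0 <= p n & \<bar>p n - r * dmart n t\<bar> <= eps * dmart n t" if "eps > 0" for eps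
  using psum_lam_estimate[OF t that, of 0]
 proof eventually_elim
  case (elim n)
  then obtain q where "0 <= dmart n t" "q \<ge> 0" "psum (%v. ennreal (lam (0 + v))) n t = ennreal q" "\<bar>q - r * dmart n t\<bar> <= eps * dmart n t"
   by (elim allE[of _ 0]) auto
  then show ?case by (simp add: p_def Mart_def nexp_ennreal)
 qed
 obtain m where m: "(%n. Mart 0 n t) ---> m" using c by (auto simp: convergent_def)
 have pm: "(%n. exp (- p n)) ---> m" by (rule Lim_transform_eventually[OF m]) (use ev[of 1] in \<open>auto elim: eventually_mono\<close>)
 have "0 <= m" by (rule LIMSEQ_le_const[OF pm]) auto
 then consider "m = 0" | "m > 0" by linarith
 then show ?thesis
 proof cases
  case 1
  have "filterlim (%n. exp (- p n)) (at_right 0) sequentially" using pm 1 by (auto simp: filterlim_at)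
  then have "filterlim (%n. inverse (exp (- p n))) at_top sequentially" by (rule filterlim_compose[OF filterlim_inverse_at_top_right])
  then have "filterlim (%n. ln (inverse (exp (- p n)))) at_top sequentially" by (rule filterlim_compose[OF ln_at_top])
  then have pt: "filterlim p at_top sequentially" by (simp add: exp_minus)
  have "filterlim (%n. p n * (1 / (2 * r))) at_top sequentially" by (rule filterlim_at_top_mult_tendsto_pos[OF tendsto_const _ pt]) (use r in simp)
  moreover have "EVN n. p n * (1 / (2 * r)) <= dmart n t" using ev[OF r]
  proof (rule eventually_mono)
   fix n assume "0 <= dmart n t & Mart 0 n t = exp (- p n) & 0 <= p n & \<bar>p n - r * dmart n t\<bar> <= r * dmart n t"
   then have "p n - r * dmart n t <= r * dmart n t" by (blast dest: abs_le_D1)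
   then have "p n <= r * dmart n t + r * dmart n t" by linarith
   also have "... = dmart n t * (2 * r)" by (simp add: algebra_simps)
   finally have "p n <= dmart n t * (2 * r)" .
   then have "p n / (2 * r) <= dmart n t" using r by (subst pos_divide_le_eq) auto
   then show "p n * (1 / (2 * r)) <= dmart n t" by simp
  qed
  ultimately have "filterlim (%n. dmart n t) at_top sequentially" by (rule filterlim_at_top_mono)
  then show ?thesis ..
 next
  case 2
  have "(%n. - ln (exp (- p n))) ---> - ln m" using 2 by (intro tendsto_intros pm) auto
  then have pl: "p ---> - ln m" by simp
  obtain C where C: "C > 0" "!!n. \<bar>p n\<bar> <= C" using convergent_imp_Bseq[OF convergentI[OF pl]] by (auto simp: Bseq_def)
  have "r / 2 > 0" using r by simp
  from ev[OF this] have dC: "EVN n. dmart n t <= 2 * C / r"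
  proof (rule eventually_mono)
   fix n assume "0 <= dmart n t & Mart 0 n t = exp (- p n) & 0 <= p n & \<bar>p n - r * dmart n t\<bar> <= r / 2 * dmart n t"
   then have "r * dmart n t - p n <= r / 2 * dmart n t" by (simp only: abs_le_iff) linarith
   then have "r / 2 * dmart n t <= p n" by simp
   also have "... <= C" using C(2)[of n] by simp
   finally have "dmart n t * r <= 2 * C" by (simp add: mult.commute)
   then show "dmart n t <= 2 * C / r" using r by (subst pos_le_divide_eq)
  qed
  have "(%n. p n - r * dmart n t) ---> 0"
  proof (rule tendstoI)
   fix e :: real assume e: "e > 0"
   define eps where "eps = e * r / (4 * C)"
   have eps: "eps > 0" using e C r by (simp add: eps_def)
   show "EVN n. dist (p n - r * dmart n t) 0 < e" using ev[OF eps] dC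
   proof eventually_elim
    case (elim n)
    have "eps * dmart n t <= eps * (2 * C / r)" using elim(2) eps by (intro mult_left_mono) auto
    also have "... = e / 2" using C r by (simp add: eps_def)
    finally have "eps * dmart n t <= e / 2" .
    moreover have "\<bar>p n - r * dmart n t\<bar> <= eps * dmart n t" using elim(1) by blast
    ultimately have "\<bar>p n - r * dmart n t\<bar> < e" using e by linarith
    then show ?case by (simp add: dist_real_def)
   qed
  qed
  then have "(%n. (p n - (p n - r * dmart n t)) / r) ---> (- ln m - 0) / r" using r by (intro tendsto_intros pl) auto
  then have "(%n. dmart n t) ---> (- ln m - 0) / r" using r by simp
  then show ?thesis by (auto simp: convergent_def)
 qed
qed

lemma lam_tendsto_0: "(lam \<longlongrightarrow> 0) at_top" proof -
 obtain A where A: "A \<ge> 1" "!!y. y \<ge> A ==> \<bar>lam y - r * y * exp (- y)\<bar> <= 1 * (y * exp (- y))"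
  using lam_asymptotics[OF zero_less_one] by blast
 have U: "((%y::real. (r + 1) * (y * exp (- y))) \<longlongrightarrow> 0) at_top" by real_asymp
 have ev: "\<forall>\<^sub>F y in at_top. lam y <= (r + 1) * (y * exp (- y))" using eventually_ge_at_top[of A]
 proof eventually_elim
  case (elim y)
  then have "lam y - r * y * exp (- y) <= 1 * (y * exp (- y))" using A(2)[of y] by (blast dest: abs_le_D1)
  then show ?case unfolding distrib_right mult.assoc by linarith
 qed
 show ?thesis by (rule tendsto_sandwich[OF _ ev tendsto_const U]) (simp add: lam_nonneg)
qed

text \<open>On the event that the derivative martingale tends to infinity every \<open>Mart x\<close> with \<open>x \<ge> 0\<close> tends to \<open>0\<close>. Its expectation is \<open>exp (- lam x)\<close>, which tends to \<open>1\<close> as \<open>x\<close> grows, so this event is null.\<close>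
lemma AE_dmart_convergent: "AE t in fam. tame t & (%n. dmart n t) ---> dlim t & 0 <= dlim t & (%n. wsum n t) ---> 0" proof -
 have [measurable]: "dmart n \<in> bmeas fam" for n unfolding dmart_def by measurable
 define L where "L x t = lim (%n. Mart x n t)" for x t
 have [measurable]: "L x \<in> bmeas fam" for x unfolding L_def[abs_def] by measurable
 define E where "E = {t. \<not> convergent (%n. dmart n t)}"
 have Em [measurable]: "E \<in> sets fam" unfolding E_def
  using sets.sets_Collect_neg[OF sets_Collect_Cauchy[of "%n t. dmart n t" fam]] by (simp add: Cauchy_convergent_iff)
 have bound: "T.prob E <= 1 - exp (- lam x)" if x: "x \<ge> 0" for x proof -
  have l: "AE t in fam. (%n. Mart x n t) ---> L x t" using Mart_convergent[of x] by eventually_elim (simp add: L_def convergent_LIMSEQ_iff)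
  have "(%n. LINT t|fam. Mart x n t) ---> (LINT t|fam. L x t)"
   by (rule integral_dominated_convergence[where w = "%_. 1"]) (use l in \<open>auto simp: Mart_def\<close>)
  then have iL: "(LINT t|fam. L x t) = exp (- lam x)" by (simp add: integral_Mart LIMSEQ_const_iff)
  have L1: "AE t in fam. 0 <= L x t & L x t <= 1" using l by eventually_elim (auto intro: LIMSEQ_le_const LIMSEQ_le_const2 simp: Mart_bounds)
  have inL: "integrable fam (L x)" by (rule T.integrable_const_bound[of _ 1]) (use L1 in auto)
  have "AE t in fam. indicator E t <= 1 - L x t" using l L1 AE_tame Mart_convergent[of 0]
  proof eventually_elim
   case (elim t)
   show ?case
   proof (cases "t \<in> E")
    case True
    then have top: "filterlim (%n. dmart n t) at_top sequentially" using dmart_dichotomy[of t] elim by (auto simp: E_def)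
    have "(%n. Mart x n t) ---> 0"
    proof (rule tendsto_sandwich[OF _ _ tendsto_const])
     have "r / 2 > 0" using r by simp
     from psum_lam_estimate[OF elim(3) this, of x] tame_wsum[OF elim(3) order_refl]
     show "EVN n. Mart x n t <= exp (- (r / 2 * exp (- x) * dmart n t))"
     proof eventually_elim
      case (elim n)
      then obtain p where p: "p \<ge> 0" "psum (%v. ennreal (lam (x + v))) n t = ennreal p"
        "\<bar>p - r * (exp (- x) * (dmart n t + x * wsum n t))\<bar> <= r / 2 * (exp (- x) * (dmart n t + x * wsum n t))" by auto
      have "r / 2 * exp (- x) * dmart n t <= r / 2 * (exp (- x) * (dmart n t + x * wsum n t))" proof -
       have "exp (- x) * dmart n t <= exp (- x) * (dmart n t + x * wsum n t)" using elim(2) x by (intro mult_left_mono) auto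
       then show ?thesis using r by (simp add: mult.assoc mult_left_mono)
      qed
      also have "... <= p" proof -
       have "r * (exp (- x) * (dmart n t + x * wsum n t)) - p <= r / 2 * (exp (- x) * (dmart n t + x * wsum n t))"
        using p(3) by (simp only: abs_le_iff) linarith
       then show ?thesis by simp
      qed
      finally show ?case using p by (simp add: Mart_def nexp_ennreal)
     qed
     have "filterlim (%n. dmart n t * (r / 2 * exp (- x))) at_top sequentially"
      by (rule filterlim_at_top_mult_tendsto_pos[OF tendsto_const _ top]) (use r in simp)
     then have "filterlim (%n. - (dmart n t * (r / 2 * exp (- x)))) at_bot sequentially" by (simp add: filterlim_uminus_at_bot)
     from filterlim_compose[OF exp_at_bot this]
     show "(%n. exp (- (r / 2 * exp (- x) * dmart n t))) ---> 0" by (simp add: mult_ac)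
    qed (simp add: Mart_bounds)
    then have "L x t = 0" using elim(1) LIMSEQ_unique by blast
    then show ?thesis by simp
   qed (use elim in simp)
  qed
  then have "(LINT t|fam. indicator E t) <= (LINT t|fam. 1 - L x t)"
   by (intro integral_mono_AE Bintegrable_diff inL T.integrable_const_bound[of "indicator E" 1]) auto
  then show ?thesis using inL T.prob_space by (simp add: iL)
 qed
 have "((%x. 1 - exp (- lam x)) \<longlongrightarrow> 1 - exp (- 0)) at_top" by (intro tendsto_intros lam_tendsto_0)
 then have "T.prob E <= 1 - exp (- 0)" by (rule tendsto_lowerbound) (use bound in \<open>auto intro: eventually_at_top_linorderI[of 0]\<close>)
 then have "T.prob E = 0" using measure_nonneg[of fam E] by simp
 then have "E \<in> null_sets fam" using Em by (auto simp: null_sets_def T.emeasure_eq_measure)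
 then have "AE t in fam. t \<notin> E" by (rule AE_not_in)
 then show ?thesis using AE_tame
 proof eventually_elim
  case (elim t)
  then have D: "(%n. dmart n t) ---> dlim t" by (simp add: E_def dlim_def convergent_LIMSEQ_iff)
  have Z0: "0 <= dlim t" by (rule tendsto_lowerbound[OF D]) (use tame_wsum[OF elim(2), of 0] in \<open>auto elim: eventually_mono\<close>)
  have "(%n. wsum n t) ---> 0"
  proof (rule tendstoI)
   fix e :: real assume e: "e > 0"
   define A where "A = (dlim t + 1) / e"
   have A: "A > 0" using Z0 e by (simp add: A_def)
   have "EVN n. dmart n t < dlim t + 1" by (rule order_tendstoD(2)[OF D]) simp
   then show "EVN n. dist (wsum n t) 0 < e" using tame_wsum[OF elim(2) less_imp_le[OF A]]
   proof eventually_elim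
    case (elim n)
    then have "A * wsum n t < dlim t + 1" by linarith
    moreover have "A * e <= A * wsum n t" if "e <= wsum n t" using that A by (intro mult_left_mono) auto
    moreover have "A * e = dlim t + 1" using e by (simp add: A_def)
    ultimately have "wsum n t < e" by linarith
    then show ?case using elim by (simp add: dist_real_def)
   qed
  qed
  then show ?case using D Z0 elim by simp
 qed
qed

lemma measurable_dmart [measurable]: "dmart n \<in> bmeas fam" unfolding dmart_def by measurable

lemma measurable_Z [measurable]: "dlim \<in> bmeas fam" unfolding dlim_def[abs_def] by measurable

lemma AE_Z_nonneg: "AE t in fam. 0 <= dlim t" using AE_dmart_convergent by (rule eventually_mono) (elim conjE)

lemma Z_Laplace: "(LINT t|fam. exp (- (r * (exp (- x) * dlim t)))) = exp (- lam x)" proof -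
 have "(%n. LINT t|fam. Mart x n t) ---> (LINT t|fam. exp (- (r * (exp (- x) * dlim t))))"
 proof (rule integral_dominated_convergence[where w = "%_. 1"])
  show "AE t in fam. (%n. Mart x n t) ---> exp (- (r * (exp (- x) * dlim t)))" using AE_dmart_convergent
  proof eventually_elim
   case (elim t)
   then have "(%n. psum (%v. ennreal (lam (x + v))) n t) ---> ennreal (r * (exp (- x) * dlim t))" by (intro psum_lam_tendsto) auto
   from tendsto_nexp[OF this] show ?case using elim r by (simp add: Mart_def nexp_ennreal)
  qed
 qed (auto simp: Mart_def)
 then show ?thesis by (simp add: integral_Mart LIMSEQ_const_iff)
qed

lemma Z_positive: "T.prob {t. dlim t > 0} > 0"
proof (rule ccontr)
 assume "\<not> ?thesis"
 then have "T.prob {t. dlim t > 0} = 0" using measure_nonneg[of fam "{t. dlim t > 0}"] by linarith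
 then have "AE t in fam. \<not> 0 < dlim t" using iffD1[OF T.prob_eq_0[of "{t. dlim t > 0}"]] predE[of "%t. dlim t > 0" fam] by (simp del: T.prob_eq_0)
 then have z: "AE t in fam. dlim t = 0" using AE_Z_nonneg
 proof eventually_elim
  case (elim t)
  show ?case using elim(1) elim(2) by (rule antisym[OF leI])
 qed
 have "lam x = 0" for x proof -
  have "(LINT t|fam. exp (- (r * (exp (- x) * dlim t)))) = (LINT t|fam. 1)"
  proof (rule integral_cong_AE)
   show "AE t in fam. exp (- (r * (exp (- x) * dlim t))) = 1" using z by eventually_elim simp
  qed simp_all
  then show ?thesis using T.prob_space by (simp add: Z_Laplace)
 qed
 moreover obtain A where "A \<ge> 1" "!!y. y \<ge> A ==> \<bar>lam y - r * y * exp (- y)\<bar> <= r / 2 * (y * exp (- y))"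
  using lam_asymptotics[OF half_gt_zero[OF r]] by blast
 ultimately have "\<bar>0 - r * A * exp (- A)\<bar> <= r / 2 * (A * exp (- A))" by (metis order_refl)
 from abs_le_D2[OF this] have "r * (A * exp (- A)) <= r / 2 * (A * exp (- A))" by (simp add: mult.assoc)
 moreover have "A * exp (- A) > 0" using \<open>A \<ge> 1\<close> by simp
 ultimately show False using r by simp
qed

end

section \<open>The Laplace functional centered at the limit\<close>

lemma limit_by_eventual_approximation:
 fixes I :: "nat => real" and J :: "nat => nat => real"
 assumes IJ: "!!k. EVN n. \<bar>I n - J n k\<bar> <= \<eta> k" and \<eta>: "\<eta> ---> 0"
  and J: "!!k. (%n. J n k) ---> K k" and K: "K ---> T"
 shows "I ---> T"
proof (rule tendstoI)
 fix e :: real assume e: "e > 0"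
 have "EVN k. \<eta> k < e / 3 & dist (K k) T < e / 3"
  using order_tendstoD(2)[OF \<eta>, of "e / 3"] tendstoD[OF K, of "e / 3"] e by (intro eventually_conj) auto
 then obtain k where k: "\<eta> k < e / 3" "dist (K k) T < e / 3" using eventually_happens[of _ sequentially] by auto
 have "EVN n. dist (J n k) (K k) < e / 3" using tendstoD[OF J, of "e / 3"] e by simp
 then show "EVN n. dist (I n) T < e" using IJ[of k]
 proof eventually_elim
  case (elim n)
  then show "dist (I n) T < e" using k unfolding dist_real_def by linarith
 qed
qed

lemma limit_by_approximation:
 assumes "!!n k. \<bar>I n - J n k\<bar> <= (\<eta> k :: real)" "\<eta> ---> 0" "!!k. (%n. J n k) ---> K k" "K ---> T"
 shows "I ---> T" by (rule limit_by_eventual_approximation[OF always_eventually assms(2-4)]) (use assms(1) in blast)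

context tip begin

definition tipF :: "nat => real => family => real" where
 "tipF n s t = nexp (psum (%v. ennreal (\<kappa> (s + v - lg n))) n t)"

lemma tipF_bounds: "0 <= tipF n s t" "tipF n s t <= 1" by (simp_all add: tipF_def)

lemma measurable_psum_shift:
 assumes [measurable]: "g \<in> bmeas borel" "\<zeta> \<in> bmeas fam"
 shows "(%t. psum (%v. ennreal (g (\<zeta> t + v))) n t) \<in> bmeas fam" proof -
 have "(%p. psum (%v. ennreal (g (\<zeta> (fst p) + v))) n (snd p)) \<in> bmeas (fam \<Otimes>\<^sub>M fam)"
  by (rule measurable_psum_param[where g = "%t v. ennreal (g (\<zeta> t + v))"]) measurable
 from measurable_compose[of "%t. (t, t)" fam, OF _ this] show ?thesis by simp
qed

lemma measurable_tipF [measurable]: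
 assumes [measurable]: "\<zeta> \<in> bmeas fam"
 shows "(%t. tipF n (\<zeta> t) t) \<in> bmeas fam" proof -
 have [measurable]: "(%t. psum (%v. ennreal (\<kappa> (\<zeta> t + v - lg n))) n t) \<in> bmeas fam"
  using measurable_psum_shift[of "%u. \<kappa> (u - lg n)" \<zeta> n] by simp
 show ?thesis unfolding tipF_def by measurable
qed

lemma tipF_mono: "s <= s' ==> tipF n s t <= tipF n s' t" unfolding tipF_def by (intro nexp_antimono psum_mono ennreal_leI \<kappa>_antimono) simp

text \<open>The constant comes from \<open>y - y\<^sup>q \<le> q - 1\<close> for \<open>y\<close> in the unit interval and \<open>q = exp (b h)\<close>.\<close>
lemma tipF_lipschitz: "\<bar>tipF n s t - tipF n s' t\<bar> <= exp (b * \<bar>s - s'\<bar>) - 1" proof -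
 have *: "tipF n s t - tipF n (s - h) t <= exp (b * h) - 1" if h: "0 <= h" for s h proof -
  have "psum (%v. ennreal (\<kappa> (s - h + v - lg n))) n t <= psum (%v. ennreal (exp (b * h)) * ennreal (\<kappa> (s + v - lg n))) n t"
  proof (rule psum_mono)
   fix v
   have "\<kappa> (s - h + v - lg n) <= exp (b * h) * \<kappa> (s + v - lg n)" using \<kappa>_scale[OF h, of "s + v - lg n"] by (simp add: algebra_simps)
   then show "ennreal (\<kappa> (s - h + v - lg n)) <= ennreal (exp (b * h)) * ennreal (\<kappa> (s + v - lg n))"
    by (simp add: ennreal_mult'[symmetric] ennreal_leI)
  qed
  then have "psum (%v. ennreal (\<kappa> (s - h + v - lg n))) n t <= ennreal (exp (b * h)) * psum (%v. ennreal (\<kappa> (s + v - lg n))) n t"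
   by (simp only: psum_cmult)
  from nexp_antimono[OF this] have 1: "tipF n s t powr exp (b * h) <= tipF n (s - h) t" by (simp add: tipF_def nexp_powr)
  have q: "1 <= exp (b * h)" using h b by simp
  define w where "w = tipF n s t"
  have "exp (b * h) * w - (exp (b * h) - 1) <= w powr exp (b * h)" using q tipF_bounds by (intro powr_tangent) (simp_all add: w_def)
  moreover have "1 * w <= exp (b * h) * w" using q tipF_bounds by (intro mult_right_mono) (simp_all add: w_def)
  ultimately show ?thesis using 1 unfolding w_def by linarith
 qed
 show ?thesis
 proof (cases "s' <= s")
  case True
  then show ?thesis using *[of "s - s'" s] tipF_mono[of s' s n t] by (simp add: abs_if)
 next
  case False
  then have "tipF n s' t - tipF n (s' - (s' - s)) t <= exp (b * (s' - s)) - 1" by (intro *) simp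
  moreover have "tipF n s t <= tipF n s' t" using False by (intro tipF_mono) simp
  ultimately show ?thesis using False by (simp add: abs_minus_commute[of s] del: diff_ge_0_iff_ge)
 qed
qed

lemma dmart_trunc: "dmart k (trunc k t) = dmart k t" unfolding dmart_def by (rule gen_sum_trunc) simp

lemma integrable_01:
 fixes f :: "family => real"
 shows "f \<in> bmeas fam ==> (!!t. 0 <= f t) ==> (!!t. f t <= 1) ==> integrable fam f"
 by (rule T.integrable_const_bound[of _ 1]) (auto simp: abs_of_nonneg)

text \<open>With the starting point known at time \<open>k\<close>, the branching property and convergence of \<open>Lam\<close> apply.\<close>
lemma frozen_start:
 assumes ch: "continuous_on UNIV ch" and c01: "!!z. 0 <= ch z" "!!z. ch z <= 1"
 shows "(%n. LINT t|fam. ch (dmart k t) * tipF n (ln (dmart k t)) t)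
  ---> (LINT t|fam. ch (dmart k t) * nexp (psum (%v. ennreal (lam (ln (dmart k t) + v))) k t))" proof -
 have chm [measurable]: "ch \<in> bmeas borel" using ch by (rule borel_measurable_continuous_onI)
 define G where "G m t = ch (dmart k t) * nexp (psum (%v. ennreal (Lam (Suc m) (ln (dmart k t) + v - gap k (Suc m)))) k t)" for m t
 have Gm [measurable]: "G m \<in> bmeas fam" for m proof -
  have [measurable]: "Lam (Suc m) \<in> bmeas borel" by (rule Lam_measurable) simp
  have [measurable]: "(%t. psum (%v. ennreal (Lam (Suc m) (ln (dmart k t) + v - gap k (Suc m)))) k t) \<in> bmeas fam"
   using measurable_psum_shift[of "%u. Lam (Suc m) (u - gap k (Suc m))" "%t. ln (dmart k t)" k] by simp
  show ?thesis unfolding G_def by measurable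
 qed
 have lm [measurable]: "(%t. psum (%v. ennreal (lam (ln (dmart k t) + v))) k t) \<in> bmeas fam" by (rule measurable_psum_shift) measurable
 have G01: "0 <= G m t" "G m t <= 1" for m t using c01 by (auto simp: G_def intro: mult_le_one)
 have eq: "(LINT t|fam. ch (dmart k t) * tipF (Suc m + k) (ln (dmart k t)) t) = (LINT t|fam. G m t)" for m proof -
  have "(NN fam (%t. ennreal (ch (dmart k t)) * ennreal (nexp (psum (%v. ennreal (\<kappa> (ln (dmart k t) + v - lg (Suc m + k)))) (Suc m + k) t))))
   = (NN fam (%t. ennreal (ch (dmart k t)) * ennreal (nexp (psum (%v. ennreal (Lam (Suc m) (ln (dmart k t) + v - gap k (Suc m)))) k t))))"
  proof (rule branch_Phi[where C = 1])
   show "ennreal (ch (dmart k t)) <= ennreal 1" for t by (rule ennreal_leI) (rule c01)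
  qed (simp_all add: dmart_trunc)
  then have n: "(NN fam (%t. ennreal (ch (dmart k t) * tipF (Suc m + k) (ln (dmart k t)) t))) = (NN fam (%t. ennreal (G m t)))"
   by (simp only: tipF_def G_def ennreal_mult[OF c01(1) nexp_bounds(1)])
  have "(LINT t|fam. ch (dmart k t) * tipF (Suc m + k) (ln (dmart k t)) t) = enn2real (NN fam (%t. ennreal (ch (dmart k t) * tipF (Suc m + k) (ln (dmart k t)) t)))"
   by (rule integral_eq_nn_integral) (use c01 tipF_bounds in auto)
  also have "... = (LINT t|fam. G m t)" unfolding n by (rule integral_eq_nn_integral[symmetric]) (use G01 in auto)
  finally show ?thesis .
 qed
 have "(%m. LINT t|fam. G m t) ---> (LINT t|fam. ch (dmart k t) * nexp (psum (%v. ennreal (lam (ln (dmart k t) + v))) k t))"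
 proof (rule integral_dominated_convergence[where w = "%_. 1"])
  show "AE t in fam. (%m. G m t) ---> ch (dmart k t) * nexp (psum (%v. ennreal (lam (ln (dmart k t) + v))) k t)" using AE_good unfolding G_def
   by eventually_elim (intro tendsto_mult tendsto_const tendsto_nexp LIMSEQ_Suc psum_Lam_tendsto)
 qed (use G01 in auto)
 then have "(%m. LINT t|fam. ch (dmart k t) * tipF (m + Suc k) (ln (dmart k t)) t)
  ---> (LINT t|fam. ch (dmart k t) * nexp (psum (%v. ennreal (lam (ln (dmart k t) + v))) k t))" using eq by simp
 then show ?thesis by (rule LIMSEQ_offset)
qed

text \<open>The weight vanishes at \<open>0\<close>, where the logarithm is discontinuous.\<close>
lemma cutoff_limit:
 assumes ch: "continuous_on UNIV ch" and c01: "!!z. 0 <= ch z" "!!z. ch z <= 1"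
  and c0: "!!z. z <= 0 ==> ch z = 0"
 shows "(%n. LINT t|fam. ch (dlim t) * tipF n (ln (dlim t)) t) ---> exp (- r) * (LINT t|fam. ch (dlim t))" proof -
 have chm [measurable]: "ch \<in> bmeas borel" using ch by (rule borel_measurable_continuous_onI)
 have cl: "(%n. ch (x n)) ---> ch y" if "x ---> y" for x and y :: real using continuous_on_tendsto_compose[OF ch that] by simp
 have lm [measurable]: "(%t. psum (%v. ennreal (lam (ln (dmart k t) + v))) k t) \<in> bmeas fam" for k by (rule measurable_psum_shift) measurable
 define e where "e k t = \<bar>ch (dlim t) - ch (dmart k t)\<bar> + ch (dlim t) * min 1 (exp (b * \<bar>ln (dlim t) - ln (dmart k t)\<bar>) - 1)" for k t
 have e0: "0 <= e k t" for k t unfolding e_def using c01 b by (intro add_nonneg_nonneg mult_nonneg_nonneg) auto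
 have e2: "e k t <= 2" for k t proof -
  have "\<bar>ch (dlim t) - ch (dmart k t)\<bar> <= 1" using c01[of "dlim t"] c01[of "dmart k t"] by linarith
  moreover have "ch (dlim t) * min 1 (exp (b * \<bar>ln (dlim t) - ln (dmart k t)\<bar>) - 1) <= 1 * 1" using c01 b by (intro mult_mono) auto
  ultimately show ?thesis by (simp add: e_def)
 qed
 have em [measurable]: "e k \<in> bmeas fam" for k unfolding e_def by measurable
 have ie: "integrable fam (e k)" for k by (rule T.integrable_const_bound[of _ 2]) (use e0 e2 in auto)
 show ?thesis
 proof (rule limit_by_approximation[OF _ _ frozen_start[OF ch c01]])
  fix n k
  have i1: "integrable fam (%t. ch (dlim t) * tipF n (ln (dlim t)) t)"
   by (intro integrable_01) (use c01 tipF_bounds in \<open>auto intro!: mult_le_one\<close>)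
  have i2: "integrable fam (%t. ch (dmart k t) * tipF n (ln (dmart k t)) t)"
   by (intro integrable_01) (use c01 tipF_bounds in \<open>auto intro!: mult_le_one\<close>)
  have "\<bar>(LINT t|fam. ch (dlim t) * tipF n (ln (dlim t)) t) - (LINT t|fam. ch (dmart k t) * tipF n (ln (dmart k t)) t)\<bar>
   = \<bar>\<integral>t. ch (dlim t) * tipF n (ln (dlim t)) t - ch (dmart k t) * tipF n (ln (dmart k t)) t \<partial>fam\<bar>" using i1 i2 by simp
  also have "... <= (LINT t|fam. \<bar>ch (dlim t) * tipF n (ln (dlim t)) t - ch (dmart k t) * tipF n (ln (dmart k t)) t\<bar>)"
   by (rule integral_abs_bound)
  also have "... <= (LINT t|fam. e k t)"
  proof (intro integral_mono integrable_abs Bintegrable_diff i1 i2 ie)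
   fix t
   define F where "F = tipF n (ln (dlim t)) t"
   define F' where "F' = tipF n (ln (dmart k t)) t"
   have F: "0 <= F" "F <= 1" "0 <= F'" "F' <= 1" unfolding F_def F'_def by (rule tipF_bounds)+
   have "\<bar>F - F'\<bar> <= 1" using F by linarith
   then have l: "\<bar>F - F'\<bar> <= min 1 (exp (b * \<bar>ln (dlim t) - ln (dmart k t)\<bar>) - 1)" unfolding F_def F'_def using tipF_lipschitz by simp
   have "ch (dlim t) * F - ch (dmart k t) * F' = (ch (dlim t) - ch (dmart k t)) * F' + ch (dlim t) * (F - F')"
    by (simp only: left_diff_distrib right_diff_distrib)
   also have "\<bar>...\<bar> <= \<bar>ch (dlim t) - ch (dmart k t)\<bar> * \<bar>F'\<bar> + \<bar>ch (dlim t)\<bar> * \<bar>F - F'\<bar>"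
    unfolding abs_mult[symmetric] by (rule abs_triangle_ineq)
   also have "... <= \<bar>ch (dlim t) - ch (dmart k t)\<bar> * 1 + ch (dlim t) * min 1 (exp (b * \<bar>ln (dlim t) - ln (dmart k t)\<bar>) - 1)"
    using F c01 l by (intro add_mono mult_mono) auto
   finally show "\<bar>ch (dlim t) * tipF n (ln (dlim t)) t - ch (dmart k t) * tipF n (ln (dmart k t)) t\<bar> <= e k t" by (simp add: e_def F_def F'_def)
  qed
  finally show "\<bar>(LINT t|fam. ch (dlim t) * tipF n (ln (dlim t)) t) - (LINT t|fam. ch (dmart k t) * tipF n (ln (dmart k t)) t)\<bar> <= (LINT t|fam. e k t)" .
 next
  have "(%k. LINT t|fam. e k t) ---> (LINT t|fam. 0)"
  proof (rule integral_dominated_convergence[where w = "%_. 2"])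
   show "AE t in fam. (%k. e k t) ---> 0" using AE_dmart_convergent
   proof eventually_elim
    case (elim t)
    then have D: "(%n. dmart n t) ---> dlim t" and Z0: "0 <= dlim t" by blast+
    have 1: "(%k. \<bar>ch (dlim t) - ch (dmart k t)\<bar>) ---> \<bar>ch (dlim t) - ch (dlim t)\<bar>" by (intro tendsto_intros cl D)
    have 2: "(%k. ch (dlim t) * min 1 (exp (b * \<bar>ln (dlim t) - ln (dmart k t)\<bar>) - 1)) ---> 0"
    proof (cases "dlim t = 0")
     case True
     then show ?thesis using c0[of "dlim t"] by simp
    next
     case False
     have "(%k. ch (dlim t) * min 1 (exp (b * \<bar>ln (dlim t) - ln (dmart k t)\<bar>) - 1)) ---> ch (dlim t) * min 1 (exp (b * \<bar>ln (dlim t) - ln (dlim t)\<bar>) - 1)"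
      using False by (intro tendsto_intros D)
     then show ?thesis by simp
    qed
    show ?case unfolding e_def using tendsto_add[OF 1 2] by simp
   qed
  qed (use e0 e2 in auto)
  then show "(%k. LINT t|fam. e k t) ---> 0" by simp
 next
  have "(%k. LINT t|fam. ch (dmart k t) * nexp (psum (%v. ennreal (lam (ln (dmart k t) + v))) k t)) ---> (LINT t|fam. exp (- r) * ch (dlim t))"
  proof (rule integral_dominated_convergence[where w = "%_. 1"])
   show "AE t in fam. (%k. ch (dmart k t) * nexp (psum (%v. ennreal (lam (ln (dmart k t) + v))) k t)) ---> exp (- r) * ch (dlim t)"
    using AE_dmart_convergent
   proof eventually_elim
    case (elim t)
    then have tm: "tame t" and D: "(%n. dmart n t) ---> dlim t" and Z0: "0 <= dlim t" and w: "(%n. wsum n t) ---> 0" by blast+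
    show ?case
    proof (cases "dlim t = 0")
     case True
     have "(%k. ch (dmart k t)) ---> 0" using cl[OF D] c0[of 0] True by simp
     then have "(%k. ch (dmart k t) * nexp (psum (%v. ennreal (lam (ln (dmart k t) + v))) k t)) ---> 0"
      by (rule Lim_null_comparison[rotated]) (use c01 in \<open>auto simp: abs_mult intro!: always_eventually mult_left_le\<close>)
     then show ?thesis using True c0[of 0] by simp
    next
     case False
     have "(%k. ln (dmart k t)) ---> ln (dlim t)" using False by (intro tendsto_intros D)
     from psum_lam_tendsto[OF tm D w this]
     have "(%k. psum (%v. ennreal (lam (ln (dmart k t) + v))) k t) ---> ennreal (r * (exp (- ln (dlim t)) * dlim t))" .
     moreover have "exp (- ln (dlim t)) * dlim t = 1" using False Z0 by (simp add: exp_minus)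
     ultimately have "(%k. psum (%v. ennreal (lam (ln (dmart k t) + v))) k t) ---> ennreal r" by simp
     from tendsto_mult[OF cl[OF D] tendsto_nexp[OF this]] show ?thesis using r by (simp add: nexp_ennreal mult.commute)
    qed
   qed
   show "AE t in fam. norm (ch (dmart k t) * nexp (psum (%v. ennreal (lam (ln (dmart k t) + v))) k t)) <= 1" for k
    using c01 by (auto simp: abs_mult intro!: mult_le_one AE_I2)
  qed auto
  then show "(%k. LINT t|fam. ch (dmart k t) * nexp (psum (%v. ennreal (lam (ln (dmart k t) + v))) k t)) ---> exp (- r) * (LINT t|fam. ch (dlim t))"
   by simp
 qed
qed

lemma Laplace_limit:
 assumes \<alpha>: "0 <= \<alpha>"
 shows "(%n. LINT t|fam. tipF n (ln (dlim t)) t * exp (- \<alpha> * dlim t) * indicator {t. dlim t > 0} t)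
  ---> exp (- r) * (LINT t|fam. exp (- \<alpha> * dlim t) * indicator {t. dlim t > 0} t)" proof -
 define ch where "ch j z = exp (- \<alpha> * max z 0) * min 1 (max 0 (real j * z))" for j :: nat and z :: real
 have cc: "continuous_on UNIV (ch j)" for j unfolding ch_def[abs_def] by (intro continuous_intros)
 have c01: "0 <= ch j z" "ch j z <= 1" for j z unfolding ch_def using \<alpha> by (auto intro!: mult_le_one)
 have c0: "ch j z = 0" if "z <= 0" for j z using that by (simp add: ch_def mult_nonneg_nonpos max_absorb1)
 have chm [measurable]: "ch j \<in> bmeas borel" for j using cc by (rule borel_measurable_continuous_onI)
 define g where "g z = exp (- \<alpha> * z) * indicator {0<..} z" for z :: real
 have gm [measurable]: "g \<in> bmeas borel" unfolding g_def by measurable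
 have g01: "0 <= g z" "g z <= 1" for z unfolding g_def using \<alpha> by (auto simp: indicator_def)
 have cg: "(%j. ch j z) ---> g z" for z
 proof (cases "z <= 0")
  case True then show ?thesis by (simp add: c0 g_def)
 next
  case False
  have "EVN j. ch j z = g z"
  proof (rule eventually_sequentiallyI)
   fix j assume j: "nat \<lceil>1 / z\<rceil> <= j"
   have "1 / z <= real j" using j by linarith
   then have "1 <= real j * z" using False by (simp add: pos_divide_le_eq)
   then show "ch j z = g z" using False by (simp add: ch_def g_def)
  qed
  then show ?thesis by (rule tendsto_eventually)
 qed
 define \<eta> where "\<eta> j = (LINT t|fam. \<bar>g (dlim t) - ch j (dlim t)\<bar>)" for j
 have gc1: "\<bar>g z - ch j z\<bar> <= 1" for z j using g01[of z] c01[of j z] by linarith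
 have icg: "integrable fam (%t. \<bar>g (dlim t) - ch j (dlim t)\<bar>)" for j by (intro integrable_01) (use gc1 in auto)
 have "\<eta> ---> (LINT t|fam. 0)" unfolding \<eta>_def
 proof (rule integral_dominated_convergence[where w = "%_. 1"])
  show "AE t in fam. (%j. \<bar>g (dlim t) - ch j (dlim t)\<bar>) ---> 0"
  proof (rule AE_I2)
   fix t
   have "(%j. \<bar>g (dlim t) - ch j (dlim t)\<bar>) ---> \<bar>g (dlim t) - g (dlim t)\<bar>" by (intro tendsto_intros cg)
   then show "(%j. \<bar>g (dlim t) - ch j (dlim t)\<bar>) ---> 0" by simp
  qed
 qed (use gc1 in auto)
 then have \<eta>0: "\<eta> ---> 0" by simp
 have main: "(%n. LINT t|fam. g (dlim t) * tipF n (ln (dlim t)) t) ---> exp (- r) * (LINT t|fam. g (dlim t))"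
 proof (rule limit_by_approximation[OF _ \<eta>0 cutoff_limit[OF cc c01 c0]])
  fix n j
  have i1: "integrable fam (%t. g (dlim t) * tipF n (ln (dlim t)) t)"
   by (intro integrable_01) (use g01 tipF_bounds in \<open>auto intro!: mult_le_one\<close>)
  have i2: "integrable fam (%t. ch j (dlim t) * tipF n (ln (dlim t)) t)"
   by (intro integrable_01) (use c01 tipF_bounds in \<open>auto intro!: mult_le_one\<close>)
  have "\<bar>(LINT t|fam. g (dlim t) * tipF n (ln (dlim t)) t) - (LINT t|fam. ch j (dlim t) * tipF n (ln (dlim t)) t)\<bar>
   = \<bar>\<integral>t. g (dlim t) * tipF n (ln (dlim t)) t - ch j (dlim t) * tipF n (ln (dlim t)) t \<partial>fam\<bar>" using i1 i2 by simp
  also have "... <= (LINT t|fam. \<bar>g (dlim t) * tipF n (ln (dlim t)) t - ch j (dlim t) * tipF n (ln (dlim t)) t\<bar>)" by (rule integral_abs_bound)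
  also have "... <= \<eta> j" unfolding \<eta>_def
  proof (rule integral_mono[OF integrable_abs[OF Bintegrable_diff[OF i1 i2]] icg])
   fix t
   show "\<bar>g (dlim t) * tipF n (ln (dlim t)) t - ch j (dlim t) * tipF n (ln (dlim t)) t\<bar> <= \<bar>g (dlim t) - ch j (dlim t)\<bar>"
    unfolding left_diff_distrib[symmetric] abs_mult using tipF_bounds by (intro mult_left_le) auto
  qed
  finally show "\<bar>(LINT t|fam. g (dlim t) * tipF n (ln (dlim t)) t) - (LINT t|fam. ch j (dlim t) * tipF n (ln (dlim t)) t)\<bar> <= \<eta> j" .
 next
  have "(%j. LINT t|fam. ch j (dlim t)) ---> (LINT t|fam. g (dlim t))" by (rule integral_dominated_convergence[where w = "%_. 1"]) (use c01 cg in auto)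
  then show "(%j. exp (- r) * (LINT t|fam. ch j (dlim t))) ---> exp (- r) * (LINT t|fam. g (dlim t))" by (intro tendsto_intros)
 qed
 have e1: "g (dlim t) * tipF n (ln (dlim t)) t = tipF n (ln (dlim t)) t * exp (- \<alpha> * dlim t) * indicator {t. dlim t > 0} t" for n t
  by (simp add: g_def indicator_def)
 have e2: "g (dlim t) = exp (- \<alpha> * dlim t) * indicator {t. dlim t > 0} t" for t by (simp add: g_def indicator_def)
 show ?thesis using main unfolding e1 unfolding e2 .
qed

end

section \<open>The branching random walk as a random family\<close>

lemma infsum_eq_nn_integral_count_space:
 fixes f :: "'a :: countable => ennreal"
 shows "infsum f A = (NN (cs A) (%x. f x))" proof -
 have S: "infsum f A = (SUP F\<in>{F. finite F & F \<subseteq> A}. sum f F)" by (rule nonneg_infsum_complete) simp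
 show ?thesis
 proof (rule antisym)
  show "infsum f A <= (NN (cs A) (%x. f x))" unfolding S
  proof (rule SUP_least)
   fix F assume "F \<in> {F. finite F & F \<subseteq> A}"
   then have F: "finite F" "F \<subseteq> A" by auto
   have "sum f F = (NN (cs F) (%x. f x))" using F by (simp add: nn_integral_count_space_finite)
   also have "... <= (NN (cs A) (%x. f x))" using F(2) by (auto simp: nn_integral_count_space_indicator intro!: nn_integral_mono split: split_indicator)
   finally show "sum f F <= (NN (cs A) (%x. f x))" .
  qed
  have "(%N. \<Sum>z\<in>{z\<in>A. to_nat z < N}. f z) ---> (NN (cs A) (%x. f x))" by (rule count_sum_limit)
  then show "(NN (cs A) (%x. f x)) <= infsum f A"
  proof (rule LIMSEQ_le_const2, intro exI allI impI)
   fix N :: nat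
   have "finite {z\<in>A. to_nat z < N}" by (rule finite_subset[of _ "from_nat ` {..<N}"]) (auto intro!: image_eqI[of _ from_nat "to_nat _"])
   then show "(\<Sum>z\<in>{z\<in>A. to_nat z < N}. f z) <= infsum f A" unfolding S by (intro SUP_upper) auto
  qed
 qed
qed

lemma gen_sum_ennreal: "gen_sum labels n f t = gsum f n t" proof -
 have "gen_sum labels n f t = infsum (%z. f (roe (pos z t))) (generation labels n t)" by (simp add: gen_sum_def position_eq_pos)
 then show ?thesis by (simp add: infsum_eq_nn_integral_count_space gen_sum_nn)
qed

lemma psum_sum: "finite I ==> psum (%v. \<Sum>i\<in>I. f i v) n t = (\<Sum>i\<in>I. psum (f i) n t)"
proof (induction I rule: finite_induct)
 case empty
 show ?case by (simp add: psum_def)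
next
 case (insert i I)
 then show ?case by (simp add: psum_add)
qed

lemma nexp_sum_ennreal:
 assumes "finite I" "!!i. i \<in> I ==> 0 <= a i"
 shows "nexp (\<Sum>i\<in>I. ennreal (a i)) = exp (- (\<Sum>i\<in>I. a i))" using assms by (simp add: nexp_ennreal sum_nonneg)

context branching_random_walk begin

lemma displ_measurable [measurable]: "\<xi> u \<in> measurable M slots" using displ_indep by (simp add: indep_vars_def2)

lemma tree_law: "tree_law L" proof -
 have "prob_space L" unfolding displ_law[of "[]", symmetric] by (rule prob_space_distr) measurable
 moreover have "sets L = sets slots" unfolding displ_law[of "[]", symmetric] by simp
 ultimately show ?thesis by (simp add: tree_law_def tree_law_axioms_def)
qed

sublocale T: tree_law L by (rule tree_law)

lemma displ_families [measurable]: "(%w u. \<xi> u w) \<in> measurable M (T.fam)"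
 by (rule T.measurable_familiesI) (simp add: measurable_cong_sets[OF refl T.sets_L])

text \<open>Independence of the offspring says that the whole family of displacements has the product law.\<close>
lemma distr_displ: "distr M (T.fam) (%w u. \<xi> u w) = T.fam" proof -
 have "distr M (Pi\<^sub>M UNIV (%_. slots)) (%x. \<lambda>i\<in>UNIV. \<xi> i x) = Pi\<^sub>M UNIV (%i. distr M slots (\<xi> i))"
  using displ_indep by (subst (asm) indep_vars_iff_distr_eq_PiM) auto
 then have "distr M (Pi\<^sub>M UNIV (%_. slots)) (%w u. \<xi> u w) = T.fam" by (simp add: displ_law restrict_def)
 moreover have "sets (Pi\<^sub>M UNIV (%_::nat list. L)) = sets (Pi\<^sub>M UNIV (%_. slots))" by (rule sets_PiM_cong) simp_all
 ultimately show ?thesis by (metis distr_cong)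
qed

lemma transfer_nn:
 "f \<in> bmeas (T.fam) ==> (NN M (%w. f (%u. \<xi> u w))) = (NN T.fam (%t. f t))" by (subst distr_displ[symmetric], subst nn_integral_distr) auto

lemma transfer_integral:
 fixes f :: "family => real"
 shows "f \<in> bmeas (T.fam) ==> (LINT w|M. f (%u. \<xi> u w)) = (LINT t|T.fam. f t)" by (subst distr_displ[symmetric], subst integral_distr) auto

lemma transfer_AE:
 assumes "AE t in T.fam. P t"
 shows "AE w in M. P (%u. \<xi> u w)" using assms by (subst (asm) distr_displ[symmetric]) (rule AE_distrD[OF displ_families])

lemma no_MInf_L: "AE l in L. \<forall>k. l k ~= - \<infinity>" unfolding displ_law[of "[]", symmetric]
 by (subst AE_distr_iff) (auto intro!: AE_I2 displ_not_MInf)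

lemma expected_sum_first_generation:
 assumes [measurable]: "\<phi> \<in> bmeas borel"
 shows "(NN M (%w. gen_sum \<xi> 1 (%v. ennreal (exp (- v)) * \<phi> v) w)) = (NN (step_law L) (%v. \<phi> v))" proof -
 have [measurable]: "(%l. l k) \<in> bmeas L" for k by (simp add: measurable_cong_sets[OF T.sets_L refl])
 have Bm: "(%l. (NN (cs UNIV) (%k. (if finr (l k) then ennreal (exp (- roe (l k))) * \<phi> (roe (l k)) else 0)))) \<in> bmeas L"
  by (rule measurable_count_sum) auto
 define G where "G = gsum (%v. ennreal (exp (- v)) * \<phi> v) 1"
 have Gm: "G \<in> bmeas (T.fam)" unfolding G_def by measurable
 have "(NN M (%w. gen_sum \<xi> 1 (%v. ennreal (exp (- v)) * \<phi> v) w)) = (NN M (%w. G (%u. \<xi> u w)))"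
  by (subst gen_sum_labels) (simp add: gen_sum_ennreal G_def)
 also have "... = (NN T.fam (%t. G t))" by (rule transfer_nn[OF Gm])
 also have "... = (NN T.fam (%t. (NN (cs UNIV) (%k. (if finr (t [] k) then ennreal (exp (- roe (t [] k))) * \<phi> (roe (t [] k)) else 0)))))"
 proof (rule nn_integral_cong_AE, rule AE_mp[OF T.AE_slots[OF no_MInf_L]], intro AE_I2 impI)
  fix t :: family assume "\<forall>u k. t u k ~= - \<infinity>"
  then show "G t = (NN (cs UNIV) (%k. (if finr (t [] k) then ennreal (exp (- roe (t [] k))) * \<phi> (roe (t [] k)) else 0)))"
   by (simp add: G_def gsum_eq_psum psum_def lev_1_sum cong: if_cong)
 qed
 also have "... = (NN (distr (T.fam) L (%t. t [])) (%l. (NN (cs UNIV) (%k. (if finr (l k) then ennreal (exp (- roe (l k))) * \<phi> (roe (l k)) else 0)))))"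
  by (rule nn_integral_distr[symmetric]) (use Bm in \<open>simp_all add: T.measurable_familiesI\<close>)
 also have "... = (NN (step_law L) (%v. \<phi> v))" by (simp add: T.distr_root T.nn_integral_step_law)
 finally show ?thesis .
qed

text \<open>The first moments of the boundary case are the total mass and the mean of the tilted step law. If its variance were \<open>0\<close>, all children would sit at \<open>0\<close>, which is a lattice.\<close>
lemma brw_law:
 assumes boundary: "boundary_case M \<xi>" and nl: "non_lattice L" and mom: "moment_conditions M \<xi>"
 shows "brw_law L" proof -
 let ?\<nu> = "step_law L"
 have sets [measurable_cong, simp]: "sets ?\<nu> = sets borel" by (rule T.sets_step_law)
 have sp [simp]: "space ?\<nu> = UNIV" using sets_eq_imp_space_eq[OF sets] by simp
 have "(NN (?\<nu>) (%v. 1)) = 1" using expected_sum_first_generation[of "%_. 1"] boundary by (simp add: boundary_case_def)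
 then interpret \<nu>: prob_space ?\<nu> by (intro prob_spaceI) simp
 have sq: "(NN (?\<nu>) (%v. ennreal (v^2))) < \<infinity>" proof -
  have "(%v::real. ennreal (exp (- v)) * ennreal (v^2)) = (%v. ennreal (v^2 * exp (- v)))" by (simp add: ennreal_mult'[symmetric] mult.commute)
  then show ?thesis using expected_sum_first_generation[of "%v. ennreal (v^2)"] mom by (simp add: moment_conditions_def)
 qed
 have isq: "integrable ?\<nu> (%v. v^2)" using sq by (intro integrableI_bounded) auto
 have iv: "integrable ?\<nu> (%v. v)" by (rule \<nu>.square_integrable_imp_integrable[OF _ isq]) measurable
 have mean: "(\<integral>v. v \<partial>?\<nu>) = 0" proof -
  define P where "P = gsum (%v. ennreal (v * exp (- v))) 1"
  define N where "N = gsum (%v. ennreal (- (v * exp (- v)))) 1"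
  have Pm [measurable]: "P \<in> bmeas (T.fam)" unfolding P_def by measurable
  have Nm [measurable]: "N \<in> bmeas (T.fam)" unfolding N_def by measurable
  have e1: "(%v::real. ennreal (exp (- v)) * ennreal v) = (%v. ennreal (v * exp (- v)))" by (rule ext) (simp add: ennreal_mult''[symmetric] mult.commute)
  have e2: "(%v::real. ennreal (exp (- v)) * ennreal (- v)) = (%v. ennreal (- (v * exp (- v))))"
   by (rule ext) (simp add: ennreal_mult''[symmetric] mult.commute)
  have PG: "P (%u. \<xi> u w) = gen_sum \<xi> 1 (%v. ennreal (v * exp (- v))) w" for w by (subst gen_sum_labels) (simp add: gen_sum_ennreal P_def)
  have NG: "N (%u. \<xi> u w) = gen_sum \<xi> 1 (%v. ennreal (- (v * exp (- v)))) w" for w by (subst gen_sum_labels) (simp add: gen_sum_ennreal N_def)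
  have EP: "(NN M (%w. P (%u. \<xi> u w))) = (NN (?\<nu>) (%v. ennreal v))" using expected_sum_first_generation[of "%v. ennreal v"] unfolding e1 PG by simp
  have EN: "(NN M (%w. N (%u. \<xi> u w))) = (NN (?\<nu>) (%v. ennreal (- v)))"
   using expected_sum_first_generation[of "%v. ennreal (- v)"] unfolding e2 NG by simp
  have fin: "(NN (?\<nu>) (%v. ennreal v)) < \<infinity>" "(NN (?\<nu>) (%v. ennreal (- v))) < \<infinity>"
   using iv by (auto simp: real_integrable_def less_top[symmetric])
  have AEP: "AE w in M. P (%u. \<xi> u w) ~= \<infinity>" using fin(1) by (intro nn_integral_noteq_infinite) (auto simp: EP)
  have AEN: "AE w in M. N (%u. \<xi> u w) ~= \<infinity>" using fin(2) by (intro nn_integral_noteq_infinite) (auto simp: EN)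
  have hP: "has_bochner_integral M (%w. enn2real (P (%u. \<xi> u w))) (enn2real (NN (?\<nu>) (%v. ennreal v)))"
  proof (rule has_bochner_integral_nn_integral)
   have "(NN M (%w. ennreal (enn2real (P (%u. \<xi> u w))))) = (NN M (%w. P (%u. \<xi> u w)))"
    by (rule nn_integral_cong_AE) (use AEP in eventually_elim, auto simp: less_top[symmetric])
   then show "(NN M (%w. ennreal (enn2real (P (%u. \<xi> u w))))) = ennreal (enn2real (NN (?\<nu>) (%v. ennreal v)))"
    using fin by (simp add: EP less_top[symmetric])
  qed auto
  have hN: "has_bochner_integral M (%w. enn2real (N (%u. \<xi> u w))) (enn2real (NN (?\<nu>) (%v. ennreal (- v))))"
  proof (rule has_bochner_integral_nn_integral)
   have "(NN M (%w. ennreal (enn2real (N (%u. \<xi> u w))))) = (NN M (%w. N (%u. \<xi> u w)))"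
    by (rule nn_integral_cong_AE) (use AEN in eventually_elim, auto simp: less_top[symmetric])
   then show "(NN M (%w. ennreal (enn2real (N (%u. \<xi> u w))))) = ennreal (enn2real (NN (?\<nu>) (%v. ennreal (- v))))"
    using fin by (simp add: EN less_top[symmetric])
  qed auto
  have "(LINT w|M. gen_sum \<xi> 1 (%v. v * exp (- v)) w)
    = (LINT w|M. enn2real (P (%u. \<xi> u w)) - enn2real (N (%u. \<xi> u w)))"
  proof (rule integral_cong_AE)
   show "AE w in M. gen_sum \<xi> 1 (%v. v * exp (- v)) w = enn2real (P (%u. \<xi> u w)) - enn2real (N (%u. \<xi> u w))" using AEP AEN
   proof eventually_elim
    case (elim w)
    have "gsum (%v. ennreal \<bar>v * exp (- v)\<bar>) 1 t = P t + N t" for t proof -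
     have "P t + N t = (NN (cs (lev 1)) (%z. (if pos z t ~= \<infinity> then ennreal (roe (pos z t) * exp (- roe (pos z t))) else 0)
      + (if pos z t ~= \<infinity> then ennreal (- (roe (pos z t) * exp (- roe (pos z t)))) else 0)))"
      unfolding P_def N_def gsum_def by (rule nn_integral_add[symmetric]) auto
     moreover have "ennreal x + ennreal (- x) = ennreal \<bar>x\<bar>" for x by (cases "0 <= x") (simp_all add: ennreal_neg)
     ultimately show ?thesis unfolding gsum_def by (auto intro!: nn_integral_cong)
    qed
    then have "gsum (%v. ennreal \<bar>v * exp (- v)\<bar>) 1 (%u. \<xi> u w) < \<infinity>" using elim by (simp add: less_top[symmetric])
    then show ?case by (subst gen_sum_labels, subst gen_sum_real) (simp add: P_def N_def)
   qed
   have "(%w. gen_sum labels 1 (%v. v * exp (- v)) (%u. \<xi> u w)) \<in> bmeas M" by (rule measurable_compose[OF displ_families]) measurable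
   then show "gen_sum \<xi> 1 (%v. v * exp (- v)) \<in> bmeas M" by (subst gen_sum_labels[abs_def])
  qed measurable
  also have "... = enn2real (NN (?\<nu>) (%v. ennreal v)) - enn2real (NN (?\<nu>) (%v. ennreal (- v)))"
   by (rule has_bochner_integral_integral_eq[OF has_bochner_integral_diff[OF hP hN]])
  also have "... = (\<integral>v. v \<partial>?\<nu>)" by (rule real_lebesgue_integral_def[OF iv, symmetric])
  finally show ?thesis using has_bochner_integral_integral_eq[of M "gen_sum \<xi> 1 (%v. v * exp (- v))" 0] boundary by (simp add: boundary_case_def)
 qed
 have var: "(\<integral>v. v^2 \<partial>?\<nu>) > 0"
 proof (rule ccontr)
  assume "\<not> ?thesis"
  moreover have "0 <= (\<integral>v. v^2 \<partial>?\<nu>)" by (intro integral_nonneg_AE AE_I2) simp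
  ultimately have "(\<integral>v. v^2 \<partial>?\<nu>) = 0" by linarith
  then have z: "(NN (?\<nu>) (%v. ennreal (v^2))) = 0" by (subst nn_integral_eq_integral[OF isq]) auto
  have [measurable]: "(%l. l k) \<in> bmeas L" for k by (simp add: measurable_cong_sets[OF T.sets_L refl])
  have "(%l. (NN (cs UNIV) (%k. (if finr (l k) then ennreal (exp (- roe (l k))) * ennreal ((roe (l k))^2) else 0)))) \<in> bmeas L"
   by (rule measurable_count_sum) auto
  then have "AE l in L. (NN (cs UNIV) (%k. (if finr (l k) then ennreal (exp (- roe (l k))) * ennreal ((roe (l k))^2) else 0))) = 0"
   using z by (subst (asm) T.nn_integral_step_law) (auto simp: nn_integral_0_iff_AE)
  then have "AE l in L. \<forall>k. l k ~= \<infinity> --> (\<exists>m :: int. l k = ereal (0 + 1 * of_int m))" using no_MInf_L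
  proof eventually_elim
   case (elim l)
   show ?case
   proof (intro allI impI exI[of _ 0])
    fix k assume k: "l k ~= \<infinity>"
    then obtain v where v: "l k = ereal v" using elim(2) by (cases "l k") auto
    have "(if finr (l k) then ennreal (exp (- roe (l k))) * ennreal ((roe (l k))^2) else 0) = 0"
     using elim(1) by (subst (asm) nn_integral_0_iff_AE) (auto simp: AE_count_space)
    then have "ennreal (exp (- v)) * ennreal (v^2) = 0" using v by simp
    then have "ennreal (exp (- v) * v^2) = 0" by (subst ennreal_mult) simp_all
    then have "exp (- v) * v^2 <= 0" by (simp only: ennreal_eq_0_iff)
    moreover have "0 < exp (- v) * v^2" if "v ~= 0" using that by (intro mult_pos_pos) simp_all
    ultimately have "v = 0" by fastforce
    then show "l k = ereal (0 + 1 * of_int 0)" using v by simp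
   qed
  qed
  then have "\<exists>a h :: real. h > 0 & (AE l in L. \<forall>k. l k ~= \<infinity> --> (\<exists>m :: int. l k = ereal (a + h * of_int m)))"
   by (intro exI[of _ "0::real"] exI[of _ "1::real"] conjI zero_less_one)
  then show False using nl unfolding non_lattice_def by blast
 qed
 show ?thesis by unfold_locales (use mean isq var no_MInf_L in auto)
qed

end

section \<open>The joint Laplace transform\<close>

text \<open>At \<open>s = ln Z\<close> this is \<open>mu_hat\<close>, and up to a factor it is \<open>W_tilde\<close>.\<close>
definition partition :: "(nat list => 'w => nat => ereal) => nat => real => real => 'w => real" where
 "partition \<xi> n b s w = real n powr (3/2 * b) * gen_sum \<xi> n (%v. exp (- b * (v + s))) w"

lemma partition_labels: "partition \<xi> n b s w = partition labels n b s (%u. \<xi> u w)" unfolding partition_def by (subst gen_sum_labels) simp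

lemma partition_W_tilde: "partition \<xi> n b s w = exp (- b * s) * W_tilde \<xi> n b w" proof -
 have "(%v::real. exp (- b * (v + s))) = (%v. exp (- b * s) * exp (- b * v))" by (simp add: fun_eq_iff exp_add[symmetric] distrib_left)
 then show ?thesis by (simp add: partition_def W_tilde_def gen_sum_def infsum_cmult_right')
qed

lemma partition_mu_hat: "mu_hat \<xi> n b w = partition \<xi> n b (ln (Z_inf \<xi> w)) w" by (simp add: mu_hat_def partition_def)

lemma partition_nonneg: "0 <= partition \<xi> n b s w" unfolding partition_def gen_sum_def by (intro mult_nonneg_nonneg infsum_nonneg) auto

lemma psum_partition:
 assumes t: "good t" "\<forall>u k. t u k ~= - \<infinity>" and n: "0 < n" and b: "1 <= b"
 shows "psum (%v. ennreal (exp (- b * (s + v - lg n)))) n t = ennreal (partition labels n b s t)" proof -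
 have fin: "psum (%v. ennreal (exp (- b * (v + s)))) n t < \<infinity>"
 proof (rule psum_finite_if_dominated[OF t(1)])
  fix s' :: real
  have "exp (- b * (v + s)) <= exp (- b * s + (b - 1) * s') * ((1 + v^2) * exp (- v))" if v: "- s' <= v" for v proof -
   have "(b - 1) * (- v) <= (b - 1) * s'" using v b by (intro mult_left_mono) auto
   then have "- b * (v + s) <= (- b * s + (b - 1) * s') + - v" by (simp add: algebra_simps)
   then have "exp (- b * (v + s)) <= exp (- b * s + (b - 1) * s') * exp (- v)" unfolding exp_add[symmetric] by simp
   also have "exp (- v) <= (1 + v^2) * exp (- v)" by (simp add: mult_le_cancel_right1)
   finally show ?thesis by (simp add: mult_left_mono)
  qed
  then show "\<exists>C\<ge>0. \<forall>v\<ge>- s'. exp (- b * (v + s)) <= C * ((1 + v^2) * exp (- v))"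
   by (intro exI[of _ "exp (- b * s + (b - 1) * s')"]) auto
 qed
 have g: "ennreal (gen_sum labels n (%v. exp (- b * (v + s))) t) = psum (%v. ennreal (exp (- b * (v + s)))) n t"
  using fin by (subst gen_sum_nonneg_psum[OF t(2) _ fin]) auto
 have e: "exp (- b * (s + v - lg n)) = real n powr (3/2 * b) * exp (- b * (v + s))" for v proof -
  have "real n powr (3/2 * b) = exp (b * lg n)" using n by (simp add: powr_def lg_def)
  moreover have "- b * (s + v - lg n) = b * lg n + - b * (v + s)" by (simp add: algebra_simps)
  ultimately show ?thesis by (simp only: exp_add)
 qed
 have "psum (%v. ennreal (exp (- b * (s + v - lg n)))) n t = psum (%v. ennreal (real n powr (3/2 * b)) * ennreal (exp (- b * (v + s)))) n t"
  unfolding e by (intro psum_cong) (simp add: ennreal_mult')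
 also have "... = ennreal (partition labels n b s t)" unfolding psum_cmult g[symmetric] partition_def
  by (rule ennreal_mult[symmetric]) (auto simp: gen_sum_def intro!: infsum_nonneg)
 finally show ?thesis .
qed

locale critical_brw = branching_random_walk M L \<xi>
 for M :: "'w measure" and L \<xi> +
 fixes \<beta> :: "real ^ 'd" and \<rho> :: "real ^ 'd => real"
 assumes boundary: "boundary_case M \<xi>"
  and nonlattice: "non_lattice L"
  and moments: "moment_conditions M \<xi>"
  and beta: "!!i. \<beta> $ i > 1"
  and rho: "is_rho M \<xi> \<beta> \<rho>"
begin

sublocale brw: brw_law L by (rule brw_law[OF boundary nonlattice moments])

definition \<kappa> :: "real ^ 'd => real => real" where
 "\<kappa> \<theta> u = (\<Sum>i\<in>UNIV. \<theta> $ i * exp (- (\<beta> $ i) * u))"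

lemma nexp_partition:
 assumes t: "good t" "\<forall>u k. t u k ~= - \<infinity>" and n: "0 < n" and \<theta>: "!!i. \<theta> $ i > 0"
 shows "nexp (psum (%v. ennreal (\<kappa> \<theta> (s + v - lg n))) n t)
  = exp (- (\<Sum>i\<in>UNIV. \<theta> $ i * partition labels n (\<beta> $ i) s t))" proof -
 have b: "1 <= \<beta> $ i" for i using beta[of i] by simp
 have "psum (%v. ennreal (\<kappa> \<theta> (s + v - lg n))) n t
   = psum (%v. \<Sum>i\<in>UNIV. ennreal (\<theta> $ i) * ennreal (exp (- (\<beta> $ i) * (s + v - lg n)))) n t"
  unfolding \<kappa>_def using \<theta> by (intro psum_cong) (simp add: sum_ennreal less_imp_le flip: ennreal_mult)
 also have "... = (\<Sum>i\<in>UNIV. ennreal (\<theta> $ i * partition labels n (\<beta> $ i) s t))"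
  using \<theta> by (simp only: psum_sum[OF finite] psum_cmult psum_partition[OF t n b] ennreal_mult[OF less_imp_le[OF \<theta>] partition_nonneg])
 finally show ?thesis using \<theta> by (simp only:) (intro nexp_sum_ennreal mult_nonneg_nonneg partition_nonneg less_imp_le, simp)
qed

text \<open>The exponents above \<open>1\<close> make \<open>exp u * \<kappa> \<theta> u\<close> decay for large \<open>u\<close>; for negative \<open>u\<close> the truncation at \<open>1\<close> suffices.\<close>
lemma tip:
 assumes \<theta>: "!!i. \<theta> $ i > 0"
 shows "tip L (\<kappa> \<theta>) (Max (range (%i. \<beta> $ i))) (min 1 (Min (range (%i. \<beta> $ i - 1)))) (max 1 (\<Sum>i\<in>UNIV. \<theta> $ i)) (\<rho> \<theta>)"
proof
 let ?b = "Max (range (%i. \<beta> $ i))" and ?m = "Min (range (%i. \<beta> $ i - 1))"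
 have b_ge: "\<beta> $ i <= ?b" for i by (intro Max_ge) auto
 have m_le: "?m <= \<beta> $ i - 1" for i by (intro Min_le) auto
 have m0: "?m > 0" using beta by (subst Min_gr_iff) auto
 have \<beta>0: "\<beta> $ i > 0" for i using beta[of i] by simp
 show "\<kappa> \<theta> \<in> bmeas borel" unfolding \<kappa>_def[abs_def] by measurable
 show "0 <= \<kappa> \<theta> u" for u unfolding \<kappa>_def using \<theta> by (intro sum_nonneg mult_nonneg_nonneg) (auto intro: less_imp_le)
 show "\<kappa> \<theta> v <= \<kappa> \<theta> u" if "u <= v" for u v
  unfolding \<kappa>_def using \<theta> \<beta>0 that by (intro sum_mono mult_left_mono) (auto intro: less_imp_le)
 show "\<kappa> \<theta> (u - h) <= exp (?b * h) * \<kappa> \<theta> u" if h: "0 <= h" for u h unfolding \<kappa>_def sum_distrib_left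
 proof (rule sum_mono)
  fix i
  have "\<beta> $ i * h <= ?b * h" using h b_ge by (intro mult_right_mono)
  then have "- (\<beta> $ i) * (u - h) <= ?b * h + - (\<beta> $ i) * u" by (simp add: right_diff_distrib)
  then have "exp (- (\<beta> $ i) * (u - h)) <= exp (?b * h) * exp (- (\<beta> $ i) * u)" unfolding exp_add[symmetric] by simp
  then have "\<theta> $ i * exp (- (\<beta> $ i) * (u - h)) <= \<theta> $ i * (exp (?b * h) * exp (- (\<beta> $ i) * u))"
   using \<theta>[of i] by (intro mult_left_mono) auto
  then show "\<theta> $ i * exp (- (\<beta> $ i) * (u - h)) <= exp (?b * h) * (\<theta> $ i * exp (- (\<beta> $ i) * u))" by (simp only: mult.left_commute)
 qed
 show "?b > 0" using \<beta>0 b_ge by (meson less_le_trans)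
 show "min 1 ?m > 0" using m0 by simp
 show "max 1 (\<Sum>i\<in>UNIV. \<theta> $ i) \<ge> 0" by simp
 show "exp u * min 1 (\<kappa> \<theta> u) <= max 1 (\<Sum>i\<in>UNIV. \<theta> $ i) * exp (- min 1 ?m * \<bar>u\<bar>)" for u
 proof (cases "u <= 0")
  case True
  have "min 1 ?m * \<bar>u\<bar> <= 1 * \<bar>u\<bar>" by (intro mult_right_mono) auto
  then have "exp u <= exp (- min 1 ?m * \<bar>u\<bar>)" using True by simp
  moreover have "exp u * min 1 (\<kappa> \<theta> u) <= exp u * 1" by (intro mult_left_mono) auto
  moreover have "1 * exp (- min 1 ?m * \<bar>u\<bar>) <= max 1 (\<Sum>i\<in>UNIV. \<theta> $ i) * exp (- min 1 ?m * \<bar>u\<bar>)"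
   by (intro mult_right_mono) auto
  ultimately show ?thesis by linarith
 next
  case False
  have "exp u * min 1 (\<kappa> \<theta> u) <= exp u * \<kappa> \<theta> u" by (intro mult_left_mono) auto
  also have "... = (\<Sum>i\<in>UNIV. \<theta> $ i * exp (- (\<beta> $ i - 1) * u))" unfolding \<kappa>_def sum_distrib_left
  proof (rule sum.cong[OF refl])
   fix i
   have "exp u * exp (- (\<beta> $ i) * u) = exp (- (\<beta> $ i - 1) * u)" unfolding exp_add[symmetric] by (simp add: left_diff_distrib)
   then have "\<theta> $ i * (exp u * exp (- (\<beta> $ i) * u)) = \<theta> $ i * exp (- (\<beta> $ i - 1) * u)" by (rule arg_cong)
   then show "exp u * (\<theta> $ i * exp (- (\<beta> $ i) * u)) = \<theta> $ i * exp (- (\<beta> $ i - 1) * u)"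
    by (simp only: mult.left_commute[of "exp u"])
  qed
  also have "... <= (\<Sum>i\<in>UNIV. \<theta> $ i * exp (- min 1 ?m * \<bar>u\<bar>))"
  proof (intro sum_mono mult_left_mono)
   fix i
   have "min 1 ?m * u <= (\<beta> $ i - 1) * u" using order_trans[OF min.cobounded2 m_le[of i]] False by (intro mult_right_mono) simp_all
   moreover have "\<bar>u\<bar> = u" using False by simp
   ultimately have "- (\<beta> $ i - 1) * u <= - min 1 ?m * \<bar>u\<bar>" by (simp only: mult_minus_left neg_le_iff_le)
   then show "exp (- (\<beta> $ i - 1) * u) <= exp (- min 1 ?m * \<bar>u\<bar>)" by simp
  qed (use \<theta> in \<open>auto intro: less_imp_le\<close>)
  also have "... <= max 1 (\<Sum>i\<in>UNIV. \<theta> $ i) * exp (- min 1 ?m * \<bar>u\<bar>)"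
   unfolding sum_distrib_right[symmetric] by (intro mult_right_mono) auto
  finally show ?thesis .
 qed
 show "\<rho> \<theta> > 0" by (rule rho[unfolded is_rho_def, THEN spec, THEN mp, OF allI[OF \<theta>], THEN conjunct1])
 fix eps :: real assume "eps > 0"
 from rho[unfolded is_rho_def, THEN spec, THEN mp, OF allI[OF \<theta>], THEN conjunct2, THEN spec, THEN mp, OF this]
 obtain A N where A: "A \<ge> 0" and AN: "\<forall>n>N. \<forall>x\<in>{A .. 3/2 * ln (real n) - A}.
  \<bar>exp x / x * (LINT w|M. 1 - exp (- (\<Sum>i\<in>UNIV. \<theta> $ i * exp (- \<beta> $ i * x) * W_tilde \<xi> n (\<beta> $ i) w))) - \<rho> \<theta>\<bar> <= eps"
  by (elim exE conjE)
 have eq: "(LINT w|M. 1 - exp (- (\<Sum>i\<in>UNIV. \<theta> $ i * exp (- \<beta> $ i * x) * W_tilde \<xi> n (\<beta> $ i) w)))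
  = 1 - (LINT t|T.fam. nexp (psum (%v. ennreal (\<kappa> \<theta> (x + v - lg n))) n t))" if n: "0 < n" for n x proof -
  have [measurable]: "\<kappa> \<theta> \<in> bmeas borel" unfolding \<kappa>_def[abs_def] by measurable
  have W: "\<theta> $ i * exp (- \<beta> $ i * x) * W_tilde \<xi> n (\<beta> $ i) w = \<theta> $ i * partition labels n (\<beta> $ i) x (%u. \<xi> u w)" for i w
   by (simp only: partition_labels[of \<xi>, symmetric] partition_W_tilde mult.assoc vector_uminus_component)
  have "(LINT w|M. 1 - exp (- (\<Sum>i\<in>UNIV. \<theta> $ i * exp (- \<beta> $ i * x) * W_tilde \<xi> n (\<beta> $ i) w)))
   = (LINT t|T.fam. 1 - exp (- (\<Sum>i\<in>UNIV. \<theta> $ i * partition labels n (\<beta> $ i) x t)))" unfolding W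
   by (rule transfer_integral[of "%t. 1 - exp (- (\<Sum>i\<in>UNIV. \<theta> $ i * partition labels n (\<beta> $ i) x t))"])
    (unfold partition_def, measurable)
  also have "... = (LINT t|T.fam. 1 - nexp (psum (%v. ennreal (\<kappa> \<theta> (x + v - lg n))) n t))"
  proof (rule integral_cong_AE)
   show "AE t in T.fam. 1 - exp (- (\<Sum>i\<in>UNIV. \<theta> $ i * partition labels n (\<beta> $ i) x t)) = 1 - nexp (psum (%v. ennreal (\<kappa> \<theta> (x + v - lg n))) n t)"
    using brw.AE_tame
   proof eventually_elim
    case (elim t)
    then show ?case using nexp_partition[of t n \<theta> x] n \<theta> by (simp add: tame_def)
   qed
  qed (unfold partition_def, measurable)
  also have "... = 1 - (LINT t|T.fam. nexp (psum (%v. ennreal (\<kappa> \<theta> (x + v - lg n))) n t))"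
   using T.T.prob_space by (subst Bint_diff) (auto intro!: T.T.integrable_const_bound[of _ 1])
  finally show ?thesis .
 qed
 show "\<exists>A\<ge>0. \<exists>N. \<forall>n>N. \<forall>x\<in>{A..lg n - A}.
   \<bar>exp x / x * (1 - (LINT t|T.fam. nexp (psum (%v. ennreal (\<kappa> \<theta> (x + v - lg n))) n t))) - \<rho> \<theta>\<bar> <= eps"
 proof (intro exI[of _ A] exI[of _ N] conjI A allI impI ballI)
  fix n x assume n: "N < n" and x: "x \<in> {A..lg n - A}"
  show "\<bar>exp x / x * (1 - (LINT t|T.fam. nexp (psum (%v. ennreal (\<kappa> \<theta> (x + v - lg n))) n t))) - \<rho> \<theta>\<bar> <= eps" proof -
   have "0 < n" using n by simp
   note AN[THEN spec, THEN mp, OF n, THEN bspec, OF x[unfolded lg_def]]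
   then show ?thesis unfolding eq[OF \<open>0 < n\<close>] .
  qed
 qed
qed

lemma Z_inf_labels: "Z_inf \<xi> w = dlim (%u. \<xi> u w)" unfolding Z_eq Z_inf_def by (subst gen_sum_labels) simp

lemma dlim_measurable [measurable]: "dlim \<in> bmeas T.fam" proof -
 interpret tip L "\<kappa> 1" "Max (range (%i. \<beta> $ i))" "min 1 (Min (range (%i. \<beta> $ i - 1)))" "max 1 (\<Sum>i\<in>UNIV. (1 :: real ^ 'd) $ i)" "\<rho> 1"
  by (rule tip) simp
 show ?thesis by (rule measurable_Z)
qed

lemma measurable_Z_inf [measurable]: "Z_inf \<xi> \<in> bmeas M" unfolding Z_inf_labels[abs_def] by measurable

lemma survival_possible: "prob {w \<in> space M. Z_inf \<xi> w > 0} > 0" proof -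
 interpret tip L "\<kappa> 1" "Max (range (%i. \<beta> $ i))" "min 1 (Min (range (%i. \<beta> $ i - 1)))" "max 1 (\<Sum>i\<in>UNIV. (1 :: real ^ 'd) $ i)" "\<rho> 1"
  by (rule tip) simp
 have "T.T.prob {t. dlim t > 0} = measure (distr M T.fam (%w u. \<xi> u w)) {t. dlim t > 0}" by (simp only: distr_displ)
 also have "... = prob {w \<in> space M. Z_inf \<xi> w > 0}"
  by (subst measure_distr) (auto simp: Z_inf_labels vimage_def Int_def conj_commute intro: predE[of "%t. dlim t > 0" T.fam, simplified])
 finally show ?thesis using Z_positive by simp
qed

lemma measurable_mu_hat [measurable]: "mu_hat \<xi> n b \<in> bmeas M" proof -
 have [measurable]: "gen_sum \<xi> n (%v. exp (- b * v)) \<in> bmeas M"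
  unfolding gen_sum_labels[of \<xi>, abs_def] by (rule measurable_compose[OF displ_families]) measurable
 have "mu_hat \<xi> n b = (%w. exp (- b * ln (Z_inf \<xi> w)) * (real n powr (3/2 * b) * gen_sum \<xi> n (%v. exp (- b * v)) w))"
  by (simp add: fun_eq_iff partition_mu_hat partition_W_tilde W_tilde_def)
 also have "... \<in> bmeas M" by measurable
 finally show ?thesis .
qed

theorem joint_Laplace_limit:
 assumes \<theta>: "!!i. \<theta> $ i > 0" and \<alpha>: "\<alpha> \<ge> 0"
 shows "(%n. LINT w|M. exp (- (\<Sum>i\<in>UNIV. \<theta> $ i * mu_hat \<xi> n (\<beta> $ i) w))
           * exp (- \<alpha> * Z_inf \<xi> w) * indicator {w. Z_inf \<xi> w > 0} w)
      ---> exp (- \<rho> \<theta>)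
        * (LINT w|M. exp (- \<alpha> * Z_inf \<xi> w) * indicator {w. Z_inf \<xi> w > 0} w)" proof -
 interpret tip L "\<kappa> \<theta>" "Max (range (%i. \<beta> $ i))" "min 1 (Min (range (%i. \<beta> $ i - 1)))" "max 1 (\<Sum>i\<in>UNIV. \<theta> $ i)" "\<rho> \<theta>"
  by (rule tip[OF \<theta>])
 define g where "g n t = exp (- (\<Sum>i\<in>UNIV. \<theta> $ i * partition labels n (\<beta> $ i) (ln (dlim t)) t)) * exp (- \<alpha> * dlim t) * indicator {t. dlim t > 0} t" for n t
 have ind [measurable]: "{t. dlim t > 0} \<in> sets T.fam" using predE[of "%t. dlim t > 0" T.fam] by simp
 have pm [measurable]: "(%t. partition labels n (\<beta> $ i) (ln (dlim t)) t) \<in> bmeas T.fam" for n i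
  unfolding partition_W_tilde W_tilde_def by measurable
 have gm: "g n \<in> bmeas T.fam" for n unfolding g_def by measurable
 have L: "(LINT w|M. exp (- (\<Sum>i\<in>UNIV. \<theta> $ i * mu_hat \<xi> n (\<beta> $ i) w)) * exp (- \<alpha> * Z_inf \<xi> w) * indicator {w. Z_inf \<xi> w > 0} w)
  = (LINT t|T.fam. tipF n (ln (dlim t)) t * exp (- \<alpha> * dlim t) * indicator {t. dlim t > 0} t)" if n: "0 < n" for n proof -
  have "exp (- (\<Sum>i\<in>UNIV. \<theta> $ i * mu_hat \<xi> n (\<beta> $ i) w)) * exp (- \<alpha> * Z_inf \<xi> w) * indicator {w. Z_inf \<xi> w > 0} w = g n (%u. \<xi> u w)" for w
   by (simp add: g_def partition_mu_hat partition_labels[of \<xi>] Z_inf_labels indicator_def)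
  then have "(LINT w|M. exp (- (\<Sum>i\<in>UNIV. \<theta> $ i * mu_hat \<xi> n (\<beta> $ i) w)) * exp (- \<alpha> * Z_inf \<xi> w) * indicator {w. Z_inf \<xi> w > 0} w) = (LINT t|T.fam. g n t)"
   by (simp only: transfer_integral[OF gm])
  also have "... = (LINT t|T.fam. tipF n (ln (dlim t)) t * exp (- \<alpha> * dlim t) * indicator {t. dlim t > 0} t)"
  proof (rule integral_cong_AE[OF gm])
   show "AE t in T.fam. g n t = tipF n (ln (dlim t)) t * exp (- \<alpha> * dlim t) * indicator {t. dlim t > 0} t" using brw.AE_tame
   proof eventually_elim
    case (elim t)
    then show ?case using nexp_partition[of t n \<theta> "ln (dlim t)"] n \<theta> by (simp add: tame_def g_def tipF_def)
   qed
  qed measurable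
  finally show ?thesis .
 qed
 have R: "(LINT w|M. exp (- \<alpha> * Z_inf \<xi> w) * indicator {w. Z_inf \<xi> w > 0} w)
  = (LINT t|T.fam. exp (- \<alpha> * dlim t) * indicator {t. dlim t > 0} t)"
  using transfer_integral[of "%t. exp (- \<alpha> * dlim t) * indicator {t. dlim t > 0} t"] by (simp add: Z_inf_labels indicator_def)
 have "(%n. LINT t|T.fam. tipF n (ln (dlim t)) t * exp (- \<alpha> * dlim t) * indicator {t. dlim t > 0} t)
  ---> exp (- \<rho> \<theta>) * (LINT t|T.fam. exp (- \<alpha> * dlim t) * indicator {t. dlim t > 0} t)" by (rule Laplace_limit[OF \<alpha>])
 then show ?thesis unfolding R by (rule Lim_transform_eventually) (use L in \<open>auto intro!: eventually_sequentiallyI[of 1]\<close>)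
qed

end

section \<open>A curve through the cube and selection of limit laws\<close>

text \<open>A sequence of binary digits is stored in the Cantor set.\<close>
definition ternary :: "(nat => real) => real" where
 "ternary d = (\<Sum>n. 2 * d n / 3 ^ Suc n)"

lemma ternary:
 assumes d: "!!n. d n \<in> {0, 1}"
 shows "ternary d = (2 * d 0 + ternary (%n. d (Suc n))) / 3" "0 <= ternary d" "ternary d <= 1" proof -
 have g: "summable (%n. 2 * (1/3::real) ^ Suc n)" by (intro summable_mult) (simp add: summable_Suc_iff summable_geometric)
 have le: "2 * d n / 3 ^ Suc n <= 2 * (1/3) ^ Suc n" and ge: "0 <= 2 * d n / 3 ^ Suc n" if "d n \<in> {0, 1}" for d :: "nat => real" and n
  using that by (auto simp: power_divide)
 have s: "summable (%n. 2 * d n / 3 ^ Suc n)" if "!!n. d n \<in> {0, 1}" for d :: "nat => real"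
 proof (rule summable_comparison_test'[OF g, of 0])
  show "norm (2 * d n / 3 ^ Suc n) <= 2 * (1/3) ^ Suc n" for n unfolding real_norm_def abs_of_nonneg[OF ge[of d n, OF that]] by (rule le[of d n, OF that])
 qed
 have "(\<Sum>n. 2 * d (Suc n) / 3 ^ Suc (Suc n)) = (\<Sum>n. (2 * d (Suc n) / 3 ^ Suc n) / 3)" by simp
 also have "... = ternary (%n. d (Suc n)) / 3" unfolding ternary_def by (rule suminf_divide) (rule s[of "%n. d (Suc n)", OF d])
 finally show "ternary d = (2 * d 0 + ternary (%n. d (Suc n))) / 3" using suminf_split_head[OF s[of d, OF d]] unfolding ternary_def[of d] by simp
 show "0 <= ternary d" unfolding ternary_def by (intro suminf_nonneg s d ge)
 have "ternary d <= (\<Sum>n. 2 * (1/3::real) ^ Suc n)" unfolding ternary_def by (intro suminf_le s d g le)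
 also have "... = 2 * (1 / 3) * (\<Sum>n. (1/3::real) ^ n)" by (subst suminf_mult[symmetric]) (simp_all add: summable_geometric)
 also have "... = 1" by (subst suminf_geometric) simp_all
 finally show "ternary d <= 1" .
qed

lemma ternary_shift:
 assumes d: "!!n. d n \<in> {0, 1 :: real}"
 shows "\<exists>N :: int. 3 ^ j * ternary d = 2 * of_int N + ternary (%n. d (n + j))" using d
proof (induction j arbitrary: d)
 case 0
 show ?case by (rule exI[of _ 0]) simp
next
 case (Suc j)
 obtain N :: int where N: "3 ^ j * ternary (%n. d (Suc n)) = 2 * of_int N + ternary (%n. d (Suc (n + j)))"
  using Suc.IH[of "%n. d (Suc n)"] Suc.prems by auto
 obtain D :: int where D: "d 0 = of_int D" using Suc.prems[of 0] by (metis insertE of_int_0 of_int_1 singletonD)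
 have "3 ^ Suc j * ternary d = 3 ^ j * (3 * ternary d)" by simp
 also have "3 * ternary d = 2 * d 0 + ternary (%n. d (Suc n))" using ternary(1)[of d, OF Suc.prems] by simp
 also have "3 ^ j * ... = 2 * of_int (3 ^ j * D) + 3 ^ j * ternary (%n. d (Suc n))" by (simp add: D distrib_left)
 also have "... = 2 * of_int (3 ^ j * D + N) + ternary (%n. d (n + Suc j))" by (simp add: N)
 finally show ?case by blast
qed

text \<open>Schoenberg's function: continuous of period \<open>2\<close>, equal to \<open>0\<close> on the interval from \<open>0\<close> to \<open>1/3\<close> and to \<open>1\<close> on that from \<open>2/3\<close> to \<open>1\<close>.\<close>
definition digit_reader :: "real => real" where
 "digit_reader y = max 0 (min 1 (1/2 - cos (pi * y)))"

lemma digit_reader_ternary: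
 assumes d: "!!n. d n \<in> {0, 1 :: real}"
 shows "digit_reader (3 ^ j * ternary d) = d j" proof -
 define e where "e = (%n. d (n + j))"
 have e: "e n \<in> {0, 1}" for n using d by (simp add: e_def)
 obtain N :: int where N: "3 ^ j * ternary d = 2 * of_int N + ternary e" using ternary_shift[of d j, OF d] unfolding e_def by blast
 define f where "f = ternary (%n. e (Suc n))"
 have f: "0 <= f" "f <= 1" unfolding f_def by (rule ternary(2,3); use e in blast)+
 have te: "ternary e = (2 * e 0 + f) / 3" unfolding f_def by (rule ternary(1)[of e, OF e])
 have "pi * (3 ^ j * ternary d) = pi * ternary e + of_int N * (2 * pi)" unfolding N by (simp add: distrib_left)
 then have c: "cos (pi * (3 ^ j * ternary d)) = cos (pi * ternary e)" using cos.plus_of_int[of "pi * ternary e" N] by simp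
 have e0: "e 0 = d j" by (simp add: e_def)
 consider "e 0 = 0" | "e 0 = 1" using e by blast
 then show ?thesis
 proof cases
  case 1
  have "cos (pi / 3) <= cos (pi * ternary e)" using f 1 te by (intro cos_monotone_0_pi_le) auto
  then show ?thesis using 1 e0 by (simp add: digit_reader_def c cos_60)
 next
  case 2
  have "pi * ternary e \<ge> 2 * pi / 3" using f 2 te by simp
  moreover have "pi * ternary e <= pi" using f 2 te by simp
  ultimately have "cos (pi * ternary e) <= cos (2 * pi / 3)" by (intro cos_monotone_0_pi_le) auto
  then show ?thesis using 2 e0 by (simp add: digit_reader_def c cos_120)
 qed
qed

definition binary_digit :: "real => nat => real" where
 "binary_digit x m = of_int (\<lfloor>2 ^ Suc m * x\<rfloor> mod 2)"

lemma binary_digit: "binary_digit x m \<in> {0, 1}" proof -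
 have "\<lfloor>2 ^ Suc m * x\<rfloor> mod 2 \<in> {0, 1}" by auto
 then show ?thesis unfolding binary_digit_def by (metis insertE insertI1 insertI2 of_int_0 of_int_1 singletonD)
qed

lemma binary_expansion:
 assumes x: "0 <= x" "x < 1"
 shows "(%m. binary_digit x m / 2 ^ Suc m) sums x" proof -
 have part: "(\<Sum>m<N. binary_digit x m / 2 ^ Suc m) = of_int \<lfloor>2 ^ N * x\<rfloor> / 2 ^ N" for N
 proof (induction N)
  case 0
  have "\<lfloor>x\<rfloor> = 0" using x by (simp add: floor_eq_iff)
  then show ?case by simp
 next
  case (Suc N)
  define q where "q = \<lfloor>2 ^ Suc N * x\<rfloor>"
  have "\<lfloor>2 ^ N * x\<rfloor> = \<lfloor>(2 ^ Suc N * x) / of_int 2\<rfloor>" by simp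
  also have "... = q div 2" unfolding q_def by (rule floor_divide_real_eq_div) simp
  finally have "\<lfloor>2 ^ N * x\<rfloor> = q div 2" .
  then have "(\<Sum>m<Suc N. binary_digit x m / 2 ^ Suc m) = of_int (q div 2) / 2 ^ N + of_int (q mod 2) / 2 ^ Suc N"
   using Suc by (simp add: binary_digit_def q_def)
  also have "... = of_int (2 * (q div 2) + q mod 2) / 2 ^ Suc N" unfolding of_int_add of_int_mult by (simp add: add_divide_distrib)
  also have "2 * (q div 2) + q mod 2 = q" by simp
  finally show ?case by (simp add: q_def)
 qed
 have "(%N. of_int \<lfloor>2 ^ N * x\<rfloor> / 2 ^ N) ---> x"
 proof (rule tendsto_sandwich)
  have "(%N. x - (1/2) ^ N) ---> x - 0" by (intro tendsto_intros LIMSEQ_power_zero) simp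
  then show "(%N. x - (1/2) ^ N) ---> x" by simp
  show "EVN N. x - (1/2) ^ N <= of_int \<lfloor>2 ^ N * x\<rfloor> / 2 ^ N"
  proof (intro always_eventually allI)
   fix N
   have "2 ^ N * x - 1 <= of_int \<lfloor>2 ^ N * x\<rfloor>" by linarith
   then have "(2 ^ N * x - 1) / 2 ^ N <= of_int \<lfloor>2 ^ N * x\<rfloor> / 2 ^ N" by (rule divide_right_mono) simp
   then show "x - (1/2) ^ N <= of_int \<lfloor>2 ^ N * x\<rfloor> / 2 ^ N" by (simp add: diff_divide_distrib power_divide)
  qed
  show "EVN N. of_int \<lfloor>2 ^ N * x\<rfloor> / 2 ^ N <= x"
  proof (intro always_eventually allI)
   fix N
   have "of_int \<lfloor>2 ^ N * x\<rfloor> / 2 ^ N <= (2 ^ N * x) / 2 ^ N" by (intro divide_right_mono) auto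
   then show "of_int \<lfloor>2 ^ N * x\<rfloor> / 2 ^ N <= x" by simp
  qed
 qed simp
 then show ?thesis by (simp only: sums_def part)
qed

text \<open>A Borel right inverse of the curve \<open>decode\<close>: the binary digits of all halved coordinates are interleaved. Halving avoids the coordinate \<open>1\<close>, whose integer part is not \<open>0\<close>.\<close>
definition encode :: "real ^ 'd => real" where
 "encode x = ternary (%j. case prod_decode j of (a, m) => binary_digit (x $ from_nat a / 2) m)"

definition decode :: "real => real ^ 'd" where
 "decode y = (\<chi> i. min 1 (2 * (\<Sum>m. digit_reader (3 ^ prod_encode (to_nat i, m) * y) / 2 ^ Suc m)))"

lemma digit_reader_bounds: "0 <= digit_reader y" "digit_reader y <= 1" by (auto simp: digit_reader_def)

lemma summable_half: "summable (%m. 1 / 2 ^ Suc m :: real)" using sums_summable[OF power_half_series] by (simp add: power_divide)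

lemma decode_summable: "summable (%m. digit_reader (f m) / 2 ^ Suc m)" by (rule summable_comparison_test'[OF summable_half, of 0])
  (auto simp: digit_reader_bounds divide_right_mono simp del: power_Suc)

lemma decode_bounds: "0 <= decode y $ i" "decode y $ i <= 1"
 unfolding decode_def by (auto intro!: suminf_nonneg decode_summable simp: digit_reader_bounds simp del: power_Suc)

lemma decode_encode:
 assumes "!!i. 0 <= x $ i" "!!i. x $ i <= 1"
 shows "decode (encode x) = x"
proof (rule vec_eq_iff[THEN iffD2], rule allI)
 fix i
 have "digit_reader (3 ^ prod_encode (to_nat i, m) * encode x) = binary_digit (x $ i / 2) m" for m
  unfolding encode_def by (subst digit_reader_ternary) (use binary_digit in \<open>auto split: prod.split\<close>)
 moreover have "(%m. binary_digit (x $ i / 2) m / 2 ^ Suc m) sums (x $ i / 2)" using assms[of i] by (intro binary_expansion) auto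
 ultimately have "(\<Sum>m. digit_reader (3 ^ prod_encode (to_nat i, m) * encode x) / 2 ^ Suc m) = x $ i / 2" by (simp add: sums_iff del: power_Suc)
 then show "decode (encode x) $ i = x $ i" using assms(2)[of i] unfolding decode_def by simp
qed

lemma continuous_decode: "continuous_on UNIV (decode :: real => real ^ 'd)" proof -
 have "continuous_on UNIV (%y. \<Sum>m. digit_reader (3 ^ prod_encode (to_nat i, m) * y) / 2 ^ Suc m)" for i :: 'd
 proof (rule uniform_limit_theorem)
  show "uniform_limit UNIV (%n y. \<Sum>m<n. digit_reader (3 ^ prod_encode (to_nat i, m) * y) / 2 ^ Suc m)
   (%y. \<Sum>m. digit_reader (3 ^ prod_encode (to_nat i, m) * y) / 2 ^ Suc m) sequentially"
   by (rule Weierstrass_m_test[OF _ summable_half]) (auto simp: digit_reader_bounds divide_right_mono simp del: power_Suc)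
  show "EVN n. continuous_on UNIV (%y. \<Sum>m<n. digit_reader (3 ^ prod_encode (to_nat i, m) * y) / 2 ^ Suc m)"
   unfolding digit_reader_def by (intro always_eventually allI continuous_intros) auto
 qed simp
 then show ?thesis unfolding decode_def by (intro continuous_intros)
qed

lemma measurable_encode [measurable]: "(encode :: real ^ 'd => real) \<in> bmeas borel" proof -
 have [measurable]: "(%x :: real ^ 'd. binary_digit (x $ i / 2) m) \<in> bmeas borel" for i m unfolding binary_digit_def by measurable
 have "(%x :: real ^ 'd. case prod_decode j of (a, m) => binary_digit (x $ from_nat a / 2) m) \<in> bmeas borel" for j by (cases "prod_decode j") simp
 then show ?thesis unfolding encode_def[abs_def] ternary_def suminf_eq_lim by measurable
qed

text \<open>The laws of the encoded vectors live on a compact interval of the line, where Helly's theorem applies; continuity of \<open>decode\<close> transports the limit back.\<close>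
lemma (in prob_space) vector_selection:
 fixes X :: "nat => 'a => real ^ 'd"
 assumes X [measurable]: "!!n. X n \<in> bmeas M"
  and X01: "!!n u i. 0 <= X n u $ i" "!!n u i. X n u $ i <= 1"
 obtains r :: "nat => nat" and \<nu> :: "(real ^ 'd) measure"
  where "strict_mono r" "prob_space \<nu>" "sets \<nu> = sets borel"
   "AE x in \<nu>. \<forall>i. 0 <= x $ i & x $ i <= 1"
   "\<forall>(f :: real ^ 'd => real) B. continuous_on UNIV f --> (\<forall>x. \<bar>f x\<bar> <= B) --> (%n. LINT u|M. f (X (r n) u)) ---> (LINT x|\<nu>. f x)"
proof -
 define \<mu> where "\<mu> n = distr M borel (%u. encode (X n u))" for n
 have rd: "real_distribution (\<mu> n)" for n unfolding \<mu>_def by (rule real_distribution_distr) measurable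
 have e01: "0 <= encode x" "encode x <= 1" for x :: "real ^ 'd"
  unfolding encode_def by (rule ternary(2,3); use binary_digit in \<open>auto split: prod.split\<close>)+
 have full: "measure (\<mu> n) {-1<..1} = 1" for n proof -
  have "measure (\<mu> n) {-1<..1} = prob ((%u. encode (X n u)) -` {-1<..1} \<inter> space M)" unfolding \<mu>_def by (rule measure_distr) measurable
  also have "(%u. encode (X n u)) -` {-1<..1} \<inter> space M = space M" using e01 by (auto intro!: less_le_trans[OF _ e01(1)])
  finally show ?thesis by (simp add: prob_space)
 qed
 have "tight \<mu>" unfolding tight_def
 proof (intro conjI allI impI rd)
  fix eps :: real assume "0 < eps"
  then show "\<exists>a b. a < b & (\<forall>n. 1 - eps < measure (\<mu> n) {a<..b})" by (intro exI[of _ "-1"] exI[of _ 1]) (simp add: full)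
 qed
 from tight_imp_convergent_subsubsequence[OF this strict_mono_id]
 obtain r T where r: "strict_mono r" and T: "real_distribution T" and w: "weak_conv_m (\<mu> \<circ> id \<circ> r) T" by blast
 interpret T: real_distribution T by (rule T)
 have dm [measurable]: "(decode :: real => real ^ 'd) \<in> bmeas borel" by (rule borel_measurable_continuous_onI[OF continuous_decode])
 define \<nu> where "\<nu> = distr T borel (decode :: real => real ^ 'd)"
 show ?thesis
 proof (rule that[OF r])
  show "prob_space \<nu>" unfolding \<nu>_def by (rule T.prob_space_distr) measurable
  show "sets \<nu> = sets borel" by (simp add: \<nu>_def)
  show "AE x in \<nu>. \<forall>i. 0 <= x $ i & x $ i <= 1" unfolding \<nu>_def by (subst AE_distr_iff) (auto simp: decode_bounds)
  show "\<forall>(f :: real ^ 'd => real) B. continuous_on UNIV f --> (\<forall>x. \<bar>f x\<bar> <= B) \<longrightarrow>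
   (%n. LINT u|M. f (X (r n) u)) ---> (LINT x|\<nu>. f x)"
  proof (intro allI impI)
  fix f :: "real ^ 'd => real" and B assume f: "continuous_on UNIV f" "\<forall>x. \<bar>f x\<bar> <= B"
  have [measurable]: "f \<in> bmeas borel" by (rule borel_measurable_continuous_onI[OF f(1)])
  have c: "continuous_on UNIV (%y. f (decode y))" using continuous_on_compose2[OF f(1) continuous_decode] by simp
  have "(%n. \<integral>y. f (decode y) \<partial>(\<mu> \<circ> id \<circ> r) n) ---> (LINT y|T. f (decode y))"
   by (rule weak_conv_imp_integral_bdd_continuous_conv[OF _ T w, where B = B])
    (use c f(2) rd in \<open>auto simp: continuous_on_eq_continuous_at\<close>)
  moreover have "(\<integral>y. f (decode y) \<partial>(\<mu> \<circ> id \<circ> r) n) = (LINT u|M. f (X (r n) u))" for n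
   by (simp add: \<mu>_def integral_distr decode_encode[OF X01])
  moreover have "(LINT y|T. f (decode y)) = (LINT x|\<nu>. f x)" by (simp add: \<nu>_def integral_distr)
  ultimately show "(%n. LINT u|M. f (X (r n) u)) ---> (LINT x|\<nu>. f x)" by simp
  qed
 qed
qed

lemma measurable_vec_nth [measurable (raw)]:
 fixes f :: "'a => real ^ 'd"
 assumes "f \<in> bmeas M"
 shows "(%x. f x $ i) \<in> bmeas M" proof -
 have "(%x :: real ^ 'd. x $ i) \<in> bmeas borel" by (intro borel_measurable_continuous_onI continuous_intros)
 from measurable_compose[OF assms this] show ?thesis .
qed

lemma measurable_vec_lambda:
 fixes f :: "'a => 'd :: finite => real"
 assumes "!!i. (%x. f x i) \<in> bmeas M"
 shows "(%x. \<chi> i. f x i) \<in> bmeas M" using assms by (subst borel_measurable_euclidean_space) (auto simp: Basis_vec_def inner_axis)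

lemma prod_powr_exp:
 fixes x :: "'d :: finite => real"
 shows "(\<Prod>i\<in>UNIV. exp (- x i) powr a i) = exp (- (\<Sum>i\<in>UNIV. a i * x i))" by (simp add: powr_def exp_sum[symmetric] sum_negf)

definition mon :: "real ^ 'd => real => (real ^ 'd) \<times> real => real" where
 "mon a \<alpha> z = (\<Prod>i\<in>UNIV. fst z $ i powr (a $ i)) * snd z powr \<alpha>"

locale laplace_convergence = prob_space M
 for M :: "'a measure" +
 fixes X :: "nat => 'a => real ^ 'd" and Z :: "'a => real" and \<rho> :: "real ^ 'd => real" and \<eta> :: "nat => real ^ 'd"
 assumes X_measurable [measurable]: "!!n. X n \<in> bmeas M"
  and X_nonneg: "!!n u i. 0 <= X n u $ i"
  and Z_measurable [measurable]: "Z \<in> bmeas M"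
  and Z_nonneg: "!!u. 0 <= Z u"
  and laplace: "!!\<theta> \<alpha>. (!!i. 0 < \<theta> $ i) ==> 0 <= \<alpha> ==>
   (%n. LINT u|M. exp (- (\<Sum>i\<in>UNIV. \<theta> $ i * X n u $ i)) * exp (- \<alpha> * Z u))
    ---> exp (- \<rho> \<theta>) * (LINT u|M. exp (- \<alpha> * Z u))"
  and \<eta>_pos: "!!k i. 0 < \<eta> k $ i" and \<eta>_0: "!!i. (%k. \<eta> k $ i) ---> 0"
  and \<rho>_0: "(%k. \<rho> (\<eta> k)) ---> 0"
begin

definition v :: "nat => 'a => real ^ 'd" where "v n u = (\<chi> i. exp (- X n u $ i))"
definition w :: "'a => real" where "w u = exp (- Z u)"

lemma v_measurable [measurable]: "v n \<in> bmeas M" unfolding v_def[abs_def] by (rule measurable_vec_lambda) measurable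

lemma w_measurable [measurable]: "w \<in> bmeas M" unfolding w_def[abs_def] by measurable

lemma v_bounds: "0 < v n u $ i" "v n u $ i <= 1" using X_nonneg by (auto simp: v_def)

lemma w_bounds: "0 < w u" "w u <= 1" using Z_nonneg by (auto simp: w_def)

end

section \<open>Identification of the limit law\<close>

context laplace_convergence begin

lemma mono_v_w: "mon a \<alpha> (v n u, w u) = exp (- (\<Sum>i\<in>UNIV. a $ i * X n u $ i)) * exp (- \<alpha> * Z u)"
 unfolding mon_def v_def w_def by (simp add: prod_powr_exp) (simp add: powr_def)

text \<open>On a face of the cube the moments with exponents \<open>\<eta> k\<close> vanish, but they tend to \<open>1\<close> because \<open>\<rho>\<close> vanishes along \<open>\<eta>\<close>.\<close>
lemma limit_law:
 obtains \<nu> :: "(real ^ 'd) measure" where "prob_space \<nu>" "sets \<nu> = sets borel" "AE x in \<nu>. \<forall>i. 0 < x $ i & x $ i <= 1"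
  "\<forall>\<theta>. (\<forall>i. 0 < \<theta> $ i) --> (LINT x|\<nu>. (\<Prod>i\<in>UNIV. x $ i powr \<theta> $ i)) = exp (- \<rho> \<theta>)" proof -
 have X01: "0 <= v n u $ i" "v n u $ i <= 1" for n u i using v_bounds[of n u i] by auto
 obtain r \<nu> where r: "strict_mono r" and \<nu>: "prob_space \<nu>" and s: "sets \<nu> = sets borel" and c: "AE x in \<nu>. \<forall>i. 0 <= x $ i & x $ i <= 1"
  and lim: "\<forall>(f :: real ^ 'd => real) B. continuous_on UNIV f --> (\<forall>x. \<bar>f x\<bar> <= B) --> (%n. LINT u|M. f (v (r n) u)) ---> (LINT x|\<nu>. f x)"
  by (rule vector_selection[of v, OF v_measurable X01]) (rule that)
 interpret \<nu>: prob_space \<nu> by (rule \<nu>)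
 have [measurable_cong]: "sets \<nu> = sets borel" by (rule s)
 have moment: "(LINT x|\<nu>. (\<Prod>i\<in>UNIV. x $ i powr \<theta> $ i)) = exp (- \<rho> \<theta>)" if \<theta>: "!!i. 0 < \<theta> $ i" for \<theta> :: "real ^ 'd"
 proof -
  define f where "f x = (\<Prod>i\<in>UNIV. max 0 (min 1 (x $ i)) powr \<theta> $ i)" for x :: "real ^ 'd"
  have fc: "continuous_on UNIV f" unfolding f_def by (intro continuous_on_prod continuous_on_powr' continuous_intros) (use \<theta> in auto)
  have fb: "\<bar>f x\<bar> <= 1" for x proof -
   have "0 <= f x" unfolding f_def by (intro prod_nonneg) auto
   moreover have "f x <= 1" unfolding f_def by (intro prod_le_1) (auto intro!: powr_le1 less_imp_le[OF \<theta>])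
   ultimately show ?thesis by simp
  qed
  have fv: "f (v n u) = exp (- (\<Sum>i\<in>UNIV. \<theta> $ i * X n u $ i)) * exp (- 0 * Z u)" for n u proof -
   have "max 0 (min 1 (v n u $ i)) = exp (- X n u $ i)" for i using X01[of n u i] by (simp add: v_def)
   then show ?thesis unfolding f_def by (simp add: prod_powr_exp)
  qed
  have "(%n. LINT u|M. f (v n u)) ---> exp (- \<rho> \<theta>) * (LINT u|M. exp (- 0 * Z u))" unfolding fv by (rule laplace) (use \<theta> in auto)
  then have "(%n. LINT u|M. f (v n u)) ---> exp (- \<rho> \<theta>)" by (simp add: prob_space)
  from LIMSEQ_subseq_LIMSEQ[OF this r] have "(%n. LINT u|M. f (v (r n) u)) ---> exp (- \<rho> \<theta>)" by (simp add: o_def)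
  then have "(LINT x|\<nu>. f x) = exp (- \<rho> \<theta>)" using lim[rule_format, OF fc fb] LIMSEQ_unique by blast
  moreover have "(LINT x|\<nu>. f x) = (LINT x|\<nu>. (\<Prod>i\<in>UNIV. x $ i powr \<theta> $ i))"
  proof (rule integral_cong_AE)
   show "AE x in \<nu>. f x = (\<Prod>i\<in>UNIV. x $ i powr \<theta> $ i)" using c by eventually_elim (auto simp: f_def intro!: prod.cong)
  qed (unfold f_def, measurable)
  ultimately show ?thesis by simp
 qed
 define E where "E = {x :: real ^ 'd. \<exists>i. x $ i = 0}"
 have Em [measurable]: "E \<in> sets \<nu>" proof -
  have "{x \<in> space \<nu>. \<exists>i. x $ i = 0} \<in> sets \<nu>" by measurable
  moreover have "space \<nu> = UNIV" using sets_eq_imp_space_eq[OF s] by simp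
  ultimately show ?thesis by (simp add: E_def)
 qed
 have "\<nu>.prob E <= 1 - exp (- \<rho> (\<eta> k))" for k proof -
  have i1: "integrable \<nu> (%x. \<Prod>i\<in>UNIV. x $ i powr \<eta> k $ i)"
  proof (rule \<nu>.integrable_const_bound[of _ 1])
   show "AE x in \<nu>. norm (\<Prod>i\<in>UNIV. x $ i powr \<eta> k $ i) <= 1" using c
   proof eventually_elim
    case (elim x)
    then show ?case unfolding prod_norm[symmetric] by (intro prod_le_1) (auto intro!: powr_le1 less_imp_le[OF \<eta>_pos])
   qed
  qed measurable
  have "(LINT x|\<nu>. indicator E x) <= (LINT x|\<nu>. 1 - (\<Prod>i\<in>UNIV. x $ i powr \<eta> k $ i))"
  proof (intro integral_mono_AE Bintegrable_diff i1)
   show "AE x in \<nu>. indicator E x <= 1 - (\<Prod>i\<in>UNIV. x $ i powr \<eta> k $ i)" using c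
   proof eventually_elim
    case (elim x)
    have "(\<Prod>i\<in>UNIV. x $ i powr \<eta> k $ i) <= 1" using elim by (intro prod_le_1) (auto intro!: powr_le1 less_imp_le[OF \<eta>_pos])
    note le = this
    show ?case
    proof (cases "x \<in> E")
     case True
     then have z: "(\<Prod>i\<in>UNIV. x $ i powr \<eta> k $ i) = 0" by (auto simp: E_def)
     show ?thesis using True unfolding z by simp
    next
     case False
     then show ?thesis using le by simp
    qed
   qed
  qed (auto intro: \<nu>.integrable_const_bound[of _ 1])
  also have "... = 1 - exp (- \<rho> (\<eta> k))" using i1 by (simp add: moment[OF \<eta>_pos] \<nu>.prob_space)
  finally show ?thesis by simp
 qed
 moreover have "(%k. 1 - exp (- \<rho> (\<eta> k))) ---> 1 - exp (- 0)" by (intro tendsto_intros \<rho>_0)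
 ultimately have "\<nu>.prob E <= 1 - exp (- 0)" by (intro LIMSEQ_le_const) auto
 then have "\<nu>.prob E = 0" using measure_nonneg[of \<nu> E] by simp
 then have "AE x in \<nu>. x \<notin> E" using Em by (intro AE_not_in) (auto simp: null_sets_def \<nu>.emeasure_eq_measure)
 with c have pos: "AE x in \<nu>. \<forall>i. 0 < x $ i & x $ i <= 1" by eventually_elim (auto simp: E_def less_le)
 show ?thesis by (rule that[OF \<nu> s pos]) (intro allI impI moment, blast)
qed

end

definition cube :: "((real ^ 'd) \<times> real) set" where "cube = cbox (0, 0) (1, 1)"

lemma cube_iff: "z \<in> cube \<longleftrightarrow> (\<forall>i. 0 <= fst z $ i & fst z $ i <= 1) & 0 <= snd z & snd z <= 1"
 by (cases z) (auto simp: cube_def cbox_Pair_eq mem_box_cart)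

definition positive :: "(real ^ 'd) \<times> real => bool" where
 "positive z \<longleftrightarrow> z \<in> cube & (\<forall>i. 0 < fst z $ i) & 0 < snd z"

lemma mon_bounds:
 assumes "z \<in> cube" "!!i. 0 <= a $ i" "0 <= \<alpha>"
 shows "0 <= mon a \<alpha> z" "mon a \<alpha> z <= 1" proof -
 show "0 <= mon a \<alpha> z" unfolding mon_def by (intro mult_nonneg_nonneg prod_nonneg) auto
 show "mon a \<alpha> z <= 1" unfolding mon_def using assms by (intro mult_le_one prod_le_1 prod_nonneg) (auto simp: cube_iff intro!: powr_le1)
qed

lemma mono_coord:
 assumes "positive z"
 shows "fst z $ i * mon a \<alpha> z = mon (a + axis i 1) \<alpha> z" proof -
 have p: "0 < fst z $ j" for j using assms by (simp add: positive_def)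
 have "(\<Prod>j\<in>UNIV. fst z $ j powr (a + axis i 1) $ j) = (\<Prod>j\<in>UNIV. fst z $ j powr a $ j * (if j = i then fst z $ j else 1))"
  using p by (intro prod.cong) (auto simp: axis_def powr_add abs_of_pos)
 also have "... = (\<Prod>j\<in>UNIV. fst z $ j powr a $ j) * fst z $ i" by (simp add: prod.distrib)
 finally show ?thesis by (simp add: mon_def mult_ac)
qed

lemma mono_last:
 assumes "positive z"
 shows "snd z * mon a \<alpha> z = mon a (\<alpha> + 1) z" using assms by (simp add: mon_def powr_add positive_def mult_ac less_imp_le)

lemma linear_pair_expansion:
 fixes f :: "(real ^ 'd) \<times> real => real"
 assumes "bounded_linear f"
 shows "f z = (\<Sum>i\<in>UNIV. f (axis i 1, 0) * fst z $ i) + f (0, 1) * snd z" proof -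
 interpret bounded_linear f by (rule assms)
 have "z = (\<Sum>i\<in>UNIV. fst z $ i *\<^sub>R (axis i 1, 0)) + snd z *\<^sub>R (0, 1)"
 proof (rule prod_eqI)
  show "fst z = fst ((\<Sum>i\<in>UNIV. fst z $ i *\<^sub>R (axis i 1, 0 :: real)) + snd z *\<^sub>R (0, 1))"
   by (simp add: fst_sum vec_eq_iff axis_def if_distrib cong: if_cong)
  show "snd z = snd ((\<Sum>i\<in>UNIV. fst z $ i *\<^sub>R (axis i 1 :: real ^ 'd, 0)) + snd z *\<^sub>R (0 :: real ^ 'd, 1))" by (simp add: snd_sum)
 qed
 then have "f z = f ((\<Sum>i\<in>UNIV. fst z $ i *\<^sub>R (axis i 1, 0)) + snd z *\<^sub>R (0, 1))" by simp
 then show ?thesis by (simp only: add sum scaleR) (simp add: mult.commute)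
qed

text \<open>The law \<open>\<nu>\<close> is that of the limit of the vectors \<open>v n\<close>.\<close>
locale laplace_limit = laplace_convergence M X Z \<rho> \<eta>
 for M :: "'a measure" and X :: "nat => 'a => real ^ 'd" and Z \<rho> \<eta> +
 fixes \<nu> :: "(real ^ 'd) measure"
 assumes prob_\<nu>: "prob_space \<nu>" and sets_\<nu> [measurable_cong]: "sets \<nu> = sets borel"
  and \<nu>_bounds: "AE x in \<nu>. \<forall>i. 0 < x $ i & x $ i <= 1"
  and \<nu>_moment: "!!\<theta>. (!!i. 0 < \<theta> $ i) ==> (LINT x|\<nu>. (\<Prod>i\<in>UNIV. x $ i powr \<theta> $ i)) = exp (- \<rho> \<theta>)"
begin

abbreviation wlaw :: "real measure" where "wlaw \<equiv> distr M borel w"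
abbreviation \<mu> :: "((real ^ 'd) \<times> real) measure" where "\<mu> \<equiv> \<nu> \<Otimes>\<^sub>M wlaw"

sublocale N: prob_space \<nu> by (rule prob_\<nu>)
sublocale W: prob_space wlaw by (rule prob_space_distr) measurable
sublocale P: pair_prob_space \<nu> wlaw ..

lemma sets_\<mu> [measurable_cong]: "sets \<mu> = sets borel" unfolding borel_prod[symmetric] by (intro sets_pair_measure_cong sets_\<nu>) simp

lemma AE_positive: "AE z in \<mu>. positive z"
proof (rule AE_I2[THEN AE_mp, rotated])
 have 1: "AE z in \<mu>. \<forall>i. 0 < fst z $ i & fst z $ i <= 1" proof -
  have "AE x in distr \<mu> \<nu> fst. \<forall>i. 0 < x $ i & x $ i <= 1" unfolding W.distr_pair_fst by (rule \<nu>_bounds)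
  then show ?thesis by (rule AE_distrD[rotated]) measurable
 qed
 have w1: "AE y in wlaw. 0 < y & y <= 1" by (subst AE_distr_iff) (auto simp: w_bounds)
 have 2: "AE z in \<mu>. 0 < snd z & snd z <= 1"
 proof (rule P.AE_pair_measure)
  show "{z \<in> space \<mu>. 0 < snd z & snd z <= 1} \<in> sets \<mu>" by measurable
  show "AE x in \<nu>. AE y in wlaw. 0 < snd (x, y) & snd (x, y) <= 1" using w1 by simp
 qed
 show "AE z in \<mu>. positive z" using 1 2 by eventually_elim (auto simp: positive_def cube_iff intro: less_imp_le)
qed simp

lemma positive_v_w: "positive (v n u, w u)" using v_bounds[of n u] w_bounds[of u] by (auto simp: positive_def cube_iff intro: less_imp_le)

lemma continuous_bounded_on_cube:
 fixes q :: "(real ^ 'd) \<times> real => real"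
 assumes "continuous_on UNIV q"
 obtains B where "!!z. z \<in> cube ==> \<bar>q z\<bar> <= B" proof -
 have "compact (q ` cube)" unfolding cube_def by (rule compact_continuous_image[OF continuous_on_subset[OF assms]]) (auto simp: compact_cbox)
 from compact_imp_bounded[OF this] show ?thesis using that by (auto simp: bounded_iff)
qed

lemma measurable_mono [measurable]: "mon a \<alpha> \<in> bmeas borel" unfolding mon_def[abs_def] borel_prod[symmetric] by measurable

lemma measurable_pair_v_w [measurable]: "(%u. (v n u, w u)) \<in> bmeas M" by (rule borel_measurable_Pair) measurable

lemma integrable_cube:
 fixes q :: "(real ^ 'd) \<times> real => real"
 assumes [measurable]: "q \<in> bmeas borel" and B: "!!z. z \<in> cube ==> \<bar>q z\<bar> <= B"
 shows "integrable M (%u. q (v n u, w u))" "integrable \<mu> q" proof -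
 show "integrable M (%u. q (v n u, w u))" by (rule integrable_const_bound[of _ B]) (use B positive_v_w in \<open>auto simp: positive_def\<close>)
 show "integrable \<mu> q"
 proof (rule P.integrable_const_bound[of _ B])
  show "AE z in \<mu>. norm (q z) <= B" using AE_positive by eventually_elim (use B in \<open>auto simp: positive_def\<close>)
 qed measurable
qed

lemma integrable_times_mono:
 fixes q :: "(real ^ 'd) \<times> real => real"
 assumes q: "continuous_on UNIV q" and a: "!!i. 0 <= a $ i" "0 <= \<alpha>"
 shows "integrable M (%u. q (v n u, w u) * mon a \<alpha> (v n u, w u))" "integrable \<mu> (%z. q z * mon a \<alpha> z)" proof -
 obtain B where B: "!!z. z \<in> cube ==> \<bar>q z\<bar> <= B" using continuous_bounded_on_cube[OF q] by blast
 have m: "(%z. q z * mon a \<alpha> z) \<in> bmeas borel" using borel_measurable_continuous_onI[OF q] by measurable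
 have b: "\<bar>q z * mon a \<alpha> z\<bar> <= B" if z: "z \<in> cube" for z proof -
  have "\<bar>q z * mon a \<alpha> z\<bar> <= \<bar>q z\<bar> * 1" unfolding abs_mult using mon_bounds[OF z a] by (intro mult_left_mono) auto
  then show ?thesis using B[OF z] by simp
 qed
 show "integrable M (%u. q (v n u, w u) * mon a \<alpha> (v n u, w u))" by (rule integrable_cube(1)[OF m b])
 show "integrable \<mu> (%z. q z * mon a \<alpha> z)" by (rule integrable_cube(2)[OF m b])
qed

text \<open>The hypothesis only covers positive exponents. A vanishing exponent is reached by adding \<open>\<eta> k\<close>, which changes the expectation by at most \<open>1 - exp (- \<rho> (\<eta> k))\<close> in the limit.\<close>
lemma mono_converges:
 assumes a: "!!i. 0 <= a $ i" "0 <= \<alpha>"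
 shows "(%n. LINT u|M. mon a \<alpha> (v n u, w u)) ---> (LINT z|\<mu>. mon a \<alpha> z)" proof -
 define c where "c a = (LINT x|\<nu>. (\<Prod>i\<in>UNIV. x $ i powr a $ i))" for a :: "real ^ 'd"
 define W where "W = (LINT u|M. exp (- \<alpha> * Z u))"
 have ak: "0 < (a + \<eta> k) $ i" for k i using a(1)[of i] \<eta>_pos[of k i] by simp
 have prod: "(LINT z|\<mu>. mon a \<alpha> z) = c a * W" proof -
  have i: "integrable \<mu> (mon a \<alpha>)" using integrable_times_mono(2)[of "%_. 1" a \<alpha>] a by simp
  have "(LINT z|\<mu>. mon a \<alpha> z) = (LINT x|\<nu>. (LINT y|wlaw. mon a \<alpha> (x, y)))" by (rule P.integral_fst'[OF i, symmetric])
  also have "(%x. LINT y|wlaw. mon a \<alpha> (x, y)) = (%x. (\<Prod>i\<in>UNIV. x $ i powr a $ i) * W)"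
  proof
   fix x
   have "(LINT y|wlaw. y powr \<alpha>) = W" by (subst integral_distr) (auto simp: W_def w_def powr_def)
   then show "(LINT y|wlaw. mon a \<alpha> (x, y)) = (\<Prod>i\<in>UNIV. x $ i powr a $ i) * W" by (simp add: mon_def)
  qed
  finally show ?thesis by (simp add: c_def)
 qed
 have ck: "(%k. c (a + \<eta> k)) ---> c a" unfolding c_def
 proof (rule integral_dominated_convergence[where w = "%_. 1"])
  show "AE x in \<nu>. (%k. \<Prod>i\<in>UNIV. x $ i powr (a + \<eta> k) $ i) ---> (\<Prod>i\<in>UNIV. x $ i powr a $ i)" using \<nu>_bounds
  proof eventually_elim
   case (elim x)
   have "(%k. x $ i powr (a $ i + \<eta> k $ i)) ---> x $ i powr (a $ i + 0)" for i
   proof (rule tendsto_powr)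
    show "(%k. a $ i + \<eta> k $ i) ---> a $ i + 0" by (intro tendsto_add tendsto_const \<eta>_0)
    show "x $ i ~= 0" using elim[rule_format, of i] by simp
   qed simp
   then show ?case by (intro tendsto_prod) simp
  qed
  show "AE x in \<nu>. norm (\<Prod>i\<in>UNIV. x $ i powr (a + \<eta> k) $ i) <= 1" for k using \<nu>_bounds
  proof eventually_elim
   case (elim x)
   then show ?case unfolding prod_norm[symmetric] using less_imp_le[OF ak] by (intro prod_le_1) (auto intro!: powr_le1 simp: less_imp_le)
  qed
 qed measurable
 define J where "J n k = (LINT u|M. mon (a + \<eta> k) \<alpha> (v n u, w u))" for n k
 define D where "D n k = (LINT u|M. 1 - mon (\<eta> k) 0 (v n u, w u))" for n k
 have im: "integrable M (%u. mon b \<alpha> (v n u, w u))" if "!!i. 0 <= b $ i" "0 <= \<alpha>" for b \<alpha> n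
  using integrable_times_mono(1)[of "%_. 1" b \<alpha>] that by simp
 show ?thesis unfolding prod
 proof (rule limit_by_eventual_approximation[where J = J and K = "%k. c (a + \<eta> k) * W"
   and \<eta> = "%k. (1 - exp (- \<rho> (\<eta> k))) + inverse (real (Suc k))"])
  show "(%k. c (a + \<eta> k) * W) ---> c a * W" by (intro tendsto_intros ck)
  show "(%n. J n k) ---> c (a + \<eta> k) * W" for k unfolding J_def mono_v_w W_def c_def \<nu>_moment[OF ak] by (rule laplace[OF ak a(2)])
  have "(%k. (1 - exp (- \<rho> (\<eta> k))) + inverse (real (Suc k))) ---> (1 - exp (- 0)) + 0"
   by (intro tendsto_intros \<rho>_0 LIMSEQ_inverse_real_of_nat)
  then show "(%k. (1 - exp (- \<rho> (\<eta> k))) + inverse (real (Suc k))) ---> 0" by simp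
  fix k
  have ek: "0 <= \<eta> k $ i" for i using \<eta>_pos[of k i] by simp
  have "(%n. D n k) ---> 1 - exp (- \<rho> (\<eta> k))" proof -
   have "(%n. LINT u|M. mon (\<eta> k) 0 (v n u, w u)) ---> exp (- \<rho> (\<eta> k)) * (LINT u|M. exp (- 0 * Z u))"
    unfolding mono_v_w by (rule laplace[OF \<eta>_pos]) simp
   then have "(%n. 1 - (LINT u|M. mon (\<eta> k) 0 (v n u, w u))) ---> 1 - exp (- \<rho> (\<eta> k))" by (intro tendsto_intros) (simp add: prob_space)
   moreover have "D n k = 1 - (LINT u|M. mon (\<eta> k) 0 (v n u, w u))" for n unfolding D_def using im[OF ek order_refl] by (simp add: prob_space)
   ultimately show ?thesis by simp
  qed
  then have "EVN n. D n k < 1 - exp (- \<rho> (\<eta> k)) + inverse (real (Suc k))" by (rule order_tendstoD) simp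
  then show "EVN n. \<bar>(LINT u|M. mon a \<alpha> (v n u, w u)) - J n k\<bar> <= (1 - exp (- \<rho> (\<eta> k))) + inverse (real (Suc k))"
  proof (rule eventually_mono)
   fix n assume D: "D n k < 1 - exp (- \<rho> (\<eta> k)) + inverse (real (Suc k))"
   have "(LINT u|M. mon a \<alpha> (v n u, w u)) - J n k = (LINT u|M. mon a \<alpha> (v n u, w u) - mon (a + \<eta> k) \<alpha> (v n u, w u))"
    unfolding J_def by (rule Bint_diff[symmetric]) (intro im a less_imp_le[OF ak])+
   moreover have "\<bar>\<integral>u. mon a \<alpha> (v n u, w u) - mon (a + \<eta> k) \<alpha> (v n u, w u) \<partial>M\<bar>
    <= (LINT u|M. \<bar>mon a \<alpha> (v n u, w u) - mon (a + \<eta> k) \<alpha> (v n u, w u)\<bar>)" by (rule integral_abs_bound)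
   moreover have "... <= D n k" unfolding D_def
   proof (rule integral_mono)
    show "integrable M (%u. \<bar>mon a \<alpha> (v n u, w u) - mon (a + \<eta> k) \<alpha> (v n u, w u)\<bar>)"
     by (intro integrable_abs Bintegrable_diff im a less_imp_le[OF ak])
    show "integrable M (%u. 1 - mon (\<eta> k) 0 (v n u, w u))" using im[OF ek order_refl] by simp
    fix u
    define s where "s = mon a \<alpha> (v n u, w u)"
    define t where "t = mon (\<eta> k) 0 (v n u, w u)"
    have cu: "(v n u, w u) \<in> cube" using positive_v_w by (simp add: positive_def)
    have s: "0 <= s" "s <= 1" and t: "0 <= t" "t <= 1" unfolding s_def t_def by (rule mon_bounds[OF cu a] mon_bounds[OF cu ek order_refl])+
    have S: "(\<Sum>i\<in>UNIV. (a + \<eta> k) $ i * X n u $ i) = (\<Sum>i\<in>UNIV. a $ i * X n u $ i) + (\<Sum>i\<in>UNIV. \<eta> k $ i * X n u $ i)"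
     by (simp add: distrib_right sum.distrib)
    have "mon (a + \<eta> k) \<alpha> (v n u, w u) = s * t" unfolding s_def t_def mono_v_w S minus_add_distrib exp_add by simp
    moreover have "\<bar>s - s * t\<bar> = s * (1 - t)" proof -
     have "0 <= s * (1 - t)" using s t by (intro mult_nonneg_nonneg) auto
     moreover have "s - s * t = s * (1 - t)" by (simp add: right_diff_distrib)
     ultimately show ?thesis by (simp only: abs_of_nonneg)
    qed
    moreover have "s * (1 - t) <= 1 * (1 - t)" using s t by (intro mult_right_mono) auto
    ultimately show "\<bar>mon a \<alpha> (v n u, w u) - mon (a + \<eta> k) \<alpha> (v n u, w u)\<bar> <= 1 - mon (\<eta> k) 0 (v n u, w u)"
     by (simp add: s_def[symmetric] t_def[symmetric])
   qed
   ultimately show "\<bar>(LINT u|M. mon a \<alpha> (v n u, w u)) - J n k\<bar> <= (1 - exp (- \<rho> (\<eta> k))) + inverse (real (Suc k))"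
    using D by linarith
  qed
 qed
qed

end

section \<open>From mixed moments to bounded continuous functions\<close>

context laplace_limit begin

text \<open>Closed under multiplication by coordinates, which lets the induction over polynomials pass through products.\<close>
definition nice :: "((real ^ 'd) \<times> real => real) => bool" where
 "nice q \<longleftrightarrow> continuous_on UNIV q & (\<forall>a \<alpha>. (\<forall>i. 0 <= a $ i) --> 0 <= \<alpha> \<longrightarrow>
  (%n. LINT u|M. q (v n u, w u) * mon a \<alpha> (v n u, w u)) ---> (LINT z|\<mu>. q z * mon a \<alpha> z))"

lemma nice_add:
 assumes "nice f" "nice g"
 shows "nice (%z. f z + g z)" unfolding nice_def
proof (intro conjI allI impI)
 show "continuous_on UNIV (%z. f z + g z)" using assms by (auto simp: nice_def intro: continuous_on_add)
 fix a :: "real ^ 'd" and \<alpha> :: real assume a: "\<forall>i. 0 <= a $ i" "0 <= \<alpha>"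
 have c: "continuous_on UNIV f" "continuous_on UNIV g" using assms by (auto simp: nice_def)
 note i = integrable_times_mono[OF c(1) a(1)[rule_format] a(2)] integrable_times_mono[OF c(2) a(1)[rule_format] a(2)]
 have "(%n. (LINT u|M. f (v n u, w u) * mon a \<alpha> (v n u, w u)) + (LINT u|M. g (v n u, w u) * mon a \<alpha> (v n u, w u)))
  ---> (LINT z|\<mu>. f z * mon a \<alpha> z) + (LINT z|\<mu>. g z * mon a \<alpha> z)" using assms a by (intro tendsto_add) (auto simp: nice_def)
 then show "(%n. LINT u|M. (f (v n u, w u) + g (v n u, w u)) * mon a \<alpha> (v n u, w u))
  ---> (LINT z|\<mu>. (f z + g z) * mon a \<alpha> z)" unfolding distrib_right Bint_add[OF i(2) i(4)] Bint_add[OF i(1) i(3)] .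
qed

lemma nice_cmult:
 assumes "nice f"
 shows "nice (%z. c * f z)" unfolding nice_def
proof (intro conjI allI impI)
 show "continuous_on UNIV (%z. c * f z)" using assms by (auto simp: nice_def intro: continuous_on_mult_left)
 fix a :: "real ^ 'd" and \<alpha> :: real assume "\<forall>i. 0 <= a $ i" "0 <= \<alpha>"
 then have "(%n. c * (LINT u|M. f (v n u, w u) * mon a \<alpha> (v n u, w u))) ---> c * (LINT z|\<mu>. f z * mon a \<alpha> z)"
  using assms by (intro tendsto_mult_left) (simp add: nice_def)
 then show "(%n. LINT u|M. c * f (v n u, w u) * mon a \<alpha> (v n u, w u)) ---> (LINT z|\<mu>. c * f z * mon a \<alpha> z)"
  by (simp only: mult.assoc integral_mult_right_zero)
qed

lemma nice_sum: "finite I ==> (!!i. i \<in> I ==> nice (f i)) ==> nice (%z. \<Sum>i\<in>I. f i z)"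
proof (induction I rule: finite_induct)
 case empty
 show ?case by (simp add: nice_def)
next
 case (insert i I)
 then show ?case by (simp add: nice_add)
qed

lemma nice_shift:
 assumes q: "nice q" and k: "continuous_on UNIV k"
  and shift: "!!a \<alpha>. (!!i. 0 <= a $ i) ==> 0 <= \<alpha> ==> \<exists>a' \<alpha>'. (\<forall>i. 0 <= a' $ i) & 0 <= \<alpha>' & (\<forall>z. positive z --> k z * mon a \<alpha> z = mon a' \<alpha>' z)"
 shows "nice (%z. k z * q z)" unfolding nice_def
proof (intro conjI allI impI)
 have qc: "continuous_on UNIV q" using q by (simp add: nice_def)
 show "continuous_on UNIV (%z. k z * q z)" by (intro continuous_on_mult k qc)
 fix a :: "real ^ 'd" and \<alpha> :: real assume a: "\<forall>i. 0 <= a $ i" "0 <= \<alpha>"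
 obtain a' \<alpha>' where s: "\<forall>i. 0 <= a' $ i" "0 <= \<alpha>'" "!!z. positive z ==> k z * mon a \<alpha> z = mon a' \<alpha>' z"
  using shift[of a \<alpha>] a by blast
 have e: "k z * q z * mon a \<alpha> z = q z * mon a' \<alpha>' z" if "positive z" for z proof -
  have "k z * q z * mon a \<alpha> z = q z * (k z * mon a \<alpha> z)" by (simp only: mult_ac)
  then show ?thesis by (simp only: s(3)[OF that])
 qed
 have [measurable]: "q \<in> bmeas borel" "k \<in> bmeas borel" using borel_measurable_continuous_onI[OF qc] borel_measurable_continuous_onI[OF k] .
 have "(LINT z|\<mu>. k z * q z * mon a \<alpha> z) = (LINT z|\<mu>. q z * mon a' \<alpha>' z)"
 proof (rule integral_cong_AE)
  show "AE z in \<mu>. k z * q z * mon a \<alpha> z = q z * mon a' \<alpha>' z" using AE_positive by eventually_elim (rule e)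
 qed measurable
 moreover have "(LINT u|M. k (v n u, w u) * q (v n u, w u) * mon a \<alpha> (v n u, w u)) = (LINT u|M. q (v n u, w u) * mon a' \<alpha>' (v n u, w u))" for n
  by (simp only: e[OF positive_v_w])
 moreover have "(%n. LINT u|M. q (v n u, w u) * mon a' \<alpha>' (v n u, w u)) ---> (LINT z|\<mu>. q z * mon a' \<alpha>' z)"
  using q s by (simp add: nice_def)
 ultimately show "(%n. LINT u|M. k (v n u, w u) * q (v n u, w u) * mon a \<alpha> (v n u, w u)) ---> (LINT z|\<mu>. k z * q z * mon a \<alpha> z)"
  by (simp only:)
qed

lemma nice_coord: "nice q ==> nice (%z. fst z $ i * q z)"
proof (rule nice_shift)
 fix a :: "real ^ 'd" and \<alpha> :: real assume a: "!!i. 0 <= a $ i" "0 <= \<alpha>"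
 have "0 <= (a + axis i 1) $ j" for j using a(1)[of j] by (simp add: axis_def)
 then show "\<exists>a' \<alpha>'. (\<forall>i. 0 <= a' $ i) & 0 <= \<alpha>' & (\<forall>z. positive z --> fst z $ i * mon a \<alpha> z = mon a' \<alpha>' z)"
  using a(2) mono_coord by blast
qed (auto intro!: continuous_intros)

lemma nice_last: "nice q ==> nice (%z. snd z * q z)"
proof (rule nice_shift)
 fix a :: "real ^ 'd" and \<alpha> :: real assume a: "!!i. 0 <= a $ i" "0 <= \<alpha>"
 have "0 <= \<alpha> + 1" using a(2) by simp
 then show "\<exists>a' \<alpha>'. (\<forall>i. 0 <= a' $ i) & 0 <= \<alpha>' & (\<forall>z. positive z --> snd z * mon a \<alpha> z = mon a' \<alpha>' z)"
  using a(1) mono_last by blast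
qed (auto intro!: continuous_intros)

lemma nice_polynomial:
 assumes "real_polynomial_function p"
 shows "nice q ==> nice (%z. p z * q z)" using assms
proof (induction p arbitrary: q rule: real_polynomial_function.induct)
 case (linear f)
 have "nice (%z. (\<Sum>i\<in>UNIV. f (axis i 1, 0) * (fst z $ i * q z)) + f (0, 1) * (snd z * q z))"
  by (intro nice_add nice_sum nice_cmult nice_coord nice_last linear finite)
 moreover have "(\<Sum>i\<in>UNIV. f (axis i 1, 0) * (fst z $ i * q z)) + f (0, 1) * (snd z * q z) = f z * q z" for z
  unfolding linear_pair_expansion[OF linear(1), of z] by (simp add: distrib_right sum_distrib_right mult.assoc)
 ultimately show ?case by simp
next
 case (const c)
 then show ?case by (rule nice_cmult)
next
 case (add f g)
 then show ?case unfolding distrib_right by (intro nice_add) auto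
next
 case (mult f g)
 have "nice (%z. f z * (g z * q z))" by (intro mult)
 then show ?case by (simp only: mult.assoc)
qed

lemma nice_1: "nice (%_. 1)" unfolding nice_def using mono_converges by simp

lemma mon_0: "positive z ==> mon 0 0 z = 1" proof -
 assume z: "positive z"
 have "fst z $ i ~= 0" for i proof -
  have "0 < fst z $ i" using z by (simp add: positive_def)
  then show ?thesis by simp
 qed
 moreover have "snd z ~= 0" using z by (simp add: positive_def)
 ultimately show ?thesis by (simp add: mon_def)
qed

lemma polynomial_converges:
 assumes "real_polynomial_function p"
 shows "(%n. LINT u|M. p (v n u, w u)) ---> (LINT z|\<mu>. p z)" proof -
 have n: "nice p" using nice_polynomial[OF assms nice_1] by simp
 then have pc: "continuous_on UNIV p" by (simp add: nice_def)
 have [measurable]: "p \<in> bmeas borel" by (rule borel_measurable_continuous_onI[OF pc])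
 have "(%n. LINT u|M. p (v n u, w u) * mon 0 0 (v n u, w u)) ---> (LINT z|\<mu>. p z * mon 0 0 z)" using n by (simp add: nice_def)
 moreover have "(LINT z|\<mu>. p z * mon 0 0 z) = (LINT z|\<mu>. p z)"
 proof (rule integral_cong_AE)
  show "AE z in \<mu>. p z * mon 0 0 z = p z" using AE_positive by eventually_elim (simp add: mon_0)
 qed measurable
 ultimately show ?thesis by (simp add: mon_0[OF positive_v_w])
qed

lemma continuous_converges:
 assumes F: "continuous_on UNIV F"
 shows "(%n. LINT u|M. F (v n u, w u)) ---> (LINT z|\<mu>. (F z :: real))" proof -
 have "\<exists>p. real_polynomial_function p & (\<forall>z\<in>cube. \<bar>F z - p z\<bar> < inverse (real (Suc k)))" for k proof -
  have "compact (cube :: ((real ^ 'd) \<times> real) set)" by (simp add: cube_def compact_cbox)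
  moreover have "0 < inverse (real (Suc k))" by simp
  ultimately show ?thesis by (rule Stone_Weierstrass_real_polynomial_function[OF _ continuous_on_subset[OF F subset_UNIV]]) blast
 qed
 then obtain p where p: "!!k. real_polynomial_function (p k)" "!!k z. z \<in> cube ==> \<bar>F z - p k z\<bar> < inverse (real (Suc k))" by metis
 have pc: "continuous_on UNIV (p k)" for k using nice_polynomial[OF p(1) nice_1, of k] by (simp add: nice_def)
 have i: "integrable M (%u. q (v n u, w u))" "integrable \<mu> q" if qc: "continuous_on UNIV q" for q :: "(real ^ 'd) \<times> real => real" and n proof -
  obtain B where B: "!!z. z \<in> cube ==> \<bar>q z\<bar> <= B" using continuous_bounded_on_cube[OF qc] by blast
  show "integrable M (%u. q (v n u, w u))" by (rule integrable_cube(1)[OF borel_measurable_continuous_onI[OF qc] B])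
  show "integrable \<mu> q" by (rule integrable_cube(2)[OF borel_measurable_continuous_onI[OF qc] B])
 qed
 show ?thesis
 proof (rule limit_by_eventual_approximation[where J = "%n k. LINT u|M. p k (v n u, w u)" and K = "%k. LINT z|\<mu>. p k z" and \<eta> = "%k. inverse (real (Suc k))"])
  show "(%k. inverse (real (Suc k))) ---> 0" by (rule LIMSEQ_inverse_real_of_nat)
  show "(%n. LINT u|M. p k (v n u, w u)) ---> (LINT z|\<mu>. p k z)" for k by (rule polynomial_converges[OF p(1)])
  show "EVN n. \<bar>(LINT u|M. F (v n u, w u)) - (LINT u|M. p k (v n u, w u))\<bar> <= inverse (real (Suc k))" for k
  proof (intro always_eventually allI)
   fix n
   have "(LINT u|M. F (v n u, w u)) - (LINT u|M. p k (v n u, w u)) = (LINT u|M. F (v n u, w u) - p k (v n u, w u))"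
    by (rule Bint_diff[symmetric, OF i(1)[OF F] i(1)[OF pc]])
   moreover have "\<bar>\<integral>u. F (v n u, w u) - p k (v n u, w u) \<partial>M\<bar> <= (LINT u|M. \<bar>F (v n u, w u) - p k (v n u, w u)\<bar>)"
    by (rule integral_abs_bound)
   moreover have "... <= inverse (real (Suc k))"
   proof (rule integral_le_const)
    show "integrable M (%u. \<bar>F (v n u, w u) - p k (v n u, w u)\<bar>)" by (rule integrable_abs[OF Bintegrable_diff[OF i(1)[OF F] i(1)[OF pc]]])
    show "AE u in M. \<bar>F (v n u, w u) - p k (v n u, w u)\<bar> <= inverse (real (Suc k))"
    proof (rule AE_I2)
     fix u
     have "(v n u, w u) \<in> cube" using positive_v_w by (simp add: positive_def)
     from less_imp_le[OF p(2)[OF this]] show "\<bar>F (v n u, w u) - p k (v n u, w u)\<bar> <= inverse (real (Suc k))" .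
    qed
   qed
   ultimately show "\<bar>(LINT u|M. F (v n u, w u)) - (LINT u|M. p k (v n u, w u))\<bar> <= inverse (real (Suc k))" by linarith
  qed
  show "(%k. LINT z|\<mu>. p k z) ---> (LINT z|\<mu>. F z)"
  proof (rule integral_dominated_convergence[where w = "%z. \<bar>F z\<bar> + 1"])
   show "AE z in \<mu>. (%k. p k z) ---> F z" using AE_positive
   proof eventually_elim
    case (elim z)
    then have z: "z \<in> cube" by (simp add: positive_def)
    show ?case
    proof (rule LIM_zero_cancel, rule Lim_null_comparison[OF always_eventually LIMSEQ_inverse_real_of_nat], intro allI)
     show "norm (p k z - F z) <= inverse (real (Suc k))" for k using p(2)[OF z, of k] by (simp add: abs_minus_commute)
    qed
   qed
   show "AE z in \<mu>. norm (p k z) <= \<bar>F z\<bar> + 1" for k using AE_positive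
   proof eventually_elim
    case (elim z)
    then have z: "z \<in> cube" by (simp add: positive_def)
    have "inverse (real (Suc k)) <= 1" by (simp add: field_simps)
    with p(2)[OF z, of k] show ?case unfolding real_norm_def by linarith
   qed
   show "integrable \<mu> (%z. \<bar>F z\<bar> + 1)" by (rule i(2)) (intro continuous_intros F)
   have [measurable]: "F \<in> bmeas borel" "p k \<in> bmeas borel" for k
    using borel_measurable_continuous_onI[OF F] borel_measurable_continuous_onI[OF pc] .
   show "F \<in> bmeas \<mu>" "p k \<in> bmeas \<mu>" for k by measurable
  qed
 qed
qed

definition neg_log :: "(real ^ 'd) \<times> real => (real ^ 'd) \<times> real" where
 "neg_log z = ((\<chi> i. - ln (fst z $ i)), - ln (snd z))"

lemma neg_log_v_w: "neg_log (v n u, w u) = (X n u, Z u)" by (simp add: neg_log_def v_def w_def vec_eq_iff)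

lemma measurable_neg_log [measurable]: "neg_log \<in> bmeas borel" unfolding neg_log_def[abs_def]
proof (rule borel_measurable_Pair)
 have [measurable]: "fst \<in> bmeas (borel :: ((real ^ 'd) \<times> real) measure)" "snd \<in> bmeas (borel :: ((real ^ 'd) \<times> real) measure)"
  unfolding borel_prod[symmetric] by measurable
 show "(%z :: (real ^ 'd) \<times> real. \<chi> i. - ln (fst z $ i)) \<in> bmeas borel" by (rule measurable_vec_lambda) measurable
 show "(%z :: (real ^ 'd) \<times> real. - ln (snd z)) \<in> bmeas borel" by measurable
qed

text \<open>The logarithm is unbounded near the faces of the cube, so the test function is cut off there; the error is the expectation of a continuous function, which is small because the limit law does not charge the faces.\<close>
lemma bounded_continuous_converges:
 fixes f :: "(real ^ 'd) \<times> real => real"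
 assumes f: "continuous_on UNIV f" and B: "!!z. \<bar>f z\<bar> <= B"
 shows "(%n. LINT u|M. f (X n u, Z u)) ---> (LINT z|\<mu>. f (neg_log z))" proof -
 have B0: "0 <= B" using B[of "(0, 0)"] by linarith
 define cut where "cut k s = min 1 (max 0 (real (Suc k) * s - 1))" for k and s :: real
 define K where "K k z = (\<Prod>i\<in>UNIV. cut k (fst z $ i)) * cut k (snd z)" for k and z :: "(real ^ 'd) \<times> real"
 define low where "low k s = - ln (max s (inverse (real (Suc k))))" for k and s :: real
 define F where "F k z = f ((\<chi> i. low k (fst z $ i)), low k (snd z)) * K k z" for k z
 have cut01: "0 <= cut k s" "cut k s <= 1" for k s by (auto simp: cut_def)
 have K01: "0 <= K k z" "K k z <= 1" for k z unfolding K_def by (auto intro!: mult_nonneg_nonneg prod_nonneg mult_le_one prod_le_1 simp: cut01)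
 have cut_c: "continuous_on UNIV (%z. cut k (g z))" if "continuous_on UNIV g" for k and g :: "(real ^ 'd) \<times> real => real"
  unfolding cut_def by (intro continuous_intros that)
 have lc: "continuous_on UNIV (%z. low k (g z))" if "continuous_on UNIV g" for k and g :: "(real ^ 'd) \<times> real => real" proof -
  have "max s (inverse (real (Suc k))) ~= 0" for s proof -
   have "0 < inverse (real (Suc k))" by simp
   also have "... <= max s (inverse (real (Suc k)))" by (rule max.cobounded2)
   finally show ?thesis by (rule less_imp_neq[symmetric])
  qed
  then show ?thesis unfolding low_def by (intro continuous_intros that) simp
 qed
 have Kc: "continuous_on UNIV (K k)" for k unfolding K_def by (intro continuous_intros cut_c)
 have Fc: "continuous_on UNIV (F k)" for k proof -
  have "continuous_on UNIV (%z :: (real ^ 'd) \<times> real. ((\<chi> i. low k (fst z $ i)) :: real ^ 'd, low k (snd z)))" by (intro continuous_intros lc)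
  from continuous_on_compose2[OF f this] show ?thesis unfolding F_def by (intro continuous_on_mult Kc) simp
 qed
 have key: "\<bar>f (neg_log z) - F k z\<bar> <= B * (1 - K k z)" for k z
 proof (cases "K k z = 0")
  case True
  then show ?thesis using B by (simp add: F_def)
 next
  case False
  have lowln: "low k s = - ln s" if "cut k s ~= 0" for s proof -
   have "0 < real (Suc k) * s - 1" using that by (simp add: cut_def max_def split: if_splits)
   then have "1 < s * real (Suc k)" by (simp only: mult.commute[of s])
   then have "1 / real (Suc k) < s" by (subst pos_divide_less_eq) simp_all
   then have "inverse (real (Suc k)) < s" by (simp only: inverse_eq_divide)
   then show ?thesis by (simp add: low_def max_absorb1)
  qed
  have "cut k (fst z $ i) ~= 0" for i using False by (auto simp: K_def)
  moreover have "cut k (snd z) ~= 0" using False by (auto simp: K_def)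
  ultimately have "F k z = f (neg_log z) * K k z" by (simp add: F_def neg_log_def lowln)
  then have "\<bar>f (neg_log z) - F k z\<bar> = \<bar>f (neg_log z) * (1 - K k z)\<bar>" by (simp add: right_diff_distrib)
  also have "... <= B * (1 - K k z)" unfolding abs_mult using B B0 K01[of k z] by (intro mult_mono) auto
  finally show ?thesis .
 qed
 have Klim: "AE z in \<mu>. (%k. K k z) ---> 1" using AE_positive
 proof eventually_elim
  case (elim z)
  have one: "(%k. cut k s) ---> 1" if s: "0 < s" for s
  proof (rule tendsto_eventually, rule eventually_sequentiallyI)
   fix k assume "nat \<lceil>2 / s\<rceil> <= k"
   then have "2 / s <= real k" by linarith
   then have "2 <= real k * s" using s by (simp add: pos_divide_le_eq)
   moreover have "real (Suc k) * s = real k * s + s" by (simp add: distrib_right)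
   ultimately show "cut k s = 1" using s by (simp add: cut_def)
  qed
  have "(%k. (\<Prod>i\<in>UNIV. cut k (fst z $ i)) * cut k (snd z)) ---> (\<Prod>i\<in>(UNIV :: 'd set). 1) * 1"
   using elim by (intro tendsto_mult tendsto_prod one) (auto simp: positive_def)
  then show ?case by (simp add: K_def)
 qed
 have fm [measurable]: "f \<in> bmeas borel" "K k \<in> bmeas borel" "F k \<in> bmeas borel" for k
  using borel_measurable_continuous_onI[OF f] borel_measurable_continuous_onI[OF Kc] borel_measurable_continuous_onI[OF Fc] .
 have iK: "integrable \<mu> (K k)" "integrable M (%u. K k (v n u, w u))" for k n by (rule integrable_cube[of _ 1]; use K01 in simp)+
 have ifb: "integrable \<mu> (%z. f (neg_log z))" "integrable M (%u. f (neg_log (v n u, w u)))" for n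
  using B by (intro integrable_cube[of "%z. f (neg_log z)" B]; simp)+
 have F_B: "\<bar>F k z\<bar> <= B" for k z proof -
  have "\<bar>F k z\<bar> <= B * 1" unfolding F_def abs_mult using K01[of k z] B0 by (intro mult_mono B) auto
  then show ?thesis by simp
 qed
 have iF: "integrable \<mu> (F k)" "integrable M (%u. F k (v n u, w u))" for k n by (rule integrable_cube[of _ B]; use F_B in simp)+
 define e where "e k = B * (1 - (LINT z|\<mu>. K k z))" for k
 have "(%k. LINT z|\<mu>. K k z) ---> (LINT z|\<mu>. 1)" by (rule integral_dominated_convergence[where w = "%_. 1"]) (use Klim K01 in auto)
 then have "(%k. LINT z|\<mu>. K k z) ---> 1" using P.prob_space by simp
 then have "e ---> B * (1 - 1)" unfolding e_def by (intro tendsto_intros)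
 then have e0: "e ---> 0" by simp
 have "(%n. LINT u|M. f (neg_log (v n u, w u))) ---> (LINT z|\<mu>. f (neg_log z))"
 proof (rule limit_by_eventual_approximation[where J = "%n k. LINT u|M. F k (v n u, w u)" and K = "%k. LINT z|\<mu>. F k z" and \<eta> = "%k. e k + inverse (real (Suc k))"])
  show "(%k. e k + inverse (real (Suc k))) ---> 0" using tendsto_add[OF e0 LIMSEQ_inverse_real_of_nat] by simp
  show "(%n. LINT u|M. F k (v n u, w u)) ---> (LINT z|\<mu>. F k z)" for k by (rule continuous_converges[OF Fc])
  show "EVN n. \<bar>(LINT u|M. f (neg_log (v n u, w u))) - (LINT u|M. F k (v n u, w u))\<bar> <= e k + inverse (real (Suc k))" for k proof -
   have "(%n. B * (1 - (LINT u|M. K k (v n u, w u)))) ---> e k" unfolding e_def by (intro tendsto_intros continuous_converges[OF Kc])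
   then have "EVN n. B * (1 - (LINT u|M. K k (v n u, w u))) < e k + inverse (real (Suc k))" by (rule order_tendstoD) simp
   then show ?thesis
   proof (rule eventually_mono)
    fix n assume n: "B * (1 - (LINT u|M. K k (v n u, w u))) < e k + inverse (real (Suc k))"
    have "(LINT u|M. f (neg_log (v n u, w u))) - (LINT u|M. F k (v n u, w u)) = (LINT u|M. f (neg_log (v n u, w u)) - F k (v n u, w u))"
     by (rule Bint_diff[symmetric, OF ifb(2) iF(2)])
    moreover have "\<bar>\<integral>u. f (neg_log (v n u, w u)) - F k (v n u, w u) \<partial>M\<bar> <= (LINT u|M. \<bar>f (neg_log (v n u, w u)) - F k (v n u, w u)\<bar>)"
     by (rule integral_abs_bound)
    moreover have "... <= (LINT u|M. B * (1 - K k (v n u, w u)))" using iK by (intro integral_mono integrable_abs Bintegrable_diff ifb(2) iF(2) key) auto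
    moreover have "... = B * (1 - (LINT u|M. K k (v n u, w u)))" using iK by (simp add: prob_space)
    ultimately show "\<bar>(LINT u|M. f (neg_log (v n u, w u))) - (LINT u|M. F k (v n u, w u))\<bar> <= e k + inverse (real (Suc k))" using n by linarith
   qed
  qed
  show "(%k. LINT z|\<mu>. F k z) ---> (LINT z|\<mu>. f (neg_log z))"
  proof (rule integral_dominated_convergence[where w = "%_. B"])
   show "AE z in \<mu>. (%k. F k z) ---> f (neg_log z)" using Klim
   proof eventually_elim
    case (elim z)
    have "(%k. B * (1 - K k z)) ---> B * (1 - 1)" by (intro tendsto_intros elim)
    then have b: "(%k. B * (1 - K k z)) ---> 0" by simp
    show ?case
    proof (rule LIM_zero_cancel, rule Lim_null_comparison[OF always_eventually b], intro allI)
     show "norm (F k z - f (neg_log z)) <= B * (1 - K k z)" for k using key[of z k] by (simp add: abs_minus_commute)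
    qed
   qed
  qed (use F_B in auto)
 qed
 then show ?thesis by (simp only: neg_log_v_w)
qed

end

section \<open>Scaling of the limit exponent and the theorem\<close>

context critical_brw begin

text \<open>Replacing \<open>\<theta>\<close> by its rescaling shifts \<open>x\<close> by \<open>y\<close> in the defining expectation.\<close>
lemma rho_scaling:
 assumes \<theta>: "!!i. 0 < \<theta> $ i"
 shows "\<rho> (\<chi> i. \<theta> $ i * exp (\<beta> $ i * y)) = exp y * \<rho> \<theta>" proof -
 define \<theta>' where "\<theta>' = (\<chi> i. \<theta> $ i * exp (\<beta> $ i * y))"
 have \<theta>': "0 < \<theta>' $ i" for i using \<theta> by (simp add: \<theta>'_def)
 define h where "h \<theta> n x = (LINT u|M. 1 - exp (- (\<Sum>i\<in>UNIV. \<theta> $ i * exp (- \<beta> $ i * x) * W_tilde \<xi> n (\<beta> $ i) u)))" for \<theta> :: "real ^ 'd" and n x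
 have hs: "h \<theta>' n x = h \<theta> n (x - y)" for n x proof -
  have "\<theta>' $ i * exp (- \<beta> $ i * x) = \<theta> $ i * exp (- \<beta> $ i * (x - y))" for i proof -
   have "\<beta> $ i * y + - \<beta> $ i * x = - \<beta> $ i * (x - y)" by (simp add: right_diff_distrib)
   then have "exp (\<beta> $ i * y) * exp (- \<beta> $ i * x) = exp (- \<beta> $ i * (x - y))" by (simp only: exp_add[symmetric])
   then show ?thesis by (simp only: \<theta>'_def vec_lambda_beta mult.assoc)
  qed
  then show ?thesis unfolding h_def by (simp only:)
 qed
 (* a generation so late that k - z is admissible for every fixed z and A *)
 define m where "m k = nat \<lceil>exp (2 * real k)\<rceil>" for k :: nat
 have m: "2 * real k <= ln (real (m k))" "k <= m k" for k proof -
  have e: "exp (2 * real k) <= real (m k)" unfolding m_def by linarith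
  then have "ln (exp (2 * real k)) <= ln (real (m k))" using less_le_trans[OF exp_gt_zero e] by (subst ln_le_cancel_iff) auto
  then show "2 * real k <= ln (real (m k))" by simp
  have "2 * real k <= exp (2 * real k)" using exp_ge_add_one_self[of "2 * real k"] by linarith
  then show "k <= m k" using e by linarith
 qed
 have lim: "(%k. exp (real k - z) / (real k - z) * h \<theta> (m k) (real k - z)) ---> \<rho> \<theta>" if \<theta>: "!!i. 0 < \<theta> $ i" for z :: real and \<theta> :: "real ^ 'd"
 proof (rule tendstoI)
  fix eps :: real assume eps: "eps > 0"
  then have "eps / 2 > 0" by simp
  from rho[unfolded is_rho_def, THEN spec, THEN mp, OF allI[OF \<theta>], THEN conjunct2, THEN spec, THEN mp, OF this]
  obtain A N where A: "A \<ge> 0" and AN: "\<forall>n>N. \<forall>x\<in>{A .. 3/2 * ln (real n) - A}. \<bar>exp x / x * h \<theta> n x - \<rho> \<theta>\<bar> <= eps / 2"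
   unfolding h_def by (elim exE conjE)
  show "EVN k. dist (exp (real k - z) / (real k - z) * h \<theta> (m k) (real k - z)) (\<rho> \<theta>) < eps"
  proof (rule eventually_sequentiallyI)
   fix k assume k: "max (Suc N) (nat \<lceil>A + \<bar>z\<bar>\<rceil>) <= k"
   then have 1: "N < m k" using m(2)[of k] by simp
   have kA: "A + \<bar>z\<bar> <= real k" using k by linarith
   have "real k - z \<in> {A .. 3/2 * ln (real (m k)) - A}" using kA A m(1)[of k] by (simp add: abs_if split: if_splits)
   then have "\<bar>exp (real k - z) / (real k - z) * h \<theta> (m k) (real k - z) - \<rho> \<theta>\<bar> <= eps / 2" using AN 1 by blast
   then show "dist (exp (real k - z) / (real k - z) * h \<theta> (m k) (real k - z)) (\<rho> \<theta>) < eps" using eps unfolding dist_real_def by linarith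
  qed
 qed
 have q: "(%k. exp y * ((real k - y) / real k)) ---> exp y * 1" by (intro tendsto_intros) real_asymp
 have "(%k. (exp y * ((real k - y) / real k)) * (exp (real k - y) / (real k - y) * h \<theta> (m k) (real k - y))) ---> (exp y * 1) * \<rho> \<theta>"
  by (rule tendsto_mult[OF q lim[OF \<theta>]])
 moreover have "EVN k. (exp y * ((real k - y) / real k)) * (exp (real k - y) / (real k - y) * h \<theta> (m k) (real k - y))
  = exp (real k - 0) / (real k - 0) * h \<theta>' (m k) (real k - 0)"
 proof (rule eventually_sequentiallyI)
  fix k assume "nat \<lceil>\<bar>y\<bar> + 1\<rceil> <= k"
  then have k: "\<bar>y\<bar> + 1 <= real k" by linarith
  have e: "exp (real k) = exp y * exp (real k - y)" by (simp add: exp_add[symmetric])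
  have "real k - y ~= 0" using k by linarith
  then have "(E * ((real k - y) / real k)) * (F / (real k - y) * H) = (E * F) / real k * H" for E F H by simp
  then show "(exp y * ((real k - y) / real k)) * (exp (real k - y) / (real k - y) * h \<theta> (m k) (real k - y))
   = exp (real k - 0) / (real k - 0) * h \<theta>' (m k) (real k - 0)" unfolding hs diff_0_right e .
 qed
 ultimately have "(%k. exp (real k - 0) / (real k - 0) * h \<theta>' (m k) (real k - 0)) ---> (exp y * 1) * \<rho> \<theta>"
  by (rule Lim_transform_eventually)
 from LIMSEQ_unique[OF this lim[OF \<theta>', of 0]] show ?thesis by (simp add: \<theta>'_def)
qed

lemma conditional_expectation:
 fixes f :: "'w => real"
 assumes [measurable]: "f \<in> bmeas M"
 shows "(\<integral>u. f u \<partial>cond_survival M \<xi>) = (LINT u|M. f u * indicator {u. Z_inf \<xi> u > 0} u) / prob {u \<in> space M. Z_inf \<xi> u > 0}"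
proof -
 define S where "S = {u \<in> space M. Z_inf \<xi> u > 0}"
 have S [measurable]: "S \<in> sets M" unfolding S_def by measurable
 have p: "prob S > 0" using survival_possible by (simp add: S_def)
 have "(\<integral>u. f u \<partial>cond_survival M \<xi>) = (\<integral>u. f u \<partial>density M (%u. ennreal (indicator S u / prob S)))" proof -
  have "1 / ennreal (prob S) = ennreal (1 / prob S)" using divide_ennreal[of 1 "prob S"] p by simp
  then have "indicator S u / emeasure M S = ennreal (indicator S u / prob S)" for u by (cases "u \<in> S") (simp_all add: emeasure_eq_measure)
  then show ?thesis unfolding cond_survival_def S_def[symmetric] uniform_measure_def by (simp only:)
 qed
 also have "... = (LINT u|M. (indicator S u / prob S) *\<^sub>R f u)" using p by (intro integral_density) auto
 also have "... = (LINT u|M. (f u * indicator {u. Z_inf \<xi> u > 0} u) / prob S)"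
  by (intro Bochner_Integration.integral_cong) (auto simp: S_def indicator_def)
 finally show ?thesis by (simp add: S_def)
qed

lemma convergence_in_law:
 "\<exists>(Q :: ((real ^ 'd) \<times> real) measure) (mu_inf :: (real ^ 'd) \<times> real => real ^ 'd) Z.
      prob_space Q \<and>
      independent_rvs Q mu_inf Z \<and>
      distr Q borel Z = distr (cond_survival M \<xi>) borel (Z_inf \<xi>) \<and>
      converges_in_law
       (%n. distr (cond_survival M \<xi>) borel (mu_hat_vec \<xi> n \<beta>))
       (distr Q borel mu_inf) \<and>
      converges_in_law
       (%n. distr (cond_survival M \<xi>) borel (%u. (mu_hat_vec \<xi> n \<beta> u, Z_inf \<xi> u)))
       (distr Q borel (%q. (mu_inf q, Z q)))" proof -
 define C where "C = cond_survival M \<xi>"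
 define S where "S = {u \<in> space M. Z_inf \<xi> u > 0}"
 have S [measurable]: "S \<in> sets M" unfolding S_def by measurable
 have p: "prob S > 0" using survival_possible by (simp add: S_def)
 have sC [measurable_cong]: "sets C = sets M" by (simp add: C_def cond_survival_def)
 interpret C: prob_space C unfolding C_def cond_survival_def S_def[symmetric]
  using p by (intro prob_space_uniform_measure) (auto simp: emeasure_eq_measure)
 have aeZ: "AE u in C. Z_inf \<xi> u > 0" unfolding C_def cond_survival_def S_def[symmetric]
  using p by (intro AE_uniform_measureI[OF S]) (auto simp: S_def)
 define Zp where "Zp u = max 0 (Z_inf \<xi> u)" for u
 have Zm [measurable]: "Z_inf \<xi> \<in> bmeas C" by measurable
 have Zpm [measurable]: "Zp \<in> bmeas C" unfolding Zp_def[abs_def] by measurable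
 have mum [measurable]: "mu_hat_vec \<xi> n \<beta> \<in> bmeas C" for n unfolding mu_hat_vec_def[abs_def] by (rule measurable_vec_lambda) measurable
 have aeZp: "AE u in C. Zp u = Z_inf \<xi> u" using aeZ by eventually_elim (simp add: Zp_def)
 define \<eta> where "\<eta> k = (\<chi> i. exp (- (\<beta> $ i * real k)))" for k :: nat
 interpret LC: laplace_convergence C "%n. mu_hat_vec \<xi> n \<beta>" Zp \<rho> \<eta>
 proof
  show "0 <= mu_hat_vec \<xi> n \<beta> u $ i" for n u i by (simp add: mu_hat_vec_def partition_mu_hat partition_nonneg)
  show "0 <= Zp u" for u by (simp add: Zp_def)
  show "0 < \<eta> k $ i" for k i by (simp add: \<eta>_def)
  show "(%k. \<eta> k $ i) ---> 0" for i proof -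
   have "0 < \<beta> $ i" using beta[of i] by simp
   then show ?thesis unfolding \<eta>_def vec_lambda_beta by real_asymp
  qed
  have "\<rho> (\<eta> k) = exp (- real k) * \<rho> 1" for k using rho_scaling[of 1 "- real k"] by (simp add: \<eta>_def)
  moreover have "(%k. exp (- real k) * \<rho> 1) ---> 0" by real_asymp
  ultimately show "(%k. \<rho> (\<eta> k)) ---> 0" by simp
  fix \<theta> :: "real ^ 'd" and \<alpha> :: real assume \<theta>: "!!i. 0 < \<theta> $ i" and \<alpha>: "0 <= \<alpha>"
  have 1: "(LINT u|C. exp (- (\<Sum>i\<in>UNIV. \<theta> $ i * mu_hat_vec \<xi> n \<beta> u $ i)) * exp (- \<alpha> * Zp u))
   = (LINT u|M. exp (- (\<Sum>i\<in>UNIV. \<theta> $ i * mu_hat \<xi> n (\<beta> $ i) u)) * exp (- \<alpha> * Z_inf \<xi> u) * indicator {u. Z_inf \<xi> u > 0} u) / prob S" for n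
  proof -
   have "(LINT u|C. exp (- (\<Sum>i\<in>UNIV. \<theta> $ i * mu_hat_vec \<xi> n \<beta> u $ i)) * exp (- \<alpha> * Zp u))
    = (LINT u|C. exp (- (\<Sum>i\<in>UNIV. \<theta> $ i * mu_hat \<xi> n (\<beta> $ i) u)) * exp (- \<alpha> * Z_inf \<xi> u))"
   proof (rule integral_cong_AE)
    show "AE u in C. exp (- (\<Sum>i\<in>UNIV. \<theta> $ i * mu_hat_vec \<xi> n \<beta> u $ i)) * exp (- \<alpha> * Zp u)
     = exp (- (\<Sum>i\<in>UNIV. \<theta> $ i * mu_hat \<xi> n (\<beta> $ i) u)) * exp (- \<alpha> * Z_inf \<xi> u)"
     using aeZp by eventually_elim (simp add: mu_hat_vec_def)
   qed measurable
   then show ?thesis unfolding C_def S_def by (subst (asm) (2) conditional_expectation) simp_all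
  qed
  have 2: "(LINT u|C. exp (- \<alpha> * Zp u)) = (LINT u|M. exp (- \<alpha> * Z_inf \<xi> u) * indicator {u. Z_inf \<xi> u > 0} u) / prob S" proof -
   have "(LINT u|C. exp (- \<alpha> * Zp u)) = (LINT u|C. exp (- \<alpha> * Z_inf \<xi> u))"
   proof (rule integral_cong_AE)
    show "AE u in C. exp (- \<alpha> * Zp u) = exp (- \<alpha> * Z_inf \<xi> u)" using aeZp by eventually_elim simp
   qed measurable
   then show ?thesis unfolding C_def S_def by (subst (asm) (2) conditional_expectation) simp_all
  qed
  show "(%n. LINT u|C. exp (- (\<Sum>i\<in>UNIV. \<theta> $ i * mu_hat_vec \<xi> n \<beta> u $ i)) * exp (- \<alpha> * Zp u))
   ---> exp (- \<rho> \<theta>) * (LINT u|C. exp (- \<alpha> * Zp u))"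
   unfolding 1 2 times_divide_eq_right using p by (intro tendsto_divide tendsto_const joint_Laplace_limit \<theta> \<alpha>) simp
 qed measurable
 obtain \<nu> where \<nu>: "prob_space \<nu>" "sets \<nu> = sets borel" "AE x in \<nu>. \<forall>i. 0 < x $ i & x $ i <= 1"
  "\<forall>\<theta>. (\<forall>i. 0 < \<theta> $ i) --> (LINT x|\<nu>. (\<Prod>i\<in>UNIV. x $ i powr \<theta> $ i)) = exp (- \<rho> \<theta>)"
  by (rule LC.limit_law) (rule that)
 interpret LL: laplace_limit C "%n. mu_hat_vec \<xi> n \<beta>" Zp \<rho> \<eta> \<nu>
  by (intro laplace_limit.intro laplace_limit_axioms.intro LC.laplace_convergence_axioms \<nu>(1-3) \<nu>(4)[rule_format])
 define Y where "Y q = fst (LL.neg_log q)" for q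
 define T where "T q = snd (LL.neg_log q)" for q
 have Ym [measurable]: "Y \<in> bmeas LL.\<mu>" and Tm [measurable]: "T \<in> bmeas LL.\<mu>" proof -
  have f: "fst \<in> bmeas (borel :: ((real ^ 'd) \<times> real) measure)" and s: "snd \<in> bmeas (borel :: ((real ^ 'd) \<times> real) measure)"
   unfolding borel_prod[symmetric] by (rule measurable_fst, rule measurable_snd)
  show "Y \<in> bmeas LL.\<mu>" "T \<in> bmeas LL.\<mu>" unfolding Y_def[abs_def] T_def[abs_def] measurable_cong_sets[OF LL.sets_\<mu> refl]
   by (rule measurable_compose[OF LL.measurable_neg_log f], rule measurable_compose[OF LL.measurable_neg_log s])
 qed
 have YT: "(Y q, T q) = LL.neg_log q" for q by (simp add: Y_def T_def)
 have joint: "converges_in_law (%n. distr C borel (%u. (mu_hat_vec \<xi> n \<beta> u, Z_inf \<xi> u))) (distr LL.\<mu> borel (%q. (Y q, T q)))"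
  unfolding converges_in_law_def
 proof (intro allI impI)
  fix f :: "(real ^ 'd) \<times> real => real" assume f: "continuous_on UNIV f" "bounded (range f)"
  then obtain B where B: "\<bar>f z\<bar> <= B" for z by (auto simp: bounded_iff)
  have fm [measurable]: "f \<in> bmeas borel" by (rule borel_measurable_continuous_onI[OF f(1)])
  have pm: "(%u. (mu_hat_vec \<xi> n \<beta> u, Z_inf \<xi> u)) \<in> bmeas C" "(%u. (mu_hat_vec \<xi> n \<beta> u, Zp u)) \<in> bmeas C" for n
   by (rule borel_measurable_Pair; measurable)+
  have "(\<integral>x. f x \<partial>distr C borel (%u. (mu_hat_vec \<xi> n \<beta> u, Z_inf \<xi> u))) = (LINT u|C. f (mu_hat_vec \<xi> n \<beta> u, Zp u))" for n
  proof (subst integral_distr)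
   show "(LINT u|C. f (mu_hat_vec \<xi> n \<beta> u, Z_inf \<xi> u)) = (LINT u|C. f (mu_hat_vec \<xi> n \<beta> u, Zp u))"
   proof (rule integral_cong_AE)
    show "AE u in C. f (mu_hat_vec \<xi> n \<beta> u, Z_inf \<xi> u) = f (mu_hat_vec \<xi> n \<beta> u, Zp u)" using aeZp by eventually_elim simp
   qed (rule measurable_compose[OF pm(1) fm] measurable_compose[OF pm(2) fm])+
  qed (rule pm(1) fm)+
  moreover have "(\<integral>x. f x \<partial>distr LL.\<mu> borel (%q. (Y q, T q))) = (LINT z|LL.\<mu>. f (LL.neg_log z))"
   unfolding YT by (rule integral_distr) measurable
  ultimately show "(%n. \<integral>x. f x \<partial>distr C borel (%u. (mu_hat_vec \<xi> n \<beta> u, Z_inf \<xi> u))) ---> (\<integral>x. f x \<partial>distr LL.\<mu> borel (%q. (Y q, T q)))"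
   using LL.bounded_continuous_converges[OF f(1) B] by simp
 qed
 have marginal: "converges_in_law (%n. distr C borel (mu_hat_vec \<xi> n \<beta>)) (distr LL.\<mu> borel Y)" unfolding converges_in_law_def
 proof (intro allI impI)
  fix f :: "real ^ 'd => real" assume f: "continuous_on UNIV f" "bounded (range f)"
  have [measurable]: "f \<in> bmeas borel" by (rule borel_measurable_continuous_onI[OF f(1)])
  have fc: "continuous_on UNIV (%z :: (real ^ 'd) \<times> real. f (fst z))"
   using continuous_on_compose2[OF f(1) continuous_on_fst[OF continuous_on_id]] by simp
  obtain B where B: "\<bar>f x\<bar> <= B" for x using f(2) by (auto simp: bounded_iff)
  have "(%n. LINT u|C. f (fst (mu_hat_vec \<xi> n \<beta> u, Zp u))) ---> (LINT z|LL.\<mu>. f (fst (LL.neg_log z)))"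
   by (rule LL.bounded_continuous_converges[OF fc B])
  then show "(%n. \<integral>x. f x \<partial>distr C borel (mu_hat_vec \<xi> n \<beta>)) ---> (\<integral>x. f x \<partial>distr LL.\<mu> borel Y)"
   by (simp add: integral_distr Y_def)
 qed
 have law: "distr LL.\<mu> borel T = distr C borel (Z_inf \<xi>)" proof -
  have sm: "snd \<in> measurable LL.\<mu> LL.wlaw" by (rule measurable_snd)
  have Teq: "T = (%y. - ln y) \<circ> snd" by (simp add: T_def LL.neg_log_def fun_eq_iff)
  have "distr LL.\<mu> borel T = distr (distr LL.\<mu> LL.wlaw snd) borel (%y. - ln y)" unfolding Teq by (rule distr_distr[OF _ sm, symmetric]) measurable
  also have "distr LL.\<mu> LL.wlaw snd = LL.wlaw"
  proof (rule measure_eqI)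
   fix A assume A: "A \<in> sets (distr LL.\<mu> LL.wlaw snd)"
   have "emeasure (distr LL.\<mu> LL.wlaw snd) A = emeasure LL.\<mu> (space \<nu> \<times> A)"
    using A by (subst emeasure_distr[OF sm]) (auto simp: space_pair_measure dest: sets.sets_into_space intro!: arg_cong2[where f = emeasure])
   also have "... = emeasure LL.wlaw A" using A by (subst LL.W.emeasure_pair_measure_Times) (auto simp: LL.N.emeasure_space_1)
   finally show "emeasure (distr LL.\<mu> LL.wlaw snd) A = emeasure LL.wlaw A" .
  qed simp
  also have "distr LL.wlaw borel (%y. - ln y) = distr C borel Zp" by (subst distr_distr) (auto simp: LC.w_def comp_def)
  also have "... = distr C borel (Z_inf \<xi>)" by (rule distr_cong_AE[OF refl refl aeZp]) measurable
  finally show ?thesis .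
 qed
 have indep: "independent_rvs LL.\<mu> Y T" unfolding independent_rvs_def
 proof (intro conjI Ym Tm)
  show "LL.P.indep_set {Y -` A \<inter> space LL.\<mu> | A. A \<in> sets borel} {T -` B \<inter> space LL.\<mu> | B. B \<in> sets borel}"
   unfolding LL.P.indep_sets2_eq
  proof (intro conjI ballI)
   show "{Y -` A \<inter> space LL.\<mu> | A. A \<in> sets borel} \<subseteq> LL.P.events" using measurable_sets[OF Ym] by auto
   show "{T -` B \<inter> space LL.\<mu> | B. B \<in> sets borel} \<subseteq> LL.P.events" using measurable_sets[OF Tm] by auto
   fix a b assume "a \<in> {Y -` A \<inter> space LL.\<mu> | A. A \<in> sets borel}" "b \<in> {T -` B \<inter> space LL.\<mu> | B. B \<in> sets borel}"
   then obtain A B where A: "A \<in> sets borel" "a = Y -` A \<inter> space LL.\<mu>" and B: "B \<in> sets borel" "b = T -` B \<inter> space LL.\<mu>" by blast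
   define g where "g x = (\<chi> i. - ln (x $ i))" for x :: "real ^ 'd"
   define A' where "A' = g -` A \<inter> space \<nu>"
   define B' where "B' = (%y :: real. - ln y) -` B \<inter> space LL.wlaw"
   have gm: "g \<in> bmeas \<nu>" unfolding g_def[abs_def] by (rule measurable_vec_lambda) measurable
   have A'm: "A' \<in> sets \<nu>" unfolding A'_def using gm A(1) by (rule measurable_sets)
   have B'm: "B' \<in> sets LL.wlaw" unfolding B'_def by (rule measurable_sets[OF _ B(1)]) measurable
   have a: "a = A' \<times> space LL.wlaw" and b: "b = space \<nu> \<times> B'" and ab: "a \<inter> b = A' \<times> B'"
    unfolding A(2) B(2) A'_def B'_def Y_def T_def LL.neg_log_def g_def by (auto simp: space_pair_measure)
   have m: "LL.P.prob (E \<times> F) = measure \<nu> E * measure LL.wlaw F" if "E \<in> sets \<nu>" "F \<in> sets LL.wlaw" for E F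
    using LL.W.emeasure_pair_measure_Times[OF that] by (simp add: measure_def enn2real_mult)
   show "LL.P.prob (a \<inter> b) = LL.P.prob a * LL.P.prob b" unfolding ab unfolding a b using m[OF A'm B'm] m[OF A'm sets.top] m[OF sets.top B'm]
    by (simp add: LL.N.prob_space LL.W.prob_space del: space_distr)
  qed
 qed
 show ?thesis
 proof (intro exI conjI)
  show "prob_space LL.\<mu>" by unfold_locales
  show "independent_rvs LL.\<mu> Y T" by (rule indep)
  show "distr LL.\<mu> borel T = distr (cond_survival M \<xi>) borel (Z_inf \<xi>)" using law by (simp only: C_def)
 qed (use joint marginal in \<open>simp_all only: C_def\<close>)
qed

end

theorem theorem2p3:
  fixes M :: "'w measure" and L :: "(nat \<Rightarrow> ereal) measure"
    and \<xi> :: "nat list \<Rightarrow> 'w \<Rightarrow> nat \<Rightarrow> ereal"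
    and \<beta> :: "real ^ 'd" and \<rho> :: "real ^ 'd \<Rightarrow> real"
  assumes brw: "branching_random_walk M L \<xi>"
    and boundary: "boundary_case M \<xi>"
    and nonlattice: "non_lattice L"
    and moments: "moment_conditions M \<xi>"
    and beta: "\<And>i. \<beta> $ i > 1"
    and rho: "is_rho M \<xi> \<beta> \<rho>"
  shows "(\<forall>\<theta> \<alpha>. (\<forall>i. \<theta> $ i > 0) \<longrightarrow> \<alpha> \<ge> 0 \<longrightarrow>
            (\<lambda>n. \<integral>\<omega>. exp (- (\<Sum>i\<in>UNIV. \<theta> $ i * mu_hat \<xi> n (\<beta> $ i) \<omega>))
                      * exp (- \<alpha> * Z_inf \<xi> \<omega>) * indicator {\<omega>. Z_inf \<xi> \<omega> > 0} \<omega> \<partial>M)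
            \<longlonglongrightarrow> exp (- \<rho> \<theta>)
                * (\<integral>\<omega>. exp (- \<alpha> * Z_inf \<xi> \<omega>) * indicator {\<omega>. Z_inf \<xi> \<omega> > 0} \<omega> \<partial>M)) \<and>
         (\<exists>(Q :: ((real ^ 'd) \<times> real) measure) (mu_inf :: (real ^ 'd) \<times> real \<Rightarrow> real ^ 'd) Z.
            prob_space Q \<and>
            independent_rvs Q mu_inf Z \<and>
            distr Q borel Z = distr (cond_survival M \<xi>) borel (Z_inf \<xi>) \<and>
            converges_in_law
              (\<lambda>n. distr (cond_survival M \<xi>) borel (mu_hat_vec \<xi> n \<beta>))
              (distr Q borel mu_inf) \<and>
            converges_in_law
              (\<lambda>n. distr (cond_survival M \<xi>) borel (\<lambda>\<omega>. (mu_hat_vec \<xi> n \<beta> \<omega>, Z_inf \<xi> \<omega>)))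
              (distr Q borel (\<lambda>q. (mu_inf q, Z q))))"
proof -
  interpret critical_brw M L \<xi> \<beta> \<rho>
    using brw boundary nonlattice moments beta rho by (simp add: critical_brw_def critical_brw_axioms_def)
  show ?thesis
    by (intro conjI allI impI joint_Laplace_limit convergence_in_law) auto
qed

end
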